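(* Let $V_1,V_2$ satisfy (TraPot) and let $(\mu_1,\mu_2,\beta)\in\mathbb{R}^3$ satisfy (NonDeg), as defined in the context. If $\rho_1,\rho_2>0$ and $\alpha>\lambda_{V_1}\rho_1+\lambda_{V_2}\rho_2$, then \[ M(\alpha,\rho_1,\rho_2)=\sup\Big\{F(u_1,u_2): (u_1,u_2)\in\mathcal{H},\ \|(u_1,u_2)\|_{\mathcal H}^2=\alpha,\ \int_\Omega u_1^2\,dx=\rho_1,\ \int_\Omega u_2^2\,dx=\rho_2\Big\} \] is achieved. Besides, for every maximum point $(u_1,u_2)$ there exists $(\omega_1,\omega_2,\gamma)\in\mathbb{R}^3$ with $\gamma>0$ such that, setting $U_i=\sqrt{\gamma}\,u_i$, the pair $(U_1,U_2)\in\mathcal H$ satisfies \[ \begin{cases} -\Delta U_1+(V_1(x)+\omega_1)U_1=\mu_1U_1^3+\beta U_1U_2^2,\\ -\Delta U_2+(V_2(x)+\omega_2)U_2=\mu_2U_2^3+\beta U_2U_1^2,\\ \int_\Omega U_1^2\,dx=\gamma\rho_1,\quad \int_\Omega U_2^2\,dx=\gamma\rho_2 . \end{cases} \]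
   Context: Let $N\le 3$ and let $\Omega\subset\mathbb{R}^N$ be either $\mathbb{R}^N$ or a bounded Lipschitz domain. (TraPot): for $i=1,2$, $V_i\in C(\overline\Omega)$, $V_i\ge0$, and (only when $\Omega=\mathbb{R}^N$) $\lim_{|x|\to\infty}V_i(x)=+\infty$. (NonDeg): one of the following holds: (i) $\mu_1\mu_2<0$ and $\beta\in\mathbb{R}$; (ii) $\mu_1,\mu_2\ge0$, not both zero, and $\beta\ne-\sqrt{\mu_1\mu_2}$; (iii) $\mu_1,\mu_2\le0$, not both zero, and $\beta\neq\sqrt{\mu_1\mu_2}$. $\mathcal H=\{(u_1,u_2): u_i\in H^1_0(\Omega;\mathbb{R}),\ \int_\Omega(|\nabla u_i|^2+V_iu_i^2)\,dx<\infty,\ i=1,2\}$, with $\|(u_1,u_2)\|_{\mathcal H}^2=\sum_{i=1}^2\int_\Omega(|\nabla u_i|^2+V_iu_i^2)\,dx$. $F(u_1,u_2)=\frac14\int_\Omega(\mu_1u_1^4+2\beta u_1^2u_2^2+\mu_2u_2^4)\,dx$. $\lambda_{V_i}>0$ is the principal eigenvalue of $-\Delta+V_i$ (with zero Dirichlet conditions if $\Omega$ is bounded), i.e. $\lambda_{V_i}=\inf\{\int_\Omega(|\nabla\varphi|^2+V_i\varphi^2)\,dx:\int_\Omega\varphi^2\,dx=1\}$. Elliptic equations are understood in the weak sense. *)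

theory Defs
  imports "HOL-Analysis.Analysis"
begin

section \<open>Domains\<close>

text \<open>
  Near every boundary point, after a rotation, the set is the strict epigraph of a Lipschitz
  function. The rotation is encoded by a unit vector \<open>e\<close> (the vertical direction); the graph
  function lives on the hyperplane orthogonal to \<open>e\<close>, which is \<open>{0}\<close> in dimension one.
\<close>
definition lipschitz_boundary :: "'a::euclidean_space set \<Rightarrow> bool" where
  "lipschitz_boundary \<Omega> \<longleftrightarrow>
     (\<forall>p\<in>frontier \<Omega>. \<exists>r>0. \<exists>e g L. norm e = 1 \<and> L-lipschitz_on {y. y \<bullet> e = 0} g \<and>
        \<Omega> \<inter> ball p r = {x \<in> ball p r. x \<bullet> e > g (x - (x \<bullet> e) *\<^sub>R e)})"

definition bounded_lipschitz_domain :: "'a::euclidean_space set \<Rightarrow> bool" where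
  "bounded_lipschitz_domain \<Omega> \<longleftrightarrow>
     open \<Omega> \<and> connected \<Omega> \<and> \<Omega> \<noteq> {} \<and> bounded \<Omega> \<and> lipschitz_boundary \<Omega>"

section \<open>Sobolev spaces\<close>

primrec times_cont_differentiable :: "nat \<Rightarrow> ('a::euclidean_space \<Rightarrow> real) \<Rightarrow> bool" where
  "times_cont_differentiable 0 \<phi> \<longleftrightarrow> continuous_on UNIV \<phi>"
| "times_cont_differentiable (Suc k) \<phi> \<longleftrightarrow>
     (\<forall>x. \<phi> differentiable (at x)) \<and>
     (\<forall>b\<in>Basis. times_cont_differentiable k (\<lambda>x. frechet_derivative \<phi> (at x) b))"

definition test_functions :: "'a::euclidean_space set \<Rightarrow> ('a \<Rightarrow> real) set" where
  "test_functions \<Omega> = {\<phi>. (\<forall>k. times_cont_differentiable k \<phi>) \<and>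
     compact (closure {x. \<phi> x \<noteq> 0}) \<and> closure {x. \<phi> x \<noteq> 0} \<subseteq> \<Omega>}"

text \<open>
  Elements of Lebesgue and Sobolev spaces are represented by functions on the whole type. Only
  their values on \<open>\<Omega>\<close> matter, and functions are not identified when they agree almost everywhere.
\<close>
definition L2 :: "'a::euclidean_space set \<Rightarrow> ('a \<Rightarrow> 'b::euclidean_space) set" where
  "L2 \<Omega> = {f \<in> borel_measurable (lebesgue_on \<Omega>).
     integrable (lebesgue_on \<Omega>) (\<lambda>x. (norm (f x))\<^sup>2)}"

definition is_weak_grad :: "'a::euclidean_space set \<Rightarrow> ('a \<Rightarrow> real) \<Rightarrow> ('a \<Rightarrow> 'a) \<Rightarrow> bool" where
  "is_weak_grad \<Omega> u g \<longleftrightarrow> g \<in> L2 \<Omega> \<and>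
     (\<forall>\<phi>\<in>test_functions \<Omega>. \<forall>b\<in>Basis.
        (LINT x|lebesgue_on \<Omega>. u x * frechet_derivative \<phi> (at x) b) =
        - (LINT x|lebesgue_on \<Omega>. (g x \<bullet> b) * \<phi> x))"

definition H1 :: "'a::euclidean_space set \<Rightarrow> ('a \<Rightarrow> real) set" where
  "H1 \<Omega> = {u \<in> L2 \<Omega>. \<exists>g. is_weak_grad \<Omega> u g}"

text \<open>For \<open>u\<close> in \<open>H1 \<Omega>\<close> the weak gradient is unique up to a null set, so integrals of it do not
  depend on the choice made here.\<close>
definition weak_grad :: "'a::euclidean_space set \<Rightarrow> ('a \<Rightarrow> real) \<Rightarrow> 'a \<Rightarrow> 'a" where
  "weak_grad \<Omega> u = (SOME g. is_weak_grad \<Omega> u g)"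

definition H1_norm :: "'a::euclidean_space set \<Rightarrow> ('a \<Rightarrow> real) \<Rightarrow> real" where
  "H1_norm \<Omega> u =
     sqrt (LINT x|lebesgue_on \<Omega>. (norm (weak_grad \<Omega> u x))\<^sup>2 + (u x)\<^sup>2)"

definition H10 :: "'a::euclidean_space set \<Rightarrow> ('a \<Rightarrow> real) set" where
  "H10 \<Omega> = {u \<in> H1 \<Omega>. \<forall>\<epsilon>>0. \<exists>\<phi>\<in>test_functions \<Omega>. H1_norm \<Omega> (\<lambda>x. u x - \<phi> x) < \<epsilon>}"

section \<open>The variational problem\<close>

definition TraPot :: "'a::euclidean_space set \<Rightarrow> ('a \<Rightarrow> real) \<Rightarrow> bool" where
  "TraPot \<Omega> V \<longleftrightarrow> continuous_on (closure \<Omega>) V \<and> (\<forall>x\<in>closure \<Omega>. V x \<ge> 0) \<and>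
     (\<Omega> = UNIV \<longrightarrow> filterlim V at_top at_infinity)"

definition NonDeg :: "real \<Rightarrow> real \<Rightarrow> real \<Rightarrow> bool" where
  "NonDeg \<mu>1 \<mu>2 \<beta> \<longleftrightarrow>
     \<mu>1 * \<mu>2 < 0 \<or>
     (\<mu>1 \<ge> 0 \<and> \<mu>2 \<ge> 0 \<and> (\<mu>1 \<noteq> 0 \<or> \<mu>2 \<noteq> 0) \<and> \<beta> \<noteq> - sqrt (\<mu>1 * \<mu>2)) \<or>
     (\<mu>1 \<le> 0 \<and> \<mu>2 \<le> 0 \<and> (\<mu>1 \<noteq> 0 \<or> \<mu>2 \<noteq> 0) \<and> \<beta> \<noteq> sqrt (\<mu>1 * \<mu>2))"

definition energy_space ::
    "'a::euclidean_space set \<Rightarrow> ('a \<Rightarrow> real) \<Rightarrow> ('a \<Rightarrow> real) set" where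
  "energy_space \<Omega> V = {u \<in> H10 \<Omega>.
     integrable (lebesgue_on \<Omega>) (\<lambda>x. (norm (weak_grad \<Omega> u x))\<^sup>2 + V x * (u x)\<^sup>2)}"

definition energy :: "'a::euclidean_space set \<Rightarrow> ('a \<Rightarrow> real) \<Rightarrow> ('a \<Rightarrow> real) \<Rightarrow> real" where
  "energy \<Omega> V u =
     (LINT x|lebesgue_on \<Omega>. (norm (weak_grad \<Omega> u x))\<^sup>2 + V x * (u x)\<^sup>2)"

definition mass :: "'a::euclidean_space set \<Rightarrow> ('a \<Rightarrow> real) \<Rightarrow> real" where
  "mass \<Omega> u = (LINT x|lebesgue_on \<Omega>. (u x)\<^sup>2)"

definition principal_eigenvalue :: "'a::euclidean_space set \<Rightarrow> ('a \<Rightarrow> real) \<Rightarrow> real" where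
  "principal_eigenvalue \<Omega> V = (INF \<phi>\<in>{\<phi> \<in> energy_space \<Omega> V. mass \<Omega> \<phi> = 1}. energy \<Omega> V \<phi>)"

definition HH :: "'a::euclidean_space set \<Rightarrow> ('a \<Rightarrow> real) \<Rightarrow> ('a \<Rightarrow> real) \<Rightarrow>
    (('a \<Rightarrow> real) \<times> ('a \<Rightarrow> real)) set" where
  "HH \<Omega> V1 V2 = energy_space \<Omega> V1 \<times> energy_space \<Omega> V2"

text \<open>The integral converges on \<open>HH \<Omega> V1 V2\<close> in dimension at most three, by the Sobolev embedding
  into \<open>L\<^sup>4\<close>.\<close>
definition F_functional :: "'a::euclidean_space set \<Rightarrow> real \<Rightarrow> real \<Rightarrow> real \<Rightarrow>
    ('a \<Rightarrow> real) \<times> ('a \<Rightarrow> real) \<Rightarrow> real" where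
  "F_functional \<Omega> \<mu>1 \<mu>2 \<beta> = (\<lambda>(u1, u2).
     1 / 4 * (LINT x|lebesgue_on \<Omega>.
       \<mu>1 * (u1 x) ^ 4 + 2 * \<beta> * (u1 x)\<^sup>2 * (u2 x)\<^sup>2 + \<mu>2 * (u2 x) ^ 4))"

definition admissible :: "'a::euclidean_space set \<Rightarrow> ('a \<Rightarrow> real) \<Rightarrow> ('a \<Rightarrow> real) \<Rightarrow>
    real \<Rightarrow> real \<Rightarrow> real \<Rightarrow> (('a \<Rightarrow> real) \<times> ('a \<Rightarrow> real)) set" where
  "admissible \<Omega> V1 V2 \<alpha> \<rho>1 \<rho>2 = {(u1, u2) \<in> HH \<Omega> V1 V2.
     energy \<Omega> V1 u1 + energy \<Omega> V2 u2 = \<alpha> \<and> mass \<Omega> u1 = \<rho>1 \<and> mass \<Omega> u2 = \<rho>2}"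

text \<open>The supremum is taken in the extended reals, so that its being achieved includes finiteness.\<close>
definition M_value :: "'a::euclidean_space set \<Rightarrow> ('a \<Rightarrow> real) \<Rightarrow> ('a \<Rightarrow> real) \<Rightarrow>
    real \<Rightarrow> real \<Rightarrow> real \<Rightarrow> real \<Rightarrow> real \<Rightarrow> real \<Rightarrow> ereal" where
  "M_value \<Omega> V1 V2 \<mu>1 \<mu>2 \<beta> \<alpha> \<rho>1 \<rho>2 =
     (SUP u\<in>admissible \<Omega> V1 V2 \<alpha> \<rho>1 \<rho>2. ereal (F_functional \<Omega> \<mu>1 \<mu>2 \<beta> u))"

definition maximum_point :: "'a::euclidean_space set \<Rightarrow> ('a \<Rightarrow> real) \<Rightarrow> ('a \<Rightarrow> real) \<Rightarrow>
    real \<Rightarrow> real \<Rightarrow> real \<Rightarrow> real \<Rightarrow> real \<Rightarrow> real \<Rightarrow> ('a \<Rightarrow> real) \<times> ('a \<Rightarrow> real) \<Rightarrow> bool" where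
  "maximum_point \<Omega> V1 V2 \<mu>1 \<mu>2 \<beta> \<alpha> \<rho>1 \<rho>2 u \<longleftrightarrow>
     u \<in> admissible \<Omega> V1 V2 \<alpha> \<rho>1 \<rho>2 \<and>
     ereal (F_functional \<Omega> \<mu>1 \<mu>2 \<beta> u) = M_value \<Omega> V1 V2 \<mu>1 \<mu>2 \<beta> \<alpha> \<rho>1 \<rho>2"

text \<open>
  Weak form of \<open>-\<Delta>U + (V + \<omega>) U = f\<close> with zero boundary values, for \<open>V \<ge> 0\<close>, tested against the
  whole energy space (hence in particular against all test functions).
\<close>
definition weak_solution :: "'a::euclidean_space set \<Rightarrow> ('a \<Rightarrow> real) \<Rightarrow> real \<Rightarrow>
    ('a \<Rightarrow> real) \<Rightarrow> ('a \<Rightarrow> real) \<Rightarrow> bool" where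
  "weak_solution \<Omega> V \<omega> U f \<longleftrightarrow> U \<in> energy_space \<Omega> V \<and>
     (\<forall>\<phi>\<in>energy_space \<Omega> V.
        integrable (lebesgue_on \<Omega>)
          (\<lambda>x. weak_grad \<Omega> U x \<bullet> weak_grad \<Omega> \<phi> x + (V x + \<omega>) * U x * \<phi> x) \<and>
        integrable (lebesgue_on \<Omega>) (\<lambda>x. f x * \<phi> x) \<and>
        (LINT x|lebesgue_on \<Omega>.
           weak_grad \<Omega> U x \<bullet> weak_grad \<Omega> \<phi> x + (V x + \<omega>) * U x * \<phi> x) =
        (LINT x|lebesgue_on \<Omega>. f x * \<phi> x))"

end

theory Submission
  imports Defs "HOL-Complex_Analysis.Great_Picard"
begin

text \<open>
  The maximum is first sought in a larger class, where the energy is only required to be at most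
  \<open>\<alpha>\<close>. Sequences in that class have subsequences converging in \<open>L\<^sup>2\<close> and, in dimension at most
  three, in \<open>L\<^sup>4\<close>. The masses and \<open>F\<close> therefore pass to the limit, while the energy can only
  drop, and a relaxed maximum exists (\<open>relaxed_maximum_exists\<close>).

  If a relaxed maximum had energy below \<open>\<alpha>\<close>, all directions tangent to the mass constraints would
  be allowed and the derivative of \<open>F\<close> would vanish on them. The Euler equations then contain no
  derivatives: almost everywhere \<open>u1 = 0\<close> or \<open>\<mu>1 u1\<^sup>2 + \<beta> u2\<^sup>2 = \<omega>1\<close>, and symmetrically for
  \<open>u2\<close>. Under (NonDeg) some combination \<open>a u1\<^sup>2 + b u2\<^sup>2\<close> with nonnegative weights, not both
  zero, takes finitely many values only. Such a function has to vanish: its square root has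
  increments of size \<open>O(\<bar>h\<bar>)\<close> in \<open>L\<^sup>2\<close>, and since an increment is either zero or at least the
  smallest gap between two values, also of size \<open>O(\<bar>h\<bar>\<^sup>2)\<close> in \<open>L\<^sup>1\<close>; dividing \<open>h\<close> into \<open>n\<close>
  equal steps improves this to \<open>O(\<bar>h\<bar>\<^sup>2 / n)\<close>. The masses are positive, so this is impossible
  (\<open>free_critical_point_impossible\<close>). Hence relaxed maxima have energy exactly \<open>\<alpha>\<close>, which is
  the existence part, and maximum points of the original problem are relaxed maxima.

  The relaxed problem also gives the sign of the multiplier. Along a curve that keeps the masses and
  does not raise the energy, \<open>F\<close> cannot increase. If the derivative of the energy is not zero on
  the tangent space, then the derivative of \<open>F\<close> equals \<open>\<kappa>\<close> times that of half the energy with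
  \<open>\<kappa> \<ge> 0\<close>, and \<open>\<kappa> = 0\<close> is the case just excluded. If it is zero, then \<open>u1\<close> and \<open>u2\<close> are
  critical points of their energies for fixed mass, and the bound on \<open>\<alpha>\<close> places one of them above
  the principal eigenvalue. The energy then decreases to second order along an open cone of
  directions, and the derivative of \<open>F\<close> vanishes once more (\<open>not_energy_critical\<close>). Multiplying
  \<open>u1\<close> and \<open>u2\<close> by \<open>sqrt \<gamma>\<close> with \<open>\<gamma> = 1 / \<kappa>\<close> normalises the multiplier.

  All estimates come from one inequality for test functions: a translation by \<open>h\<close> moves \<open>\<phi>\<close> in
  \<open>L\<^sup>2\<close> by at most \<open>\<bar>h\<bar>\<close> times the norm of the gradient. Averaging over the dyadic cubes of
  side \<open>2\<^sup>-\<^sup>k\<close> therefore costs \<open>O(2\<^sup>-\<^sup>k)\<close> in \<open>L\<^sup>2\<close>. The difference of two consecutive averages is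
  constant on cubes, so that its supremum is controlled by its \<open>L\<^sup>2\<close> norm; in dimension \<open>N\<close> its
  fourth power has integral \<open>O(2\<^sup>(\<^sup>N\<^sup>-\<^sup>4\<^sup>)\<^sup>k)\<close>, which is summable for \<open>N \<le> 3\<close>
  (\<open>test_function_fourth_moment\<close>). The averages involve countably many numbers, and a diagonal
  subsequence makes them converge (\<open>tight_test_functions_Cauchy_subsequence\<close>). Functions in \<open>H10\<close>
  are limits of test functions and inherit these facts. The lower semicontinuity of the energy is
  obtained by minimising it over midpoints of the tails of the sequence
  (\<open>energy_lower_semicontinuous\<close>).
\<close>

section \<open>Square-integrable functions\<close>

definition square_integrable :: "'m measure \<Rightarrow> ('m \<Rightarrow> 'b::euclidean_space) \<Rightarrow> bool" where
  "square_integrable M f \<longleftrightarrow> f \<in> borel_measurable M \<and> integrable M (\<lambda>x. (norm (f x))\<^sup>2)"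

text \<open>  The integrals \<open>sqnorm\<close> and \<open>sqinner\<close> are the squared norm and the inner product of
  \<open>L\<^sup>2\<close>. Values in a Euclidean space allow a function and its gradient to be treated as one object.\<close>
definition sqnorm :: "'m measure \<Rightarrow> ('m \<Rightarrow> 'b::euclidean_space) \<Rightarrow> real" where
  "sqnorm M f = (LINT x|M. (norm (f x))\<^sup>2)"

definition sqinner :: "'m measure \<Rightarrow> ('m \<Rightarrow> 'b::euclidean_space) \<Rightarrow> ('m \<Rightarrow> 'b) \<Rightarrow> real" where
  "sqinner M f g = (LINT x|M. f x \<bullet> g x)"

lemma square_integrable_measurable: "square_integrable M f \<Longrightarrow> f \<in> borel_measurable M"
  and square_integrable_integrable: "square_integrable M f \<Longrightarrow> integrable M (\<lambda>x. (norm (f x))\<^sup>2)"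
  by (auto simp: square_integrable_def)

lemma sqnorm_nonneg [simp]: "0 \<le> sqnorm M f"
  unfolding sqnorm_def by (rule integral_nonneg_AE) simp

lemma sqnorm_eq_sqinner: "sqnorm M f = sqinner M f f"
  unfolding sqnorm_def sqinner_def by (simp add: power2_norm_eq_inner)

lemma sqinner_commute: "sqinner M f g = sqinner M g f"
  unfolding sqinner_def by (simp add: inner_commute)

lemma square_integrable_cong_AE:
  assumes "square_integrable M f" "AE x in M. f x = g x" "g \<in> borel_measurable M"
  shows "square_integrable M g"
proof -
  have [measurable]: "f \<in> borel_measurable M" "g \<in> borel_measurable M"
    using assms by (auto simp: square_integrable_def)
  have "integrable M (\<lambda>x. (norm (g x))\<^sup>2) \<longleftrightarrow> integrable M (\<lambda>x. (norm (f x))\<^sup>2)"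
    using assms(2) by (intro integrable_cong_AE) auto
  then show ?thesis using assms by (auto simp: square_integrable_def)
qed

lemma sqnorm_cong_AE:
  assumes "f \<in> borel_measurable M" "g \<in> borel_measurable M" "AE x in M. f x = g x"
  shows "sqnorm M f = sqnorm M g"
  unfolding sqnorm_def using assms by (intro integral_cong_AE) auto

lemma square_integrable_inner:
  assumes "square_integrable M f" "square_integrable M g"
  shows "integrable M (\<lambda>x. f x \<bullet> g x)"
proof (rule Bochner_Integration.integrable_bound)
  show "integrable M (\<lambda>x. (norm (f x))\<^sup>2 + (norm (g x))\<^sup>2)"
    using assms by (auto simp: square_integrable_def)
  show "(\<lambda>x. f x \<bullet> g x) \<in> borel_measurable M"
    using assms by (auto simp: square_integrable_def)
  have "\<bar>a \<bullet> b\<bar> \<le> (norm a)\<^sup>2 + (norm b)\<^sup>2" for a b :: 'b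
  proof -
    have "\<bar>a \<bullet> b\<bar> \<le> norm a * norm b" by (rule Cauchy_Schwarz_ineq2)
    also have "\<dots> \<le> (norm a)\<^sup>2 + (norm b)\<^sup>2"
    proof -
      have "0 \<le> norm a * norm b" by simp
      then show ?thesis using sum_squares_bound[of "norm a" "norm b"] by linarith
    qed
    finally show ?thesis .
  qed
  then show "AE x in M. norm (f x \<bullet> g x) \<le> norm ((norm (f x))\<^sup>2 + (norm (g x))\<^sup>2)"
    by simp
qed

lemma square_integrable_lincomb:
  assumes "square_integrable M f" "square_integrable M g"
  shows "square_integrable M (\<lambda>x. a *\<^sub>R f x + b *\<^sub>R g x)"
proof -
  have [measurable]: "f \<in> borel_measurable M" "g \<in> borel_measurable M"
    using assms by (auto simp: square_integrable_def)
  have eq: "(norm (a *\<^sub>R f x + b *\<^sub>R g x))\<^sup>2 =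
      a\<^sup>2 * (norm (f x))\<^sup>2 + 2 * a * b * (f x \<bullet> g x) + b\<^sup>2 * (norm (g x))\<^sup>2" for x
    by (simp add: power2_norm_eq_inner inner_add_left inner_add_right inner_commute)
      (simp add: power2_eq_square algebra_simps)
  show ?thesis
    unfolding square_integrable_def eq
    using square_integrable_inner[OF assms] assms by (auto simp: square_integrable_def)
qed

lemma square_integrable_diff:
    "square_integrable M f \<Longrightarrow> square_integrable M g \<Longrightarrow> square_integrable M (\<lambda>x. f x - g x)"
  and square_integrable_scaleR:
    "square_integrable M f \<Longrightarrow> square_integrable M (\<lambda>x. a *\<^sub>R f x)"
  using square_integrable_lincomb[of M f g 1 1] square_integrable_lincomb[of M f g 1 "-1"]
    square_integrable_lincomb[of M f f a 0] by auto

lemma square_integrable_mult: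
  fixes f :: "'m \<Rightarrow> real"
  shows "square_integrable M f \<Longrightarrow> square_integrable M (\<lambda>x. a * f x)"
  using square_integrable_scaleR[of M f a] by simp

lemma sqnorm_lincomb:
  assumes "square_integrable M f" "square_integrable M g"
  shows "sqnorm M (\<lambda>x. a *\<^sub>R f x + b *\<^sub>R g x) =
    a\<^sup>2 * sqnorm M f + 2 * a * b * sqinner M f g + b\<^sup>2 * sqnorm M g"
proof -
  have eq: "(norm (a *\<^sub>R f x + b *\<^sub>R g x))\<^sup>2 =
      a\<^sup>2 * (norm (f x))\<^sup>2 + 2 * a * b * (f x \<bullet> g x) + b\<^sup>2 * (norm (g x))\<^sup>2" for x
    by (simp add: power2_norm_eq_inner inner_add_left inner_add_right inner_commute)
      (simp add: power2_eq_square algebra_simps)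
  show ?thesis
    unfolding sqnorm_def sqinner_def eq
    using square_integrable_inner[OF assms] assms[THEN square_integrable_integrable] by simp
qed

lemma sqnorm_scaleR: "sqnorm M (\<lambda>x. a *\<^sub>R f x) = a\<^sup>2 * sqnorm M f"
  by (simp add: sqnorm_def power_mult_distrib)

lemma sqnorm_mult: "sqnorm M (\<lambda>x. a * f x) = a\<^sup>2 * sqnorm M f" for f :: "'m \<Rightarrow> real"
  using sqnorm_scaleR[of M a f] by simp

lemma sqnorm_minus_commute: "sqnorm M (\<lambda>x. f x - g x) = sqnorm M (\<lambda>x. g x - f x)"
  by (simp add: sqnorm_def norm_minus_commute)

lemma sqinner_lincomb_left:
  assumes "square_integrable M f" "square_integrable M g" "square_integrable M h"
  shows "sqinner M (\<lambda>x. a *\<^sub>R f x + b *\<^sub>R g x) h = a * sqinner M f h + b * sqinner M g h"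
  unfolding sqinner_def
  using square_integrable_inner[OF assms(1,3)] square_integrable_inner[OF assms(2,3)]
  by (simp add: inner_add_left)

lemma sqnorm_add:
  assumes "square_integrable M f" "square_integrable M g"
  shows "sqnorm M (\<lambda>x. f x + g x) = sqnorm M f + 2 * sqinner M f g + sqnorm M g"
    and "sqnorm M (\<lambda>x. f x - g x) = sqnorm M f - 2 * sqinner M f g + sqnorm M g"
  using sqnorm_lincomb[OF assms, of 1 1] sqnorm_lincomb[OF assms, of 1 "-1"] by auto

lemma sqnorm_add_le:
  assumes "square_integrable M f" "square_integrable M g"
  shows "sqnorm M (\<lambda>x. f x + g x) \<le> 2 * sqnorm M f + 2 * sqnorm M g"
    and "sqnorm M (\<lambda>x. f x - g x) \<le> 2 * sqnorm M f + 2 * sqnorm M g"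
  using sqnorm_add[OF assms] sqnorm_nonneg[of M "\<lambda>x. f x + g x"]
    sqnorm_nonneg[of M "\<lambda>x. f x - g x"] by linarith+

lemma sqinner_Cauchy_Schwarz:
  assumes "square_integrable M f" "square_integrable M g"
  shows "\<bar>sqinner M f g\<bar> \<le> sqrt (sqnorm M f) * sqrt (sqnorm M g)"
proof -
  let ?s = "sqinner M f g" and ?A = "sqnorm M f" and ?B = "sqnorm M g"
  have pos: "0 \<le> ?A + 2 * t * ?s + t\<^sup>2 * ?B" for t
    using sqnorm_lincomb[OF assms, of 1 t] sqnorm_nonneg[of M "\<lambda>x. 1 *\<^sub>R f x + t *\<^sub>R g x"]
    by simp
  have "?s\<^sup>2 \<le> ?A * ?B"
  proof (cases "?B = 0")
    case True
    have "?s = 0"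
    proof (rule ccontr)
      assume "?s \<noteq> 0"
      then have "2 * (- (?A + 1) / (2 * ?s)) * ?s = - (?A + 1)" by simp
      with pos[of "- (?A + 1) / (2 * ?s)"] True show False by simp
    qed
    then show ?thesis by simp
  next
    case False
    then have B: "?B > 0" using sqnorm_nonneg[of M g] by linarith
    have "0 \<le> ?A - ?s\<^sup>2 / ?B"
      using pos[of "- ?s / ?B"] B by (simp add: power2_eq_square field_simps)
    then show ?thesis using B by (simp add: field_simps)
  qed
  then have "sqrt (?s\<^sup>2) \<le> sqrt (?A * ?B)" by (rule real_sqrt_le_mono)
  then show ?thesis by (simp add: real_sqrt_mult)
qed

lemma sqinner_tendsto:
  assumes f: "\<And>n. square_integrable M (f n)" "square_integrable M f'"
      "(\<lambda>n. sqnorm M (\<lambda>x. f n x - f' x)) \<longlonglongrightarrow> 0"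
    and g: "\<And>n. square_integrable M (g n)" "square_integrable M g'"
      "(\<lambda>n. sqnorm M (\<lambda>x. g n x - g' x)) \<longlonglongrightarrow> 0"
  shows "(\<lambda>n. sqinner M (f n) (g n)) \<longlonglongrightarrow> sqinner M f' g'"
proof -
  let ?a = "\<lambda>n. sqrt (sqnorm M (\<lambda>x. f n x - f' x))"
  let ?b = "\<lambda>n. sqrt (sqnorm M (\<lambda>x. g n x - g' x))"
  have df: "square_integrable M (\<lambda>x. f n x - f' x)" and dg: "square_integrable M (\<lambda>x. g n x - g' x)"
    for n using f g by (auto intro: square_integrable_diff)
  have eq: "sqinner M (f n) (g n) - sqinner M f' g' =
      sqinner M (\<lambda>x. f n x - f' x) (\<lambda>x. g n x - g' x) + sqinner M f' (\<lambda>x. g n x - g' x)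
      + sqinner M (\<lambda>x. f n x - f' x) g'" for n
  proof -
    have "f n x \<bullet> g n x = f' x \<bullet> g' x + (f n x - f' x) \<bullet> (g n x - g' x) +
      f' x \<bullet> (g n x - g' x) + (f n x - f' x) \<bullet> g' x" for x
      by (simp add: inner_diff_left inner_diff_right)
    then show ?thesis unfolding sqinner_def
      using square_integrable_inner[OF f(2) g(2)] square_integrable_inner[OF df dg, of n n]
        square_integrable_inner[OF f(2) dg, of n] square_integrable_inner[OF df g(2), of n]
      by simp
  qed
  have "(\<lambda>n. sqinner M (f n) (g n) - sqinner M f' g') \<longlonglongrightarrow> 0"
  proof (rule Lim_null_comparison)
    show "\<forall>\<^sub>F n in sequentially. norm (sqinner M (f n) (g n) - sqinner M f' g') \<le>
        ?a n * ?b n + sqrt (sqnorm M f') * ?b n + ?a n * sqrt (sqnorm M g')"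
    proof (intro always_eventually allI)
      fix n
      show "norm (sqinner M (f n) (g n) - sqinner M f' g') \<le>
        ?a n * ?b n + sqrt (sqnorm M f') * ?b n + ?a n * sqrt (sqnorm M g')"
        unfolding eq real_norm_def
        using sqinner_Cauchy_Schwarz[OF df[of n] dg[of n]] sqinner_Cauchy_Schwarz[OF f(2) dg[of n]]
          sqinner_Cauchy_Schwarz[OF df[of n] g(2)] by linarith
    qed
    have a: "?a \<longlonglongrightarrow> 0" and b: "?b \<longlonglongrightarrow> 0"
      using tendsto_real_sqrt[OF f(3)] tendsto_real_sqrt[OF g(3)] by simp_all
    show "(\<lambda>n. ?a n * ?b n + sqrt (sqnorm M f') * ?b n + ?a n * sqrt (sqnorm M g')) \<longlonglongrightarrow> 0"
      by (rule tendsto_eq_intros a b | simp)+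
  qed
  then show ?thesis by (simp add: LIM_zero_iff)
qed

lemma sqnorm_tendsto:
  assumes "\<And>n. square_integrable M (f n)" "square_integrable M f'"
      "(\<lambda>n. sqnorm M (\<lambda>x. f n x - f' x)) \<longlonglongrightarrow> 0"
  shows "(\<lambda>n. sqnorm M (f n)) \<longlonglongrightarrow> sqnorm M f'"
  unfolding sqnorm_eq_sqinner using sqinner_tendsto[OF assms assms] .

lemma sqnorm_tendsto_AE_subseq:
  assumes "\<And>n. square_integrable M (f n)" "square_integrable M f'"
      "(\<lambda>n. sqnorm M (\<lambda>x. f n x - f' x)) \<longlonglongrightarrow> 0"
  obtains r where "strict_mono r" "AE x in M. (\<lambda>n. f (r n) x) \<longlonglongrightarrow> f' x"
proof -
  have "\<exists>r::nat\<Rightarrow>nat. strict_mono r \<and> (AE x in M. (\<lambda>n. (norm (f (r n) x - f' x))\<^sup>2) \<longlonglongrightarrow> 0)"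
  proof (rule tendsto_L1_AE_subseq)
    show "integrable M (\<lambda>x. (norm (f n x - f' x))\<^sup>2)" for n
      using square_integrable_diff[OF assms(1)[of n] assms(2)] by (rule square_integrable_integrable)
    show "(\<lambda>n. LINT x|M. norm ((norm (f n x - f' x))\<^sup>2)) \<longlonglongrightarrow> 0"
      using assms(3) by (simp add: sqnorm_def)
  qed
  then obtain r :: "nat \<Rightarrow> nat" where r: "strict_mono r"
    and ae: "AE x in M. (\<lambda>n. (norm (f (r n) x - f' x))\<^sup>2) \<longlonglongrightarrow> 0" by auto
  have "AE x in M. (\<lambda>n. f (r n) x) \<longlonglongrightarrow> f' x"
    using ae
  proof eventually_elim
    case (elim x)
    have "(\<lambda>n. sqrt ((norm (f (r n) x - f' x))\<^sup>2)) \<longlonglongrightarrow> sqrt 0"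
      by (rule tendsto_real_sqrt[OF elim])
    then have "(\<lambda>n. norm (f (r n) x - f' x)) \<longlonglongrightarrow> 0" by simp
    then show ?case using LIM_zero_iff tendsto_norm_zero_iff by blast
  qed
  with r show ?thesis using that by blast
qed

lemma nn_integral_eq_sqnorm:
  assumes "square_integrable M f"
  shows "(\<integral>\<^sup>+x. ennreal ((norm (f x))\<^sup>2) \<partial>M) = ennreal (sqnorm M f)"
  unfolding sqnorm_def using assms by (intro nn_integral_eq_integral) (auto simp: square_integrable_def)

text \<open>  Norm bounds survive almost everywhere convergence. Most estimates below are proved for test functions
  and carried over in this way.\<close>
lemma square_integrable_Fatou:
  assumes f: "\<And>n. square_integrable M (f n)" and g: "g \<in> borel_measurable M"
    and ae: "AE x in M. (\<lambda>n. f n x) \<longlonglongrightarrow> g x"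
    and le: "\<And>n. sqnorm M (f n) \<le> C"
  shows "square_integrable M g" "sqnorm M g \<le> C"
proof -
  have C: "0 \<le> C" using le[of 0] sqnorm_nonneg[of M "f 0"] by linarith
  have [measurable]: "f n \<in> borel_measurable M" for n using f by (rule square_integrable_measurable)
  have [measurable]: "g \<in> borel_measurable M" by (rule g)
  have "(\<integral>\<^sup>+x. ennreal ((norm (g x))\<^sup>2) \<partial>M) = (\<integral>\<^sup>+x. liminf (\<lambda>n. ennreal ((norm (f n x))\<^sup>2)) \<partial>M)"
  proof (rule nn_integral_cong_AE)
    show "AE x in M. ennreal ((norm (g x))\<^sup>2) = liminf (\<lambda>n. ennreal ((norm (f n x))\<^sup>2))"
      using ae
    proof eventually_elim
      case (elim x)
      have "(\<lambda>n. ennreal ((norm (f n x))\<^sup>2)) \<longlonglongrightarrow> ennreal ((norm (g x))\<^sup>2)"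
        by (intro tendsto_ennrealI tendsto_intros elim)
      then show ?case using lim_imp_Liminf[OF sequentially_bot] by fastforce
    qed
  qed
  also have "\<dots> \<le> liminf (\<lambda>n. \<integral>\<^sup>+x. ennreal ((norm (f n x))\<^sup>2) \<partial>M)"
    by (rule nn_integral_liminf) simp
  also have "\<dots> = liminf (\<lambda>n. ennreal (sqnorm M (f n)))"
    by (simp add: nn_integral_eq_sqnorm[OF f])
  also have "\<dots> \<le> liminf (\<lambda>n. ennreal C)"
    by (rule Liminf_mono) (auto intro!: always_eventually ennreal_leI le)
  also have "\<dots> = ennreal C" by (simp add: Liminf_const)
  finally have *: "(\<integral>\<^sup>+x. ennreal ((norm (g x))\<^sup>2) \<partial>M) \<le> ennreal C" .
  have "integrable M (\<lambda>x. (norm (g x))\<^sup>2)"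
  proof (rule integrableI_bounded)
    have "(\<integral>\<^sup>+x. ennreal (norm ((norm (g x))\<^sup>2)) \<partial>M) \<le> ennreal C" using * by simp
    then show "(\<integral>\<^sup>+x. ennreal (norm ((norm (g x))\<^sup>2)) \<partial>M) < \<infinity>"
      by (rule le_less_trans) simp
  qed measurable
  then show S: "square_integrable M g" using g by (simp add: square_integrable_def)
  show "sqnorm M g \<le> C" using * C unfolding nn_integral_eq_sqnorm[OF S] by simp
qed

text \<open>  From \<open>2 \<bar>d\<bar> \<le> 2\<^sup>k \<bar>d\<bar>\<^sup>2 + 2\<^sup>-\<^sup>k\<close>. In the proof of completeness the weighted sum of squares can be
  integrated term by term, while the sum of the norms cannot, as the measure may be infinite.\<close>
lemma summable_norm_if_weighted_squares_summable:
  fixes d :: "nat \<Rightarrow> 'b::euclidean_space"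
  assumes "summable (\<lambda>k. 2^k * (norm (d k))\<^sup>2)"
  shows "summable (\<lambda>k. norm (d k))"
proof (rule summable_comparison_test)
  show "\<exists>N. \<forall>k\<ge>N. norm (norm (d k)) \<le> 2^k * (norm (d k))\<^sup>2 + (1/2)^k"
  proof (intro exI[of _ 0] allI impI)
    fix k :: nat
    let ?s = "sqrt (2^k)"
    have s: "?s\<^sup>2 = 2^k" "?s > 0" by auto
    have "2 * (?s * norm (d k)) * (1 / ?s) \<le> (?s * norm (d k))\<^sup>2 + (1 / ?s)\<^sup>2"
      by (rule sum_squares_bound)
    then have "2 * norm (d k) \<le> 2^k * (norm (d k))\<^sup>2 + (1/2)^k"
      unfolding power_mult_distrib power_divide s(1) using s(2) by simp
    then show "norm (norm (d k)) \<le> 2^k * (norm (d k))\<^sup>2 + (1/2)^k"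
      unfolding real_norm_def abs_norm_cancel using norm_ge_zero[of "d k"] by linarith
  qed
  show "summable (\<lambda>k. 2^k * (norm (d k))\<^sup>2 + (1/2)^k)"
    by (intro summable_add assms summable_geometric) simp
qed

text \<open>  A subsequence whose consecutive distances decay geometrically converges almost everywhere; its
  limit is the limit of the whole sequence by Fatou's lemma.\<close>
lemma square_integrable_complete:
  fixes f :: "nat \<Rightarrow> 'm \<Rightarrow> 'b::euclidean_space"
  assumes f: "\<And>n. square_integrable M (f n)"
    and cauchy: "\<And>e. e > 0 \<Longrightarrow> \<exists>N. \<forall>m\<ge>N. \<forall>n\<ge>N. sqnorm M (\<lambda>x. f m x - f n x) < e"
  obtains g where "square_integrable M g" "(\<lambda>n. sqnorm M (\<lambda>x. f n x - g x)) \<longlonglongrightarrow> 0"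
proof -
  have [measurable]: "f n \<in> borel_measurable M" for n using f by (rule square_integrable_measurable)
  have "\<exists>N. \<forall>m\<ge>N. \<forall>n\<ge>N. sqnorm M (\<lambda>x. f m x - f n x) < (1/4)^k" for k :: nat
    by (rule cauchy) simp
  then obtain N where N: "\<And>k m n. m \<ge> N k \<Longrightarrow> n \<ge> N k \<Longrightarrow> sqnorm M (\<lambda>x. f m x - f n x) < (1/4)^k"
    by metis
  \<comment> \<open>indices beyond \<open>N 0, ..., N k\<close> that also tend to infinity, so that Fatou can be applied to tails\<close>
  define r where "r k = Max (N ` {..k}) + k" for k
  have rN: "r k \<ge> N k" for k unfolding r_def by (rule trans_le_add1) (auto intro: Max_ge)
  have rk: "r k \<ge> k" for k by (simp add: r_def)
  have rmono: "N k \<le> r (Suc k)" for k unfolding r_def by (rule trans_le_add1) (auto intro: Max_ge)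
  define d where "d k x = f (r (Suc k)) x - f (r k) x" for k x
  have dS: "square_integrable M (d k)" for k unfolding d_def by (intro square_integrable_diff f)
  have d: "sqnorm M (d k) \<le> (1/4)^k" for k
    unfolding d_def using N[OF rmono rN, of k] by (rule less_imp_le)
  have [measurable]: "d k \<in> borel_measurable M" for k unfolding d_def by measurable
  have "(\<integral>\<^sup>+x. (\<Sum>k. ennreal (2^k * (norm (d k x))\<^sup>2)) \<partial>M) =
      (\<Sum>k. \<integral>\<^sup>+x. ennreal (2^k * (norm (d k x))\<^sup>2) \<partial>M)"
    by (rule nn_integral_suminf) simp
  also have "\<dots> \<le> (\<Sum>k. ennreal ((1/2)^k))"
  proof (intro suminf_le summableI)
    fix k :: nat
    have "(\<integral>\<^sup>+x. ennreal (2^k * (norm (d k x))\<^sup>2) \<partial>M) =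
        ennreal (2^k) * (\<integral>\<^sup>+x. ennreal ((norm (d k x))\<^sup>2) \<partial>M)"
      by (subst nn_integral_cmult[symmetric]) (auto simp: ennreal_mult)
    also have "\<dots> = ennreal (2^k * sqnorm M (d k))"
      by (simp add: nn_integral_eq_sqnorm[OF dS] ennreal_mult)
    also have "\<dots> \<le> ennreal (2^k * (1/4)^k)"
      by (intro ennreal_leI mult_left_mono d) simp
    also have "2^k * (1/4)^k = (1/2::real)^k" by (simp flip: power_mult_distrib)
    finally show "(\<integral>\<^sup>+x. ennreal (2^k * (norm (d k x))\<^sup>2) \<partial>M) \<le> ennreal ((1/2)^k)" .
  qed
  also have "\<dots> = ennreal (\<Sum>k. (1/2)^k)" by (intro suminf_ennreal2 summable_geometric) auto
  also have "\<dots> < \<infinity>" by simp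
  finally have "AE x in M. (\<Sum>k. ennreal (2^k * (norm (d k x))\<^sup>2)) \<noteq> \<infinity>"
    by (intro nn_integral_noteq_infinite) auto
  then have ae: "AE x in M. convergent (\<lambda>k. f (r k) x)"
  proof eventually_elim
    case (elim x)
    have "summable (\<lambda>k. 2^k * (norm (d k x))\<^sup>2)"
      using elim by (intro summable_suminf_not_top) auto
    then have "summable (\<lambda>k. norm (d k x))" by (rule summable_norm_if_weighted_squares_summable)
    then have "summable (\<lambda>k. d k x)" by (rule summable_norm_cancel)
    then have "convergent (\<lambda>n. \<Sum>k<n. d k x)" by (simp add: summable_iff_convergent)
    moreover have "(\<Sum>k<n. d k x) = f (r n) x - f (r 0) x" for n
      unfolding d_def by (rule sum_lessThan_telescope)
    ultimately have "convergent (\<lambda>n. f (r n) x - f (r 0) x)" by simp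
    then have "convergent (\<lambda>n. f (r n) x - f (r 0) x + f (r 0) x)"
      by (intro convergent_add convergent_const)
    then show ?case by simp
  qed
  define g where "g x = lim (\<lambda>k. f (r k) x)" for x
  have [measurable]: "g \<in> borel_measurable M" unfolding g_def by measurable
  have lim: "AE x in M. (\<lambda>k. f (r k) x) \<longlonglongrightarrow> g x"
    using ae by eventually_elim (simp add: g_def convergent_LIMSEQ_iff)
  have key: "square_integrable M (\<lambda>x. f m x - g x) \<and> sqnorm M (\<lambda>x. f m x - g x) \<le> e"
    if e: "e > 0" and m: "\<And>n. n \<ge> K \<Longrightarrow> sqnorm M (\<lambda>x. f m x - f n x) \<le> e" for e m K
  proof -
    have A: "AE x in M. (\<lambda>k. f m x - f (r (k + K)) x) \<longlonglongrightarrow> f m x - g x"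
      using lim
    proof eventually_elim
      case (elim x)
      show ?case using LIMSEQ_ignore_initial_segment[OF elim, of K] by (intro tendsto_intros)
    qed
    have B: "square_integrable M (\<lambda>x. f m x - f (r (k + K)) x)" for k
      by (intro square_integrable_diff f)
    have C: "sqnorm M (\<lambda>x. f m x - f (r (k + K)) x) \<le> e" for k
      by (rule m) (use rk[of "k + K"] in linarith)
    show ?thesis using square_integrable_Fatou[OF B _ A C] by simp
  qed
  obtain K0 where "\<forall>m\<ge>K0. \<forall>n\<ge>K0. sqnorm M (\<lambda>x. f m x - f n x) < 1" using cauchy[of 1] by auto
  then have "sqnorm M (\<lambda>x. f K0 x - f n x) \<le> 1" if "n \<ge> K0" for n
    using that order_refl less_imp_le by blast
  then have "square_integrable M (\<lambda>x. f K0 x - g x)" using key[of 1 K0 K0] by simp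
  from square_integrable_diff[OF f[of K0] this] have g: "square_integrable M g" by simp
  have "(\<lambda>n. sqnorm M (\<lambda>x. f n x - g x)) \<longlonglongrightarrow> 0"
  proof (rule LIMSEQ_I)
    fix e :: real assume e: "e > 0"
    then obtain K where "\<forall>m\<ge>K. \<forall>n\<ge>K. sqnorm M (\<lambda>x. f m x - f n x) < e/2" using cauchy[of "e/2"] by auto
    then have le: "sqnorm M (\<lambda>x. f m x - f n x) \<le> e/2" if "m \<ge> K" "n \<ge> K" for m n
      using that less_imp_le by blast
    have "norm (sqnorm M (\<lambda>x. f m x - g x) - 0) < e" if "m \<ge> K" for m
    proof -
      have "sqnorm M (\<lambda>x. f m x - g x) \<le> e/2" using key[of "e/2" K m] le[OF that] e by simp
      then show ?thesis using e by simp
    qed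
    then show "\<exists>K. \<forall>m\<ge>K. norm (sqnorm M (\<lambda>x. f m x - g x) - 0) < e" by blast
  qed
  with g show ?thesis using that by blast
qed

section \<open>Continuously differentiable functions\<close>

lemma times_cont_differentiable_SucI:
  assumes "\<And>x. (\<phi> has_derivative D x) (at x)"
    and "\<And>b. b \<in> Basis \<Longrightarrow> times_cont_differentiable k (\<lambda>x. D x b)"
  shows "times_cont_differentiable (Suc k) \<phi>"
proof -
  have "frechet_derivative \<phi> (at x) = D x" for x
    using frechet_derivative_at[OF assms(1)] by simp
  then show ?thesis using assms by (auto simp: differentiable_def)
qed

lemma times_cont_differentiable_SucD:
  assumes "times_cont_differentiable (Suc k) \<phi>"
  shows "(\<phi> has_derivative frechet_derivative \<phi> (at x)) (at x)"
    and "b \<in> Basis \<Longrightarrow> times_cont_differentiable k (\<lambda>x. frechet_derivative \<phi> (at x) b)"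
  using assms frechet_derivative_works by auto

lemma times_cont_differentiable_Suc_le:
  "times_cont_differentiable (Suc k) \<phi> \<Longrightarrow> times_cont_differentiable k \<phi>"
proof (induction k arbitrary: \<phi>)
  case 0
  then show ?case
    by (auto intro!: continuous_at_imp_continuous_on differentiable_imp_continuous_within)
next
  case (Suc k)
  show ?case
    by (rule times_cont_differentiable_SucI[OF times_cont_differentiable_SucD(1)[OF Suc.prems]])
      (rule Suc.IH, rule times_cont_differentiable_SucD(2)[OF Suc.prems])
qed

lemma times_cont_differentiable_const: "times_cont_differentiable k (\<lambda>x. c)"
proof (induction k arbitrary: c)
  case (Suc k)
  show ?case by (rule times_cont_differentiable_SucI[where D="\<lambda>x h. 0"]) (auto intro: Suc)
qed simp

lemma times_cont_differentiable_add:
  "times_cont_differentiable k \<phi> \<Longrightarrow> times_cont_differentiable k \<psi> \<Longrightarrow>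
    times_cont_differentiable k (\<lambda>x. \<phi> x + \<psi> x)"
proof (induction k arbitrary: \<phi> \<psi>)
  case 0 then show ?case by (auto intro: continuous_intros)
next
  case (Suc k)
  note D = times_cont_differentiable_SucD[OF Suc.prems(1)] times_cont_differentiable_SucD[OF Suc.prems(2)]
  show ?case
    by (rule times_cont_differentiable_SucI[OF has_derivative_add[OF D(1,3)]]) (rule Suc.IH[OF D(2,4)])
qed

lemma times_cont_differentiable_mult:
  "times_cont_differentiable k \<phi> \<Longrightarrow> times_cont_differentiable k \<psi> \<Longrightarrow>
    times_cont_differentiable k (\<lambda>x. \<phi> x * \<psi> x)"
proof (induction k arbitrary: \<phi> \<psi>)
  case 0 then show ?case by (auto intro: continuous_intros)
next
  case (Suc k)
  note D = times_cont_differentiable_SucD[OF Suc.prems(1)] times_cont_differentiable_SucD[OF Suc.prems(2)]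
  note C = times_cont_differentiable_Suc_le[OF Suc.prems(1)] times_cont_differentiable_Suc_le[OF Suc.prems(2)]
  show ?case
    by (rule times_cont_differentiable_SucI[OF has_derivative_mult[OF D(1,3)]])
      (intro times_cont_differentiable_add Suc.IH D(2,4) C)
qed

lemma times_cont_differentiable_prod:
  "finite I \<Longrightarrow> (\<And>i. i \<in> I \<Longrightarrow> times_cont_differentiable k (f i)) \<Longrightarrow>
    times_cont_differentiable k (\<lambda>x. \<Prod>i\<in>I. f i x)"
  by (induction I rule: finite_induct)
    (auto intro: times_cont_differentiable_const times_cont_differentiable_mult)

text \<open>  Smoothness of \<open>x \<mapsto> D 0 (x \<bullet> e + c)\<close> from a sequence of successive derivatives \<open>D\<close>; the
  statement for all members of the sequence is what the induction needs.\<close>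
lemma times_cont_differentiable_ridge:
  fixes D :: "nat \<Rightarrow> real \<Rightarrow> real" and e :: "'a::euclidean_space"
  assumes "\<And>n t. (D n has_real_derivative D (Suc n) t) (at t)"
  shows "times_cont_differentiable k (\<lambda>x::'a. D n (x \<bullet> e + c))"
proof (induction k arbitrary: n)
  case 0
  have "continuous_on UNIV (D n)"
    using assms DERIV_continuous_on by (metis has_field_derivative_at_within)
  then have "continuous_on UNIV (\<lambda>x::'a. D n (x \<bullet> e + c))"
    by (rule continuous_on_compose2) (auto intro!: continuous_intros)
  then show ?case by simp
next
  case (Suc k)
  show ?case
  proof (rule times_cont_differentiable_SucI)
    show "((\<lambda>x. D n (x \<bullet> e + c)) has_derivative (\<lambda>h. D (Suc n) (x \<bullet> e + c) * (h \<bullet> e))) (at x)" for x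
    proof -
      have "((\<lambda>x. x \<bullet> e + c) has_derivative (\<lambda>h. h \<bullet> e)) (at x)"
        by (auto intro!: derivative_eq_intros)
      from has_derivative_compose[OF this assms[unfolded has_field_derivative_def, of n]]
      show ?thesis by (simp add: o_def)
    qed
    show "times_cont_differentiable k (\<lambda>x. D (Suc n) (x \<bullet> e + c) * (b \<bullet> e))" for b
      by (intro times_cont_differentiable_mult Suc times_cont_differentiable_const)
  qed
qed

section \<open>Smooth bumps\<close>

text \<open>  The functions \<open>p(1/t) exp(-1/t)\<close>, extended by zero to \<open>t \<le> 0\<close>, with \<open>p\<close> a polynomial. The
  family is closed under differentiation, so that all its members are smooth.\<close>
definition flat_exp :: "real poly \<Rightarrow> real \<Rightarrow> real" where
  "flat_exp p t = (if t > 0 then poly p (1 / t) * exp (- (1 / t)) else 0)"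

lemma poly_times_exp_minus_tendsto_0: "((\<lambda>s. poly p s * exp (- s)) \<longlongrightarrow> 0) at_top" for p :: "real poly"
proof -
  have "((\<lambda>s. \<Sum>i\<le>degree p. coeff p i * (s ^ i / exp s)) \<longlongrightarrow> (\<Sum>i\<le>degree p. coeff p i * 0)) at_top"
    by (intro tendsto_intros tendsto_power_div_exp_0)
  moreover have "(\<Sum>i\<le>degree p. coeff p i * (s ^ i / exp s)) = poly p s * exp (- s)" for s
    by (simp add: poly_altdef sum_distrib_right exp_minus divide_inverse mult.assoc)
  ultimately show ?thesis by simp
qed

text \<open>  Only \<open>t = 0\<close> is not a formula: there the difference quotient tends to zero from the right because
  \<open>exp(-1/t)\<close> beats every power of \<open>1/t\<close>.\<close>
lemma flat_exp_has_derivative: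
  "(flat_exp p has_real_derivative flat_exp ([:0,0,1:] * (p - pderiv p)) t) (at t)"
proof -
  consider "t > 0" | "t < 0" | "t = 0" by linarith
  then show ?thesis
  proof cases
    case 1
    have "((\<lambda>t. poly p (1 / t) * exp (- (1 / t))) has_real_derivative
        flat_exp ([:0,0,1:] * (p - pderiv p)) t) (at t)"
      using 1 by (auto intro!: derivative_eq_intros DERIV_chain'[OF _ poly_DERIV]
          simp: flat_exp_def power2_eq_square field_simps)
    then show ?thesis
      by (rule has_field_derivative_transform_within_open[where S="{0<..}"])
        (use 1 in \<open>auto simp: flat_exp_def\<close>)
  next
    case 2
    have "((\<lambda>t. 0) has_real_derivative 0) (at t)" by simp
    then have "(flat_exp p has_real_derivative 0) (at t)"
      by (rule has_field_derivative_transform_within_open[where S="{..<0}"])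
        (use 2 in \<open>auto simp: flat_exp_def\<close>)
    then show ?thesis using 2 by (simp add: flat_exp_def)
  next
    case 3
    have "((\<lambda>y. (flat_exp p y - flat_exp p 0) / (y - 0)) \<longlongrightarrow> 0) (at 0)"
    proof (rule filterlim_split_at)
      have "((\<lambda>y. 0) \<longlongrightarrow> (0::real)) (at_left (0::real))" by simp
      then show "((\<lambda>y. (flat_exp p y - flat_exp p 0) / (y - 0)) \<longlongrightarrow> 0) (at_left 0)"
        by (rule Lim_transform_eventually) (auto simp: flat_exp_def eventually_at_filter)
      have "((\<lambda>y. poly (p * [:0,1:]) (inverse y) * exp (- inverse y)) \<longlongrightarrow> 0) (at_right 0)"
        by (rule filterlim_compose[OF poly_times_exp_minus_tendsto_0 filterlim_inverse_at_top_right])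
      then show "((\<lambda>y. (flat_exp p y - flat_exp p 0) / (y - 0)) \<longlongrightarrow> 0) (at_right 0)"
        by (rule Lim_transform_eventually) (auto simp: flat_exp_def eventually_at_filter field_simps)
    qed
    then have "(flat_exp p has_real_derivative 0) (at 0)"
      by (simp add: has_field_derivative_iff)
    then show ?thesis using 3 by (simp add: flat_exp_def)
  qed
qed

lemma times_cont_differentiable_flat_exp:
  "times_cont_differentiable k (\<lambda>x::'a::euclidean_space. flat_exp 1 (x \<bullet> e + c))"
proof -
  define P where "P n = ((\<lambda>p. [:0,0,1:] * (p - pderiv p)) ^^ n) (1 :: real poly)" for n
  have "(flat_exp (P n) has_real_derivative flat_exp (P (Suc n)) t) (at t)" for n t
    unfolding P_def using flat_exp_has_derivative by simp
  from times_cont_differentiable_ridge[of "\<lambda>n. flat_exp (P n)", OF this, of k 0]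
  show ?thesis by (simp add: P_def)
qed

text \<open>  A product of one-dimensional bumps. As \<open>n\<close> grows the factors \<open>exp(-1/(n t))\<close> tend to one for
  \<open>t > 0\<close>, and the bumps tend to the indicator of the open box from below.\<close>
definition box_bump :: "nat \<Rightarrow> 'a::euclidean_space \<Rightarrow> 'a \<Rightarrow> 'a \<Rightarrow> real" where
  "box_bump n a b x = (\<Prod>i\<in>Basis. flat_exp 1 (real n * (x \<bullet> i - a \<bullet> i)) * flat_exp 1 (real n * (b \<bullet> i - x \<bullet> i)))"

lemma flat_exp_1_bounds: "0 \<le> flat_exp 1 t" "flat_exp 1 t \<le> 1" "flat_exp 1 t > 0 \<longleftrightarrow> t > 0"
  by (auto simp: flat_exp_def)

lemma box_bump_bounds: "0 \<le> box_bump n a b x" "box_bump n a b x \<le> 1"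
  unfolding box_bump_def
  by (auto intro!: prod_nonneg prod_le_1 mult_nonneg_nonneg mult_le_one flat_exp_1_bounds)

lemma box_bump_outside: "x \<notin> box a b \<Longrightarrow> box_bump n a b x = 0"
  unfolding box_bump_def mem_box
  by (fastforce simp: flat_exp_def zero_less_mult_iff intro!: prod_zero)

lemma box_bump_pos: "x \<in> box a b \<Longrightarrow> n > 0 \<Longrightarrow> box_bump n a b x > 0"
  unfolding box_bump_def mem_box by (intro prod_pos ballI mult_pos_pos) (auto simp: flat_exp_1_bounds)

lemma box_bump_tendsto: "(\<lambda>n. box_bump n a b x) \<longlonglongrightarrow> indicator (box a b) x"
proof (cases "x \<in> box a b")
  case True
  have lim: "(\<lambda>n. flat_exp 1 (real n * t)) \<longlonglongrightarrow> 1" if "t > 0" for t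
  proof -
    have "(\<lambda>n. exp (- (1 / t * inverse (real n)))) \<longlonglongrightarrow> exp (- (1 / t * 0))"
      by (intro tendsto_intros LIMSEQ_inverse_real_of_nat[THEN LIMSEQ_imp_Suc] lim_inverse_n)
    then have "(\<lambda>n. exp (- (1 / t * inverse (real n)))) \<longlonglongrightarrow> 1" by simp
    then show ?thesis
      by (rule Lim_transform_eventually)
        (use that in \<open>auto simp: flat_exp_def field_simps intro!: eventually_sequentiallyI[of 1]\<close>)
  qed
  have "(\<lambda>n. box_bump n a b x) \<longlonglongrightarrow> (\<Prod>i\<in>(Basis::'a set). 1 * 1)"
    unfolding box_bump_def using True by (intro tendsto_intros lim) (auto simp: mem_box)
  then show ?thesis using True by simp
qed (simp add: box_bump_outside)

section \<open>Test functions\<close>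

lemma test_functionsI:
  assumes "\<And>k. times_cont_differentiable k \<phi>" "compact K" "\<And>x. \<phi> x \<noteq> 0 \<Longrightarrow> x \<in> K" "K \<subseteq> \<Omega>"
  shows "\<phi> \<in> test_functions \<Omega>"
proof -
  have "closure {x. \<phi> x \<noteq> 0} \<subseteq> K"
    using assms by (intro closure_minimal) (auto intro: compact_imp_closed)
  moreover from this have "compact (closure {x. \<phi> x \<noteq> 0})"
    by (metis assms(2) closed_closure compact_Int_closed inf.absorb_iff2)
  ultimately show ?thesis using assms by (auto simp: test_functions_def)
qed

lemma test_functions_tcd: "\<phi> \<in> test_functions \<Omega> \<Longrightarrow> times_cont_differentiable k \<phi>"
  by (auto simp: test_functions_def)

lemma test_functions_support:
  assumes "\<phi> \<in> test_functions \<Omega>"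
  obtains K where "compact K" "K \<subseteq> \<Omega>" "\<And>x. x \<notin> K \<Longrightarrow> \<phi> x = 0"
proof (rule that[of "closure {x. \<phi> x \<noteq> 0}"])
  show "\<phi> x = 0" if "x \<notin> closure {x. \<phi> x \<noteq> 0}" for x
    using that closure_subset[of "{x. \<phi> x \<noteq> 0}"] by blast
qed (use assms in \<open>auto simp: test_functions_def\<close>)

lemma box_bump_test_function: "cbox a b \<subseteq> \<Omega> \<Longrightarrow> box_bump n a b \<in> test_functions \<Omega>"
proof (rule test_functionsI[of _ "cbox a b"])
  show "times_cont_differentiable k (box_bump n a b)" for k
  proof -
    have "times_cont_differentiable k (\<lambda>x::'a. flat_exp 1 (real n * (x \<bullet> i - a \<bullet> i)))"
      "times_cont_differentiable k (\<lambda>x::'a. flat_exp 1 (real n * (b \<bullet> i - x \<bullet> i)))" for i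
      using times_cont_differentiable_flat_exp[of k "real n *\<^sub>R i" "- (real n * (a \<bullet> i))"]
        times_cont_differentiable_flat_exp[of k "- real n *\<^sub>R i" "real n * (b \<bullet> i)"]
      by (simp_all add: algebra_simps)
    then show ?thesis unfolding box_bump_def[abs_def]
      by (intro times_cont_differentiable_prod times_cont_differentiable_mult) auto
  qed
  show "x \<in> cbox a b" if "box_bump n a b x \<noteq> 0" for x
    using that box_bump_outside[of x a b n] box_subset_cbox[of a b] by auto
qed auto

lemma test_functions_add:
  assumes "\<phi> \<in> test_functions \<Omega>" "\<psi> \<in> test_functions \<Omega>"
  shows "(\<lambda>x. \<phi> x + \<psi> x) \<in> test_functions \<Omega>"
proof -
  obtain K where K: "compact K" "K \<subseteq> \<Omega>" "\<And>x. x \<notin> K \<Longrightarrow> \<phi> x = 0"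
    by (rule test_functions_support[OF assms(1)]) blast
  obtain L where L: "compact L" "L \<subseteq> \<Omega>" "\<And>x. x \<notin> L \<Longrightarrow> \<psi> x = 0"
    by (rule test_functions_support[OF assms(2)]) blast
  show ?thesis
  proof (rule test_functionsI[of _ "K \<union> L"])
    show "times_cont_differentiable k (\<lambda>x. \<phi> x + \<psi> x)" for k
      by (intro times_cont_differentiable_add test_functions_tcd[OF assms(1)] test_functions_tcd[OF assms(2)])
    show "x \<in> K \<union> L" if "\<phi> x + \<psi> x \<noteq> 0" for x
      using that K(3)[of x] L(3)[of x] by (cases "x \<in> K"; cases "x \<in> L") simp_all
  qed (use K L in auto)
qed

lemma test_functions_mult:
  assumes "\<phi> \<in> test_functions \<Omega>" "\<And>k. times_cont_differentiable k \<psi>"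
  shows "(\<lambda>x. \<psi> x * \<phi> x) \<in> test_functions \<Omega>"
proof -
  obtain K where K: "compact K" "K \<subseteq> \<Omega>" "\<And>x. x \<notin> K \<Longrightarrow> \<phi> x = 0"
    by (rule test_functions_support[OF assms(1)]) blast
  show ?thesis
  proof (rule test_functionsI[of _ K])
    show "times_cont_differentiable k (\<lambda>x. \<psi> x * \<phi> x)" for k
      by (intro times_cont_differentiable_mult assms(2) test_functions_tcd[OF assms(1)])
    show "x \<in> K" if "\<psi> x * \<phi> x \<noteq> 0" for x
      using that K(3)[of x] by (cases "x \<in> K") simp_all
  qed (use K in auto)
qed

lemma test_functions_scale: "\<phi> \<in> test_functions \<Omega> \<Longrightarrow> (\<lambda>x. c * \<phi> x) \<in> test_functions \<Omega>"
  by (rule test_functions_mult) (auto intro: times_cont_differentiable_const)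

definition gradient :: "('a::euclidean_space \<Rightarrow> real) \<Rightarrow> 'a \<Rightarrow> 'a" where
  "gradient \<phi> x = (\<Sum>b\<in>Basis. frechet_derivative \<phi> (at x) b *\<^sub>R b)"

lemma gradient_inner_Basis: "b \<in> Basis \<Longrightarrow> gradient \<phi> x \<bullet> b = frechet_derivative \<phi> (at x) b"
  unfolding gradient_def by (simp add: inner_sum_left_Basis)

lemma test_function_has_derivative:
  assumes "\<phi> \<in> test_functions \<Omega>"
  shows "(\<phi> has_derivative (\<lambda>h. gradient \<phi> x \<bullet> h)) (at x)"
proof -
  have D: "(\<phi> has_derivative frechet_derivative \<phi> (at x)) (at x)"
    using times_cont_differentiable_SucD(1)[OF test_functions_tcd[OF assms, of "Suc 0"]] .
  interpret linear "frechet_derivative \<phi> (at x)" using D by (rule has_derivative_linear)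
  have "frechet_derivative \<phi> (at x) h = gradient \<phi> x \<bullet> h" for h
  proof -
    have "frechet_derivative \<phi> (at x) h = frechet_derivative \<phi> (at x) (\<Sum>b\<in>Basis. (h \<bullet> b) *\<^sub>R b)"
      by (simp add: euclidean_representation)
    also have "\<dots> = (\<Sum>b\<in>Basis. (h \<bullet> b) * frechet_derivative \<phi> (at x) b)" by (simp add: sum scaleR)
    also have "\<dots> = gradient \<phi> x \<bullet> h"
      unfolding gradient_def inner_sum_left inner_scaleR_left
      by (intro sum.cong) (simp_all add: inner_commute mult.commute)
    finally show ?thesis .
  qed
  then have "frechet_derivative \<phi> (at x) = (\<lambda>h. gradient \<phi> x \<bullet> h)" by auto
  with D show ?thesis by simp
qed

lemma test_function_continuous: "\<phi> \<in> test_functions \<Omega> \<Longrightarrow> continuous_on UNIV \<phi>"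
  using test_functions_tcd[of \<phi> \<Omega> 0] by simp

lemma gradient_continuous: "\<phi> \<in> test_functions \<Omega> \<Longrightarrow> continuous_on UNIV (gradient \<phi>)"
  unfolding gradient_def[abs_def]
  using times_cont_differentiable_SucD(2)[OF test_functions_tcd[of \<phi> \<Omega> "Suc 0"]]
  by (intro continuous_intros) auto

lemma gradient_outside_support:
  assumes "\<phi> \<in> test_functions \<Omega>" "compact K" "\<And>x. x \<notin> K \<Longrightarrow> \<phi> x = 0" "x \<notin> K"
  shows "gradient \<phi> x = 0"
proof -
  have "((\<lambda>x. 0::real) has_derivative (\<lambda>h. 0)) (at x)" by simp
  then have "(\<phi> has_derivative (\<lambda>h. 0)) (at x)"
    by (rule has_derivative_transform_within_open[where s="- K"])
      (use assms in \<open>auto intro: compact_imp_closed\<close>)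
  from fun_cong[OF has_derivative_unique[OF this test_function_has_derivative[OF assms(1)]],
      of "gradient \<phi> x"]
  show ?thesis by simp
qed

lemma continuous_compact_support_bounded:
  fixes f :: "'a::euclidean_space \<Rightarrow> 'b::euclidean_space"
  assumes "continuous_on UNIV f" "compact K" "\<And>x. x \<notin> K \<Longrightarrow> f x = 0"
  shows "\<exists>C\<ge>0. \<forall>x. norm (f x) \<le> C"
proof -
  have "compact (f ` K)"
    using assms by (intro compact_continuous_image) (auto intro: continuous_on_subset)
  then obtain C where "\<And>x. x \<in> K \<Longrightarrow> norm (f x) \<le> C"
    using compact_imp_bounded bounded_iff by (metis imageI)
  then have "norm (f x) \<le> max C 0" for x
    using assms(3)[of x] by (cases "x \<in> K") (simp_all add: le_max_iff_disj)
  then show ?thesis by (intro exI[of _ "max C 0"]) simp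
qed

lemma continuous_compact_support_integrable:
  fixes f :: "'a::euclidean_space \<Rightarrow> 'b::euclidean_space"
  assumes "continuous_on UNIV f" "compact K" "\<And>x. x \<notin> K \<Longrightarrow> f x = 0"
  shows "integrable lborel f" "square_integrable lborel f"
proof -
  have *: "integrable lborel g" if "continuous_on UNIV g" "\<And>x. x \<notin> K \<Longrightarrow> g x = 0" for g :: "'a \<Rightarrow> 'c::euclidean_space"
  proof -
    have "integrable lborel (\<lambda>x. indicator K x *\<^sub>R g x)"
      using assms(2) that by (intro borel_integrable_compact) (auto intro: continuous_on_subset)
    moreover have "indicator K x *\<^sub>R g x = g x" for x using that(2)[of x] by (auto simp: indicator_def)
    ultimately show ?thesis by simp
  qed
  show "integrable lborel f" using * assms by blast
  have "integrable lborel (\<lambda>x. (norm (f x))\<^sup>2)"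
    using assms by (intro *) (auto intro!: continuous_intros)
  then show "square_integrable lborel f"
    using assms(1) by (auto simp: square_integrable_def intro: borel_measurable_continuous_onI)
qed

lemma test_function_square_integrable:
  assumes "\<phi> \<in> test_functions \<Omega>"
  shows "square_integrable lborel \<phi>" "square_integrable lborel (gradient \<phi>)"
    "integrable lborel \<phi>" "integrable lborel (gradient \<phi>)"
proof -
  obtain K where K: "compact K" "\<And>x. x \<notin> K \<Longrightarrow> \<phi> x = 0" by (rule test_functions_support[OF assms]) blast
  show "square_integrable lborel \<phi>" "integrable lborel \<phi>"
    using continuous_compact_support_integrable[OF test_function_continuous[OF assms] K] by auto
  show "square_integrable lborel (gradient \<phi>)" "integrable lborel (gradient \<phi>)"
    using continuous_compact_support_integrable[OF gradient_continuous[OF assms] K(1)]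
      gradient_outside_support[OF assms K] by auto
qed

lemma lborel_integral_translation:
  fixes f :: "'a::euclidean_space \<Rightarrow> 'b::euclidean_space"
  assumes [measurable]: "f \<in> borel_measurable borel"
  shows "(LINT x|lborel. f (x + c)) = (LINT x|lborel. f x)"
proof -
  have "(LINT x|lborel. f x) = (LINT x|distr lborel borel ((+) c). f x)"
    by (simp add: lborel_distr_plus)
  also have "\<dots> = (LINT x|lborel. f (c + x))" by (subst integral_distr) auto
  finally show ?thesis by (simp add: add.commute)
qed

lemma lborel_nn_integral_translation:
  assumes [measurable]: "f \<in> borel_measurable borel"
  shows "(\<integral>\<^sup>+x. f (x + c) \<partial>lborel) = (\<integral>\<^sup>+x. f x \<partial>(lborel :: 'a::euclidean_space measure))"
proof -
  have "(\<integral>\<^sup>+x. f x \<partial>lborel) = (\<integral>\<^sup>+x. f x \<partial>(distr lborel borel ((+) c)))"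
    by (simp add: lborel_distr_plus)
  also have "\<dots> = (\<integral>\<^sup>+x. f (c + x) \<partial>lborel)" by (subst nn_integral_distr) auto
  finally show ?thesis by (simp add: add.commute)
qed

lemma lborel_integrable_translation:
  fixes f :: "'a::euclidean_space \<Rightarrow> 'b::euclidean_space"
  assumes "integrable lborel f"
  shows "integrable lborel (\<lambda>x. f (x + c))"
proof -
  have [measurable]: "f \<in> borel_measurable borel"
    using borel_measurable_integrable[OF assms] by simp
  have "integrable (distr lborel borel ((+) c)) f" using assms by (simp add: lborel_distr_plus)
  then have "integrable lborel (\<lambda>x. f (c + x))" by (subst (asm) integrable_distr_eq) auto
  then show ?thesis by (simp add: add.commute)
qed

lemma difference_quotient_tendsto:
  assumes "\<phi> \<in> test_functions \<Omega>"
  shows "(\<lambda>n. real (Suc n) * (\<phi> (x + (1 / real (Suc n)) *\<^sub>R h) - \<phi> x)) \<longlonglongrightarrow> gradient \<phi> x \<bullet> h"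
proof -
  have "((\<lambda>t. x + t *\<^sub>R h) has_derivative (\<lambda>t. t *\<^sub>R h)) (at (0::real))"
    by (auto intro!: derivative_eq_intros)
  moreover have "(\<phi> has_derivative (\<lambda>k. gradient \<phi> x \<bullet> k)) (at (x + 0 *\<^sub>R h))"
    using test_function_has_derivative[OF assms] by simp
  ultimately have "((\<lambda>t. \<phi> (x + t *\<^sub>R h)) has_derivative (\<lambda>t. gradient \<phi> x \<bullet> (t *\<^sub>R h))) (at (0::real))"
    by (rule has_derivative_compose)
  moreover have "(\<lambda>t. gradient \<phi> x \<bullet> (t *\<^sub>R h)) = (*) (gradient \<phi> x \<bullet> h)" by (auto simp: mult.commute)
  ultimately have "((\<lambda>t. \<phi> (x + t *\<^sub>R h)) has_real_derivative gradient \<phi> x \<bullet> h) (at (0::real))"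
    by (simp add: has_field_derivative_def)
  then have "((\<lambda>t. (\<phi> (x + t *\<^sub>R h) - \<phi> x) / t) \<longlongrightarrow> gradient \<phi> x \<bullet> h) (at 0)"
    by (simp add: has_field_derivative_iff)
  moreover have "filterlim (\<lambda>n. 1 / real (Suc n)) (at 0) sequentially"
    unfolding filterlim_at using lim_1_over_n[THEN LIMSEQ_Suc] by (auto simp: del: of_nat_Suc)
  ultimately have "(\<lambda>n. (\<phi> (x + (1 / real (Suc n)) *\<^sub>R h) - \<phi> x) / (1 / real (Suc n))) \<longlonglongrightarrow> gradient \<phi> x \<bullet> h"
    by (rule filterlim_compose)
  then show ?thesis by (simp add: mult.commute)
qed

text \<open>  The mean value inequality bounds the quotients by the maximum of the gradient, and they vanish
  outside a neighbourhood of the support. Dominated convergence then applies to them and to their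
  squares.\<close>
lemma difference_quotient_dominated:
  assumes "\<phi> \<in> test_functions \<Omega>"
  obtains K L where "compact K" "L \<ge> 0"
    "\<And>n x. \<bar>real (Suc n) * (\<phi> (x + (1 / real (Suc n)) *\<^sub>R h) - \<phi> x)\<bar> \<le> indicator K x * L"
proof -
  obtain K where K: "compact K" "\<And>x. x \<notin> K \<Longrightarrow> \<phi> x = 0" by (rule test_functions_support[OF assms]) blast
  have "gradient \<phi> x = 0" if "x \<notin> K" for x
    by (rule gradient_outside_support[OF assms K that])
  then obtain C where C: "C \<ge> 0" "\<And>x. norm (gradient \<phi> x) \<le> C"
    using continuous_compact_support_bounded[OF gradient_continuous[OF assms] K(1)] by blast
  have lip: "\<bar>\<phi> (x + v) - \<phi> x\<bar> \<le> C * norm v" for x v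
  proof -
    have "norm (\<phi> (x + v) - \<phi> x) \<le> C * norm (x + v - x)"
    proof (rule differentiable_bound[where S=UNIV and f'="\<lambda>x h. gradient \<phi> x \<bullet> h"])
      show "onorm (\<lambda>h. gradient \<phi> y \<bullet> h) \<le> C" for y
      proof (rule onorm_le)
        fix h show "norm (gradient \<phi> y \<bullet> h) \<le> C * norm h"
          using Cauchy_Schwarz_ineq2[of "gradient \<phi> y" h] C(2)[of y]
            mult_right_mono[of "norm (gradient \<phi> y)" C "norm h"] by simp
      qed
    qed (auto intro: test_function_has_derivative[OF assms])
    then show ?thesis by simp
  qed
  define K' where "K' = {x + y | x y. x \<in> K \<and> y \<in> cball 0 (norm h)}"
  have "compact K'" unfolding K'_def using K(1) by (intro compact_sums) auto
  moreover have "\<bar>real (Suc n) * (\<phi> (x + (1 / real (Suc n)) *\<^sub>R h) - \<phi> x)\<bar> \<le> indicator K' x * (C * norm h)" for n x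
  proof (cases "x \<in> K'")
    case True
    have "\<bar>real (Suc n) * (\<phi> (x + (1 / real (Suc n)) *\<^sub>R h) - \<phi> x)\<bar> \<le>
        real (Suc n) * (C * norm ((1 / real (Suc n)) *\<^sub>R h))"
      unfolding abs_mult by (rule mult_mono[OF _ lip]) auto
    also have "\<dots> = C * norm h" by simp
    finally show ?thesis using True by simp
  next
    case False
    let ?v = "(1 / real (Suc n)) *\<^sub>R h"
    have v: "norm ?v \<le> norm h"
      using mult_right_mono[of "1 / real (Suc n)" 1 "norm h"] by (simp add: divide_le_eq)
    have "x \<notin> K" using False unfolding K'_def by (force intro: exI[of _ 0])
    moreover have "x + ?v \<notin> K"
    proof
      assume "x + ?v \<in> K"
      moreover have "x = (x + ?v) + (- ?v)" by simp
      moreover have "- ?v \<in> cball 0 (norm h)" using v by simp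
      ultimately show False using False unfolding K'_def by blast
    qed
    ultimately show ?thesis using K(2) False by simp
  qed
  ultimately show ?thesis using that[of K' "C * norm h"] C(1) by auto
qed

text \<open>  The integrals of the difference quotients vanish by translation invariance of Lebesgue measure.\<close>
lemma integral_gradient_eq_0:
  assumes "\<phi> \<in> test_functions \<Omega>"
  shows "(LINT x|lborel. gradient \<phi> x \<bullet> h) = 0"
proof -
  obtain K L where K: "compact K" "L \<ge> 0" and
    dom: "\<And>n x. \<bar>real (Suc n) * (\<phi> (x + (1 / real (Suc n)) *\<^sub>R h) - \<phi> x)\<bar> \<le> indicator K x * L"
    by (rule difference_quotient_dominated[OF assms]) blast
  have [measurable]: "\<phi> \<in> borel_measurable borel" "gradient \<phi> \<in> borel_measurable borel"
    using test_function_continuous[OF assms] gradient_continuous[OF assms]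
    by (auto intro: borel_measurable_continuous_onI)
  have int: "integrable lborel \<phi>" using test_function_square_integrable[OF assms] by auto
  have "(\<lambda>n. LINT x|lborel. real (Suc n) * (\<phi> (x + (1 / real (Suc n)) *\<^sub>R h) - \<phi> x))
      \<longlonglongrightarrow> (LINT x|lborel. gradient \<phi> x \<bullet> h)"
  proof (rule integral_dominated_convergence)
    show "integrable lborel (\<lambda>x. indicator K x * L)"
      using borel_integrable_compact[OF K(1), of "\<lambda>x. L"] by simp
  qed (auto intro!: AE_I2 difference_quotient_tendsto[OF assms] simp: dom simp del: of_nat_Suc)
  moreover have "(LINT x|lborel. real (Suc n) * (\<phi> (x + (1 / real (Suc n)) *\<^sub>R h) - \<phi> x)) = 0" for n
    using lborel_integral_translation[of \<phi>] lborel_integrable_translation[OF int] int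
    by (simp del: of_nat_Suc)
  ultimately have "(\<lambda>n. 0) \<longlonglongrightarrow> (LINT x|lborel. gradient \<phi> x \<bullet> h)" by (simp only:)
  then show ?thesis by (simp add: LIMSEQ_const_iff)
qed

lemma gradient_mult:
  assumes "\<phi> \<in> test_functions \<Omega>" "\<psi> \<in> test_functions \<Omega>"
  shows "gradient (\<lambda>x. \<phi> x * \<psi> x) x = \<phi> x *\<^sub>R gradient \<psi> x + \<psi> x *\<^sub>R gradient \<phi> x"
proof -
  have p: "(\<lambda>x. \<phi> x * \<psi> x) \<in> test_functions \<Omega>"
    by (intro test_functions_mult assms(2) test_functions_tcd[OF assms(1)])
  have "((\<lambda>x. \<phi> x * \<psi> x) has_derivative (\<lambda>h. \<phi> x * (gradient \<psi> x \<bullet> h) + gradient \<phi> x \<bullet> h * \<psi> x)) (at x)"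
    by (intro has_derivative_mult test_function_has_derivative[OF assms(1)]
        test_function_has_derivative[OF assms(2)])
  note eq = has_derivative_unique[OF test_function_has_derivative[OF p] this]
  have "gradient (\<lambda>x. \<phi> x * \<psi> x) x \<bullet> h = (\<phi> x *\<^sub>R gradient \<psi> x + \<psi> x *\<^sub>R gradient \<phi> x) \<bullet> h" for h
    using fun_cong[OF eq, of h] by (simp add: inner_add_left mult.commute)
  then show ?thesis using vector_eq_rdot by blast
qed

lemma square_integrable_inner_const:
  assumes "square_integrable M g"
  shows "square_integrable M (\<lambda>x. g x \<bullet> h)"
proof -
  have [measurable]: "g \<in> borel_measurable M" using square_integrable_measurable[OF assms] .
  have "integrable M (\<lambda>x. (norm h)\<^sup>2 * (norm (g x))\<^sup>2)"
    using assms by (auto simp: square_integrable_def)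
  then have "integrable M (\<lambda>x. (norm (g x \<bullet> h))\<^sup>2)"
  proof (rule Bochner_Integration.integrable_bound)
    have "(g x \<bullet> h)\<^sup>2 \<le> (norm h)\<^sup>2 * (norm (g x))\<^sup>2" for x
      unfolding power2_norm_eq_inner using Cauchy_Schwarz_ineq[of "g x" h] by (simp add: mult.commute)
    then show "AE x in M. norm ((norm (g x \<bullet> h))\<^sup>2) \<le> norm ((norm h)\<^sup>2 * (norm (g x))\<^sup>2)"
      by (auto simp: abs_mult)
  qed measurable
  then show ?thesis by (simp add: square_integrable_def)
qed

text \<open>  The product rule, and the vanishing of the integral of a derivative.\<close>
lemma integration_by_parts_test_functions:
  assumes "\<phi> \<in> test_functions \<Omega>" "\<psi> \<in> test_functions \<Omega>"
  shows "(LINT x|lborel. \<phi> x * (gradient \<psi> x \<bullet> h)) = - (LINT x|lborel. (gradient \<phi> x \<bullet> h) * \<psi> x)"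
proof -
  have p: "(\<lambda>x. \<phi> x * \<psi> x) \<in> test_functions \<Omega>"
    by (intro test_functions_mult assms(2) test_functions_tcd[OF assms(1)])
  note S = test_function_square_integrable[OF assms(1)] test_function_square_integrable[OF assms(2)]
  have i1: "integrable lborel (\<lambda>x. \<phi> x * (gradient \<psi> x \<bullet> h))"
    using square_integrable_inner[OF S(1) square_integrable_inner_const[OF S(6)]] by simp
  have i2: "integrable lborel (\<lambda>x. (gradient \<phi> x \<bullet> h) * \<psi> x)"
    using square_integrable_inner[OF square_integrable_inner_const[OF S(2)] S(5)] by simp
  have "0 = (LINT x|lborel. \<phi> x * (gradient \<psi> x \<bullet> h) + (gradient \<phi> x \<bullet> h) * \<psi> x)"
    using integral_gradient_eq_0[OF p, of h]
    by (simp add: gradient_mult[OF assms] inner_add_left mult.commute)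
  also have "\<dots> = (LINT x|lborel. \<phi> x * (gradient \<psi> x \<bullet> h)) + (LINT x|lborel. (gradient \<phi> x \<bullet> h) * \<psi> x)"
    using i1 i2 by simp
  finally show ?thesis by simp
qed

lemma borel_measurable_lebesgue_on:
  "f \<in> borel_measurable borel \<Longrightarrow> f \<in> borel_measurable (lebesgue_on S)"
  by (intro measurable_restrict_space1 measurable_completion) simp

text \<open>  Weak formulations integrate over \<open>\<Omega>\<close>, whereas translations need the whole space; a test function
  of \<open>\<Omega>\<close> has the same integrals in both settings.\<close>
lemma lebesgue_on_eq_lborel:
  fixes f :: "'a::euclidean_space \<Rightarrow> 'b::euclidean_space"
  assumes "S \<in> sets lebesgue" "f \<in> borel_measurable borel" "\<And>x. x \<notin> S \<Longrightarrow> f x = 0"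
  shows "(LINT x|lebesgue_on S. f x) = (LINT x|lborel. f x)"
    "integrable (lebesgue_on S) f \<longleftrightarrow> integrable lborel f"
proof -
  have eq: "(\<lambda>x. indicator S x *\<^sub>R f x) = f" using assms(3) by (auto simp: indicator_def)
  have f: "f \<in> borel_measurable lborel" using assms(2) by simp
  show "(LINT x|lebesgue_on S. f x) = (LINT x|lborel. f x)"
    using assms(1) by (simp add: integral_restrict_space eq integral_completion[OF f])
  show "integrable (lebesgue_on S) f \<longleftrightarrow> integrable lborel f"
    using assms(1) by (simp add: integrable_restrict_space eq integrable_completion[OF f])
qed

lemma sqnorm_lebesgue_on_eq_lborel:
  fixes f :: "'a::euclidean_space \<Rightarrow> 'b::euclidean_space"
  assumes "S \<in> sets lebesgue" "f \<in> borel_measurable borel" "\<And>x. x \<notin> S \<Longrightarrow> f x = 0"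
  shows "sqnorm (lebesgue_on S) f = sqnorm lborel f"
    "square_integrable (lebesgue_on S) f \<longleftrightarrow> square_integrable lborel f"
proof -
  have "(\<lambda>x. (norm (f x))\<^sup>2) \<in> borel_measurable borel" using assms(2) by measurable
  from lebesgue_on_eq_lborel[OF assms(1) this] assms
  show "sqnorm (lebesgue_on S) f = sqnorm lborel f"
    "square_integrable (lebesgue_on S) f \<longleftrightarrow> square_integrable lborel f"
    by (auto simp: sqnorm_def square_integrable_def intro: borel_measurable_lebesgue_on)
qed

lemma test_function_outside: "\<phi> \<in> test_functions \<Omega> \<Longrightarrow> x \<notin> \<Omega> \<Longrightarrow> \<phi> x = 0"
  using closure_subset[of "{x. \<phi> x \<noteq> 0}"] unfolding test_functions_def by blast

lemma gradient_outside:
  assumes "\<phi> \<in> test_functions \<Omega>" "x \<notin> \<Omega>"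
  shows "gradient \<phi> x = 0"
proof -
  obtain K where K: "compact K" "K \<subseteq> \<Omega>" "\<And>x. x \<notin> K \<Longrightarrow> \<phi> x = 0"
    by (rule test_functions_support[OF assms(1)]) blast
  then show ?thesis using gradient_outside_support[OF assms(1) K(1,3)] assms(2) by blast
qed

lemma test_function_measurable:
  assumes "\<phi> \<in> test_functions \<Omega>"
  shows "\<phi> \<in> borel_measurable borel" "gradient \<phi> \<in> borel_measurable borel"
  using test_function_continuous[OF assms] gradient_continuous[OF assms]
  by (auto intro: borel_measurable_continuous_onI)

lemma test_function_square_integrable_on:
  assumes "\<phi> \<in> test_functions \<Omega>" "open \<Omega>"
  shows "square_integrable (lebesgue_on \<Omega>) \<phi>" "square_integrable (lebesgue_on \<Omega>) (gradient \<phi>)"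
    "sqnorm (lebesgue_on \<Omega>) \<phi> = sqnorm lborel \<phi>"
    "sqnorm (lebesgue_on \<Omega>) (gradient \<phi>) = sqnorm lborel (gradient \<phi>)"
proof -
  have S: "\<Omega> \<in> sets lebesgue" using assms(2) by simp
  note A = sqnorm_lebesgue_on_eq_lborel[OF S test_function_measurable(1)[OF assms(1)] test_function_outside[OF assms(1)]]
  note B = sqnorm_lebesgue_on_eq_lborel[OF S test_function_measurable(2)[OF assms(1)] gradient_outside[OF assms(1)]]
  show "square_integrable (lebesgue_on \<Omega>) \<phi>" "square_integrable (lebesgue_on \<Omega>) (gradient \<phi>)"
    "sqnorm (lebesgue_on \<Omega>) \<phi> = sqnorm lborel \<phi>"
    "sqnorm (lebesgue_on \<Omega>) (gradient \<phi>) = sqnorm lborel (gradient \<phi>)"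
    using A B test_function_square_integrable[OF assms(1)] by auto
qed

section \<open>The fundamental lemma of the calculus of variations\<close>

text \<open>  Boxes generate the Borel sets and are stable under intersection, so the integral over every Borel
  set vanishes.\<close>
lemma borel_AE_zero_if_box_integrals_zero:
  fixes g :: "'a::euclidean_space \<Rightarrow> real"
  assumes g: "integrable lborel g" and total: "(LINT x|lborel. g x) = 0"
    and box: "\<And>a b. (LINT x:box a b|lborel. g x) = 0"
  shows "AE x in lborel. g x = 0"
proof -
  have si: "set_integrable lborel A g" if "A \<in> sets borel" for A
    unfolding set_integrable_def using that g by (intro integrable_mult_indicator) simp_all
  have stable: "Int_stable (range (\<lambda>(a, b). box a b :: 'a set))"
    by (auto simp: Int_stable_def box_Int_box)
  have closed: "range (\<lambda>(a, b). box a b :: 'a set) \<subseteq> Pow UNIV" by simp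
  have "(LINT x:A|lborel. g x) = 0" if "A \<in> sigma_sets UNIV (range (\<lambda>(a, b). box a b :: 'a set))" for A
    using stable closed that
  proof (induction rule: sigma_sets_induct_disjoint)
    case (basic A) then show ?case using box by auto
  next
    case empty show ?case by (simp add: set_lebesgue_integral_def)
  next
    case (compl A)
    have A: "A \<in> sets borel" using compl(1) by (simp add: borel_eq_box)
    have "(LINT x:A|lborel. g x) + (LINT x:UNIV - A|lborel. g x) = (LINT x:A \<union> (UNIV - A)|lborel. g x)"
      using A by (intro set_integral_Un[symmetric] si) auto
    also have "A \<union> (UNIV - A) = UNIV" by auto
    also have "(LINT x:UNIV|lborel. g x) = 0" using total by (simp add: set_lebesgue_integral_def)
    finally show ?case using compl(2) by simp
  next
    case (union A)
    have A: "A i \<in> sets borel" for i using union(2) by (auto simp: borel_eq_box)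
    have "(LINT x:(\<Union>i. A i)|lborel. g x) = (\<Sum>i. LINT x:A i|lborel. g x)"
      using union(1) A by (intro lebesgue_integral_countable_add si) (auto simp: disjoint_family_on_def)
    then show ?case using union(3) by simp
  qed
  then have "(LINT x:A|lborel. g x) = (LINT x:A|lborel. 0)" if "A \<in> sets lborel" for A
    using that by (simp add: borel_eq_box)
  then show ?thesis by (intro density_unique_real g) auto
qed

text \<open>  Testing with bumps that increase to the indicator of a box shows that the integral over every box
  in \<open>\<Omega>\<close> vanishes.\<close>
lemma fundamental_lemma_calculus_of_variations:
  fixes f :: "'a::euclidean_space \<Rightarrow> real"
  assumes \<Omega>: "open \<Omega>" and f[measurable]: "f \<in> borel_measurable (lebesgue_on \<Omega>)"
    and int: "\<And>a b. cbox a b \<subseteq> \<Omega> \<Longrightarrow> integrable (lebesgue_on \<Omega>) (\<lambda>x. indicator (cbox a b) x * f x)"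
    and test: "\<And>\<phi>. \<phi> \<in> test_functions \<Omega> \<Longrightarrow> (LINT x|lebesgue_on \<Omega>. f x * \<phi> x) = 0"
  shows "AE x in lebesgue_on \<Omega>. f x = 0"
proof -
  let ?M = "lebesgue_on \<Omega>"
  have \<Omega>s: "\<Omega> \<in> sets lebesgue" using \<Omega> by simp
  have bm: "(\<lambda>x. indicator A x :: real) \<in> borel_measurable ?M" if "A \<in> sets borel" for A
    by (intro borel_measurable_lebesgue_on borel_measurable_indicator that)
  have [measurable]: "(\<lambda>x. indicator (box a b) x :: real) \<in> borel_measurable ?M"
      "(\<lambda>x. indicator (cbox a b) x :: real) \<in> borel_measurable ?M" for a b
    by (auto intro: bm)
  have boxes: "(LINT x|?M. indicator (box a b) x * f x) = 0" if ab: "cbox a b \<subseteq> \<Omega>" for a b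
  proof -
    have [measurable]: "box_bump n a b \<in> borel_measurable ?M" for n
      using borel_measurable_lebesgue_on test_function_measurable(1) box_bump_test_function[OF ab] by blast
    have "(\<lambda>n. LINT x|?M. f x * box_bump n a b x) \<longlonglongrightarrow> (LINT x|?M. f x * indicator (box a b) x)"
    proof (rule integral_dominated_convergence)
      show "integrable ?M (\<lambda>x. \<bar>indicator (cbox a b) x * f x\<bar>)" by (intro integrable_abs int ab)
      show "AE x in ?M. (\<lambda>n. f x * box_bump n a b x) \<longlonglongrightarrow> f x * indicator (box a b) x"
        by (intro AE_I2 tendsto_intros box_bump_tendsto)
      have "\<bar>f x\<bar> * \<bar>box_bump n a b x\<bar> \<le> \<bar>indicator (cbox a b) x * f x\<bar>" for n x
      proof (cases "x \<in> cbox a b")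
        case True
        then show ?thesis using box_bump_bounds[of n a b x] by (simp add: mult_left_le)
      next
        case False
        then have "x \<notin> box a b" using box_subset_cbox by blast
        then show ?thesis by (simp add: box_bump_outside)
      qed
      then show "AE x in ?M. norm (f x * box_bump n a b x) \<le> \<bar>indicator (cbox a b) x * f x\<bar>" for n
        by (simp add: abs_mult)
    qed measurable
    moreover have "(LINT x|?M. f x * box_bump n a b x) = 0" for n
      by (rule test[OF box_bump_test_function[OF ab]])
    ultimately have "(\<lambda>n. 0) \<longlonglongrightarrow> (LINT x|?M. f x * indicator (box a b) x)" by (simp only:)
    then show ?thesis by (simp add: LIMSEQ_const_iff mult.commute)
  qed
  have "AE x in ?M. x \<in> cbox c d \<longrightarrow> f x = 0" if cd: "cbox c d \<subseteq> \<Omega>" for c d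
  proof -
    define g where "g x = indicator \<Omega> x * (indicator (box c d) x * f x)" for x
    have intbox: "integrable ?M (\<lambda>x. indicator (box a b) x * (indicator (box c d) x * f x))" for a b
    proof (rule Bochner_Integration.integrable_bound[OF int[OF cd]])
      show "AE x in ?M. norm (indicator (box a b) x * (indicator (box c d) x * f x))
          \<le> norm (indicator (cbox c d) x * f x)"
        using box_subset_cbox[of c d] by (auto simp: indicator_def)
    qed measurable
    have int0: "(LINT x|?M. indicator (box a b) x * (indicator (box c d) x * f x)) = 0" for a b
    proof -
      obtain a' b' where ab': "box a b \<inter> box c d = box a' b'" using box_Int_box by blast
      have eq: "indicator (box a b) x * (indicator (box c d) x * f x) = indicator (box a' b') x * f x" for x
        by (simp add: ab'[symmetric] indicator_def)
      show ?thesis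
      proof (cases "box a' b' = {}")
        case True then show ?thesis unfolding eq by simp
      next
        case False
        then have "cbox a' b' = closure (box a' b')" by (simp add: closure_box)
        also have "\<dots> \<subseteq> closure (box c d)" using ab' by (intro closure_mono) auto
        also have "\<dots> \<subseteq> cbox c d" by (intro closure_minimal box_subset_cbox closed_cbox)
        finally show ?thesis unfolding eq using boxes cd by blast
      qed
    qed
    have gm: "integrable lebesgue (\<lambda>x. indicator (box a b) x * g x)"
        "(LINT x|lebesgue. indicator (box a b) x * g x) = 0" for a b
      using intbox[of a b] int0[of a b] \<Omega>s
      by (simp_all add: integrable_restrict_space integral_restrict_space g_def mult.left_commute)
    have "indicator (box c d) x * (indicator (box c d) x * f x) = indicator (box c d) x * f x" for x
      by (simp add: indicator_def)
    then have "integrable ?M (\<lambda>x. indicator (box c d) x * f x)"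
      using intbox[of c d] by (simp only:)
    then have gi: "integrable lebesgue g"
      using \<Omega>s by (simp add: integrable_restrict_space g_def[abs_def])
    then obtain g' where g'[measurable]: "g' \<in> borel_measurable lborel" and ae: "AE x in lborel. g x = g' x"
      using completion_ex_borel_measurable_real[of g lborel] by auto
    have ae': "AE x in lebesgue. g x = g' x" using ae by (rule AE_completion)
    have g'l: "g' \<in> borel_measurable lebesgue" by (rule measurable_completion[OF g'])
    have "integrable lebesgue g'" using integrable_cong_AE[OF _ _ ae'] gi g'l by auto
    then have g'i: "integrable lborel g'" by (simp add: integrable_completion[OF g'])
    have g'box: "(LINT x|lborel. indicator (box a b) x * g' x) = 0" for a b
    proof -
      have "(LINT x|lborel. indicator (box a b) x * g' x) = (LINT x|lebesgue. indicator (box a b) x * g' x)"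
        by (intro integral_completion[symmetric]) measurable
      also have "\<dots> = (LINT x|lebesgue. indicator (box a b) x * g x)"
        using ae' g'l borel_measurable_integrable[OF gm(1)]
        by (intro integral_cong_AE) (auto intro!: borel_measurable_times measurable_completion)
      finally show ?thesis using gm(2) by simp
    qed
    have "(LINT x|lborel. g' x) = (LINT x|lborel. indicator (box c d) x * g' x)"
      using ae by (intro integral_cong_AE) (auto simp: g_def indicator_def)
    then have "(LINT x|lborel. g' x) = 0" using g'box by simp
    then have "AE x in lborel. g' x = 0"
      using g'box by (intro borel_AE_zero_if_box_integrals_zero g'i) (auto simp: set_lebesgue_integral_def)
    with ae have "AE x in lborel. g x = 0" by eventually_elim simp
    then have "AE x in lebesgue. g x = 0" by (rule AE_completion)
    moreover have "AE x in lebesgue. x \<notin> cbox c d - box c d"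
      using negligible_frontier_interval[of c d]
      by (intro AE_not_in) (simp add: negligible_iff_null_sets)
    ultimately have "AE x in lebesgue. x \<in> \<Omega> \<longrightarrow> x \<in> cbox c d \<longrightarrow> f x = 0"
      by eventually_elim (auto simp: g_def indicator_def)
    then show ?thesis using \<Omega>s by (simp add: AE_restrict_space_iff)
  qed
  note cb = this
  obtain \<D> where D: "countable \<D>" "\<D> \<subseteq> Pow \<Omega>" "\<And>X. X \<in> \<D> \<Longrightarrow> \<exists>a b. X = cbox a b" "\<Union>\<D> = \<Omega>"
    by (rule open_countable_Union_open_cbox[OF \<Omega>]) blast
  have "\<forall>X\<in>\<D>. AE x in ?M. x \<in> X \<longrightarrow> f x = 0"
  proof
    fix X assume X: "X \<in> \<D>"
    then obtain a b where "X = cbox a b" using D(3) by blast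
    then show "AE x in ?M. x \<in> X \<longrightarrow> f x = 0" using cb[of a b] X D(2) by auto
  qed
  then have "AE x in ?M. \<forall>X\<in>\<D>. x \<in> X \<longrightarrow> f x = 0" by (rule AE_ball_countable[OF D(1), THEN iffD2])
  moreover have "AE x in ?M. x \<in> \<Omega>" by (rule AE_I2) simp
  ultimately show ?thesis
  proof eventually_elim
    case (elim x)
    then obtain X where "X \<in> \<D>" "x \<in> X" using D(4) by blast
    then show ?case using elim by blast
  qed
qed

lemma square_integrable_indicator_cbox:
  "square_integrable lborel (indicator (cbox a b) :: 'a::euclidean_space \<Rightarrow> real)"
proof -
  have "(norm (indicator (cbox a b) x :: real))\<^sup>2 = indicator (cbox a b) x" for x :: 'a
    by (simp add: indicator_def)
  moreover have "integrable lborel (indicator (cbox a b) :: 'a \<Rightarrow> real)"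
    by (intro integrable_real_indicator) (auto simp: emeasure_lborel_cbox_eq)
  ultimately show ?thesis by (simp add: square_integrable_def)
qed

section \<open>Weak gradients\<close>

lemma L2_iff_square_integrable: "u \<in> L2 \<Omega> \<longleftrightarrow> square_integrable (lebesgue_on \<Omega>) u"
  by (simp add: L2_def square_integrable_def)

lemma is_weak_grad_iff:
  "is_weak_grad \<Omega> u g \<longleftrightarrow> square_integrable (lebesgue_on \<Omega>) g \<and>
    (\<forall>\<phi>\<in>test_functions \<Omega>. \<forall>b\<in>Basis. sqinner (lebesgue_on \<Omega>) u (\<lambda>x. gradient \<phi> x \<bullet> b) =
      - sqinner (lebesgue_on \<Omega>) (\<lambda>x. g x \<bullet> b) \<phi>)"
  unfolding is_weak_grad_def L2_iff_square_integrable sqinner_def by (simp add: gradient_inner_Basis)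

lemma is_weak_grad_square_integrable:
  "is_weak_grad \<Omega> u g \<Longrightarrow> square_integrable (lebesgue_on \<Omega>) g"
  by (simp add: is_weak_grad_iff)

lemma is_weak_grad_weak_grad: "is_weak_grad \<Omega> u g \<Longrightarrow> is_weak_grad \<Omega> u (weak_grad \<Omega> u)"
  unfolding weak_grad_def by (rule someI[where P="is_weak_grad \<Omega> u"])

lemma H1D:
  assumes "u \<in> H1 \<Omega>"
  shows "square_integrable (lebesgue_on \<Omega>) u" "is_weak_grad \<Omega> u (weak_grad \<Omega> u)"
    "square_integrable (lebesgue_on \<Omega>) (weak_grad \<Omega> u)"
proof -
  show S: "square_integrable (lebesgue_on \<Omega>) u" and W: "is_weak_grad \<Omega> u (weak_grad \<Omega> u)"
    using assms is_weak_grad_weak_grad by (auto simp: H1_def L2_iff_square_integrable)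
  show "square_integrable (lebesgue_on \<Omega>) (weak_grad \<Omega> u)"
    by (rule is_weak_grad_square_integrable[OF W])
qed

lemma H1I: "square_integrable (lebesgue_on \<Omega>) u \<Longrightarrow> is_weak_grad \<Omega> u g \<Longrightarrow> u \<in> H1 \<Omega>"
  by (auto simp: H1_def L2_iff_square_integrable)

lemma is_weak_grad_lincomb:
  assumes \<Omega>: "open \<Omega>" and S: "square_integrable (lebesgue_on \<Omega>) u" "square_integrable (lebesgue_on \<Omega>) v"
    and W: "is_weak_grad \<Omega> u g" "is_weak_grad \<Omega> v h"
  shows "is_weak_grad \<Omega> (\<lambda>x. a * u x + b * v x) (\<lambda>x. a *\<^sub>R g x + b *\<^sub>R h x)"
  unfolding is_weak_grad_iff
proof (intro conjI ballI)
  note G = is_weak_grad_square_integrable[OF W(1)] is_weak_grad_square_integrable[OF W(2)]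
  show "square_integrable (lebesgue_on \<Omega>) (\<lambda>x. a *\<^sub>R g x + b *\<^sub>R h x)"
    by (intro square_integrable_lincomb G)
  fix \<phi> and i :: 'a assume \<phi>: "\<phi> \<in> test_functions \<Omega>" and i: "i \<in> Basis"
  note T = test_function_square_integrable_on[OF \<phi> \<Omega>]
  show "sqinner (lebesgue_on \<Omega>) (\<lambda>x. a * u x + b * v x) (\<lambda>x. gradient \<phi> x \<bullet> i) =
      - sqinner (lebesgue_on \<Omega>) (\<lambda>x. (a *\<^sub>R g x + b *\<^sub>R h x) \<bullet> i) \<phi>"
    using sqinner_lincomb_left[OF S square_integrable_inner_const[OF T(2)], of a b i]
      sqinner_lincomb_left[OF square_integrable_inner_const[OF G(1)] square_integrable_inner_const[OF G(2)] T(1), of a i b i]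
      W \<phi> i
    by (simp add: is_weak_grad_iff inner_add_left)
qed

lemma is_weak_grad_unique:
  assumes \<Omega>: "open \<Omega>" and W: "is_weak_grad \<Omega> u g" "is_weak_grad \<Omega> u h"
  shows "AE x in lebesgue_on \<Omega>. g x = h x"
proof -
  let ?M = "lebesgue_on \<Omega>"
  note G = is_weak_grad_square_integrable[OF W(1)] is_weak_grad_square_integrable[OF W(2)]
  have "AE x in ?M. (g x - h x) \<bullet> i = 0" if i: "i \<in> Basis" for i
  proof (rule fundamental_lemma_calculus_of_variations[OF \<Omega>])
    have sq: "square_integrable ?M (\<lambda>x. (g x - h x) \<bullet> i)"
      by (intro square_integrable_inner_const square_integrable_diff G)
    then show "(\<lambda>x. (g x - h x) \<bullet> i) \<in> borel_measurable ?M" by (rule square_integrable_measurable)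
    fix a b :: 'a assume "cbox a b \<subseteq> \<Omega>"
    then have "square_integrable ?M (indicator (cbox a b) :: 'a \<Rightarrow> real)"
      using \<Omega> square_integrable_indicator_cbox
      by (subst sqnorm_lebesgue_on_eq_lborel) (auto simp: indicator_def)
    from square_integrable_inner[OF this sq]
    show "integrable ?M (\<lambda>x. indicator (cbox a b) x * ((g x - h x) \<bullet> i))" by simp
  next
    fix \<phi> assume \<phi>: "\<phi> \<in> test_functions \<Omega>"
    note T = test_function_square_integrable_on[OF \<phi> \<Omega>]
    have "sqinner ?M (\<lambda>x. g x \<bullet> i) \<phi> = sqinner ?M (\<lambda>x. h x \<bullet> i) \<phi>"
      using W \<phi> i unfolding is_weak_grad_iff by (metis neg_equal_iff_equal)
    moreover have "sqinner ?M (\<lambda>x. 1 *\<^sub>R (g x \<bullet> i) + (-1) *\<^sub>R (h x \<bullet> i)) \<phi> =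
        1 * sqinner ?M (\<lambda>x. g x \<bullet> i) \<phi> + (-1) * sqinner ?M (\<lambda>x. h x \<bullet> i) \<phi>"
      by (intro sqinner_lincomb_left square_integrable_inner_const G T)
    ultimately show "(LINT x|?M. (g x - h x) \<bullet> i * \<phi> x) = 0"
      by (simp add: sqinner_def inner_diff_left)
  qed
  then have "AE x in ?M. \<forall>i\<in>Basis. (g x - h x) \<bullet> i = 0"
    by (intro AE_finite_allI) auto
  then show ?thesis by eventually_elim (simp add: euclidean_eq_iff[where 'a='a] inner_diff_left)
qed

lemma weak_grad_eq_AE:
  assumes "open \<Omega>" "is_weak_grad \<Omega> u g"
  shows "AE x in lebesgue_on \<Omega>. weak_grad \<Omega> u x = g x"
  by (rule is_weak_grad_unique[OF assms(1) is_weak_grad_weak_grad[OF assms(2)] assms(2)])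

lemma is_weak_grad_test_function:
  assumes \<Omega>: "open \<Omega>" and \<phi>: "\<phi> \<in> test_functions \<Omega>"
  shows "is_weak_grad \<Omega> \<phi> (gradient \<phi>)"
  unfolding is_weak_grad_iff
proof (intro conjI ballI)
  show "square_integrable (lebesgue_on \<Omega>) (gradient \<phi>)"
    by (rule test_function_square_integrable_on[OF \<phi> \<Omega>])
  fix \<psi> and i :: 'a assume \<psi>: "\<psi> \<in> test_functions \<Omega>"
  note [measurable] = test_function_measurable[OF \<phi>] test_function_measurable[OF \<psi>]
  have \<Omega>s: "\<Omega> \<in> sets lebesgue" using \<Omega> by simp
  have "sqinner (lebesgue_on \<Omega>) \<phi> (\<lambda>x. gradient \<psi> x \<bullet> i) = (LINT x|lborel. \<phi> x * (gradient \<psi> x \<bullet> i))"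
    unfolding sqinner_def inner_real_def
    by (rule lebesgue_on_eq_lborel[OF \<Omega>s]) (auto simp: test_function_outside[OF \<phi>])
  moreover have "sqinner (lebesgue_on \<Omega>) (\<lambda>x. gradient \<phi> x \<bullet> i) \<psi> = (LINT x|lborel. (gradient \<phi> x \<bullet> i) * \<psi> x)"
    unfolding sqinner_def inner_real_def
    by (rule lebesgue_on_eq_lborel[OF \<Omega>s]) (auto simp: test_function_outside[OF \<psi>])
  ultimately show "sqinner (lebesgue_on \<Omega>) \<phi> (\<lambda>x. gradient \<psi> x \<bullet> i) =
      - sqinner (lebesgue_on \<Omega>) (\<lambda>x. gradient \<phi> x \<bullet> i) \<psi>"
    using integration_by_parts_test_functions[OF \<phi> \<psi>] by simp
qed

lemma sqnorm_inner_const_le: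
  assumes "square_integrable M g"
  shows "sqnorm M (\<lambda>x. g x \<bullet> h) \<le> (norm h)\<^sup>2 * sqnorm M g"
proof -
  have "(norm (g x \<bullet> h))\<^sup>2 \<le> (norm h)\<^sup>2 * (norm (g x))\<^sup>2" for x
    unfolding power2_norm_eq_inner using Cauchy_Schwarz_ineq[of "g x" h]
    by (simp add: mult.commute power2_eq_square)
  then have "sqnorm M (\<lambda>x. g x \<bullet> h) \<le> (LINT x|M. (norm h)\<^sup>2 * (norm (g x))\<^sup>2)"
    unfolding sqnorm_def
    using square_integrable_integrable[OF assms] square_integrable_integrable[OF square_integrable_inner_const[OF assms]]
    by (intro integral_mono) auto
  then show ?thesis by (simp add: sqnorm_def)
qed

text \<open>  The gradient is a closed operator in \<open>L\<^sup>2\<close>.\<close>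
lemma is_weak_grad_limit:
  assumes \<Omega>: "open \<Omega>" and W: "\<And>n. is_weak_grad \<Omega> (u n) (g n)"
    and u: "\<And>n. square_integrable (lebesgue_on \<Omega>) (u n)" "square_integrable (lebesgue_on \<Omega>) v"
      "(\<lambda>n. sqnorm (lebesgue_on \<Omega>) (\<lambda>x. u n x - v x)) \<longlonglongrightarrow> 0"
    and g: "square_integrable (lebesgue_on \<Omega>) h" "(\<lambda>n. sqnorm (lebesgue_on \<Omega>) (\<lambda>x. g n x - h x)) \<longlonglongrightarrow> 0"
  shows "is_weak_grad \<Omega> v h"
  unfolding is_weak_grad_iff
proof (intro conjI ballI g(1))
  let ?M = "lebesgue_on \<Omega>"
  fix \<phi> and i :: 'a assume \<phi>: "\<phi> \<in> test_functions \<Omega>" and i: "i \<in> Basis"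
  note T = test_function_square_integrable_on[OF \<phi> \<Omega>]
  have G: "square_integrable ?M (g n)" for n by (rule is_weak_grad_square_integrable[OF W])
  have cc: "(\<lambda>n. sqnorm ?M (\<lambda>x. f x - f x)) \<longlonglongrightarrow> 0" for f :: "'a \<Rightarrow> real" by (simp add: sqnorm_def)
  have "(\<lambda>n. sqinner ?M (u n) (\<lambda>x. gradient \<phi> x \<bullet> i)) \<longlonglongrightarrow> sqinner ?M v (\<lambda>x. gradient \<phi> x \<bullet> i)"
    by (rule sqinner_tendsto[OF u _ _ cc]) (intro square_integrable_inner_const T)+
  moreover have "(\<lambda>n. sqnorm ?M (\<lambda>x. g n x \<bullet> i - h x \<bullet> i)) \<longlonglongrightarrow> 0"
  proof (rule tendsto_sandwich[OF _ _ tendsto_const g(2)])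
    show "\<forall>\<^sub>F n in sequentially. sqnorm ?M (\<lambda>x. g n x \<bullet> i - h x \<bullet> i) \<le> sqnorm ?M (\<lambda>x. g n x - h x)"
      using sqnorm_inner_const_le[OF square_integrable_diff[OF G g(1)], of _ i] i
      by (simp add: inner_diff_left)
  qed simp
  then have "(\<lambda>n. sqinner ?M (\<lambda>x. g n x \<bullet> i) \<phi>) \<longlonglongrightarrow> sqinner ?M (\<lambda>x. h x \<bullet> i) \<phi>"
    by (intro sqinner_tendsto[OF _ _ _ T(1) T(1) cc] square_integrable_inner_const G g(1))
  then have "(\<lambda>n. - sqinner ?M (\<lambda>x. g n x \<bullet> i) \<phi>) \<longlonglongrightarrow> - sqinner ?M (\<lambda>x. h x \<bullet> i) \<phi>"
    by (rule tendsto_minus)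
  moreover have "sqinner ?M (u n) (\<lambda>x. gradient \<phi> x \<bullet> i) = - sqinner ?M (\<lambda>x. g n x \<bullet> i) \<phi>" for n
    using W \<phi> i by (simp add: is_weak_grad_iff)
  ultimately show "sqinner ?M v (\<lambda>x. gradient \<phi> x \<bullet> i) = - sqinner ?M (\<lambda>x. h x \<bullet> i) \<phi>"
    using LIMSEQ_unique by simp
qed

section \<open>Translates of test functions\<close>

lemma square_integrable_translation:
  fixes f :: "'a::euclidean_space \<Rightarrow> 'b::euclidean_space"
  assumes "square_integrable lborel f"
  shows "square_integrable lborel (\<lambda>x. f (x + c))" "sqnorm lborel (\<lambda>x. f (x + c)) = sqnorm lborel f"
proof -
  have [measurable]: "f \<in> borel_measurable borel" using square_integrable_measurable[OF assms] by simp
  show "square_integrable lborel (\<lambda>x. f (x + c))"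
    using lborel_integrable_translation[OF square_integrable_integrable[OF assms], of c]
    by (simp add: square_integrable_def)
  show "sqnorm lborel (\<lambda>x. f (x + c)) = sqnorm lborel f"
    unfolding sqnorm_def by (rule lborel_integral_translation[of "\<lambda>x. (norm (f x))\<^sup>2"]) measurable
qed

text \<open>  A translation by \<open>n v\<close> is a chain of \<open>n\<close> translations by \<open>v\<close>, all of which move \<open>f\<close> by the same
  amount.\<close>
lemma sqnorm_translation_difference_steps:
  fixes f :: "'a::euclidean_space \<Rightarrow> real"
  assumes f: "square_integrable lborel f"
  shows "sqnorm lborel (\<lambda>x. f (x + real n *\<^sub>R v) - f x) \<le> (real n)\<^sup>2 * sqnorm lborel (\<lambda>x. f (x + v) - f x)"
proof -
  have t: "square_integrable lborel (\<lambda>x. f (x + w) - f x)" for w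
    by (intro square_integrable_diff square_integrable_translation f)
  let ?D = "\<lambda>i x. f ((x + real i *\<^sub>R v) + v) - f (x + real i *\<^sub>R v)"
  have D: "square_integrable lborel (?D i)" "sqnorm lborel (?D i) = sqnorm lborel (\<lambda>x. f (x + v) - f x)" for i
    using square_integrable_translation[OF t[of v], of "real i *\<^sub>R v"] by auto
  have tele: "f (x + real n *\<^sub>R v) - f x = (\<Sum>i<n. ?D i x)" for x
    using sum_lessThan_telescope[of "\<lambda>i. f (x + real i *\<^sub>R v)" n]
    by (simp add: algebra_simps)
  have "sqnorm lborel (\<lambda>x. f (x + real n *\<^sub>R v) - f x) \<le>
      (LINT x|lborel. (\<Sum>i<n. (norm (?D i x))\<^sup>2) * real n)"
    unfolding sqnorm_def
  proof (rule integral_mono)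
    show "integrable lborel (\<lambda>x. (norm (f (x + real n *\<^sub>R v) - f x))\<^sup>2)"
      by (rule square_integrable_integrable[OF t])
    show "integrable lborel (\<lambda>x. (\<Sum>i<n. (norm (?D i x))\<^sup>2) * real n)"
      by (intro integrable_mult_left Bochner_Integration.integrable_sum square_integrable_integrable[OF D(1)])
    show "(norm (f (x + real n *\<^sub>R v) - f x))\<^sup>2 \<le> (\<Sum>i<n. (norm (?D i x))\<^sup>2) * real n" for x
      unfolding tele using sum_squared_le_sum_of_squares[of "\<lambda>i. ?D i x" "{..<n}"] by simp
  qed
  also have "\<dots> = (\<Sum>i<n. sqnorm lborel (?D i)) * real n"
    unfolding sqnorm_def using square_integrable_integrable[OF D(1)]
    by (subst integral_mult_left_zero) (simp add: Bochner_Integration.integral_sum)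
  also have "\<dots> = (real n)\<^sup>2 * sqnorm lborel (\<lambda>x. f (x + v) - f x)"
    by (simp add: D(2) power2_eq_square)
  finally show ?thesis .
qed

text \<open>  Dividing the translation into \<open>n\<close> equal steps turns the bound for chains into an integral of
  squared difference quotients, which converge as \<open>n\<close> grows.\<close>
lemma sqnorm_translation_le_gradient:
  assumes \<phi>: "\<phi> \<in> test_functions \<Omega>"
  shows "sqnorm lborel (\<lambda>x. \<phi> (x + h) - \<phi> x) \<le> (norm h)\<^sup>2 * sqnorm lborel (gradient \<phi>)"
proof -
  obtain K L where K: "compact K" "L \<ge> 0" and
    dom: "\<And>n x. \<bar>real (Suc n) * (\<phi> (x + (1 / real (Suc n)) *\<^sub>R h) - \<phi> x)\<bar> \<le> indicator K x * L"
    by (rule difference_quotient_dominated[OF \<phi>]) blast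
  note [measurable] = test_function_measurable[OF \<phi>]
  let ?q = "\<lambda>n x. real (Suc n) * (\<phi> (x + (1 / real (Suc n)) *\<^sub>R h) - \<phi> x)"
  have "(\<lambda>n. LINT x|lborel. (?q n x)\<^sup>2) \<longlonglongrightarrow> (LINT x|lborel. (gradient \<phi> x \<bullet> h)\<^sup>2)"
  proof (rule integral_dominated_convergence)
    show "integrable lborel (\<lambda>x. indicator K x * L\<^sup>2)"
      using borel_integrable_compact[OF K(1), of "\<lambda>x. L\<^sup>2"] by simp
    show "AE x in lborel. (\<lambda>n. (?q n x)\<^sup>2) \<longlonglongrightarrow> (gradient \<phi> x \<bullet> h)\<^sup>2"
      by (intro AE_I2 tendsto_power difference_quotient_tendsto[OF \<phi>])
    have "(?q n x)\<^sup>2 \<le> indicator K x * L\<^sup>2" for n x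
    proof -
      have "(?q n x)\<^sup>2 = \<bar>?q n x\<bar>\<^sup>2" by simp
      also have "\<dots> \<le> (indicator K x * L)\<^sup>2" by (intro power_mono dom) simp
      also have "\<dots> = indicator K x * L\<^sup>2" by (simp add: indicator_def)
      finally show ?thesis .
    qed
    then show "AE x in lborel. norm ((?q n x)\<^sup>2) \<le> indicator K x * L\<^sup>2" for n by simp
  qed measurable
  then have lim: "(\<lambda>n. sqnorm lborel (?q n)) \<longlonglongrightarrow> sqnorm lborel (\<lambda>x. gradient \<phi> x \<bullet> h)"
    by (simp add: sqnorm_def)
  have "sqnorm lborel (\<lambda>x. \<phi> (x + h) - \<phi> x) \<le> sqnorm lborel (?q n)" for n
    using sqnorm_translation_difference_steps[OF test_function_square_integrable(1)[OF \<phi>], of "Suc n" "(1 / real (Suc n)) *\<^sub>R h"]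
      sqnorm_mult[of lborel "real (Suc n)" "\<lambda>x. \<phi> (x + (1 / real (Suc n)) *\<^sub>R h) - \<phi> x"]
    by (simp del: of_nat_Suc)
  then have "sqnorm lborel (\<lambda>x. \<phi> (x + h) - \<phi> x) \<le> sqnorm lborel (\<lambda>x. gradient \<phi> x \<bullet> h)"
    by (intro LIMSEQ_le_const[OF lim]) auto
  also have "\<dots> \<le> (norm h)\<^sup>2 * sqnorm lborel (gradient \<phi>)"
    by (rule sqnorm_inner_const_le[OF test_function_square_integrable(2)[OF \<phi>]])
  finally show ?thesis .
qed

section \<open>Dyadic averages\<close>

text \<open>  The half-open dyadic cube of side \<open>2\<^sup>-\<^sup>k\<close> that contains \<open>x\<close>.\<close>
definition dyadic_cell :: "nat \<Rightarrow> 'a::euclidean_space \<Rightarrow> 'a set" where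
  "dyadic_cell k x = {y. \<forall>b\<in>Basis. \<lfloor>2^k * (y \<bullet> b)\<rfloor> = \<lfloor>2^k * (x \<bullet> b)\<rfloor>}"

lemma dyadic_cell_eq: "y \<in> dyadic_cell k x \<Longrightarrow> dyadic_cell k y = dyadic_cell k x"
  by (auto simp: dyadic_cell_def)

lemma dyadic_cell_Suc_subset: "dyadic_cell (Suc k) x \<subseteq> dyadic_cell k x"
proof -
  have half: "\<lfloor>t\<rfloor> = \<lfloor>s\<rfloor>" if "\<lfloor>2 * t\<rfloor> = \<lfloor>2 * s\<rfloor>" for s t :: real
  proof -
    have "\<lfloor>t\<rfloor> = \<lfloor>2 * t\<rfloor> div 2" for t :: real
      using floor_divide_real_eq_div[of 2 "2 * t"] by simp
    then show ?thesis using that by metis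
  qed
  show ?thesis
  proof
    fix y assume "y \<in> dyadic_cell (Suc k) x"
    then have "\<lfloor>2 * (2^k * (y \<bullet> b))\<rfloor> = \<lfloor>2 * (2^k * (x \<bullet> b))\<rfloor>" if "b \<in> Basis" for b
      using that by (simp add: dyadic_cell_def mult.assoc)
    then show "y \<in> dyadic_cell k x"
      unfolding dyadic_cell_def mem_Collect_eq using half by blast
  qed
qed

lemma dyadic_cell_diameter:
  assumes "y \<in> dyadic_cell k x"
  shows "b \<in> Basis \<Longrightarrow> \<bar>(y - x) \<bullet> b\<bar> \<le> 1 / 2^k"
proof -
  assume "b \<in> Basis"
  then have "\<lfloor>2^k * (y \<bullet> b)\<rfloor> = \<lfloor>2^k * (x \<bullet> b)\<rfloor>" using assms by (simp add: dyadic_cell_def)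
  then have "\<bar>2^k * (y \<bullet> b) - 2^k * (x \<bullet> b)\<bar> \<le> 1" by linarith
  then have "2^k * \<bar>(y - x) \<bullet> b\<bar> \<le> 1"
    by (simp add: inner_diff_left right_diff_distrib[symmetric] abs_mult)
  then show ?thesis by (simp add: field_simps)
qed

lemma dyadic_cell_between_boxes:
  obtains a :: "'a::euclidean_space" where "box a (a + (1 / 2^k) *\<^sub>R One) \<subseteq> dyadic_cell k x"
    "dyadic_cell k x \<subseteq> cbox a (a + (1 / 2^k) *\<^sub>R One)"
proof -
  define a :: 'a where "a = (\<Sum>b\<in>Basis. (\<lfloor>2^k * (x \<bullet> b)\<rfloor> / 2^k) *\<^sub>R b)"
  have a: "a \<bullet> b = \<lfloor>2^k * (x \<bullet> b)\<rfloor> / 2^k" if "b \<in> Basis" for b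
    using that by (simp add: a_def inner_sum_left_Basis)
  have eq: "a \<bullet> b \<le> y \<bullet> b \<longleftrightarrow> of_int \<lfloor>2^k * (x \<bullet> b)\<rfloor> \<le> 2^k * (y \<bullet> b)"
    "y \<bullet> b \<le> a \<bullet> b + 1 / 2^k \<longleftrightarrow> 2^k * (y \<bullet> b) \<le> of_int \<lfloor>2^k * (x \<bullet> b)\<rfloor> + 1"
    "y \<bullet> b < a \<bullet> b + 1 / 2^k \<longleftrightarrow> 2^k * (y \<bullet> b) < of_int \<lfloor>2^k * (x \<bullet> b)\<rfloor> + 1"
    if "b \<in> Basis" for b y
    unfolding a[OF that] by (simp_all add: field_simps)
  have "box a (a + (1 / 2^k) *\<^sub>R One) \<subseteq> dyadic_cell k x"
  proof
    fix y assume y: "y \<in> box a (a + (1 / 2^k) *\<^sub>R One)"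
    have "\<lfloor>2^k * (y \<bullet> b)\<rfloor> = \<lfloor>2^k * (x \<bullet> b)\<rfloor>" if b: "b \<in> Basis" for b
    proof (rule floor_unique)
      have "a \<bullet> b < y \<bullet> b" "y \<bullet> b < a \<bullet> b + 1 / 2^k"
        using y b by (auto simp: mem_box inner_add_left)
      then show "of_int \<lfloor>2^k * (x \<bullet> b)\<rfloor> \<le> 2^k * (y \<bullet> b)" "2^k * (y \<bullet> b) < of_int \<lfloor>2^k * (x \<bullet> b)\<rfloor> + 1"
        using eq[OF b, of y] by auto
    qed
    then show "y \<in> dyadic_cell k x" by (simp add: dyadic_cell_def)
  qed
  moreover have "dyadic_cell k x \<subseteq> cbox a (a + (1 / 2^k) *\<^sub>R One)"
  proof
    fix y assume y: "y \<in> dyadic_cell k x"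
    have "a \<bullet> b \<le> y \<bullet> b \<and> y \<bullet> b \<le> a \<bullet> b + 1 / 2^k" if b: "b \<in> Basis" for b
    proof -
      have "\<lfloor>2^k * (y \<bullet> b)\<rfloor> = \<lfloor>2^k * (x \<bullet> b)\<rfloor>" using y b by (simp add: dyadic_cell_def)
      then show ?thesis unfolding eq[OF b] by linarith
    qed
    then show "y \<in> cbox a (a + (1 / 2^k) *\<^sub>R One)" by (simp add: mem_box inner_add_left)
  qed
  ultimately show ?thesis by (rule that)
qed

lemma dyadic_cell_measurable [measurable]: "dyadic_cell k x \<in> sets borel"
  unfolding dyadic_cell_def by measurable

lemma emeasure_cube: "emeasure lborel (box a (a + s *\<^sub>R One) :: 'a::euclidean_space set) = ennreal (s ^ DIM('a))"
  "emeasure lborel (cbox a (a + s *\<^sub>R One) :: 'a set) = ennreal (s ^ DIM('a))" if "s \<ge> 0"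
  using that by (auto simp: emeasure_lborel_box_eq emeasure_lborel_cbox_eq inner_add_left)

text \<open>  The cell lies between an open and a closed cube of the same volume.\<close>
lemma emeasure_dyadic_cell:
  "emeasure lborel (dyadic_cell k (x::'a::euclidean_space)) = ennreal ((1 / 2^k) ^ DIM('a))"
proof -
  obtain a :: 'a where a: "box a (a + (1 / 2^k) *\<^sub>R One) \<subseteq> dyadic_cell k x"
    "dyadic_cell k x \<subseteq> cbox a (a + (1 / 2^k) *\<^sub>R One)" by (rule dyadic_cell_between_boxes)
  have "emeasure lborel (box a (a + (1 / 2^k) *\<^sub>R One)) \<le> emeasure lborel (dyadic_cell k x)"
    by (rule emeasure_mono[OF a(1)]) simp
  moreover have "emeasure lborel (dyadic_cell k x) \<le> emeasure lborel (cbox a (a + (1 / 2^k) *\<^sub>R One))"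
    by (rule emeasure_mono[OF a(2)]) simp
  ultimately show ?thesis by (intro antisym) (simp_all add: emeasure_cube)
qed

lemma integrable_dyadic_cell: "integrable lborel (indicator (dyadic_cell k (x::'a::euclidean_space)) :: 'a \<Rightarrow> real)"
  "(LINT y|lborel. (indicator (dyadic_cell k x) y :: real)) = (1 / 2^k) ^ DIM('a)"
  by (auto simp: emeasure_dyadic_cell measure_def intro!: integrable_real_indicator)

lemma square_integrable_dyadic_cell:
  "square_integrable lborel (indicator (dyadic_cell k (x::'a::euclidean_space)) :: 'a \<Rightarrow> real)"
  "sqnorm lborel (indicator (dyadic_cell k x) :: 'a \<Rightarrow> real) = (1 / 2^k) ^ DIM('a)"
proof -
  have "(norm (indicator A y :: real))\<^sup>2 = indicator A y" for A :: "'a set" and y by (simp add: indicator_def)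
  then show "square_integrable lborel (indicator (dyadic_cell k (x::'a)) :: 'a \<Rightarrow> real)"
    "sqnorm lborel (indicator (dyadic_cell k x) :: 'a \<Rightarrow> real) = (1 / 2^k) ^ DIM('a)"
    using integrable_dyadic_cell[of k x] by (simp_all add: square_integrable_def sqnorm_def)
qed

definition dyadic_average :: "nat \<Rightarrow> ('a::euclidean_space \<Rightarrow> real) \<Rightarrow> 'a \<Rightarrow> real" where
  "dyadic_average k f x = (2^k) ^ DIM('a) * (LINT y|lborel. indicator (dyadic_cell k x) y * f y)"

lemma dyadic_average_const_on_cell: "y \<in> dyadic_cell k x \<Longrightarrow> dyadic_average k f y = dyadic_average k f x"
  by (simp add: dyadic_average_def dyadic_cell_eq)

lemma pred_dyadic_cell [measurable]:
  "Measurable.pred (borel \<Otimes>\<^sub>M borel) (\<lambda>p. snd p \<in> dyadic_cell k (fst p :: 'a::euclidean_space))"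
  unfolding dyadic_cell_def mem_Collect_eq by measurable

lemma indicator_dyadic_cell_measurable [measurable]:
  "(\<lambda>p. indicator (dyadic_cell k (fst p)) (snd p) :: real) \<in> borel_measurable (borel \<Otimes>\<^sub>M (borel :: 'a::euclidean_space measure))"
proof -
  have "(\<lambda>p :: 'a \<times> 'a. indicator (dyadic_cell k (fst p)) (snd p) :: real) =
      indicator {p \<in> space (borel \<Otimes>\<^sub>M borel). snd p \<in> dyadic_cell k (fst p)}"
    by (auto simp: indicator_def space_pair_measure)
  moreover have "\<dots> \<in> borel_measurable (borel \<Otimes>\<^sub>M (borel :: 'a measure))"
    by (intro borel_measurable_indicator) measurable
  ultimately show ?thesis by simp
qed

lemma dyadic_average_measurable [measurable]:
  assumes [measurable]: "f \<in> borel_measurable borel"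
  shows "dyadic_average k f \<in> borel_measurable borel"
proof -
  have "(\<lambda>p. indicator (dyadic_cell k (fst p)) (snd p) * f (snd p)) \<in> borel_measurable (borel \<Otimes>\<^sub>M lborel)"
    by (simp cong: measurable_cong_sets sets_pair_measure_cong)
  then have "(\<lambda>x. LINT y|lborel. indicator (dyadic_cell k x) y * f y) \<in> borel_measurable borel"
    by (intro lborel.borel_measurable_lebesgue_integral) (simp add: split_beta')
  then show ?thesis unfolding dyadic_average_def[abs_def] by measurable
qed

lemma square_integrable_indicator_mult:
  fixes f :: "'m \<Rightarrow> real"
  assumes "square_integrable M f" "A \<in> sets M"
  shows "square_integrable M (\<lambda>x. indicator A x * f x)" "sqnorm M (\<lambda>x. indicator A x * f x) \<le> sqnorm M f"
proof -
  have eq: "(norm (indicator A x * f x))\<^sup>2 = indicator A x *\<^sub>R (norm (f x))\<^sup>2" for x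
    by (simp add: indicator_def)
  have i: "integrable M (\<lambda>x. (norm (indicator A x * f x))\<^sup>2)"
    unfolding eq using assms by (intro integrable_mult_indicator square_integrable_integrable)
  then show "square_integrable M (\<lambda>x. indicator A x * f x)"
    using assms by (auto simp: square_integrable_def intro!: borel_measurable_times)
  show "sqnorm M (\<lambda>x. indicator A x * f x) \<le> sqnorm M f"
    unfolding sqnorm_def
    by (rule integral_mono[OF i square_integrable_integrable[OF assms(1)]]) (simp add: indicator_def)
qed

text \<open>  Cauchy-Schwarz on a cell: the square of an average is at most the average of the square.\<close>
lemma cell_integral_square_le:
  fixes g :: "'a::euclidean_space \<Rightarrow> real"
  assumes "square_integrable lborel (\<lambda>y. indicator (dyadic_cell k x) y * g y)"
  shows "((2^k) ^ DIM('a) * (LINT y|lborel. indicator (dyadic_cell k x) y * g y))\<^sup>2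
    \<le> (2^k) ^ DIM('a) * sqnorm lborel (\<lambda>y. indicator (dyadic_cell k x) y * g y)"
proof -
  let ?V = "(2^k) ^ DIM('a) :: real" and ?I = "LINT y|lborel. indicator (dyadic_cell k x) y * g y"
    and ?N = "sqnorm lborel (\<lambda>y. indicator (dyadic_cell k x) y * g y)"
  have V: "?V > 0" "(1 / 2^k) ^ DIM('a) = 1 / ?V" by (auto simp: power_one_over)
  have "sqinner lborel (indicator (dyadic_cell k x)) (\<lambda>y. indicator (dyadic_cell k x) y * g y) = ?I"
    unfolding sqinner_def by (intro Bochner_Integration.integral_cong) (auto simp: indicator_def)
  then have "\<bar>?I\<bar> \<le> sqrt (1 / ?V) * sqrt ?N"
    using sqinner_Cauchy_Schwarz[OF square_integrable_dyadic_cell(1)[of k x] assms]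
    by (simp add: square_integrable_dyadic_cell V)
  then have "\<bar>?I\<bar>\<^sup>2 \<le> (sqrt (1 / ?V) * sqrt ?N)\<^sup>2" by (intro power_mono) auto
  also have "\<dots> = ?N / ?V" using V(1) by (simp add: power_mult_distrib)
  finally have "?V\<^sup>2 * ?I\<^sup>2 \<le> ?V\<^sup>2 * (?N / ?V)" by (intro mult_left_mono) auto
  moreover have "?V\<^sup>2 * (?N / ?V) = ?V * ?N" using V(1) by (simp add: power2_eq_square)
  ultimately show ?thesis by (simp add: power_mult_distrib)
qed

lemma dyadic_average_difference_pointwise:
  fixes f :: "'a::euclidean_space \<Rightarrow> real"
  assumes f: "square_integrable lborel f"
  shows "ennreal ((f x - dyadic_average k f x)\<^sup>2) \<le>
    ennreal ((2^k) ^ DIM('a)) * (\<integral>\<^sup>+y. indicator (dyadic_cell k x) y * ennreal ((f y - f x)\<^sup>2) \<partial>lborel)"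
proof -
  let ?c = "indicator (dyadic_cell k x) :: 'a \<Rightarrow> real" and ?V = "(2^k) ^ DIM('a) :: real"
  have [measurable]: "f \<in> borel_measurable borel" using square_integrable_measurable[OF f] by simp
  have V: "?V * (1 / 2^k) ^ DIM('a) = 1" by (simp add: power_one_over)
  have sq: "square_integrable lborel (\<lambda>y. ?c y * (f y - f x))"
    using square_integrable_diff[OF square_integrable_indicator_mult(1)[OF f, of "dyadic_cell k x"]
        square_integrable_mult[OF square_integrable_dyadic_cell(1)[of k x], of "f x"]]
    by (simp add: algebra_simps)
  have cf: "integrable lborel (\<lambda>y. ?c y * f y)"
    using square_integrable_inner[OF square_integrable_dyadic_cell(1)[of k x] f] by simp
  have "f x - dyadic_average k f x = - (?V * (LINT y|lborel. ?c y * (f y - f x)))"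
  proof -
    have "(LINT y|lborel. ?c y * (f y - f x)) = (LINT y|lborel. ?c y * f y) - (LINT y|lborel. ?c y * f x)"
      using cf integrable_dyadic_cell(1)[of k x] by (simp add: right_diff_distrib)
    also have "(LINT y|lborel. ?c y * f x) = (1 / 2^k) ^ DIM('a) * f x"
      using integrable_dyadic_cell[of k x] by simp
    finally have "?V * (LINT y|lborel. ?c y * (f y - f x)) = dyadic_average k f x - (?V * (1 / 2^k) ^ DIM('a)) * f x"
      by (simp add: dyadic_average_def right_diff_distrib)
    then show ?thesis unfolding V by simp
  qed
  then have "(f x - dyadic_average k f x)\<^sup>2 \<le> ?V * sqnorm lborel (\<lambda>y. ?c y * (f y - f x))"
    using cell_integral_square_le[OF sq] by simp
  then have "ennreal ((f x - dyadic_average k f x)\<^sup>2) \<le> ennreal (?V * sqnorm lborel (\<lambda>y. ?c y * (f y - f x)))"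
    by (rule ennreal_leI)
  also have "\<dots> = ennreal ?V * (\<integral>\<^sup>+y. ennreal ((norm (?c y * (f y - f x)))\<^sup>2) \<partial>lborel)"
    unfolding nn_integral_eq_sqnorm[OF sq] by (simp add: ennreal_mult)
  also have "(\<integral>\<^sup>+y. ennreal ((norm (?c y * (f y - f x)))\<^sup>2) \<partial>lborel) =
      (\<integral>\<^sup>+y. indicator (dyadic_cell k x) y * ennreal ((f y - f x)\<^sup>2) \<partial>lborel)"
    by (intro nn_integral_cong) (simp add: indicator_def)
  finally show ?thesis .
qed

text \<open>  A Poincare inequality on cubes. The error at \<open>x\<close> is at most the mean of the squared increments of
  \<open>\<phi>\<close> over displacements \<open>h\<close> that stay in the cell of \<open>x\<close>. Allowing all \<open>h\<close> in the cube of side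
  \<open>2 / 2\<^sup>k\<close> around zero makes the range of \<open>h\<close> independent of \<open>x\<close>, and Fubini reduces the claim to
  the translation inequality.\<close>
lemma dyadic_average_approximation:
  fixes \<phi> :: "'a::euclidean_space \<Rightarrow> real"
  assumes \<phi>: "\<phi> \<in> test_functions \<Omega>"
  shows "square_integrable lborel (\<lambda>x. \<phi> x - dyadic_average k \<phi> x)"
    "sqnorm lborel (\<lambda>x. \<phi> x - dyadic_average k \<phi> x) \<le>
      2 ^ DIM('a) * (real DIM('a))\<^sup>2 / 4^k * sqnorm lborel (gradient \<phi>)"
proof -
  note S = test_function_square_integrable[OF \<phi>]
  note [measurable] = test_function_measurable[OF \<phi>]
  let ?V = "(2^k) ^ DIM('a) :: real" and ?G = "sqnorm lborel (gradient \<phi>)"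
  \<comment> \<open>the closed cube of side \<open>2 / 2\<^sup>k\<close> centred at zero\<close>
  define Q :: "'a set" where "Q = cbox (- (1 / 2^k) *\<^sub>R One) (- (1 / 2^k) *\<^sub>R One + (2 / 2^k) *\<^sub>R One)"
  have Qn: "norm h \<le> real DIM('a) / 2^k" if "h \<in> Q" for h
  proof -
    have "\<bar>h \<bullet> b\<bar> \<le> 1 / 2^k" if b: "b \<in> Basis" for b
      using \<open>h \<in> Q\<close> b by (auto simp: Q_def mem_box inner_add_left inner_diff_left abs_le_iff)
    then have "(\<Sum>b\<in>Basis. \<bar>h \<bullet> b\<bar>) \<le> (\<Sum>b\<in>(Basis::'a set). 1 / 2^k)" by (intro sum_mono) auto
    then show ?thesis using norm_le_l1[of h] by simp
  qed
  have cell: "h \<in> Q" if hx: "h + x \<in> dyadic_cell k x" for h x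
  proof -
    have "- (1 / 2^k) \<le> h \<bullet> b \<and> h \<bullet> b \<le> 1 / 2^k" if "b \<in> Basis" for b
      using dyadic_cell_diameter[OF hx that] by (simp add: abs_le_iff)
    then show ?thesis by (auto simp: Q_def mem_box inner_add_left inner_diff_left)
  qed
  have [measurable]: "Q \<in> sets borel" by (simp add: Q_def)
  have Qe: "emeasure lborel Q = ennreal ((2 / 2^k) ^ DIM('a))"
    unfolding Q_def by (subst emeasure_cube) auto
  have "(\<integral>\<^sup>+x. ennreal ((\<phi> x - dyadic_average k \<phi> x)\<^sup>2) \<partial>lborel) \<le>
      (\<integral>\<^sup>+x. ennreal ?V * (\<integral>\<^sup>+y. indicator (dyadic_cell k x) y * ennreal ((\<phi> y - \<phi> x)\<^sup>2) \<partial>lborel) \<partial>lborel)"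
    by (intro nn_integral_mono dyadic_average_difference_pointwise S)
  also have "\<dots> \<le> (\<integral>\<^sup>+x. ennreal ?V * (\<integral>\<^sup>+h. indicator Q h * ennreal ((\<phi> (x + h) - \<phi> x)\<^sup>2) \<partial>lborel) \<partial>lborel)"
  proof (rule nn_integral_mono, rule mult_left_mono)
    fix x
    have "(\<integral>\<^sup>+y. indicator (dyadic_cell k x) y * ennreal ((\<phi> y - \<phi> x)\<^sup>2) \<partial>lborel) =
        (\<integral>\<^sup>+h. indicator (dyadic_cell k x) (h + x) * ennreal ((\<phi> (h + x) - \<phi> x)\<^sup>2) \<partial>lborel)"
      by (rule lborel_nn_integral_translation[symmetric]) measurable
    also have "\<dots> \<le> (\<integral>\<^sup>+h. indicator Q h * ennreal ((\<phi> (x + h) - \<phi> x)\<^sup>2) \<partial>lborel)"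
      using cell by (intro nn_integral_mono) (auto simp: indicator_def add.commute)
    finally show "(\<integral>\<^sup>+y. indicator (dyadic_cell k x) y * ennreal ((\<phi> y - \<phi> x)\<^sup>2) \<partial>lborel) \<le>
      (\<integral>\<^sup>+h. indicator Q h * ennreal ((\<phi> (x + h) - \<phi> x)\<^sup>2) \<partial>lborel)" .
  qed simp
  also have "\<dots> = ennreal ?V * (\<integral>\<^sup>+x. (\<integral>\<^sup>+h. indicator Q h * ennreal ((\<phi> (x + h) - \<phi> x)\<^sup>2) \<partial>lborel) \<partial>lborel)"
    by (rule nn_integral_cmult) measurable
  also have "(\<integral>\<^sup>+x. (\<integral>\<^sup>+h. indicator Q h * ennreal ((\<phi> (x + h) - \<phi> x)\<^sup>2) \<partial>lborel) \<partial>lborel) =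
      (\<integral>\<^sup>+h. (\<integral>\<^sup>+x. indicator Q h * ennreal ((\<phi> (x + h) - \<phi> x)\<^sup>2) \<partial>lborel) \<partial>lborel)"
    by (rule lborel_pair.Fubini'[symmetric]) measurable
  also have "\<dots> = (\<integral>\<^sup>+h. indicator Q h * ennreal (sqnorm lborel (\<lambda>x. \<phi> (x + h) - \<phi> x)) \<partial>lborel)"
  proof (intro nn_integral_cong)
    fix h
    have "(\<integral>\<^sup>+x. indicator Q h * ennreal ((\<phi> (x + h) - \<phi> x)\<^sup>2) \<partial>lborel) =
        indicator Q h * (\<integral>\<^sup>+x. ennreal ((norm (\<phi> (x + h) - \<phi> x))\<^sup>2) \<partial>lborel)"
      by (subst nn_integral_cmult) auto
    then show "(\<integral>\<^sup>+x. indicator Q h * ennreal ((\<phi> (x + h) - \<phi> x)\<^sup>2) \<partial>lborel) =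
        indicator Q h * ennreal (sqnorm lborel (\<lambda>x. \<phi> (x + h) - \<phi> x))"
      using nn_integral_eq_sqnorm[OF square_integrable_diff[OF square_integrable_translation(1)[OF S(1)] S(1)], of h]
      by simp
  qed
  also have "\<dots> \<le> (\<integral>\<^sup>+h. ennreal ((real DIM('a) / 2^k)\<^sup>2 * ?G) * indicator Q h \<partial>lborel)"
  proof (intro nn_integral_mono)
    fix h :: 'a
    have "sqnorm lborel (\<lambda>x. \<phi> (x + h) - \<phi> x) \<le> (real DIM('a) / 2^k)\<^sup>2 * ?G" if "h \<in> Q"
      by (rule order_trans[OF sqnorm_translation_le_gradient[OF \<phi>]],
          rule mult_right_mono[OF power_mono[OF Qn[OF that]]]) auto
    then show "indicator Q h * ennreal (sqnorm lborel (\<lambda>x. \<phi> (x + h) - \<phi> x)) \<le>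
        ennreal ((real DIM('a) / 2^k)\<^sup>2 * ?G) * indicator Q h"
      by (auto simp: indicator_def intro: ennreal_leI)
  qed
  also have "\<dots> = ennreal ((real DIM('a) / 2^k)\<^sup>2 * ?G) * ennreal ((2 / 2^k) ^ DIM('a))"
    by (subst nn_integral_cmult_indicator) (auto simp: Qe)
  also have "ennreal ?V * \<dots> = ennreal (?V * ((real DIM('a) / 2^k)\<^sup>2 * ?G * (2 / 2^k) ^ DIM('a)))"
    by (simp add: ennreal_mult)
  also have "?V * ((real DIM('a) / 2^k)\<^sup>2 * ?G * (2 / 2^k) ^ DIM('a)) = 2 ^ DIM('a) * (real DIM('a))\<^sup>2 / 4^k * ?G"
  proof -
    have "?V * (2 / 2^k) ^ DIM('a) = 2 ^ DIM('a)" by (simp add: power_divide)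
    moreover have "(2^k)\<^sup>2 = (4^k :: real)" by (simp add: power2_eq_square flip: power_mult_distrib)
    ultimately show ?thesis by (simp add: power_divide)
  qed
  finally have *: "(\<integral>\<^sup>+x. ennreal ((\<phi> x - dyadic_average k \<phi> x)\<^sup>2) \<partial>lborel)
      \<le> ennreal (2 ^ DIM('a) * (real DIM('a))\<^sup>2 / 4^k * ?G)" by (simp add: mult_left_mono)
  have "integrable lborel (\<lambda>x. (norm (\<phi> x - dyadic_average k \<phi> x))\<^sup>2)"
  proof (rule integrableI_bounded)
    have "(\<integral>\<^sup>+x. ennreal (norm ((norm (\<phi> x - dyadic_average k \<phi> x))\<^sup>2)) \<partial>lborel)
        \<le> ennreal (2 ^ DIM('a) * (real DIM('a))\<^sup>2 / 4^k * ?G)" using * by simp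
    then show "(\<integral>\<^sup>+x. ennreal (norm ((norm (\<phi> x - dyadic_average k \<phi> x))\<^sup>2)) \<partial>lborel) < \<infinity>"
      by (rule le_less_trans) simp
  qed measurable
  then show sq: "square_integrable lborel (\<lambda>x. \<phi> x - dyadic_average k \<phi> x)"
    by (simp add: square_integrable_def)
  show "sqnorm lborel (\<lambda>x. \<phi> x - dyadic_average k \<phi> x) \<le> 2 ^ DIM('a) * (real DIM('a))\<^sup>2 / 4^k * ?G"
    using * nn_integral_eq_sqnorm[OF sq] by simp
qed

text \<open>  The gain that drives the fourth moment estimate: one value of such a function already occupies a
  whole cell.\<close>
lemma cellwise_constant_bounded:
  fixes f :: "'a::euclidean_space \<Rightarrow> real"
  assumes f: "square_integrable lborel f" and c: "\<And>x y. y \<in> dyadic_cell k x \<Longrightarrow> f y = f x"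
  shows "(f x)\<^sup>2 \<le> (2^k) ^ DIM('a) * sqnorm lborel f"
proof -
  have eq: "indicator (dyadic_cell k x) y * f y = f x * indicator (dyadic_cell k x) y" for y
    using c[of y x] by (simp add: indicator_def)
  have "(f x)\<^sup>2 * (1 / 2^k) ^ DIM('a) = sqnorm lborel (\<lambda>y. indicator (dyadic_cell k x) y * f y)"
    unfolding eq sqnorm_mult square_integrable_dyadic_cell(2) ..
  also have "\<dots> \<le> sqnorm lborel f" by (rule square_integrable_indicator_mult[OF f]) simp
  finally show ?thesis by (simp add: power_one_over field_simps)
qed

lemma bounded_square_integrable_4:
  fixes f :: "'m \<Rightarrow> real"
  assumes f: "square_integrable M f" and b: "\<And>x. (f x)\<^sup>2 \<le> B"
  shows "square_integrable M (\<lambda>x. (f x)\<^sup>2)" "sqnorm M (\<lambda>x. (f x)\<^sup>2) \<le> B * sqnorm M f"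
proof -
  have [measurable]: "f \<in> borel_measurable M" by (rule square_integrable_measurable[OF f])
  have le: "(norm ((f x)\<^sup>2))\<^sup>2 \<le> B * (norm (f x))\<^sup>2" for x
    using mult_right_mono[OF b[of x], of "(f x)\<^sup>2"] by (simp add: power2_eq_square)
  have i: "integrable M (\<lambda>x. B * (norm (f x))\<^sup>2)" using square_integrable_integrable[OF f] by simp
  have i2: "integrable M (\<lambda>x. (norm ((f x)\<^sup>2))\<^sup>2)"
    by (rule Bochner_Integration.integrable_bound[OF i])
      (use le in \<open>auto intro!: AE_I2 intro: order_trans[OF _ abs_ge_self]\<close>)
  then show "square_integrable M (\<lambda>x. (f x)\<^sup>2)" by (simp add: square_integrable_def)
  have "sqnorm M (\<lambda>x. (f x)\<^sup>2) \<le> (LINT x|M. B * (norm (f x))\<^sup>2)"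
    unfolding sqnorm_def by (rule integral_mono[OF i2 i le])
  then show "sqnorm M (\<lambda>x. (f x)\<^sup>2) \<le> B * sqnorm M f" by (simp add: sqnorm_def)
qed

section \<open>Fourth moments of test functions\<close>

lemma weighted_Cauchy_Schwarz_sum:
  fixes a :: "nat \<Rightarrow> real"
  assumes "q > 0"
  shows "(\<Sum>j<m. a j)\<^sup>2 \<le> (\<Sum>j<m. q^j) * (\<Sum>j<m. (a j)\<^sup>2 / q^j)"
proof -
  have "(\<Sum>j<m. sqrt (q^j) * (a j / sqrt (q^j)))\<^sup>2 \<le> (\<Sum>j<m. (sqrt (q^j))\<^sup>2) * (\<Sum>j<m. (a j / sqrt (q^j))\<^sup>2)"
    by (rule Cauchy_Schwarz_ineq_sum)
  moreover have "sqrt (q^j) * (a j / sqrt (q^j)) = a j" "(sqrt (q^j))\<^sup>2 = q^j"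
    "(a j / sqrt (q^j))\<^sup>2 = (a j)\<^sup>2 / q^j" for j
    using assms by (auto simp: power_divide)
  ultimately show ?thesis by simp
qed

lemma geometric_sum_le:
  fixes q :: real
  assumes "0 < q" "q < 1"
  shows "(\<Sum>j<m. q^j) \<le> 1 / (1 - q)"
proof -
  have "(\<Sum>j<m. q^j) = (1 - q^m) / (1 - q)" using assms by (simp add: geometric_sum field_simps)
  also have "\<dots> \<le> 1 / (1 - q)" using assms by (intro divide_right_mono) auto
  finally show ?thesis .
qed

text \<open>  Two applications of the weighted Cauchy-Schwarz inequality with ratio \<open>9/10\<close>. The growth rate
  \<open>1000/729 = (10/9)\<^sup>3\<close> stays below two, the rate at which the fourth moments of the increments
  decay in dimension three.\<close>
lemma sum_fourth_power_le:
  fixes a :: "nat \<Rightarrow> real"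
  shows "((\<Sum>j<m. a j)\<^sup>2)\<^sup>2 \<le> 1000 * (\<Sum>j<m. (1000 / 729)^j * ((a j)\<^sup>2)\<^sup>2)"
proof -
  let ?q = "9/10 :: real" and ?S = "\<Sum>j<m. (9/10 :: real)^j"
  have S: "0 \<le> ?S" "?S \<le> 10" using geometric_sum_le[of ?q m] by (auto intro: sum_nonneg)
  have eqj: "((a j)\<^sup>2 / ?q^j)\<^sup>2 / ?q^j = (1000 / 729)^j * ((a j)\<^sup>2)\<^sup>2" for j
  proof -
    have gen: "(s / c)\<^sup>2 / c = s\<^sup>2 / (c * c * c)" for s c :: real
      by (simp add: power2_eq_square)
    have "?q^j * ?q^j * ?q^j = (?q * ?q * ?q)^j" unfolding power_mult_distrib ..
    then have q3: "?q^j * ?q^j * ?q^j = (729 / 1000)^j" by simp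
    have "((a j)\<^sup>2 / ?q^j)\<^sup>2 / ?q^j = ((a j)\<^sup>2)\<^sup>2 / (?q^j * ?q^j * ?q^j)"
      by (rule gen)
    also have "\<dots> = (1000 / 729)^j * ((a j)\<^sup>2)\<^sup>2" unfolding q3 by (simp add: power_divide)
    finally show ?thesis .
  qed
  have "(\<Sum>j<m. a j)\<^sup>2 \<le> ?S * (\<Sum>j<m. (a j)\<^sup>2 / ?q^j)" by (rule weighted_Cauchy_Schwarz_sum) simp
  also have "\<dots> \<le> 10 * (\<Sum>j<m. (a j)\<^sup>2 / ?q^j)" using S by (intro mult_right_mono sum_nonneg) auto
  finally have "((\<Sum>j<m. a j)\<^sup>2)\<^sup>2 \<le> (10 * (\<Sum>j<m. (a j)\<^sup>2 / ?q^j))\<^sup>2" by (intro power_mono) auto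
  also have "\<dots> = 100 * (\<Sum>j<m. (a j)\<^sup>2 / ?q^j)\<^sup>2" by (simp add: power_mult_distrib)
  also have "(\<Sum>j<m. (a j)\<^sup>2 / ?q^j)\<^sup>2 \<le> ?S * (\<Sum>j<m. ((a j)\<^sup>2 / ?q^j)\<^sup>2 / ?q^j)"
    by (rule weighted_Cauchy_Schwarz_sum) simp
  also have "\<dots> \<le> 10 * (\<Sum>j<m. ((a j)\<^sup>2 / ?q^j)\<^sup>2 / ?q^j)" using S by (intro mult_right_mono sum_nonneg) auto
  also have "\<dots> = 10 * (\<Sum>j<m. (1000 / 729)^j * ((a j)\<^sup>2)\<^sup>2)" unfolding eqj ..
  finally show ?thesis by simp
qed

lemma dyadic_average_square_integrable:
  assumes \<phi>: "\<phi> \<in> test_functions \<Omega>"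
  shows "square_integrable lborel (dyadic_average k \<phi>)"
  using square_integrable_diff[OF test_function_square_integrable(1)[OF \<phi>] dyadic_average_approximation(1)[OF \<phi>, of k]]
  by simp

lemma sqnorm_dyadic_average_le:
  fixes \<phi> :: "'a::euclidean_space \<Rightarrow> real"
  assumes \<phi>: "\<phi> \<in> test_functions \<Omega>"
  shows "sqnorm lborel (dyadic_average k \<phi>) \<le>
    2 * sqnorm lborel \<phi> + 2 * (2 ^ DIM('a) * (real DIM('a))\<^sup>2 / 4^k * sqnorm lborel (gradient \<phi>))"
  using sqnorm_add_le(2)[OF test_function_square_integrable(1)[OF \<phi>] dyadic_average_approximation(1)[OF \<phi>, of k]]
    dyadic_average_approximation(2)[OF \<phi>, of k] by simp

definition dyadic_increment :: "nat \<Rightarrow> ('a::euclidean_space \<Rightarrow> real) \<Rightarrow> 'a \<Rightarrow> real" where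
  "dyadic_increment k f x = dyadic_average (Suc k) f x - dyadic_average k f x"

lemma dyadic_increment_square_integrable:
  assumes \<phi>: "\<phi> \<in> test_functions \<Omega>"
  shows "square_integrable lborel (dyadic_increment k \<phi>)"
  unfolding dyadic_increment_def[abs_def]
  by (intro square_integrable_diff dyadic_average_square_integrable[OF \<phi>])

lemma sqnorm_dyadic_increment_le:
  fixes \<phi> :: "'a::euclidean_space \<Rightarrow> real"
  assumes \<phi>: "\<phi> \<in> test_functions \<Omega>"
  shows "sqnorm lborel (dyadic_increment k \<phi>) \<le>
    4 * (2 ^ DIM('a) * (real DIM('a))\<^sup>2) / 4^k * sqnorm lborel (gradient \<phi>)"
proof -
  let ?C = "2 ^ DIM('a) * (real DIM('a))\<^sup>2" and ?G = "sqnorm lborel (gradient \<phi>)"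
  note A = dyadic_average_approximation[OF \<phi>]
  have eq: "dyadic_increment k \<phi> = (\<lambda>x. (\<phi> x - dyadic_average k \<phi> x) - (\<phi> x - dyadic_average (Suc k) \<phi> x))"
    by (auto simp: dyadic_increment_def)
  have "sqnorm lborel (dyadic_increment k \<phi>) \<le>
      2 * (?C / 4^k * ?G) + 2 * (?C / 4^Suc k * ?G)"
    unfolding eq using sqnorm_add_le(2)[OF A(1)[of k] A(1)[of "Suc k"]] A(2)[of k] A(2)[of "Suc k"] by linarith
  also have "\<dots> \<le> 2 * (?C / 4^k * ?G) + 2 * (?C / 4^k * ?G)"
    by (intro add_mono mult_left_mono mult_right_mono divide_left_mono) auto
  finally show ?thesis by (simp add: mult_ac)
qed

text \<open>  Supremum bound times \<open>L\<^sup>2\<close> bound: \<open>2\<^sup>(\<^sup>k\<^sup>+\<^sup>1\<^sup>)\<^sup>N (4 C / 4\<^sup>k)\<^sup>2\<close>, which decays in \<open>k\<close> for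
  \<open>N < 4\<close>. This is the place where the dimension matters.\<close>
lemma dyadic_increment_fourth_moment:
  fixes \<phi> :: "'a::euclidean_space \<Rightarrow> real"
  assumes \<phi>: "\<phi> \<in> test_functions \<Omega>" and dim: "DIM('a) \<le> 3"
  shows "square_integrable lborel (\<lambda>x. (dyadic_increment k \<phi> x)\<^sup>2)"
    "sqnorm lborel (\<lambda>x. (dyadic_increment k \<phi> x)\<^sup>2) \<le>
      128 * (2 ^ DIM('a) * (real DIM('a))\<^sup>2)\<^sup>2 / 2^k * (sqnorm lborel (gradient \<phi>))\<^sup>2"
proof -
  let ?C = "2 ^ DIM('a) * (real DIM('a))\<^sup>2" and ?G = "sqnorm lborel (gradient \<phi>)"
    and ?d = "dyadic_increment k \<phi>" and ?V = "(2^Suc k) ^ DIM('a) :: real"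
  note S = dyadic_increment_square_integrable[OF \<phi>, of k]
  have b: "(?d x)\<^sup>2 \<le> ?V * sqnorm lborel ?d" for x
  proof (rule cellwise_constant_bounded[OF S])
    fix x y :: 'a assume y: "y \<in> dyadic_cell (Suc k) x"
    then have "y \<in> dyadic_cell k x" using dyadic_cell_Suc_subset by blast
    with y show "?d y = ?d x" by (simp add: dyadic_increment_def dyadic_average_const_on_cell)
  qed
  note F = bounded_square_integrable_4[OF S b]
  show "square_integrable lborel (\<lambda>x. (?d x)\<^sup>2)" by (rule F)
  have "sqnorm lborel (\<lambda>x. (?d x)\<^sup>2) \<le> ?V * (sqnorm lborel ?d)\<^sup>2"
    using F(2) by (simp add: power2_eq_square mult.assoc)
  also have "\<dots> \<le> (2^Suc k)^3 * (4 * ?C / 4^k * ?G)\<^sup>2"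
    using sqnorm_dyadic_increment_le[OF \<phi>, of k] dim
    by (intro mult_mono power_mono power_increasing one_le_power) auto
  also have "\<dots> = 128 * ?C\<^sup>2 / 2^k * ?G\<^sup>2"
  proof -
    have 4: "(4::real)^k = 2^k * 2^k" by (simp flip: power_mult_distrib)
    show ?thesis unfolding 4 by (simp add: field_simps power2_eq_square power3_eq_cube)
  qed
  finally show "sqnorm lborel (\<lambda>x. (?d x)\<^sup>2) \<le> 128 * ?C\<^sup>2 / 2^k * ?G\<^sup>2" .
qed

lemma dyadic_average_fourth_moment:
  fixes \<phi> :: "'a::euclidean_space \<Rightarrow> real"
  assumes \<phi>: "\<phi> \<in> test_functions \<Omega>" and dim: "DIM('a) \<le> 3"
  shows "square_integrable lborel (\<lambda>x. (dyadic_average k \<phi> x)\<^sup>2)"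
    "sqnorm lborel (\<lambda>x. (dyadic_average k \<phi> x)\<^sup>2) \<le>
      8 * 8^k * (sqnorm lborel \<phi>)\<^sup>2 + 8 * (2 ^ DIM('a) * (real DIM('a))\<^sup>2)\<^sup>2 / 2^k * (sqnorm lborel (gradient \<phi>))\<^sup>2"
proof -
  let ?C = "2 ^ DIM('a) * (real DIM('a))\<^sup>2" and ?G = "sqnorm lborel (gradient \<phi>)"
    and ?d = "dyadic_average k \<phi>" and ?V = "(2^k) ^ DIM('a) :: real" and ?N = "sqnorm lborel \<phi>"
  note S = dyadic_average_square_integrable[OF \<phi>, of k]
  note F = bounded_square_integrable_4[OF S cellwise_constant_bounded[OF S dyadic_average_const_on_cell]]
  show "square_integrable lborel (\<lambda>x. (?d x)\<^sup>2)" by (rule F)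
  have "sqnorm lborel (\<lambda>x. (?d x)\<^sup>2) \<le> ?V * (sqnorm lborel ?d)\<^sup>2"
    using F(2) by (simp add: power2_eq_square mult.assoc)
  also have "\<dots> \<le> (2^k)^3 * (2 * ?N + 2 * (?C / 4^k * ?G))\<^sup>2"
    using sqnorm_dyadic_average_le[OF \<phi>, of k] dim
    by (intro mult_mono power_mono power_increasing one_le_power) auto
  also have "\<dots> \<le> (2^k)^3 * (8 * ?N\<^sup>2 + 8 * (?C / 4^k * ?G)\<^sup>2)"
  proof (intro mult_left_mono)
    have "(2 * a + 2 * b)\<^sup>2 \<le> 8 * a\<^sup>2 + 8 * b\<^sup>2" for a b :: real
      using sum_squares_bound[of a b] by (simp add: power2_eq_square algebra_simps)
    then show "(2 * ?N + 2 * (?C / 4^k * ?G))\<^sup>2 \<le> 8 * ?N\<^sup>2 + 8 * (?C / 4^k * ?G)\<^sup>2" .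
  qed simp
  also have "\<dots> = 8 * 8^k * ?N\<^sup>2 + 8 * ?C\<^sup>2 / 2^k * ?G\<^sup>2"
  proof -
    have 4: "(4::real)^k = 2^k * 2^k" "(8::real)^k = 2^k * 2^k * 2^k" by (simp_all flip: power_mult_distrib)
    show ?thesis unfolding 4 by (simp add: field_simps power2_eq_square power3_eq_cube)
  qed
  finally show "sqnorm lborel (\<lambda>x. (?d x)\<^sup>2) \<le> 8 * 8^k * ?N\<^sup>2 + 8 * ?C\<^sup>2 / 2^k * ?G\<^sup>2" .
qed

text \<open>  The average at level \<open>k + m\<close> is the one at level \<open>k\<close> plus \<open>m\<close> increments. Both contributions of
  the gradient are of order \<open>2\<^sup>-\<^sup>k\<close>, uniformly in \<open>m\<close>.\<close>
lemma dyadic_average_tail_fourth_moment: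
  fixes \<phi> :: "'a::euclidean_space \<Rightarrow> real"
  assumes \<phi>: "\<phi> \<in> test_functions \<Omega>" and dim: "DIM('a) \<le> 3"
  shows "square_integrable lborel (\<lambda>x. (dyadic_average (k + m) \<phi> x)\<^sup>2)"
    "sqnorm lborel (\<lambda>x. (dyadic_average (k + m) \<phi> x)\<^sup>2) \<le>
      64 * 8^k * (sqnorm lborel \<phi>)\<^sup>2 + 5000000 * (2 ^ DIM('a) * (real DIM('a))\<^sup>2)\<^sup>2 / 2^k * (sqnorm lborel (gradient \<phi>))\<^sup>2"
proof -
  let ?C = "2 ^ DIM('a) * (real DIM('a))\<^sup>2" and ?G = "sqnorm lborel (gradient \<phi>)"
    and ?N = "sqnorm lborel \<phi>" and ?d = "\<lambda>j. dyadic_increment (k + j) \<phi>"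
  show S: "square_integrable lborel (\<lambda>x. (dyadic_average (k + m) \<phi> x)\<^sup>2)" for m
    by (rule dyadic_average_fourth_moment(1)[OF \<phi> dim])
  note D = dyadic_increment_fourth_moment[OF \<phi> dim]
  let ?R = "\<lambda>x. 8 * (norm ((dyadic_average k \<phi> x)\<^sup>2))\<^sup>2 + 8 * (1000 * (\<Sum>j<m. (1000/729)^j * (norm ((?d j x)\<^sup>2))\<^sup>2))"
  have le: "(norm ((dyadic_average (k + m) \<phi> x)\<^sup>2))\<^sup>2 \<le> ?R x" for x
  proof -
    have "(\<Sum>j<m. ?d j x) = dyadic_average (k + m) \<phi> x - dyadic_average k \<phi> x"
      using sum_lessThan_telescope[of "\<lambda>j. dyadic_average (k + j) \<phi> x" m] by (simp add: dyadic_increment_def)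
    then have split: "dyadic_average (k + m) \<phi> x = dyadic_average k \<phi> x + (\<Sum>j<m. ?d j x)" by simp
    have four: "((a + b)\<^sup>2)\<^sup>2 \<le> 8 * (a\<^sup>2)\<^sup>2 + 8 * (b\<^sup>2)\<^sup>2" for a b :: real
    proof -
      have two: "(s + t)\<^sup>2 \<le> 2 * s\<^sup>2 + 2 * t\<^sup>2" for s t :: real
        using sum_squares_bound[of s t] by (simp add: power2_eq_square algebra_simps)
      have "((a + b)\<^sup>2)\<^sup>2 \<le> (2 * a\<^sup>2 + 2 * b\<^sup>2)\<^sup>2" using two by (intro power_mono) auto
      also have "\<dots> \<le> 2 * (2 * a\<^sup>2)\<^sup>2 + 2 * (2 * b\<^sup>2)\<^sup>2" by (rule two)
      finally show ?thesis by (simp add: power_mult_distrib)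
    qed
    show ?thesis unfolding split real_norm_def power2_abs
      using four[of "dyadic_average k \<phi> x" "\<Sum>j<m. ?d j x"] sum_fourth_power_le[of "\<lambda>j. ?d j x" m]
      by linarith
  qed
  have iR1: "integrable lborel (\<lambda>x. 8 * (norm ((dyadic_average k \<phi> x)\<^sup>2))\<^sup>2)"
    using square_integrable_integrable[OF dyadic_average_fourth_moment(1)[OF \<phi> dim]] by simp
  have iRj: "integrable lborel (\<lambda>x. (1000/729)^j * (norm ((?d j x)\<^sup>2))\<^sup>2)" for j
    using square_integrable_integrable[OF D(1)] by simp
  have iR2: "integrable lborel (\<lambda>x. 8 * (1000 * (\<Sum>j<m. (1000/729)^j * (norm ((?d j x)\<^sup>2))\<^sup>2)))"
    by (intro integrable_mult_right Bochner_Integration.integrable_sum iRj)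
  have "sqnorm lborel (\<lambda>x. (dyadic_average (k + m) \<phi> x)\<^sup>2) \<le> (LINT x|lborel. ?R x)"
    unfolding sqnorm_def
    by (rule integral_mono[OF square_integrable_integrable[OF S] Bochner_Integration.integrable_add[OF iR1 iR2] le])
  also have "\<dots> = 8 * sqnorm lborel (\<lambda>x. (dyadic_average k \<phi> x)\<^sup>2)
      + 8 * (1000 * (\<Sum>j<m. (1000/729)^j * sqnorm lborel (\<lambda>x. (?d j x)\<^sup>2)))"
    unfolding Bochner_Integration.integral_add[OF iR1 iR2] integral_mult_right_zero
      Bochner_Integration.integral_sum[OF iRj] sqnorm_def ..
  also have "(\<Sum>j<m. (1000/729)^j * sqnorm lborel (\<lambda>x. (?d j x)\<^sup>2)) \<le> (\<Sum>j<m. (500/729)^j * (128 * ?C\<^sup>2 / 2^k * ?G\<^sup>2))"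
  proof (intro sum_mono)
    fix j
    have "(1000/729)^j * sqnorm lborel (\<lambda>x. (?d j x)\<^sup>2) \<le> (1000/729)^j * (128 * ?C\<^sup>2 / 2^(k+j) * ?G\<^sup>2)"
      by (intro mult_left_mono D) simp
    also have "\<dots> = ((1000/729)^j / 2^j) * (128 * ?C\<^sup>2 / 2^k * ?G\<^sup>2)" by (simp add: power_add)
    also have "(1000/729)^j / 2^j = (500/729 :: real)^j" by (simp flip: power_divide)
    finally show "(1000/729)^j * sqnorm lborel (\<lambda>x. (?d j x)\<^sup>2) \<le> (500/729)^j * (128 * ?C\<^sup>2 / 2^k * ?G\<^sup>2)" .
  qed
  also have "\<dots> = (\<Sum>j<m. (500/729)^j) * (128 * ?C\<^sup>2 / 2^k * ?G\<^sup>2)"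
    by (rule sum_distrib_right[symmetric])
  also have "\<dots> \<le> 4 * (128 * ?C\<^sup>2 / 2^k * ?G\<^sup>2)"
    using geometric_sum_le[of "500/729" m] by (intro mult_right_mono) auto
  finally have X: "sqnorm lborel (\<lambda>x. (dyadic_average (k + m) \<phi> x)\<^sup>2) \<le>
      8 * sqnorm lborel (\<lambda>x. (dyadic_average k \<phi> x)\<^sup>2) + 8 * (1000 * (4 * (128 * ?C\<^sup>2 / 2^k * ?G\<^sup>2)))"
    by simp
  define A where "A = ?C\<^sup>2 / 2^k * ?G\<^sup>2"
  have A: "128 * ?C\<^sup>2 / 2^k * ?G\<^sup>2 = 128 * A" "8 * ?C\<^sup>2 / 2^k * ?G\<^sup>2 = 8 * A"
    "5000000 * ?C\<^sup>2 / 2^k * ?G\<^sup>2 = 5000000 * A" "A \<ge> 0"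
    by (simp_all add: A_def)
  show "sqnorm lborel (\<lambda>x. (dyadic_average (k + m) \<phi> x)\<^sup>2) \<le>
      64 * 8^k * ?N\<^sup>2 + 5000000 * ?C\<^sup>2 / 2^k * ?G\<^sup>2"
    using X dyadic_average_fourth_moment(2)[OF \<phi> dim, of k] A(4) unfolding A(1-3) by linarith
qed

lemma dyadic_average_tendsto:
  fixes \<phi> :: "'a::euclidean_space \<Rightarrow> real"
  assumes \<phi>: "\<phi> \<in> test_functions \<Omega>"
  shows "(\<lambda>k. sqnorm lborel (\<lambda>x. \<phi> x - dyadic_average k \<phi> x)) \<longlonglongrightarrow> 0"
proof -
  let ?C = "2 ^ DIM('a) * (real DIM('a))\<^sup>2" and ?G = "sqnorm lborel (gradient \<phi>)"
  have "(\<lambda>k. ?C * ?G * (1/4)^k) \<longlonglongrightarrow> ?C * ?G * 0" by (intro tendsto_intros LIMSEQ_power_zero) simp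
  then have lim: "(\<lambda>k. ?C * ?G * (1/4)^k) \<longlonglongrightarrow> 0" by simp
  have "sqnorm lborel (\<lambda>x. \<phi> x - dyadic_average k \<phi> x) \<le> ?C * ?G * (1/4)^k" for k
    using dyadic_average_approximation(2)[OF \<phi>, of k] by (simp add: power_one_over field_simps)
  then show ?thesis
    by (intro tendsto_sandwich[OF _ _ tendsto_const lim]) (auto intro!: always_eventually)
qed

text \<open>  An interpolated Sobolev inequality with a free parameter \<open>k\<close>: for large \<open>k\<close> the gradient term is
  negligible, so convergence in \<open>L\<^sup>2\<close> with bounded gradients is convergence in \<open>L\<^sup>4\<close>. The averages
  satisfy it uniformly, and they converge to \<open>\<phi>\<close> almost everywhere along a subsequence.\<close>
lemma test_function_fourth_moment:
  fixes \<phi> :: "'a::euclidean_space \<Rightarrow> real"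
  assumes \<phi>: "\<phi> \<in> test_functions \<Omega>" and dim: "DIM('a) \<le> 3"
  shows "sqnorm lborel (\<lambda>x. (\<phi> x)\<^sup>2) \<le> 64 * 8^k * (sqnorm lborel \<phi>)\<^sup>2 +
    5000000 * (2 ^ DIM('a) * (real DIM('a))\<^sup>2)\<^sup>2 / 2^k * (sqnorm lborel (gradient \<phi>))\<^sup>2"
proof -
  have lim: "(\<lambda>m. sqnorm lborel (\<lambda>x. dyadic_average (k + m) \<phi> x - \<phi> x)) \<longlonglongrightarrow> 0"
    using LIMSEQ_ignore_initial_segment[OF dyadic_average_tendsto[OF \<phi>], of k]
    by (simp add: sqnorm_minus_commute[of lborel \<phi>] add.commute)
  obtain r where r: "strict_mono r" "AE x in lborel. (\<lambda>m. dyadic_average (k + r m) \<phi> x) \<longlonglongrightarrow> \<phi> x"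
    by (rule sqnorm_tendsto_AE_subseq[OF dyadic_average_square_integrable[OF \<phi>] test_function_square_integrable(1)[OF \<phi>] lim])
  have ae: "AE x in lborel. (\<lambda>m. (dyadic_average (k + r m) \<phi> x)\<^sup>2) \<longlonglongrightarrow> (\<phi> x)\<^sup>2"
    using r(2) by eventually_elim (rule tendsto_power)
  show ?thesis
    by (rule square_integrable_Fatou(2)[OF dyadic_average_tail_fourth_moment(1)[OF \<phi> dim] _ ae
          dyadic_average_tail_fourth_moment(2)[OF \<phi> dim]])
      (use test_function_measurable(1)[OF \<phi>] in simp)
qed

section \<open>Compactness\<close>

lemma cell_integral_bound:
  fixes f :: "'a::euclidean_space \<Rightarrow> real"
  assumes f: "square_integrable lborel f" and B: "sqnorm lborel f \<le> B"
  shows "\<bar>LINT y|lborel. indicator (dyadic_cell k x) y * f y\<bar> \<le> sqrt B"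
proof -
  have "\<bar>LINT y|lborel. indicator (dyadic_cell k x) y * f y\<bar> \<le> sqrt ((1 / 2^k) ^ DIM('a)) * sqrt (sqnorm lborel f)"
    using sqinner_Cauchy_Schwarz[OF square_integrable_dyadic_cell(1)[of k x] f]
    by (simp add: sqinner_def square_integrable_dyadic_cell(2))
  also have "\<dots> \<le> 1 * sqrt B"
    using B by (intro mult_mono) (auto intro!: power_le_one)
  finally show ?thesis by simp
qed

text \<open>  Every cell contains a point of a countable dense set, so there are countably many averages to
  control, and a diagonal subsequence makes them all converge.\<close>
lemma bounded_cell_integrals_subsequence:
  fixes f :: "nat \<Rightarrow> 'a::euclidean_space \<Rightarrow> real"
  assumes f: "\<And>n. square_integrable lborel (f n)" and B: "\<And>n. sqnorm lborel (f n) \<le> B"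
  obtains r where "strict_mono r" "\<And>k x. convergent (\<lambda>n. dyadic_average k (f (r n)) x)"
proof -
  obtain D :: "'a set" where D: "countable D" "\<And>X. open X \<Longrightarrow> X \<noteq> {} \<Longrightarrow> \<exists>d\<in>D. d \<in> X"
    by (rule countable_dense_setE) blast
  define F where "F n p = (LINT y|lborel. indicator (dyadic_cell (fst p) (snd p)) y * f n y)" for n and p :: "nat \<times> 'a"
  have "countable ((UNIV :: nat set) \<times> D)" using D(1) by simp
  moreover have "norm (F n p) \<le> sqrt B" for n p
    unfolding F_def using cell_integral_bound[OF f B] by simp
  ultimately obtain r :: "nat \<Rightarrow> nat" where r: "strict_mono r" "\<And>p. p \<in> UNIV \<times> D \<Longrightarrow> \<exists>l. (\<lambda>n. F (r n) p) \<longlonglongrightarrow> l"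
    by (rule function_convergent_subsequence[of "UNIV \<times> D" F "sqrt B"]) blast
  have "convergent (\<lambda>n. dyadic_average k (f (r n)) x)" for k x
  proof -
    obtain a :: 'a where a: "box a (a + (1 / 2^k) *\<^sub>R One) \<subseteq> dyadic_cell k x" by (rule dyadic_cell_between_boxes)
    have "box a (a + (1 / 2^k) *\<^sub>R One) \<noteq> {}" by (simp add: box_ne_empty inner_add_left)
    then obtain d where d: "d \<in> D" "d \<in> dyadic_cell k x" using D(2)[OF open_box] a by blast
    from r(2)[of "(k, d)"] d(1) obtain l where "(\<lambda>n. F (r n) (k, d)) \<longlonglongrightarrow> l" by auto
    then have "(\<lambda>n. (2^k) ^ DIM('a) * F (r n) (k, d)) \<longlonglongrightarrow> (2^k) ^ DIM('a) * l" by (rule tendsto_mult_left)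
    moreover have "(2^k) ^ DIM('a) * F (r n) (k, d) = dyadic_average k (f (r n)) x" for n
      using dyadic_cell_eq[OF d(2)] by (simp add: F_def dyadic_average_def)
    ultimately show ?thesis by (auto simp: convergent_def)
  qed
  with r(1) show ?thesis by (rule that)
qed

lemma dyadic_averages_converge_on_balls:
  fixes f :: "nat \<Rightarrow> 'a::euclidean_space \<Rightarrow> real"
  assumes f: "\<And>n. square_integrable lborel (f n)" and B: "\<And>n. sqnorm lborel (f n) \<le> B"
    and c: "\<And>x. convergent (\<lambda>n. dyadic_average k (f n) x)"
  obtains e where "e \<in> borel_measurable borel"
    "\<And>n. integrable lborel (\<lambda>x. indicator (ball 0 R) x * (dyadic_average k (f n) x - e x)\<^sup>2)"
    "(\<lambda>n. LINT x|lborel. indicator (ball 0 R) x * (dyadic_average k (f n) x - e x)\<^sup>2) \<longlonglongrightarrow> 0"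
proof -
  let ?E = "\<lambda>n. dyadic_average k (f n)"
  define D where "D = (2^k) ^ DIM('a) * sqrt B"
  have [measurable]: "f n \<in> borel_measurable borel" for n using square_integrable_measurable[OF f] by simp
  define e where "e x = lim (\<lambda>n. ?E n x)" for x
  have [measurable]: "e \<in> borel_measurable borel" unfolding e_def by measurable
  have lim: "(\<lambda>n. ?E n x) \<longlonglongrightarrow> e x" for x using c by (simp add: e_def convergent_LIMSEQ_iff)
  have E: "\<bar>?E n x\<bar> \<le> D" for n x
    unfolding dyadic_average_def D_def abs_mult
    by (intro mult_mono cell_integral_bound[OF f B]) auto
  have "\<bar>e x\<bar> \<le> D" for x
    by (rule LIMSEQ_le_const2[OF tendsto_rabs[OF lim]]) (use E in auto)
  then have b: "(?E n x - e x)\<^sup>2 \<le> (2 * D)\<^sup>2" for n x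
    using E[of n x] by (intro power2_le_iff_abs_le[THEN iffD2]) (smt (verit))+
  have "integrable lborel (indicator (ball 0 R) :: 'a \<Rightarrow> real)"
    using emeasure_bounded_finite[OF bounded_ball, of 0 R] by (intro integrable_real_indicator) simp_all
  then have iw: "integrable lborel (\<lambda>x::'a. indicator (ball 0 R) x * (2 * D)\<^sup>2)"
    by (rule integrable_mult_left)
  have dom: "norm (indicator (ball 0 R) x * (?E n x - e x)\<^sup>2) \<le> indicator (ball 0 R) x * (2 * D)\<^sup>2" for n x
    using b[of n x] by (simp add: indicator_def)
  have [measurable]: "ball (0::'a) R \<in> sets borel" by simp
  have bm: "(\<lambda>x. indicator (ball 0 R) x * (?E n x - e x)\<^sup>2) \<in> borel_measurable lborel" for n
    by measurable
  have int: "integrable lborel (\<lambda>x. indicator (ball 0 R) x * (?E n x - e x)\<^sup>2)" for n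
    by (rule Bochner_Integration.integrable_bound[OF iw])
      (use bm dom in \<open>auto intro!: AE_I2 intro: order_trans[OF _ abs_ge_self]\<close>)
  have "(\<lambda>n. LINT x|lborel. indicator (ball 0 R) x * (?E n x - e x)\<^sup>2) \<longlonglongrightarrow>
      (LINT x|lborel. indicator (ball 0 R) x * (e x - e x :: real)\<^sup>2)"
  proof (rule integral_dominated_convergence[OF _ bm iw])
    show "AE x in lborel. (\<lambda>n. indicator (ball 0 R) x * (?E n x - e x)\<^sup>2) \<longlonglongrightarrow> indicator (ball 0 R) x * (e x - e x)\<^sup>2"
      by (intro AE_I2 tendsto_intros lim)
  qed (use dom in simp_all)
  then have "(\<lambda>n. LINT x|lborel. indicator (ball 0 R) x * (?E n x - e x)\<^sup>2) \<longlonglongrightarrow> 0" by simp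
  then show ?thesis using that[of e] int by simp
qed

text \<open>  A Kolmogorov-Riesz argument. Three errors are small uniformly in \<open>n\<close> once the radius \<open>R\<close> and the
  level \<open>k\<close> are large: the part outside the ball, the distance to the averages, and, for large \<open>n\<close>,
  the distance of the averages to their limit on the ball.\<close>
lemma tight_test_functions_Cauchy_subsequence:
  fixes \<phi> :: "nat \<Rightarrow> 'a::euclidean_space \<Rightarrow> real"
  assumes \<phi>: "\<And>n. \<phi> n \<in> test_functions \<Omega>"
    and B: "\<And>n. sqnorm lborel (\<phi> n) \<le> B" "\<And>n. sqnorm lborel (gradient (\<phi> n)) \<le> B"
    and tight: "\<And>e. e > 0 \<Longrightarrow> \<exists>R. \<forall>\<^sub>F n in sequentially. sqnorm lborel (\<lambda>x. indicator (- ball 0 R) x * \<phi> n x) \<le> e"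
  obtains r :: "nat \<Rightarrow> nat" where "strict_mono r"
    "\<And>e. e > 0 \<Longrightarrow> \<exists>N. \<forall>m\<ge>N. \<forall>n\<ge>N. sqnorm lborel (\<lambda>x. \<phi> (r m) x - \<phi> (r n) x) < e"
proof -
  note S = test_function_square_integrable(1)[OF \<phi>]
  obtain r where r: "strict_mono r" "\<And>k x. convergent (\<lambda>n. dyadic_average k (\<phi> (r n)) x)"
    by (rule bounded_cell_integrals_subsequence[of \<phi> B, OF S B(1)]) blast
  let ?C = "2 ^ DIM('a) * (real DIM('a))\<^sup>2"
  have "\<exists>N. \<forall>m\<ge>N. \<forall>n\<ge>N. sqnorm lborel (\<lambda>x. \<phi> (r m) x - \<phi> (r n) x) < e" if e: "e > 0" for e
  proof -
    \<comment> \<open>each of the two functions contributes three errors \<open>d\<close>, and the pointwise inequality costs a factor four\<close>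
    define d where "d = e / 32"
    have d: "d > 0" using e by (simp add: d_def)
    obtain R where R: "\<forall>\<^sub>F n in sequentially. sqnorm lborel (\<lambda>x. indicator (- ball 0 R) x * \<phi> n x) \<le> d"
      using tight[OF d] by blast
    have "(\<lambda>k. ?C * B * (1/4)^k) \<longlonglongrightarrow> ?C * B * 0" by (intro tendsto_intros LIMSEQ_power_zero) simp
    then have "\<forall>\<^sub>F k in sequentially. ?C * B * (1/4)^k < d" using d by (intro order_tendstoD(2)) auto
    then obtain k where k: "?C * B * (1/4)^k < d" by (auto simp: eventually_sequentially)
    let ?E = "\<lambda>n. dyadic_average k (\<phi> n)"
    have ap: "sqnorm lborel (\<lambda>x. \<phi> n x - ?E n x) \<le> d" for n
    proof -
      have "sqnorm lborel (\<lambda>x. \<phi> n x - ?E n x) \<le> ?C / 4^k * sqnorm lborel (gradient (\<phi> n))"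
        by (rule dyadic_average_approximation(2)[OF \<phi>])
      also have "\<dots> \<le> ?C / 4^k * B" by (intro mult_left_mono B) simp
      also have "\<dots> = ?C * B * (1/4)^k" by (simp add: power_one_over)
      finally show ?thesis using k by simp
    qed
    obtain c where c: "c \<in> borel_measurable borel"
      "\<And>n. integrable lborel (\<lambda>x. indicator (ball 0 R) x * (?E (r n) x - c x)\<^sup>2)"
      "(\<lambda>n. LINT x|lborel. indicator (ball 0 R) x * (?E (r n) x - c x)\<^sup>2) \<longlonglongrightarrow> 0"
      by (rule dyadic_averages_converge_on_balls[of "\<lambda>n. \<phi> (r n)" B k R, OF S B(1) r(2)]) blast
    let ?J = "\<lambda>n. LINT x|lborel. indicator (ball 0 R) x * (?E (r n) x - c x)\<^sup>2"
    have "\<forall>\<^sub>F n in sequentially. ?J n < d" using c(3) d by (rule order_tendstoD(2))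
    moreover have "\<forall>\<^sub>F n in sequentially. sqnorm lborel (\<lambda>x. indicator (- ball 0 R) x * \<phi> (r n) x) \<le> d"
      using R filterlim_subseq[OF r(1)] by (rule eventually_compose_filterlim)
    ultimately have "\<forall>\<^sub>F n in sequentially. ?J n < d \<and> sqnorm lborel (\<lambda>x. indicator (- ball 0 R) x * \<phi> (r n) x) \<le> d"
      by eventually_elim simp
    then obtain N where N: "\<And>n. n \<ge> N \<Longrightarrow> ?J n < d"
        "\<And>n. n \<ge> N \<Longrightarrow> sqnorm lborel (\<lambda>x. indicator (- ball 0 R) x * \<phi> (r n) x) \<le> d"
      unfolding eventually_sequentially by blast
    let ?P = "\<lambda>n x. (norm (indicator (- ball 0 R) x * \<phi> (r n) x))\<^sup>2 + (norm (\<phi> (r n) x - ?E (r n) x))\<^sup>2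
        + indicator (ball 0 R) x * (?E (r n) x - c x)\<^sup>2"
    have iP: "integrable lborel (?P n)" for n
      by (intro Bochner_Integration.integrable_add square_integrable_integrable c(2)
          square_integrable_indicator_mult(1) S dyadic_average_approximation(1)[OF \<phi>]) simp
    have P: "(LINT x|lborel. ?P n x) \<le> 3 * d" if "n \<ge> N" for n
    proof -
      have "(LINT x|lborel. ?P n x) = sqnorm lborel (\<lambda>x. indicator (- ball 0 R) x * \<phi> (r n) x)
          + sqnorm lborel (\<lambda>x. \<phi> (r n) x - ?E (r n) x) + ?J n"
        unfolding sqnorm_def
        using c(2)[of n] square_integrable_integrable[OF square_integrable_indicator_mult(1)[OF S[of "r n"], of "- ball 0 R"]]
          square_integrable_integrable[OF dyadic_average_approximation(1)[OF \<phi>[of "r n"], of k]]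
        by (simp del: norm_mult real_norm_def)
      then show ?thesis using N[OF that] ap[of "r n"] by linarith
    qed
    have "sqnorm lborel (\<lambda>x. \<phi> (r m) x - \<phi> (r n) x) < e" if "m \<ge> N" "n \<ge> N" for m n
    proof -
      have "sqnorm lborel (\<lambda>x. \<phi> (r m) x - \<phi> (r n) x) \<le> (LINT x|lborel. 4 * (?P m x + ?P n x))"
        unfolding sqnorm_def
      proof (rule integral_mono)
        show "integrable lborel (\<lambda>x. (norm (\<phi> (r m) x - \<phi> (r n) x))\<^sup>2)"
          by (intro square_integrable_integrable square_integrable_diff S)
        show "integrable lborel (\<lambda>x. 4 * (?P m x + ?P n x))"
          by (intro integrable_mult_right Bochner_Integration.integrable_add[OF iP iP])
        fix x
        have two: "(s + t)\<^sup>2 \<le> 2 * s\<^sup>2 + 2 * t\<^sup>2" "(s - t)\<^sup>2 \<le> 2 * s\<^sup>2 + 2 * t\<^sup>2" for s t :: real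
          using sum_squares_bound[of s t] sum_squares_bound[of s "-t"] by (auto simp: power2_eq_square algebra_simps)
        have four: "(a - b)\<^sup>2 \<le> 4 * ((a - a')\<^sup>2 + (b - b')\<^sup>2 + (a' - c')\<^sup>2 + (b' - c')\<^sup>2)" for a b a' b' c' :: real
        proof -
          have "(a - b)\<^sup>2 \<le> 2 * (a - c')\<^sup>2 + 2 * (b - c')\<^sup>2" using two(2)[of "a - c'" "b - c'"] by simp
          moreover have "(a - c')\<^sup>2 \<le> 2 * (a - a')\<^sup>2 + 2 * (a' - c')\<^sup>2" using two(1)[of "a - a'" "a' - c'"] by simp
          moreover have "(b - c')\<^sup>2 \<le> 2 * (b - b')\<^sup>2 + 2 * (b' - c')\<^sup>2" using two(1)[of "b - b'" "b' - c'"] by simp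
          ultimately show ?thesis by (simp add: algebra_simps)
        qed
        show "(norm (\<phi> (r m) x - \<phi> (r n) x))\<^sup>2 \<le> 4 * (?P m x + ?P n x)"
        proof (cases "x \<in> ball 0 R")
          case True
          then show ?thesis
            using four[of "\<phi> (r m) x" "\<phi> (r n) x" "?E (r m) x" "?E (r n) x" "c x"] by (simp add: algebra_simps)
        next
          case False
          have "(\<phi> (r m) x - \<phi> (r n) x)\<^sup>2 \<le> 2 * (\<phi> (r m) x)\<^sup>2 + 2 * (\<phi> (r n) x)\<^sup>2" by (rule two)
          also have "\<dots> \<le> 4 * ((\<phi> (r m) x)\<^sup>2 + (\<phi> (r m) x - ?E (r m) x)\<^sup>2 + ((\<phi> (r n) x)\<^sup>2 + (\<phi> (r n) x - ?E (r n) x)\<^sup>2))"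
            by (simp add: add_increasing2)
          finally show ?thesis using False by simp
        qed
      qed
      also have "\<dots> = 4 * ((LINT x|lborel. ?P m x) + (LINT x|lborel. ?P n x))"
        unfolding integral_mult_right_zero Bochner_Integration.integral_add[OF iP iP] ..
      also have "\<dots> \<le> 4 * (3 * d + 3 * d)" using P[OF that(1)] P[OF that(2)] by simp
      also have "\<dots> < e" using e by (simp add: d_def)
      finally show ?thesis .
    qed
    then show ?thesis by blast
  qed
  note Cauchy = this
  show ?thesis
  proof (rule that)
    show "strict_mono r" by (rule r(1))
    show "\<exists>N. \<forall>m\<ge>N. \<forall>n\<ge>N. sqnorm lborel (\<lambda>x. \<phi> (r m) x - \<phi> (r n) x) < e" if "e > 0" for e
      by (rule Cauchy[OF that])
  qed
qed

section \<open>Functions vanishing on the boundary\<close>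

lemma H1_lincomb:
  assumes \<Omega>: "open \<Omega>" and u: "u \<in> H1 \<Omega>" and v: "v \<in> H1 \<Omega>"
  shows "(\<lambda>x. a * u x + b * v x) \<in> H1 \<Omega>"
    "AE x in lebesgue_on \<Omega>. weak_grad \<Omega> (\<lambda>x. a * u x + b * v x) x = a *\<^sub>R weak_grad \<Omega> u x + b *\<^sub>R weak_grad \<Omega> v x"
proof -
  note U = H1D[OF u] and V = H1D[OF v]
  have W: "is_weak_grad \<Omega> (\<lambda>x. a * u x + b * v x) (\<lambda>x. a *\<^sub>R weak_grad \<Omega> u x + b *\<^sub>R weak_grad \<Omega> v x)"
    by (rule is_weak_grad_lincomb[OF \<Omega> U(1) V(1) U(2) V(2)])
  show "(\<lambda>x. a * u x + b * v x) \<in> H1 \<Omega>"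
    using square_integrable_lincomb[OF U(1) V(1), of a b] by (intro H1I[OF _ W]) simp
  show "AE x in lebesgue_on \<Omega>. weak_grad \<Omega> (\<lambda>x. a * u x + b * v x) x = a *\<^sub>R weak_grad \<Omega> u x + b *\<^sub>R weak_grad \<Omega> v x"
    by (rule weak_grad_eq_AE[OF \<Omega> W])
qed

lemma test_function_H1:
  assumes "open \<Omega>" "\<phi> \<in> test_functions \<Omega>"
  shows "\<phi> \<in> H1 \<Omega>" "AE x in lebesgue_on \<Omega>. weak_grad \<Omega> \<phi> x = gradient \<phi> x"
  using H1I[OF test_function_square_integrable_on(1)[OF assms(2,1)] is_weak_grad_test_function[OF assms]]
    weak_grad_eq_AE[OF assms(1) is_weak_grad_test_function[OF assms]] by auto

lemma H1_norm_square:
  assumes "u \<in> H1 \<Omega>"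
  shows "(H1_norm \<Omega> u)\<^sup>2 = sqnorm (lebesgue_on \<Omega>) (weak_grad \<Omega> u) + sqnorm (lebesgue_on \<Omega>) u"
proof -
  have "(LINT x|lebesgue_on \<Omega>. (norm (weak_grad \<Omega> u x))\<^sup>2 + (u x)\<^sup>2) =
      sqnorm (lebesgue_on \<Omega>) (weak_grad \<Omega> u) + sqnorm (lebesgue_on \<Omega>) u"
    unfolding sqnorm_def
    using square_integrable_integrable[OF H1D(1)[OF assms]] square_integrable_integrable[OF H1D(3)[OF assms]]
    by simp
  then show ?thesis unfolding H1_norm_def by simp
qed

lemma H1_norm_square_minus_test_function:
  assumes \<Omega>: "open \<Omega>" and u: "u \<in> H1 \<Omega>" and \<phi>: "\<phi> \<in> test_functions \<Omega>"
  shows "(H1_norm \<Omega> (\<lambda>x. u x - \<phi> x))\<^sup>2 =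
    sqnorm (lebesgue_on \<Omega>) (\<lambda>x. weak_grad \<Omega> u x - gradient \<phi> x) + sqnorm (lebesgue_on \<Omega>) (\<lambda>x. u x - \<phi> x)"
proof -
  note T = test_function_H1[OF \<Omega> \<phi>]
  note L = H1_lincomb[OF \<Omega> u T(1), of 1 "-1"]
  have d: "(\<lambda>x. u x - \<phi> x) \<in> H1 \<Omega>" using L(1) by simp
  have "AE x in lebesgue_on \<Omega>. weak_grad \<Omega> (\<lambda>x. u x - \<phi> x) x = weak_grad \<Omega> u x - gradient \<phi> x"
    using L(2) T(2) by eventually_elim simp
  then have "sqnorm (lebesgue_on \<Omega>) (weak_grad \<Omega> (\<lambda>x. u x - \<phi> x)) =
      sqnorm (lebesgue_on \<Omega>) (\<lambda>x. weak_grad \<Omega> u x - gradient \<phi> x)"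
    by (intro sqnorm_cong_AE square_integrable_measurable square_integrable_diff H1D(3)[OF d] H1D(3)[OF u]
        test_function_square_integrable_on(2)[OF \<phi> \<Omega>])
  then show ?thesis using H1_norm_square[OF d] by simp
qed

lemma H10_imp_H1: "u \<in> H10 \<Omega> \<Longrightarrow> u \<in> H1 \<Omega>"
  by (simp add: H10_def)

text \<open>  The weak gradient is only determined almost everywhere; here the distance to a test function is
  expressed by its classical gradient.\<close>
lemma H10_iff:
  assumes \<Omega>: "open \<Omega>"
  shows "u \<in> H10 \<Omega> \<longleftrightarrow> u \<in> H1 \<Omega> \<and> (\<forall>e>0. \<exists>\<phi>\<in>test_functions \<Omega>.
    sqnorm (lebesgue_on \<Omega>) (\<lambda>x. weak_grad \<Omega> u x - gradient \<phi> x) + sqnorm (lebesgue_on \<Omega>) (\<lambda>x. u x - \<phi> x) < e)"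
    (is "_ \<longleftrightarrow> _ \<and> (\<forall>e>0. \<exists>\<phi>\<in>test_functions \<Omega>. ?d \<phi> < e)")
proof (cases "u \<in> H1 \<Omega>")
  case True
  have nn: "0 \<le> H1_norm \<Omega> w" for w unfolding H1_norm_def by (intro real_sqrt_ge_zero integral_nonneg_AE) simp
  have d: "?d \<phi> = (H1_norm \<Omega> (\<lambda>x. u x - \<phi> x))\<^sup>2" if "\<phi> \<in> test_functions \<Omega>" for \<phi>
    by (rule H1_norm_square_minus_test_function[OF \<Omega> True that, symmetric])
  have "(\<forall>e>0. \<exists>\<phi>\<in>test_functions \<Omega>. H1_norm \<Omega> (\<lambda>x. u x - \<phi> x) < e) \<longleftrightarrow> (\<forall>e>0. \<exists>\<phi>\<in>test_functions \<Omega>. ?d \<phi> < e)"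
  proof (intro iffI allI impI)
    fix e :: real assume H: "\<forall>e>0. \<exists>\<phi>\<in>test_functions \<Omega>. H1_norm \<Omega> (\<lambda>x. u x - \<phi> x) < e" and e: "e > 0"
    obtain \<phi> where \<phi>: "\<phi> \<in> test_functions \<Omega>" "H1_norm \<Omega> (\<lambda>x. u x - \<phi> x) < sqrt e"
      using H[rule_format, of "sqrt e"] e by auto
    have "(H1_norm \<Omega> (\<lambda>x. u x - \<phi> x))\<^sup>2 < (sqrt e)\<^sup>2" by (rule power_strict_mono[OF \<phi>(2) nn]) simp
    then have "?d \<phi> < e" using d[OF \<phi>(1)] e by simp
    with \<phi>(1) show "\<exists>\<phi>\<in>test_functions \<Omega>. ?d \<phi> < e" by blast
  next
    fix e :: real assume H: "\<forall>e>0. \<exists>\<phi>\<in>test_functions \<Omega>. ?d \<phi> < e" and e: "e > 0"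
    have "0 < e\<^sup>2" using e by simp
    with H obtain \<phi> where \<phi>: "\<phi> \<in> test_functions \<Omega>" "?d \<phi> < e\<^sup>2" by blast
    have "H1_norm \<Omega> (\<lambda>x. u x - \<phi> x) < e"
      using \<phi>(2) e unfolding d[OF \<phi>(1)] by (intro power2_less_imp_less[of _ e]) auto
    with \<phi>(1) show "\<exists>\<phi>\<in>test_functions \<Omega>. H1_norm \<Omega> (\<lambda>x. u x - \<phi> x) < e" by blast
  qed
  then show ?thesis using True unfolding H10_def by simp
qed (simp add: H10_def)

lemma H10_approx:
  assumes \<Omega>: "open \<Omega>" and u: "u \<in> H10 \<Omega>" and e: "e > 0"
  obtains \<phi> where "\<phi> \<in> test_functions \<Omega>" "sqnorm (lebesgue_on \<Omega>) (\<lambda>x. u x - \<phi> x) < e"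
    "sqnorm (lebesgue_on \<Omega>) (\<lambda>x. weak_grad \<Omega> u x - gradient \<phi> x) < e"
proof -
  obtain \<phi> where \<phi>: "\<phi> \<in> test_functions \<Omega>"
    "sqnorm (lebesgue_on \<Omega>) (\<lambda>x. weak_grad \<Omega> u x - gradient \<phi> x) + sqnorm (lebesgue_on \<Omega>) (\<lambda>x. u x - \<phi> x) < e"
    using u e unfolding H10_iff[OF \<Omega>] by blast
  show ?thesis
    using \<phi>(2) sqnorm_nonneg[of "lebesgue_on \<Omega>" "\<lambda>x. weak_grad \<Omega> u x - gradient \<phi> x"]
      sqnorm_nonneg[of "lebesgue_on \<Omega>" "\<lambda>x. u x - \<phi> x"]
    by (intro that[OF \<phi>(1)]) linarith+
qed

lemma H10_approx_sequence:
  assumes \<Omega>: "open \<Omega>" and u: "u \<in> H10 \<Omega>"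
  obtains \<phi> :: "nat \<Rightarrow> _" where "\<And>n. \<phi> n \<in> test_functions \<Omega>"
    "(\<lambda>n. sqnorm (lebesgue_on \<Omega>) (\<lambda>x. \<phi> n x - u x)) \<longlonglongrightarrow> 0"
    "(\<lambda>n. sqnorm (lebesgue_on \<Omega>) (\<lambda>x. gradient (\<phi> n) x - weak_grad \<Omega> u x)) \<longlonglongrightarrow> 0"
proof -
  have "\<exists>\<phi>. \<phi> \<in> test_functions \<Omega> \<and> sqnorm (lebesgue_on \<Omega>) (\<lambda>x. u x - \<phi> x) < 1 / real (Suc n) \<and>
    sqnorm (lebesgue_on \<Omega>) (\<lambda>x. weak_grad \<Omega> u x - gradient \<phi> x) < 1 / real (Suc n)" for n
  proof -
    have "0 < 1 / real (Suc n)" by simp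
    from H10_approx[OF \<Omega> u this] show ?thesis by blast
  qed
  then obtain \<phi> where \<phi>: "\<And>n. \<phi> n \<in> test_functions \<Omega>"
    "\<And>n. sqnorm (lebesgue_on \<Omega>) (\<lambda>x. u x - \<phi> n x) < 1 / real (Suc n)"
    "\<And>n. sqnorm (lebesgue_on \<Omega>) (\<lambda>x. weak_grad \<Omega> u x - gradient (\<phi> n) x) < 1 / real (Suc n)"
    by metis
  have lim: "(\<lambda>n. 1 / real (Suc n)) \<longlonglongrightarrow> 0" using lim_1_over_n[THEN LIMSEQ_Suc] .
  have 1: "(\<lambda>n. sqnorm (lebesgue_on \<Omega>) (\<lambda>x. \<phi> n x - u x)) \<longlonglongrightarrow> 0"
    by (rule tendsto_sandwich[OF _ _ tendsto_const lim])
      (use \<phi>(2) in \<open>auto simp: sqnorm_minus_commute[of _ u] simp del: of_nat_Suc intro!: always_eventually less_imp_le\<close>)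
  have 2: "(\<lambda>n. sqnorm (lebesgue_on \<Omega>) (\<lambda>x. gradient (\<phi> n) x - weak_grad \<Omega> u x)) \<longlonglongrightarrow> 0"
    by (rule tendsto_sandwich[OF _ _ tendsto_const lim])
      (use \<phi>(3) in \<open>auto simp: sqnorm_minus_commute[of _ "weak_grad \<Omega> u"] simp del: of_nat_Suc intro!: always_eventually less_imp_le\<close>)
  show ?thesis by (rule that[OF \<phi>(1) 1 2])
qed

lemma H10_limit:
  assumes \<Omega>: "open \<Omega>" and u: "\<And>n. u n \<in> H10 \<Omega>"
    and v: "square_integrable (lebesgue_on \<Omega>) v" "(\<lambda>n. sqnorm (lebesgue_on \<Omega>) (\<lambda>x. u n x - v x)) \<longlonglongrightarrow> 0"
    and g: "square_integrable (lebesgue_on \<Omega>) g"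
      "(\<lambda>n. sqnorm (lebesgue_on \<Omega>) (\<lambda>x. weak_grad \<Omega> (u n) x - g x)) \<longlonglongrightarrow> 0"
  shows "v \<in> H10 \<Omega>" "AE x in lebesgue_on \<Omega>. weak_grad \<Omega> v x = g x"
proof -
  let ?M = "lebesgue_on \<Omega>"
  note U = H1D[OF H10_imp_H1[OF u]]
  have W: "is_weak_grad \<Omega> v g" by (rule is_weak_grad_limit[OF \<Omega> U(2) U(1) v g])
  show ae: "AE x in ?M. weak_grad \<Omega> v x = g x" by (rule weak_grad_eq_AE[OF \<Omega> W])
  have vH: "v \<in> H1 \<Omega>" by (rule H1I[OF v(1) W])
  show "v \<in> H10 \<Omega>" unfolding H10_iff[OF \<Omega>]
  proof (intro conjI vH allI impI)
    fix e :: real assume e: "e > 0"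
    have "\<forall>\<^sub>F n in sequentially. sqnorm ?M (\<lambda>x. u n x - v x) < e / 8"
      "\<forall>\<^sub>F n in sequentially. sqnorm ?M (\<lambda>x. weak_grad \<Omega> (u n) x - g x) < e / 8"
      using e by (intro order_tendstoD(2)[OF v(2)] order_tendstoD(2)[OF g(2)], simp)+
    then have "\<forall>\<^sub>F n in sequentially. sqnorm ?M (\<lambda>x. u n x - v x) < e / 8 \<and> sqnorm ?M (\<lambda>x. weak_grad \<Omega> (u n) x - g x) < e / 8"
      by eventually_elim simp
    then obtain n where n: "sqnorm ?M (\<lambda>x. u n x - v x) < e / 8" "sqnorm ?M (\<lambda>x. weak_grad \<Omega> (u n) x - g x) < e / 8"
      by (auto simp: eventually_sequentially)
    obtain \<phi> where \<phi>: "\<phi> \<in> test_functions \<Omega>" "sqnorm ?M (\<lambda>x. u n x - \<phi> x) < e / 8"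
      "sqnorm ?M (\<lambda>x. weak_grad \<Omega> (u n) x - gradient \<phi> x) < e / 8"
      using H10_approx[OF \<Omega> u[of n], of "e / 8"] e by auto
    note T = test_function_square_integrable_on[OF \<phi>(1) \<Omega>]
    have "sqnorm ?M (\<lambda>x. v x - \<phi> x) < e / 2"
      using sqnorm_add_le(2)[OF square_integrable_diff[OF U(1)[of n] T(1)] square_integrable_diff[OF U(1)[of n] v(1)]] \<phi>(2) n(1)
      by simp
    moreover have "sqnorm ?M (\<lambda>x. g x - gradient \<phi> x) < e / 2"
      using sqnorm_add_le(2)[OF square_integrable_diff[OF U(3)[of n] T(2)] square_integrable_diff[OF U(3)[of n] g(1)]] \<phi>(3) n(2)
      by simp
    moreover have "sqnorm ?M (\<lambda>x. weak_grad \<Omega> v x - gradient \<phi> x) = sqnorm ?M (\<lambda>x. g x - gradient \<phi> x)"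
      using ae by (intro sqnorm_cong_AE square_integrable_measurable square_integrable_diff T(2) g(1) H1D(3)[OF vH]) auto
    ultimately show "\<exists>\<phi>\<in>test_functions \<Omega>.
        sqnorm ?M (\<lambda>x. weak_grad \<Omega> v x - gradient \<phi> x) + sqnorm ?M (\<lambda>x. v x - \<phi> x) < e"
      using \<phi>(1) by (intro bexI[of _ \<phi>]) auto
  qed
qed

lemma test_function_H10: "open \<Omega> \<Longrightarrow> \<phi> \<in> test_functions \<Omega> \<Longrightarrow> \<phi> \<in> H10 \<Omega>"
proof -
  assume \<Omega>: "open \<Omega>" and \<phi>: "\<phi> \<in> test_functions \<Omega>"
  have "(H1_norm \<Omega> (\<lambda>x. \<phi> x - \<phi> x))\<^sup>2 = 0"
    unfolding H1_norm_square_minus_test_function[OF \<Omega> test_function_H1(1)[OF \<Omega> \<phi>] \<phi>]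
    using sqnorm_cong_AE[of "\<lambda>x. weak_grad \<Omega> \<phi> x - gradient \<phi> x" "lebesgue_on \<Omega>" "\<lambda>x. 0"]
      test_function_H1(2)[OF \<Omega> \<phi>]
      square_integrable_measurable[OF square_integrable_diff[OF H1D(3)[OF test_function_H1(1)[OF \<Omega> \<phi>]]
          test_function_square_integrable_on(2)[OF \<phi> \<Omega>]]]
    by (simp add: sqnorm_def)
  then have "H1_norm \<Omega> (\<lambda>x. \<phi> x - \<phi> x) = 0" by simp
  then have "\<exists>\<psi>\<in>test_functions \<Omega>. H1_norm \<Omega> (\<lambda>x. \<phi> x - \<psi> x) < e" if "e > 0" for e
    using that \<phi> by (intro bexI[of _ \<phi>]) simp_all
  then show ?thesis unfolding H10_def using test_function_H1(1)[OF \<Omega> \<phi>] by simp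
qed

lemma H10_lincomb:
  assumes \<Omega>: "open \<Omega>" and u: "u \<in> H10 \<Omega>" and v: "v \<in> H10 \<Omega>"
  shows "(\<lambda>x. a * u x + b * v x) \<in> H10 \<Omega>"
proof -
  let ?M = "lebesgue_on \<Omega>"
  obtain \<phi> where \<phi>: "\<And>n. \<phi> n \<in> test_functions \<Omega>"
    "(\<lambda>n. sqnorm ?M (\<lambda>x. \<phi> n x - u x)) \<longlonglongrightarrow> 0" "(\<lambda>n. sqnorm ?M (\<lambda>x. gradient (\<phi> n) x - weak_grad \<Omega> u x)) \<longlonglongrightarrow> 0"
    by (rule H10_approx_sequence[OF \<Omega> u]) blast
  obtain \<psi> where \<psi>: "\<And>n. \<psi> n \<in> test_functions \<Omega>"
    "(\<lambda>n. sqnorm ?M (\<lambda>x. \<psi> n x - v x)) \<longlonglongrightarrow> 0" "(\<lambda>n. sqnorm ?M (\<lambda>x. gradient (\<psi> n) x - weak_grad \<Omega> v x)) \<longlonglongrightarrow> 0"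
    by (rule H10_approx_sequence[OF \<Omega> v]) blast
  note U = H1D[OF H10_imp_H1[OF u]] and V = H1D[OF H10_imp_H1[OF v]]
  note P = test_function_square_integrable_on[OF \<phi>(1) \<Omega>] and Q = test_function_square_integrable_on[OF \<psi>(1) \<Omega>]
  let ?w = "\<lambda>n x. a * \<phi> n x + b * \<psi> n x"
  have T: "?w n \<in> test_functions \<Omega>" for n
    by (intro test_functions_add test_functions_scale \<phi>(1) \<psi>(1))
  have comb: "(\<lambda>n. sqnorm ?M (\<lambda>x. (a *\<^sub>R f n x + b *\<^sub>R g n x) - (a *\<^sub>R f' x + b *\<^sub>R g' x))) \<longlonglongrightarrow> 0"
    if "\<And>n. square_integrable ?M (f n)" "square_integrable ?M f'" "\<And>n. square_integrable ?M (g n)" "square_integrable ?M g'"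
      "(\<lambda>n. sqnorm ?M (\<lambda>x. f n x - f' x)) \<longlonglongrightarrow> 0" "(\<lambda>n. sqnorm ?M (\<lambda>x. g n x - g' x)) \<longlonglongrightarrow> 0"
    for f g :: "nat \<Rightarrow> 'a \<Rightarrow> 'b::euclidean_space" and f' g'
  proof (rule tendsto_sandwich[OF _ _ tendsto_const])
    have eq: "(a *\<^sub>R f n x + b *\<^sub>R g n x) - (a *\<^sub>R f' x + b *\<^sub>R g' x) = a *\<^sub>R (f n x - f' x) + b *\<^sub>R (g n x - g' x)" for n x
      by (simp add: algebra_simps)
    show "\<forall>\<^sub>F n in sequentially. sqnorm ?M (\<lambda>x. (a *\<^sub>R f n x + b *\<^sub>R g n x) - (a *\<^sub>R f' x + b *\<^sub>R g' x)) \<le>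
        2 * (a\<^sup>2 * sqnorm ?M (\<lambda>x. f n x - f' x)) + 2 * (b\<^sup>2 * sqnorm ?M (\<lambda>x. g n x - g' x))"
      unfolding eq sqnorm_scaleR[symmetric]
      by (intro always_eventually allI sqnorm_add_le(1) square_integrable_scaleR square_integrable_diff that)
    have "(\<lambda>n. 2 * (a\<^sup>2 * sqnorm ?M (\<lambda>x. f n x - f' x)) + 2 * (b\<^sup>2 * sqnorm ?M (\<lambda>x. g n x - g' x)))
        \<longlonglongrightarrow> 2 * (a\<^sup>2 * 0) + 2 * (b\<^sup>2 * 0)"
      by (intro tendsto_intros that)
    then show "(\<lambda>n. 2 * (a\<^sup>2 * sqnorm ?M (\<lambda>x. f n x - f' x)) + 2 * (b\<^sup>2 * sqnorm ?M (\<lambda>x. g n x - g' x))) \<longlonglongrightarrow> 0"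
      by simp
  qed simp
  have 1: "(\<lambda>n. sqnorm ?M (\<lambda>x. ?w n x - (a * u x + b * v x))) \<longlonglongrightarrow> 0"
    using comb[OF P(1) U(1) Q(1) V(1) \<phi>(2) \<psi>(2)] by simp
  have "(\<lambda>n. sqnorm ?M (\<lambda>x. (a *\<^sub>R gradient (\<phi> n) x + b *\<^sub>R gradient (\<psi> n) x) - (a *\<^sub>R weak_grad \<Omega> u x + b *\<^sub>R weak_grad \<Omega> v x))) \<longlonglongrightarrow> 0"
    by (rule comb[OF P(2) U(3) Q(2) V(3) \<phi>(3) \<psi>(3)])
  moreover have "sqnorm ?M (\<lambda>x. weak_grad \<Omega> (?w n) x - (a *\<^sub>R weak_grad \<Omega> u x + b *\<^sub>R weak_grad \<Omega> v x)) =
    sqnorm ?M (\<lambda>x. (a *\<^sub>R gradient (\<phi> n) x + b *\<^sub>R gradient (\<psi> n) x) - (a *\<^sub>R weak_grad \<Omega> u x + b *\<^sub>R weak_grad \<Omega> v x))" for n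
  proof (intro sqnorm_cong_AE square_integrable_measurable square_integrable_diff square_integrable_lincomb P(2) Q(2) U(3) V(3))
    show "square_integrable ?M (weak_grad \<Omega> (?w n))" by (rule H1D(3)[OF test_function_H1(1)[OF \<Omega> T]])
    show "AE x in ?M. weak_grad \<Omega> (?w n) x - (a *\<^sub>R weak_grad \<Omega> u x + b *\<^sub>R weak_grad \<Omega> v x) =
      (a *\<^sub>R gradient (\<phi> n) x + b *\<^sub>R gradient (\<psi> n) x) - (a *\<^sub>R weak_grad \<Omega> u x + b *\<^sub>R weak_grad \<Omega> v x)"
      using H1_lincomb(2)[OF \<Omega> test_function_H1(1)[OF \<Omega> \<phi>(1)] test_function_H1(1)[OF \<Omega> \<psi>(1)], of a n b n]
        test_function_H1(2)[OF \<Omega> \<phi>(1), of n] test_function_H1(2)[OF \<Omega> \<psi>(1), of n]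
      by eventually_elim simp
  qed
  ultimately have 2: "(\<lambda>n. sqnorm ?M (\<lambda>x. weak_grad \<Omega> (?w n) x - (a *\<^sub>R weak_grad \<Omega> u x + b *\<^sub>R weak_grad \<Omega> v x))) \<longlonglongrightarrow> 0"
    by simp
  show ?thesis
    by (rule H10_limit(1)[OF \<Omega> test_function_H10[OF \<Omega> T] _ 1 _ 2])
      (use square_integrable_lincomb[OF U(1) V(1), of a b] square_integrable_lincomb[OF U(3) V(3)] in auto)
qed

lemma H10_fourth_moment:
  fixes u :: "'a::euclidean_space \<Rightarrow> real"
  assumes \<Omega>: "open \<Omega>" and u: "u \<in> H10 \<Omega>" and dim: "DIM('a) \<le> 3"
  shows "square_integrable (lebesgue_on \<Omega>) (\<lambda>x. (u x)\<^sup>2)"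
    "sqnorm (lebesgue_on \<Omega>) (\<lambda>x. (u x)\<^sup>2) \<le> 64 * 8^k * (sqnorm (lebesgue_on \<Omega>) u)\<^sup>2 +
      5000000 * (2 ^ DIM('a) * (real DIM('a))\<^sup>2)\<^sup>2 / 2^k * (sqnorm (lebesgue_on \<Omega>) (weak_grad \<Omega> u))\<^sup>2"
proof -
  let ?M = "lebesgue_on \<Omega>" and ?K = "5000000 * (2 ^ DIM('a) * (real DIM('a))\<^sup>2)\<^sup>2 / 2^k"
  note U = H1D[OF H10_imp_H1[OF u]]
  obtain \<phi> where \<phi>: "\<And>n. \<phi> n \<in> test_functions \<Omega>"
    "(\<lambda>n. sqnorm ?M (\<lambda>x. \<phi> n x - u x)) \<longlonglongrightarrow> 0" "(\<lambda>n. sqnorm ?M (\<lambda>x. gradient (\<phi> n) x - weak_grad \<Omega> u x)) \<longlonglongrightarrow> 0"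
    by (rule H10_approx_sequence[OF \<Omega> u]) blast
  note P = test_function_square_integrable_on[OF \<phi>(1) \<Omega>]
  have "(\<lambda>n. 64 * 8^k * (sqnorm ?M (\<phi> n))\<^sup>2 + ?K * (sqnorm ?M (gradient (\<phi> n)))\<^sup>2) \<longlonglongrightarrow>
      64 * 8^k * (sqnorm ?M u)\<^sup>2 + ?K * (sqnorm ?M (weak_grad \<Omega> u))\<^sup>2" (is "?b \<longlonglongrightarrow> ?B")
    by (intro tendsto_intros sqnorm_tendsto[OF P(1) U(1) \<phi>(2)] sqnorm_tendsto[OF P(2) U(3) \<phi>(3)])
  note lim = this
  have sq: "square_integrable ?M (\<lambda>x. (\<phi> n x)\<^sup>2)" "sqnorm ?M (\<lambda>x. (\<phi> n x)\<^sup>2) \<le> ?b n" for n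
  proof -
    have t: "(\<lambda>x. \<phi> n x * \<phi> n x) \<in> test_functions \<Omega>" by (intro test_functions_mult \<phi>(1) test_functions_tcd[OF \<phi>(1)])
    show "square_integrable ?M (\<lambda>x. (\<phi> n x)\<^sup>2)"
      using test_function_square_integrable_on(1)[OF t \<Omega>] by (simp add: power2_eq_square)
    show "sqnorm ?M (\<lambda>x. (\<phi> n x)\<^sup>2) \<le> ?b n"
      using test_function_fourth_moment[OF \<phi>(1) dim, of n k] test_function_square_integrable_on(3)[OF t \<Omega>] P(3,4)[of n]
      by (simp add: power2_eq_square)
  qed
  obtain r where r: "strict_mono r" "AE x in ?M. (\<lambda>n. \<phi> (r n) x) \<longlonglongrightarrow> u x"
    by (rule sqnorm_tendsto_AE_subseq[OF P(1) U(1) \<phi>(2)]) blast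
  have m: "(\<lambda>x. (u x)\<^sup>2) \<in> borel_measurable ?M" using square_integrable_measurable[OF U(1)] by measurable
  have *: "square_integrable ?M (\<lambda>x. (u x)\<^sup>2) \<and> sqnorm ?M (\<lambda>x. (u x)\<^sup>2) \<le> ?B + e" if e: "e > 0" for e
  proof -
    have "\<forall>\<^sub>F n in sequentially. ?b n < ?B + e" using e by (intro order_tendstoD(2)[OF lim]) simp
    then obtain N where N: "\<And>n. n \<ge> N \<Longrightarrow> ?b n < ?B + e" unfolding eventually_sequentially by blast
    have A: "AE x in ?M. (\<lambda>n. (\<phi> (r (n + N)) x)\<^sup>2) \<longlonglongrightarrow> (u x)\<^sup>2"
      using r(2)
    proof eventually_elim
      case (elim x)
      show ?case by (rule tendsto_power[OF LIMSEQ_ignore_initial_segment[OF elim, of N]])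
    qed
    have B: "sqnorm ?M (\<lambda>x. (\<phi> (r (n + N)) x)\<^sup>2) \<le> ?B + e" for n
      using sq(2)[of "r (n + N)"] N[of "r (n + N)"] seq_suble[OF r(1), of "n + N"] by linarith
    show ?thesis using square_integrable_Fatou[OF sq(1) m A B] by blast
  qed
  show "square_integrable ?M (\<lambda>x. (u x)\<^sup>2)" using *[of 1] by simp
  show "sqnorm ?M (\<lambda>x. (u x)\<^sup>2) \<le> ?B" 
  proof (rule field_le_epsilon)
    fix e :: real assume "0 < e"
    then show "sqnorm ?M (\<lambda>x. (u x)\<^sup>2) \<le> ?B + e" using *[of e] by simp
  qed
qed

text \<open>  The approximating test functions are defined on the whole space and form a Cauchy sequence there.
  Their limit is a Borel representative of the extension by zero, and the translation inequality
  passes to the limit.\<close>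
lemma H10_zero_extension:
  fixes u :: "'a::euclidean_space \<Rightarrow> real"
  assumes \<Omega>: "open \<Omega>" and u: "u \<in> H10 \<Omega>"
  obtains w where "square_integrable lborel w" "AE x in lebesgue_on \<Omega>. w x = u x"
    "AE x in lborel. x \<notin> \<Omega> \<longrightarrow> w x = 0"
    "\<And>h. sqnorm lborel (\<lambda>x. w (x + h) - w x) \<le> (norm h)\<^sup>2 * sqnorm (lebesgue_on \<Omega>) (weak_grad \<Omega> u)"
proof -
  let ?M = "lebesgue_on \<Omega>"
  have \<Omega>s: "\<Omega> \<in> sets lebesgue" using \<Omega> by simp
  note U = H1D[OF H10_imp_H1[OF u]]
  obtain \<phi> where \<phi>: "\<And>n. \<phi> n \<in> test_functions \<Omega>"
    "(\<lambda>n. sqnorm ?M (\<lambda>x. \<phi> n x - u x)) \<longlonglongrightarrow> 0" "(\<lambda>n. sqnorm ?M (\<lambda>x. gradient (\<phi> n) x - weak_grad \<Omega> u x)) \<longlonglongrightarrow> 0"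
    by (rule H10_approx_sequence[OF \<Omega> u]) blast
  note P = test_function_square_integrable_on[OF \<phi>(1) \<Omega>]
  note L = test_function_square_integrable[OF \<phi>(1)]
  have "\<exists>N. \<forall>m\<ge>N. \<forall>n\<ge>N. sqnorm lborel (\<lambda>x. \<phi> m x - \<phi> n x) < e" if e: "e > 0" for e
  proof -
    have "\<forall>\<^sub>F n in sequentially. sqnorm ?M (\<lambda>x. \<phi> n x - u x) < e / 4" using e by (intro order_tendstoD(2)[OF \<phi>(2)]) simp
    then obtain N where N: "\<And>n. n \<ge> N \<Longrightarrow> sqnorm ?M (\<lambda>x. \<phi> n x - u x) < e / 4" unfolding eventually_sequentially by blast
    have "sqnorm lborel (\<lambda>x. \<phi> m x - \<phi> n x) < e" if "m \<ge> N" "n \<ge> N" for m n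
    proof -
      have "(\<lambda>x. \<phi> m x - \<phi> n x) \<in> borel_measurable borel"
        using test_function_measurable(1)[OF \<phi>(1)] by measurable
      then have "sqnorm lborel (\<lambda>x. \<phi> m x - \<phi> n x) = sqnorm ?M (\<lambda>x. \<phi> m x - \<phi> n x)"
        by (intro sqnorm_lebesgue_on_eq_lborel(1)[OF \<Omega>s, symmetric]) (auto simp: test_function_outside[OF \<phi>(1)])
      also have "\<dots> \<le> 2 * sqnorm ?M (\<lambda>x. \<phi> m x - u x) + 2 * sqnorm ?M (\<lambda>x. \<phi> n x - u x)"
        using sqnorm_add_le(2)[OF square_integrable_diff[OF P(1)[of m] U(1)] square_integrable_diff[OF P(1)[of n] U(1)]] by simp
      also have "\<dots> < e" using N[OF that(1)] N[OF that(2)] by simp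
      finally show ?thesis .
    qed
    then show ?thesis by blast
  qed
  then obtain w where w: "square_integrable lborel w" "(\<lambda>n. sqnorm lborel (\<lambda>x. \<phi> n x - w x)) \<longlonglongrightarrow> 0"
    using square_integrable_complete[of lborel \<phi>, OF L(1)] by blast
  obtain r where r: "strict_mono r" "AE x in ?M. (\<lambda>n. \<phi> (r n) x) \<longlonglongrightarrow> u x"
    by (rule sqnorm_tendsto_AE_subseq[OF P(1) U(1) \<phi>(2)]) blast
  have w2: "(\<lambda>n. sqnorm lborel (\<lambda>x. \<phi> (r n) x - w x)) \<longlonglongrightarrow> 0"
    using LIMSEQ_subseq_LIMSEQ[OF w(2) r(1)] by (simp add: o_def)
  obtain s where s: "strict_mono s" "AE x in lborel. (\<lambda>n. \<phi> (r (s n)) x) \<longlonglongrightarrow> w x"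
    by (rule sqnorm_tendsto_AE_subseq[of lborel "\<lambda>n. \<phi> (r n)" w, OF L(1) w(1) w2]) blast
  have "AE x in lebesgue. (\<lambda>n. \<phi> (r (s n)) x) \<longlonglongrightarrow> w x" using s(2) by (rule AE_completion)
  then have "AE x in lebesgue. x \<in> \<Omega> \<longrightarrow> (\<lambda>n. \<phi> (r (s n)) x) \<longlonglongrightarrow> w x" by eventually_elim simp
  then have "AE x in ?M. (\<lambda>n. \<phi> (r (s n)) x) \<longlonglongrightarrow> w x" using \<Omega>s by (simp add: AE_restrict_space_iff)
  then have 1: "AE x in ?M. w x = u x"
    using r(2)
  proof eventually_elim
    case (elim x)
    from LIMSEQ_unique[OF elim(1)] LIMSEQ_subseq_LIMSEQ[OF elim(2) s(1)] show ?case by (simp add: o_def)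
  qed
  have 2: "AE x in lborel. x \<notin> \<Omega> \<longrightarrow> w x = 0"
    using s(2)
  proof eventually_elim
    case (elim x)
    show ?case
    proof
      assume "x \<notin> \<Omega>"
      then have "\<phi> n x = 0" for n by (rule test_function_outside[OF \<phi>(1)])
      with elim show "w x = 0" by (simp add: LIMSEQ_const_iff)
    qed
  qed
  have 3: "sqnorm lborel (\<lambda>x. w (x + h) - w x) \<le> (norm h)\<^sup>2 * sqnorm ?M (weak_grad \<Omega> u)" for h
  proof -
    have t: "square_integrable lborel (\<lambda>x. \<phi> n (x + h) - \<phi> n x)" for n
      by (intro square_integrable_diff square_integrable_translation L(1))
    have tw: "square_integrable lborel (\<lambda>x. w (x + h) - w x)"
      by (intro square_integrable_diff square_integrable_translation w(1))
    have "(\<lambda>n. sqnorm lborel (\<lambda>x. (\<phi> n (x + h) - \<phi> n x) - (w (x + h) - w x))) \<longlonglongrightarrow> 0"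
    proof (rule tendsto_sandwich[OF _ _ tendsto_const])
      have d: "square_integrable lborel (\<lambda>x. \<phi> n x - w x)" for n by (intro square_integrable_diff L(1) w(1))
      show "\<forall>\<^sub>F n in sequentially. sqnorm lborel (\<lambda>x. (\<phi> n (x + h) - \<phi> n x) - (w (x + h) - w x)) \<le>
          4 * sqnorm lborel (\<lambda>x. \<phi> n x - w x)"
      proof (intro always_eventually allI)
        fix n
        have eq: "(\<phi> n (x + h) - \<phi> n x) - (w (x + h) - w x) = (\<phi> n (x + h) - w (x + h)) - (\<phi> n x - w x)" for x by simp
        show "sqnorm lborel (\<lambda>x. (\<phi> n (x + h) - \<phi> n x) - (w (x + h) - w x)) \<le> 4 * sqnorm lborel (\<lambda>x. \<phi> n x - w x)"
          unfolding eq using sqnorm_add_le(2)[OF square_integrable_translation(1)[OF d[of n], of h] d[of n]]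
            square_integrable_translation(2)[OF d[of n], of h] by simp
      qed
      show "(\<lambda>n. 4 * sqnorm lborel (\<lambda>x. \<phi> n x - w x)) \<longlonglongrightarrow> 0" using tendsto_mult_left[OF w(2), of 4] by simp
    qed simp
    from sqnorm_tendsto[OF t tw this]
    have A: "(\<lambda>n. sqnorm lborel (\<lambda>x. \<phi> n (x + h) - \<phi> n x)) \<longlonglongrightarrow> sqnorm lborel (\<lambda>x. w (x + h) - w x)" .
    have B: "(\<lambda>n. (norm h)\<^sup>2 * sqnorm ?M (gradient (\<phi> n))) \<longlonglongrightarrow> (norm h)\<^sup>2 * sqnorm ?M (weak_grad \<Omega> u)"
      by (intro tendsto_intros sqnorm_tendsto[OF P(2) U(3) \<phi>(3)])
    show ?thesis
    proof (rule LIMSEQ_le[OF A B])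
      show "\<exists>N. \<forall>n\<ge>N. sqnorm lborel (\<lambda>x. \<phi> n (x + h) - \<phi> n x) \<le> (norm h)\<^sup>2 * sqnorm ?M (gradient (\<phi> n))"
        using sqnorm_translation_le_gradient[OF \<phi>(1)] P(4) by simp
    qed
  qed
  show ?thesis by (rule that[OF w(1) 1 2 3])
qed

section \<open>The energy space of a nonnegative potential\<close>

locale nonneg_potential =
  fixes \<Omega> :: "'a::euclidean_space set" and V :: "'a \<Rightarrow> real"
  assumes open_domain: "open \<Omega>"
    and V_measurable: "V \<in> borel_measurable (lebesgue_on \<Omega>)"
    and V_nonneg: "\<And>x. x \<in> \<Omega> \<Longrightarrow> 0 \<le> V x"
begin

abbreviation "M \<equiv> lebesgue_on \<Omega>"
abbreviation "ES \<equiv> energy_space \<Omega> V"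

text \<open>  The energy is the squared \<open>L\<^sup>2\<close> norm of this vector field, so that completeness and the
  parallelogram law for the energy are those of \<open>L\<^sup>2\<close>.\<close>
definition energy_vec :: "('a \<Rightarrow> real) \<Rightarrow> 'a \<Rightarrow> 'a \<times> real" where
  "energy_vec u x = (weak_grad \<Omega> u x, sqrt (V x) * u x)"

definition energy_form :: "('a \<Rightarrow> real) \<Rightarrow> ('a \<Rightarrow> real) \<Rightarrow> real" where
  "energy_form u v = sqinner M (energy_vec u) (energy_vec v)"

lemma energy_vec_measurable:
  assumes "u \<in> H1 \<Omega>"
  shows "energy_vec u \<in> borel_measurable M"
proof -
  have [measurable]: "u \<in> borel_measurable M" "weak_grad \<Omega> u \<in> borel_measurable M" "V \<in> borel_measurable M"
    using square_integrable_measurable[OF H1D(1)[OF assms]] square_integrable_measurable[OF H1D(3)[OF assms]]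
      V_measurable by auto
  show ?thesis unfolding energy_vec_def[abs_def] by (intro borel_measurable_Pair) measurable
qed

lemma norm_energy_vec: "x \<in> \<Omega> \<Longrightarrow> (norm (energy_vec u x))\<^sup>2 = (norm (weak_grad \<Omega> u x))\<^sup>2 + V x * (u x)\<^sup>2"
  using V_nonneg[of x] by (simp add: energy_vec_def norm_Pair power_mult_distrib)

lemma energy_eq_sqnorm: "energy \<Omega> V u = sqnorm M (energy_vec u)"
  unfolding energy_def sqnorm_def
  by (intro Bochner_Integration.integral_cong) (simp_all add: norm_energy_vec)

lemma energy_space_iff: "u \<in> ES \<longleftrightarrow> u \<in> H10 \<Omega> \<and> square_integrable M (energy_vec u)"
proof -
  have "integrable M (\<lambda>x. (norm (weak_grad \<Omega> u x))\<^sup>2 + V x * (u x)\<^sup>2) \<longleftrightarrow> integrable M (\<lambda>x. (norm (energy_vec u x))\<^sup>2)"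
    by (intro Bochner_Integration.integrable_cong) (simp_all add: norm_energy_vec)
  then show ?thesis
    unfolding energy_space_def square_integrable_def using energy_vec_measurable H10_imp_H1 by blast
qed

lemma ES_D:
  assumes "u \<in> ES"
  shows "u \<in> H10 \<Omega>" "u \<in> H1 \<Omega>" "square_integrable M (energy_vec u)" "square_integrable M u"
    "square_integrable M (weak_grad \<Omega> u)"
  using assms H10_imp_H1 H1D unfolding energy_space_iff by blast+

lemma energy_form_self: "energy_form u u = energy \<Omega> V u"
  by (simp add: energy_form_def energy_eq_sqnorm sqnorm_eq_sqinner)

lemma energy_form_commute: "energy_form u v = energy_form v u"
  by (simp add: energy_form_def sqinner_commute)

lemma energy_nonneg: "0 \<le> energy \<Omega> V u"
  by (simp add: energy_eq_sqnorm)

lemma energy_vec_lincomb: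
  assumes u: "u \<in> H1 \<Omega>" and v: "v \<in> H1 \<Omega>"
  shows "AE x in M. energy_vec (\<lambda>x. a * u x + b * v x) x = a *\<^sub>R energy_vec u x + b *\<^sub>R energy_vec v x"
  using H1_lincomb(2)[OF open_domain u v, of a b]
  by eventually_elim (simp add: energy_vec_def algebra_simps)

lemma ES_lincomb:
  assumes u: "u \<in> ES" and v: "v \<in> ES"
  shows "(\<lambda>x. a * u x + b * v x) \<in> ES"
    "energy \<Omega> V (\<lambda>x. a * u x + b * v x) = a\<^sup>2 * energy \<Omega> V u + 2 * a * b * energy_form u v + b\<^sup>2 * energy \<Omega> V v"
proof -
  let ?w = "\<lambda>x. a * u x + b * v x"
  have w: "?w \<in> H10 \<Omega>" by (rule H10_lincomb[OF open_domain ES_D(1)[OF u] ES_D(1)[OF v]])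
  have ae: "AE x in M. a *\<^sub>R energy_vec u x + b *\<^sub>R energy_vec v x = energy_vec ?w x"
    using energy_vec_lincomb[OF ES_D(2)[OF u] ES_D(2)[OF v], of a b] by eventually_elim simp
  have s: "square_integrable M (\<lambda>x. a *\<^sub>R energy_vec u x + b *\<^sub>R energy_vec v x)"
    by (rule square_integrable_lincomb[OF ES_D(3)[OF u] ES_D(3)[OF v]])
  note m = energy_vec_measurable[OF H10_imp_H1[OF w]]
  show "?w \<in> ES" unfolding energy_space_iff using w square_integrable_cong_AE[OF s ae m] by blast
  have "energy \<Omega> V ?w = sqnorm M (\<lambda>x. a *\<^sub>R energy_vec u x + b *\<^sub>R energy_vec v x)"
    unfolding energy_eq_sqnorm using ae by (intro sqnorm_cong_AE m square_integrable_measurable[OF s]) auto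
  then show "energy \<Omega> V ?w = a\<^sup>2 * energy \<Omega> V u + 2 * a * b * energy_form u v + b\<^sup>2 * energy \<Omega> V v"
    unfolding energy_eq_sqnorm energy_form_def by (simp add: sqnorm_lincomb[OF ES_D(3)[OF u] ES_D(3)[OF v]])
qed

lemma ES_scale: "u \<in> ES \<Longrightarrow> (\<lambda>x. a * u x) \<in> ES" "u \<in> ES \<Longrightarrow> energy \<Omega> V (\<lambda>x. a * u x) = a\<^sup>2 * energy \<Omega> V u"
  using ES_lincomb[of u u a 0] by auto

lemma ES_zero:
  assumes "u \<in> ES"
  shows "(\<lambda>x. 0) \<in> ES" "energy \<Omega> V (\<lambda>x. 0) = 0"
  using ES_scale[OF assms, of 0] by auto

lemma energy_form_lincomb:
  assumes u: "u \<in> ES" and v: "v \<in> ES" and z: "z \<in> ES"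
  shows "energy_form z (\<lambda>x. a * u x + b * v x) = a * energy_form z u + b * energy_form z v"
proof -
  have "energy_form z (\<lambda>x. a * u x + b * v x) = sqinner M (energy_vec z) (\<lambda>x. a *\<^sub>R energy_vec u x + b *\<^sub>R energy_vec v x)"
    unfolding energy_form_def sqinner_def
  proof (intro integral_cong_AE borel_measurable_inner)
    show "AE x in M. energy_vec z x \<bullet> energy_vec (\<lambda>x. a * u x + b * v x) x =
        energy_vec z x \<bullet> (a *\<^sub>R energy_vec u x + b *\<^sub>R energy_vec v x)"
      using energy_vec_lincomb[OF ES_D(2)[OF u] ES_D(2)[OF v], of a b] by eventually_elim simp
    show "energy_vec (\<lambda>x. a * u x + b * v x) \<in> borel_measurable M"
      by (rule energy_vec_measurable[OF ES_D(2)[OF ES_lincomb(1)[OF u v]]])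
  qed (intro square_integrable_measurable square_integrable_lincomb ES_D(3) u v z)+
  also have "\<dots> = a * energy_form z u + b * energy_form z v"
    unfolding sqinner_commute[of M "energy_vec z"] energy_form_def
    by (rule sqinner_lincomb_left[OF ES_D(3)[OF u] ES_D(3)[OF v] ES_D(3)[OF z]])
  finally show ?thesis .
qed

lemma energy_form_zero: "u \<in> ES \<Longrightarrow> energy_form u (\<lambda>x. 0) = 0"
  using energy_form_lincomb[of u u u 0 0] by simp

lemma sqnorm_le_energy:
  assumes u: "u \<in> ES"
  shows "sqnorm M (weak_grad \<Omega> u) \<le> energy \<Omega> V u"
    "integrable M (\<lambda>x. V x * (u x)\<^sup>2)" "(LINT x|M. V x * (u x)\<^sup>2) \<le> energy \<Omega> V u"
proof -
  have i: "integrable M (\<lambda>x. (norm (weak_grad \<Omega> u x))\<^sup>2 + V x * (u x)\<^sup>2)" using u by (simp add: energy_space_def)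
  have i1: "integrable M (\<lambda>x. (norm (weak_grad \<Omega> u x))\<^sup>2)" by (rule square_integrable_integrable[OF ES_D(5)[OF u]])
  from Bochner_Integration.integrable_diff[OF i i1] show i2: "integrable M (\<lambda>x. V x * (u x)\<^sup>2)" by simp
  have "energy \<Omega> V u = sqnorm M (weak_grad \<Omega> u) + (LINT x|M. V x * (u x)\<^sup>2)"
    unfolding energy_def sqnorm_def by (rule Bochner_Integration.integral_add[OF i1 i2])
  moreover have "0 \<le> (LINT x|M. V x * (u x)\<^sup>2)"
    by (intro integral_nonneg_AE AE_I2) (simp add: V_nonneg)
  ultimately show "sqnorm M (weak_grad \<Omega> u) \<le> energy \<Omega> V u" "(LINT x|M. V x * (u x)\<^sup>2) \<le> energy \<Omega> V u"
    using sqnorm_nonneg[of M "weak_grad \<Omega> u"] by linarith+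
qed

lemma weak_form_eq_energy_form:
  assumes u: "u \<in> ES" and v: "v \<in> ES"
  shows "integrable M (\<lambda>x. weak_grad \<Omega> u x \<bullet> weak_grad \<Omega> v x + (V x + \<omega>) * u x * v x)"
    "(LINT x|M. weak_grad \<Omega> u x \<bullet> weak_grad \<Omega> v x + (V x + \<omega>) * u x * v x) = energy_form u v + \<omega> * sqinner M u v"
proof -
  have eq: "weak_grad \<Omega> u x \<bullet> weak_grad \<Omega> v x + (V x + \<omega>) * u x * v x =
      energy_vec u x \<bullet> energy_vec v x + \<omega> * (u x \<bullet> v x)" if "x \<in> space M" for x
  proof -
    have "(sqrt (V x) * u x) * (sqrt (V x) * v x) = (sqrt (V x) * sqrt (V x)) * (u x * v x)" by (simp only: mult_ac)
    also have "\<dots> = V x * u x * v x" using that V_nonneg by simp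
    finally have "(sqrt (V x) * u x) * (sqrt (V x) * v x) = V x * u x * v x" .
    then show ?thesis unfolding energy_vec_def inner_Pair inner_real_def by (simp only: distrib_right mult.assoc add.assoc)
  qed
  have i1: "integrable M (\<lambda>x. energy_vec u x \<bullet> energy_vec v x)" by (rule square_integrable_inner[OF ES_D(3)[OF u] ES_D(3)[OF v]])
  have i2: "integrable M (\<lambda>x. \<omega> * (u x \<bullet> v x))"
    by (rule integrable_mult_right[OF square_integrable_inner[OF ES_D(4)[OF u] ES_D(4)[OF v]]])
  show "integrable M (\<lambda>x. weak_grad \<Omega> u x \<bullet> weak_grad \<Omega> v x + (V x + \<omega>) * u x * v x)"
    by (subst Bochner_Integration.integrable_cong[OF refl eq]) (use Bochner_Integration.integrable_add[OF i1 i2] in auto)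
  have "(LINT x|M. weak_grad \<Omega> u x \<bullet> weak_grad \<Omega> v x + (V x + \<omega>) * u x * v x) =
      (LINT x|M. energy_vec u x \<bullet> energy_vec v x + \<omega> * (u x \<bullet> v x))"
    by (rule Bochner_Integration.integral_cong[OF refl eq])
  then show "(LINT x|M. weak_grad \<Omega> u x \<bullet> weak_grad \<Omega> v x + (V x + \<omega>) * u x * v x) = energy_form u v + \<omega> * sqinner M u v"
    unfolding Bochner_Integration.integral_add[OF i1 i2] energy_form_def sqinner_def by simp
qed

text \<open>  The limit of the energy vectors is identified with the energy vector of \<open>u\<close>: the first component
  because the gradient is closed, the second by almost everywhere convergence.\<close>
lemma ES_complete:
  assumes v: "\<And>n. v n \<in> ES" and u: "square_integrable M u" "(\<lambda>n. sqnorm M (\<lambda>x. v n x - u x)) \<longlonglongrightarrow> 0"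
    and cauchy: "\<And>e. e > 0 \<Longrightarrow> \<exists>N. \<forall>m\<ge>N. \<forall>n\<ge>N. sqnorm M (\<lambda>x. energy_vec (v m) x - energy_vec (v n) x) < e"
  shows "u \<in> ES" "(\<lambda>n. energy \<Omega> V (v n)) \<longlonglongrightarrow> energy \<Omega> V u"
proof -
  note D = ES_D[OF v]
  obtain g where g: "square_integrable M g" "(\<lambda>n. sqnorm M (\<lambda>x. energy_vec (v n) x - g x)) \<longlonglongrightarrow> 0"
    using square_integrable_complete[of M "\<lambda>n. energy_vec (v n)", OF D(3) cauchy] by blast
  have [measurable]: "g \<in> borel_measurable M" by (rule square_integrable_measurable[OF g(1)])
  have nf: "norm (fst d) \<le> norm d" for d :: "'a \<times> real" using norm_fst_le[of "fst d" "snd d"] by simp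
  have gfm: "(\<lambda>x. fst (g x)) \<in> borel_measurable M"
    by (rule borel_measurable_continuous_on[where f=fst]) (auto intro!: continuous_intros)
  have gf: "square_integrable M (\<lambda>x. fst (g x))"
    unfolding square_integrable_def
  proof
    show "integrable M (\<lambda>x. (norm (fst (g x)))\<^sup>2)"
    proof (rule Bochner_Integration.integrable_bound[OF square_integrable_integrable[OF g(1)]])
      show "(\<lambda>x. (norm (fst (g x)))\<^sup>2) \<in> borel_measurable M" using gfm by measurable
      show "AE x in M. norm ((norm (fst (g x)))\<^sup>2) \<le> norm ((norm (g x))\<^sup>2)"
      proof (rule AE_I2)
        fix x show "norm ((norm (fst (g x)))\<^sup>2) \<le> norm ((norm (g x))\<^sup>2)"
          using power_mono[OF nf[of "g x"] norm_ge_zero, of 2] by simp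
      qed
    qed
  qed (rule gfm)
  have "(\<lambda>n. sqnorm M (\<lambda>x. weak_grad \<Omega> (v n) x - fst (g x))) \<longlonglongrightarrow> 0"
  proof (rule tendsto_sandwich[OF _ _ tendsto_const g(2)])
    show "\<forall>\<^sub>F n in sequentially. sqnorm M (\<lambda>x. weak_grad \<Omega> (v n) x - fst (g x)) \<le> sqnorm M (\<lambda>x. energy_vec (v n) x - g x)"
    proof (intro always_eventually allI)
      fix n
      show "sqnorm M (\<lambda>x. weak_grad \<Omega> (v n) x - fst (g x)) \<le> sqnorm M (\<lambda>x. energy_vec (v n) x - g x)"
        unfolding sqnorm_def
      proof (rule integral_mono)
        show "integrable M (\<lambda>x. (norm (weak_grad \<Omega> (v n) x - fst (g x)))\<^sup>2)"
          by (intro square_integrable_integrable square_integrable_diff D(5) gf)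
        show "integrable M (\<lambda>x. (norm (energy_vec (v n) x - g x))\<^sup>2)"
          by (intro square_integrable_integrable square_integrable_diff D(3) g(1))
        show "(norm (weak_grad \<Omega> (v n) x - fst (g x)))\<^sup>2 \<le> (norm (energy_vec (v n) x - g x))\<^sup>2" for x
          using nf[of "energy_vec (v n) x - g x"] by (intro power_mono) (simp_all add: energy_vec_def)
      qed
    qed
  qed simp
  note H = H10_limit[OF open_domain D(1) u gf this]
  obtain r where r: "strict_mono r" "AE x in M. (\<lambda>n. energy_vec (v (r n)) x) \<longlonglongrightarrow> g x"
    by (rule sqnorm_tendsto_AE_subseq[OF D(3) g(1) g(2)]) blast
  have u2: "(\<lambda>n. sqnorm M (\<lambda>x. v (r n) x - u x)) \<longlonglongrightarrow> 0"
    using LIMSEQ_subseq_LIMSEQ[OF u(2) r(1)] by (simp add: o_def)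
  obtain s where s: "strict_mono s" "AE x in M. (\<lambda>n. v (r (s n)) x) \<longlonglongrightarrow> u x"
    by (rule sqnorm_tendsto_AE_subseq[of M "\<lambda>n. v (r n)" u, OF D(4) u(1) u2]) blast
  have ae: "AE x in M. g x = energy_vec u x"
    using r(2) s(2) H(2)
  proof eventually_elim
    case (elim x)
    have "(\<lambda>n. energy_vec (v (r (s n))) x) \<longlonglongrightarrow> g x"
      using LIMSEQ_subseq_LIMSEQ[OF elim(1) s(1)] by (simp add: o_def)
    then have "(\<lambda>n. snd (energy_vec (v (r (s n))) x)) \<longlonglongrightarrow> snd (g x)" by (rule tendsto_snd)
    then have "(\<lambda>n. sqrt (V x) * v (r (s n)) x) \<longlonglongrightarrow> snd (g x)" by (simp add: energy_vec_def)
    moreover have "(\<lambda>n. sqrt (V x) * v (r (s n)) x) \<longlonglongrightarrow> sqrt (V x) * u x" by (intro tendsto_intros elim)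
    ultimately have "snd (g x) = sqrt (V x) * u x" by (rule LIMSEQ_unique)
    with elim(3) show ?case by (simp add: energy_vec_def prod_eq_iff)
  qed
  note m = energy_vec_measurable[OF H10_imp_H1[OF H(1)]]
  have s: "square_integrable M (energy_vec u)" by (rule square_integrable_cong_AE[OF g(1) ae m])
  then show "u \<in> ES" using H(1) by (simp add: energy_space_iff)
  have "(\<lambda>n. sqnorm M (energy_vec (v n))) \<longlonglongrightarrow> sqnorm M g" by (rule sqnorm_tendsto[OF D(3) g])
  moreover have "sqnorm M g = sqnorm M (energy_vec u)" using ae by (intro sqnorm_cong_AE m) auto
  ultimately show "(\<lambda>n. energy \<Omega> V (v n)) \<longlonglongrightarrow> energy \<Omega> V u" by (simp add: energy_eq_sqnorm)
qed

text \<open>  A substitute for the convex hull: the minimising argument below uses midpoints only.\<close>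
inductive_set midpoint_hull :: "('a \<Rightarrow> real) set \<Rightarrow> ('a \<Rightarrow> real) set" for S where
  base: "u \<in> S \<Longrightarrow> u \<in> midpoint_hull S"
| mid: "u \<in> midpoint_hull S \<Longrightarrow> v \<in> midpoint_hull S \<Longrightarrow> (\<lambda>x. 1/2 * u x + 1/2 * v x) \<in> midpoint_hull S"

lemma midpoint_hull_mono: "S \<subseteq> T \<Longrightarrow> midpoint_hull S \<subseteq> midpoint_hull T"
proof
  fix u assume "S \<subseteq> T" "u \<in> midpoint_hull S"
  from this(2) show "u \<in> midpoint_hull T"
  proof induction
    case (base u) then show ?case using \<open>S \<subseteq> T\<close> by (blast intro: midpoint_hull.base)
  next
    case (mid u v) show ?case by (rule midpoint_hull.mid[OF mid.IH])
  qed
qed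

lemma midpoint_hull_properties:
  assumes S: "S \<subseteq> ES" "\<And>w. w \<in> S \<Longrightarrow> sqnorm M (\<lambda>x. w x - u x) \<le> d" and u: "square_integrable M u"
    and v: "v \<in> midpoint_hull S"
  shows "v \<in> ES \<and> sqnorm M (\<lambda>x. v x - u x) \<le> d"
  using v
proof induction
  case (base v)
  then show ?case using S by blast
next
  case (mid v w)
  have vE: "v \<in> ES" "w \<in> ES" using mid.IH by auto
  have dv: "square_integrable M (\<lambda>x. v x - u x)" and dw: "square_integrable M (\<lambda>x. w x - u x)"
    by (intro square_integrable_diff ES_D(4) vE u)+
  have "1/2 * v x + 1/2 * w x - u x = (1/2) *\<^sub>R ((v x - u x) + (w x - u x))" for x by (simp add: algebra_simps)
  then have "sqnorm M (\<lambda>x. 1/2 * v x + 1/2 * w x - u x) = (1/2)\<^sup>2 * sqnorm M (\<lambda>x. (v x - u x) + (w x - u x))"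
    by (simp only: sqnorm_scaleR)
  also have "\<dots> \<le> (1/2)\<^sup>2 * (2 * sqnorm M (\<lambda>x. v x - u x) + 2 * sqnorm M (\<lambda>x. w x - u x))"
    by (intro mult_left_mono sqnorm_add_le dv dw) simp
  also have "\<dots> \<le> d" using mid.IH by (simp add: power2_eq_square)
  finally show ?case using ES_lincomb(1)[OF vE] by blast
qed

lemma energy_parallelogram:
  assumes u: "u \<in> ES" and v: "v \<in> ES"
  shows "sqnorm M (\<lambda>x. energy_vec u x - energy_vec v x) =
    2 * energy \<Omega> V u + 2 * energy \<Omega> V v - 4 * energy \<Omega> V (\<lambda>x. 1/2 * u x + 1/2 * v x)"
  using sqnorm_add(2)[OF ES_D(3)[OF u] ES_D(3)[OF v]] ES_lincomb(2)[OF u v, of "1/2" "1/2"]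
  by (simp add: energy_eq_sqnorm energy_form_def power2_eq_square)

text \<open>  Let \<open>e m\<close> be the least energy on the midpoint hull \<open>H m\<close> of the tail from \<open>m\<close> on. These numbers
  increase to some \<open>l \<le> a\<close>. Near-minimisers \<open>v m\<close> have midpoints in the hulls, so the
  parallelogram law makes them a Cauchy sequence for the energy; since all elements of \<open>H m\<close> are
  close to \<open>u\<close> in \<open>L\<^sup>2\<close>, the limit is \<open>u\<close>.\<close>
lemma energy_lower_semicontinuous:
  assumes w: "\<And>n. w n \<in> ES" and u: "square_integrable M u" "(\<lambda>n. sqnorm M (\<lambda>x. w n x - u x)) \<longlonglongrightarrow> 0"
    and a: "(\<lambda>n. energy \<Omega> V (w n)) \<longlonglongrightarrow> a"
  shows "u \<in> ES" "energy \<Omega> V u \<le> a"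
proof -
  define H where "H m = midpoint_hull (w ` {m..})" for m
  define e where "e m = Inf (energy \<Omega> V ` H m)" for m
  have wH: "w n \<in> H m" if "m \<le> n" for m n unfolding H_def by (rule midpoint_hull.base) (use that in auto)
  have HE: "v \<in> ES" if "v \<in> H m" for v m
  proof -
    obtain B where B: "\<And>n. sqnorm M (\<lambda>x. w n x - u x) \<le> B"
      using convergent_imp_Bseq[OF convergentI[OF u(2)]] unfolding Bseq_def by (auto simp: abs_le_iff)
    show ?thesis
      using midpoint_hull_properties[of "w ` {m..}" u B v] w B u(1) that by (auto simp: H_def)
  qed
  have bdd: "bdd_below (energy \<Omega> V ` H m)" for m by (intro bdd_belowI[of _ 0]) (auto simp: energy_nonneg)
  have e_le: "e m \<le> energy \<Omega> V v" if "v \<in> H m" for m v unfolding e_def by (intro cInf_lower bdd imageI that)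
  have Hmono: "H n \<subseteq> H m" if "m \<le> n" for m n unfolding H_def by (intro midpoint_hull_mono image_mono) (use that in auto)
  have emono: "e m \<le> e n" if "m \<le> n" for m n
    unfolding e_def using Hmono[OF that] wH[of n n] by (intro cInf_superset_mono bdd) auto
  have ea: "e m \<le> a" for m
    by (rule LIMSEQ_le_const[OF a]) (use e_le wH in \<open>auto intro!: exI[of _ m]\<close>)
  have "incseq e" using emono by (simp add: incseq_def)
  then obtain l where l: "e \<longlonglongrightarrow> l" by (rule incseq_convergent[of e a]) (use ea in auto)
  have el: "e m \<le> l" for m by (rule incseq_le[OF \<open>incseq e\<close> l])
  have "\<exists>v. v \<in> H m \<and> energy \<Omega> V v < e m + 1 / real (Suc m)" for m
  proof -
    have ne: "energy \<Omega> V ` H m \<noteq> {}" using wH[of m m] by auto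
    have "Inf (energy \<Omega> V ` H m) < e m + 1 / real (Suc m)" unfolding e_def by simp
    from cInf_lessD[OF ne this] show ?thesis by blast
  qed
  then obtain v where v: "\<And>m. v m \<in> H m" "\<And>m. energy \<Omega> V (v m) < e m + 1 / real (Suc m)" by metis
  have vE: "v m \<in> ES" for m using HE[OF v(1)] .
  have vlim: "(\<lambda>m. sqnorm M (\<lambda>x. v m x - u x)) \<longlonglongrightarrow> 0"
  proof (rule LIMSEQ_I)
    fix d :: real assume d: "d > 0"
    have "\<forall>\<^sub>F n in sequentially. sqnorm M (\<lambda>x. w n x - u x) < d / 2" using d by (intro order_tendstoD(2)[OF u(2)]) simp
    then obtain N where N: "\<And>n. n \<ge> N \<Longrightarrow> sqnorm M (\<lambda>x. w n x - u x) < d / 2" unfolding eventually_sequentially by blast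
    have "norm (sqnorm M (\<lambda>x. v m x - u x) - 0) < d" if m: "m \<ge> N" for m
    proof -
      have "sqnorm M (\<lambda>x. v m x - u x) \<le> d / 2"
        using midpoint_hull_properties[of "w ` {m..}" u "d/2" "v m"] w N m u(1) v(1)[of m]
        by (force simp: H_def intro: less_imp_le)
      then show ?thesis using d by simp
    qed
    then show "\<exists>N. \<forall>m\<ge>N. norm (sqnorm M (\<lambda>x. v m x - u x) - 0) < d" by blast
  qed
  have inv: "(\<lambda>m. 1 / real (Suc m)) \<longlonglongrightarrow> 0" using lim_1_over_n[THEN LIMSEQ_Suc] .
  have close: "sqnorm M (\<lambda>x. energy_vec (v m) x - energy_vec (v n) x) \<le> 4 * (l - e N) + 4 * (1 / real (Suc N))"
    if "m \<ge> N" "n \<ge> N" for m n N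
  proof -
    have "(\<lambda>x. 1/2 * v m x + 1/2 * v n x) \<in> H N"
      using v(1)[of m] v(1)[of n] Hmono[OF that(1)] Hmono[OF that(2)]
      unfolding H_def by (intro midpoint_hull.mid) blast+
    then have "e N \<le> energy \<Omega> V (\<lambda>x. 1/2 * v m x + 1/2 * v n x)" by (rule e_le)
    moreover have "1 / real (Suc m) \<le> 1 / real (Suc N)" "1 / real (Suc n) \<le> 1 / real (Suc N)"
      using that by (simp_all add: frac_le)
    ultimately show ?thesis
      unfolding energy_parallelogram[OF vE vE] using v(2)[of m] v(2)[of n] el[of m] el[of n] by argo
  qed
  have "(\<lambda>N. 4 * (l - e N) + 4 * (1 / real (Suc N))) \<longlonglongrightarrow> 4 * (l - l) + 4 * 0"
    by (intro tendsto_intros l inv)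
  then have small: "(\<lambda>N. 4 * (l - e N) + 4 * (1 / real (Suc N))) \<longlonglongrightarrow> 0" by simp
  have cauchy: "\<exists>N. \<forall>m\<ge>N. \<forall>n\<ge>N. sqnorm M (\<lambda>x. energy_vec (v m) x - energy_vec (v n) x) < d" if "d > 0" for d
  proof -
    have "\<forall>\<^sub>F N in sequentially. 4 * (l - e N) + 4 * (1 / real (Suc N)) < d"
      by (rule order_tendstoD(2)[OF small that])
    then obtain N where "4 * (l - e N) + 4 * (1 / real (Suc N)) < d" by (auto simp: eventually_sequentially)
    then have "sqnorm M (\<lambda>x. energy_vec (v m) x - energy_vec (v n) x) < d" if "m \<ge> N" "n \<ge> N" for m n
      using close[OF that] by (rule le_less_trans[rotated])
    then show ?thesis by blast
  qed
  note C = ES_complete[OF vE u(1) vlim cauchy]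
  show "u \<in> ES" by (rule C(1))
  have "(\<lambda>m. a + 1 / real (Suc m)) \<longlonglongrightarrow> a + 0" by (intro tendsto_intros inv)
  then have lim: "(\<lambda>m. a + 1 / real (Suc m)) \<longlonglongrightarrow> a" by simp
  show "energy \<Omega> V u \<le> a"
  proof (rule LIMSEQ_le[OF C(2) lim])
    have "energy \<Omega> V (v m) \<le> a + 1 / real (Suc m)" for m using v(2)[of m] ea[of m] by linarith
    then show "\<exists>N. \<forall>m\<ge>N. energy \<Omega> V (v m) \<le> a + 1 / real (Suc m)" by blast
  qed
qed

end

section \<open>Compactness in the energy space\<close>

lemma H10_fourth_moment_tendsto:
  fixes d :: "nat \<Rightarrow> 'a::euclidean_space \<Rightarrow> real"
  assumes \<Omega>: "open \<Omega>" and dim: "DIM('a) \<le> 3"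
    and d: "\<And>n. d n \<in> H10 \<Omega>" and z: "(\<lambda>n. sqnorm (lebesgue_on \<Omega>) (d n)) \<longlonglongrightarrow> 0"
    and B: "\<And>n. sqnorm (lebesgue_on \<Omega>) (weak_grad \<Omega> (d n)) \<le> B"
  shows "(\<lambda>n. sqnorm (lebesgue_on \<Omega>) (\<lambda>x. (d n x :: real)\<^sup>2)) \<longlonglongrightarrow> 0"
proof (rule LIMSEQ_I)
  let ?M = "lebesgue_on \<Omega>"
  let ?K = "5000000 * (2 ^ DIM('a) * (real DIM('a))\<^sup>2)\<^sup>2"
  fix e :: real assume e: "e > 0"
  have "(\<lambda>k. ?K * B\<^sup>2 * (1/2)^k) \<longlonglongrightarrow> ?K * B\<^sup>2 * 0" by (intro tendsto_intros LIMSEQ_power_zero) simp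
  then have "\<forall>\<^sub>F k in sequentially. ?K * B\<^sup>2 * (1/2)^k < e / 2" using e by (intro order_tendstoD(2)) auto
  then obtain k where k: "?K * B\<^sup>2 * (1/2)^k < e / 2" by (auto simp: eventually_sequentially)
  have "(\<lambda>n. 64 * 8^k * (sqnorm ?M (d n))\<^sup>2) \<longlonglongrightarrow> 64 * 8^k * 0\<^sup>2" by (intro tendsto_intros z)
  from order_tendstoD(2)[OF this, of "e / 2"]
  have "\<forall>\<^sub>F n in sequentially. 64 * 8^k * (sqnorm ?M (d n))\<^sup>2 < e / 2" using e by simp
  then obtain N where N: "\<And>n. n \<ge> N \<Longrightarrow> 64 * 8^k * (sqnorm ?M (d n))\<^sup>2 < e / 2"
    unfolding eventually_sequentially by blast
  have "norm (sqnorm ?M (\<lambda>x. (d n x)\<^sup>2) - 0) < e" if n: "n \<ge> N" for n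
  proof -
    have "?K / 2^k * (sqnorm ?M (weak_grad \<Omega> (d n)))\<^sup>2 \<le> ?K / 2^k * B\<^sup>2"
      by (intro mult_left_mono power_mono B) auto
    also have "\<dots> = ?K * B\<^sup>2 * (1/2)^k" by (simp add: power_one_over)
    finally have "sqnorm ?M (\<lambda>x. (d n x)\<^sup>2) < e"
      using H10_fourth_moment(2)[OF \<Omega> d dim, of n k] k N[OF n] by linarith
    then show ?thesis by simp
  qed
  then show "\<exists>N. \<forall>n\<ge>N. norm (sqnorm ?M (\<lambda>x. (d n x)\<^sup>2) - 0) < e" by blast
qed

lemma sqnorm_square_difference:
  fixes f g :: "'m \<Rightarrow> real"
  assumes "square_integrable M (\<lambda>x. (f x - g x)\<^sup>2)" "square_integrable M (\<lambda>x. (f x + g x)\<^sup>2)"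
  shows "sqnorm M (\<lambda>x. (f x)\<^sup>2 - (g x)\<^sup>2) \<le>
    sqrt (sqnorm M (\<lambda>x. (f x - g x)\<^sup>2)) * sqrt (sqnorm M (\<lambda>x. (f x + g x)\<^sup>2))"
proof -
  have "(norm ((f x)\<^sup>2 - (g x)\<^sup>2))\<^sup>2 = (f x - g x)\<^sup>2 \<bullet> (f x + g x)\<^sup>2" for x
    by (simp add: power2_eq_square algebra_simps)
  then have "sqnorm M (\<lambda>x. (f x)\<^sup>2 - (g x)\<^sup>2) = sqinner M (\<lambda>x. (f x - g x)\<^sup>2) (\<lambda>x. (f x + g x)\<^sup>2)"
    unfolding sqnorm_def sqinner_def by (simp only:)
  then show ?thesis using sqinner_Cauchy_Schwarz[OF assms] by linarith
qed

context nonneg_potential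
begin

lemma ES_square_square_integrable:
  assumes "DIM('a) \<le> 3" "u \<in> ES"
  shows "square_integrable M (\<lambda>x. (u x)\<^sup>2)"
  by (rule H10_fourth_moment(1)[OF open_domain ES_D(1)[OF assms(2)] assms(1)])

text \<open>  The difference of squares is a product; one factor tends to zero in \<open>L\<^sup>4\<close> and the other one is
  bounded there.\<close>
lemma ES_squares_tendsto:
  assumes dim: "DIM('a) \<le> 3" and w: "\<And>n. w n \<in> ES" and u: "u \<in> ES"
    and B: "\<And>n. energy \<Omega> V (w n) \<le> B" and lim: "(\<lambda>n. sqnorm M (\<lambda>x. w n x - u x)) \<longlonglongrightarrow> 0"
  shows "(\<lambda>n. sqnorm M (\<lambda>x. (w n x)\<^sup>2 - (u x)\<^sup>2)) \<longlonglongrightarrow> 0"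
proof -
  let ?C = "2 * B + 2 * energy \<Omega> V u"
  have dE: "(\<lambda>x. w n x - u x) \<in> ES" and sE: "(\<lambda>x. w n x + u x) \<in> ES" for n
    using ES_lincomb(1)[OF w[of n] u, of 1 "-1"] ES_lincomb(1)[OF w[of n] u, of 1 1] by auto
  have dB: "energy \<Omega> V (\<lambda>x. w n x - u x) \<le> ?C" and sB: "energy \<Omega> V (\<lambda>x. w n x + u x) \<le> ?C" for n
    using ES_lincomb(2)[OF w[of n] u, of 1 "-1"] ES_lincomb(2)[OF w[of n] u, of 1 1] B[of n]
      energy_nonneg[of "\<lambda>x. w n x - u x"] energy_nonneg[of "\<lambda>x. w n x + u x"] by auto
  have d4: "(\<lambda>n. sqnorm M (\<lambda>x. (w n x - u x)\<^sup>2)) \<longlonglongrightarrow> 0"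
    by (rule H10_fourth_moment_tendsto[OF open_domain dim ES_D(1)[OF dE] lim order_trans[OF sqnorm_le_energy(1)[OF dE] dB]])
  have "(\<lambda>n. sqnorm M (w n)) \<longlonglongrightarrow> sqnorm M u" by (rule sqnorm_tendsto[OF ES_D(4)[OF w] ES_D(4)[OF u] lim])
  then have "Bseq (\<lambda>n. sqnorm M (w n))" by (intro convergent_imp_Bseq convergentI)
  then obtain D where "\<And>n. norm (sqnorm M (w n)) \<le> D" by (rule BseqE) blast
  then have D: "\<And>n. sqnorm M (w n) \<le> D" by simp
  let ?E = "2 * D + 2 * sqnorm M u"
  have s2: "sqnorm M (\<lambda>x. w n x + u x) \<le> ?E" for n
    using sqnorm_add_le(1)[OF ES_D(4)[OF w[of n]] ES_D(4)[OF u]] D[of n] by linarith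
  let ?K = "5000000 * (2 ^ DIM('a) * (real DIM('a))\<^sup>2)\<^sup>2 / 2^0"
  have s4: "sqnorm M (\<lambda>x. (w n x + u x)\<^sup>2) \<le> 64 * 8^0 * ?E\<^sup>2 + ?K * ?C\<^sup>2" for n
  proof -
    have "sqnorm M (\<lambda>x. (w n x + u x)\<^sup>2) \<le> 64 * 8^0 * (sqnorm M (\<lambda>x. w n x + u x))\<^sup>2 +
        ?K * (sqnorm M (weak_grad \<Omega> (\<lambda>x. w n x + u x)))\<^sup>2"
      by (rule H10_fourth_moment(2)[OF open_domain ES_D(1)[OF sE] dim])
    also have "\<dots> \<le> 64 * 8^0 * ?E\<^sup>2 + ?K * ?C\<^sup>2"
      by (intro add_mono mult_left_mono power_mono s2 order_trans[OF sqnorm_le_energy(1)[OF sE] sB]) auto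
    finally show ?thesis .
  qed
  let ?S = "sqrt (64 * 8^0 * ?E\<^sup>2 + ?K * ?C\<^sup>2)"
  have le: "sqnorm M (\<lambda>x. (w n x)\<^sup>2 - (u x)\<^sup>2) \<le> sqrt (sqnorm M (\<lambda>x. (w n x - u x)\<^sup>2)) * ?S" for n
    by (rule order_trans[OF sqnorm_square_difference[OF ES_square_square_integrable[OF dim dE] ES_square_square_integrable[OF dim sE]]])
      (intro mult_left_mono real_sqrt_le_mono s4, simp)
  have "(\<lambda>n. sqrt (sqnorm M (\<lambda>x. (w n x - u x)\<^sup>2)) * ?S) \<longlonglongrightarrow> sqrt 0 * ?S" by (intro tendsto_intros d4)
  then have lim0: "(\<lambda>n. sqrt (sqnorm M (\<lambda>x. (w n x - u x)\<^sup>2)) * ?S) \<longlonglongrightarrow> 0" by simp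
  show ?thesis
    by (rule tendsto_sandwich[OF _ _ tendsto_const lim0]) (use le in \<open>auto intro!: always_eventually\<close>)
qed

text \<open>  Where \<open>V \<ge> T\<close>, the mass is at most the energy divided by \<open>T\<close>.\<close>
lemma energy_bound_tight:
  assumes conf: "bounded \<Omega> \<or> (\<Omega> = UNIV \<and> filterlim V at_top at_infinity)" and e: "e > 0" and B: "B \<ge> 0"
  obtains R where "\<And>u. u \<in> ES \<Longrightarrow> energy \<Omega> V u \<le> B \<Longrightarrow> sqnorm M (\<lambda>x. indicator (- ball 0 R) x * u x) \<le> e"
proof -
  from conf show ?thesis
  proof
    assume "bounded \<Omega>"
    then obtain R where R: "\<Omega> \<subseteq> ball 0 R" using bounded_subset_ballD by blast
    have "sqnorm M (\<lambda>x. indicator (- ball 0 R) x * u x) = 0" for u :: "'a \<Rightarrow> real"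
    proof -
      have "sqnorm M (\<lambda>x. indicator (- ball 0 R) x * u x) = (LINT x|M. 0)"
        unfolding sqnorm_def by (intro Bochner_Integration.integral_cong) (use R in auto)
      then show ?thesis by simp
    qed
    then show ?thesis using that[of R] e by simp
  next
    assume U: "\<Omega> = UNIV \<and> filterlim V at_top at_infinity"
    \<comment> \<open>the summand \<open>1\<close> keeps \<open>T\<close> positive when \<open>B = 0\<close>\<close>
    define T where "T = (B + 1) / e"
    have T: "T > 0" using B e by (simp add: T_def)
    have "\<forall>\<^sub>F x in at_infinity. T \<le> V x" using U by (simp add: filterlim_at_top)
    then obtain R where R: "\<And>x. R \<le> norm x \<Longrightarrow> T \<le> V x" by (auto simp: eventually_at_infinity)
    have "sqnorm M (\<lambda>x. indicator (- ball 0 R) x * u x) \<le> e" if u: "u \<in> ES" "energy \<Omega> V u \<le> B" for u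
    proof -
      have m: "- ball 0 R \<in> sets M" using U by simp
      have "sqnorm M (\<lambda>x. indicator (- ball 0 R) x * u x) \<le> (LINT x|M. (1 / T) * (V x * (u x)\<^sup>2))"
        unfolding sqnorm_def
      proof (rule integral_mono)
        show "integrable M (\<lambda>x. (norm (indicator (- ball 0 R) x * u x))\<^sup>2)"
          by (rule square_integrable_integrable[OF square_integrable_indicator_mult(1)[OF ES_D(4)[OF u(1)] m]])
        show "integrable M (\<lambda>x. (1 / T) * (V x * (u x)\<^sup>2))"
          by (rule integrable_mult_right[OF sqnorm_le_energy(2)[OF u(1)]])
        fix x assume "x \<in> space M"
        then have V: "0 \<le> V x" using V_nonneg by simp
        show "(norm (indicator (- ball 0 R) x * u x))\<^sup>2 \<le> (1 / T) * (V x * (u x)\<^sup>2)"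
        proof (cases "x \<in> ball 0 R")
          case False
          then have "T \<le> V x" using R by simp
          then have "T * (u x)\<^sup>2 \<le> V x * (u x)\<^sup>2" by (intro mult_right_mono) auto
          then show ?thesis using False T by (simp add: field_simps)
        qed (use V T in simp)
      qed
      also have "\<dots> = (1 / T) * (LINT x|M. V x * (u x)\<^sup>2)" by simp
      also have "\<dots> \<le> (1 / T) * B" using sqnorm_le_energy(3)[OF u(1)] u(2) T by (intro mult_left_mono) auto
      also have "\<dots> \<le> e" using e B by (simp add: T_def field_simps)
      finally show ?thesis .
    qed
    then show ?thesis using that[of R] by blast
  qed
qed

text \<open>  Test functions within \<open>1/n\<close> of the \<open>n\<close>-th element in \<open>H1\<close> inherit the bounds and, up to an error
  that tends to zero, the tightness. The potential is not controlled on them, so tightness has to be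
  proved for the elements themselves.\<close>
lemma ES_bounded_compact:
  assumes conf: "bounded \<Omega> \<or> (\<Omega> = UNIV \<and> filterlim V at_top at_infinity)"
    and w: "\<And>n. w n \<in> ES" and B: "\<And>n. energy \<Omega> V (w n) \<le> B" "\<And>n. sqnorm M (w n) \<le> B"
  obtains r :: "nat \<Rightarrow> nat" and u where "strict_mono r" "square_integrable M u"
    "(\<lambda>n. sqnorm M (\<lambda>x. w (r n) x - u x)) \<longlonglongrightarrow> 0"
proof -
  have \<Omega>s: "\<Omega> \<in> sets lebesgue" using open_domain by simp
  have "\<exists>\<phi>. \<phi> \<in> test_functions \<Omega> \<and> sqnorm M (\<lambda>x. w n x - \<phi> x) < 1 / real (Suc n) \<and>
    sqnorm M (\<lambda>x. weak_grad \<Omega> (w n) x - gradient \<phi> x) < 1 / real (Suc n)" for n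
  proof -
    have "0 < 1 / real (Suc n)" by simp
    from H10_approx[OF open_domain ES_D(1)[OF w] this] show ?thesis by blast
  qed
  then obtain \<phi> where \<phi>: "\<And>n. \<phi> n \<in> test_functions \<Omega>"
    "\<And>n. sqnorm M (\<lambda>x. w n x - \<phi> n x) < 1 / real (Suc n)"
    "\<And>n. sqnorm M (\<lambda>x. weak_grad \<Omega> (w n) x - gradient (\<phi> n) x) < 1 / real (Suc n)"
    by metis
  note P = test_function_square_integrable_on[OF \<phi>(1) open_domain] and W = ES_D[OF w]
  have one: "1 / real (Suc n) \<le> 1" for n by (simp add: divide_le_eq)
  have B1: "sqnorm lborel (\<phi> n) \<le> 2 * B + 2" for n
  proof -
    have "sqnorm M (\<phi> n) \<le> 2 * sqnorm M (w n) + 2 * sqnorm M (\<lambda>x. w n x - \<phi> n x)"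
      using sqnorm_add_le(2)[OF W(4)[of n] square_integrable_diff[OF W(4)[of n] P(1)[of n]]] by simp
    then show ?thesis using B(2)[of n] \<phi>(2)[of n] one[of n] unfolding P(3) by linarith
  qed
  have B2: "sqnorm lborel (gradient (\<phi> n)) \<le> 2 * B + 2" for n
  proof -
    have "sqnorm M (gradient (\<phi> n)) \<le> 2 * sqnorm M (weak_grad \<Omega> (w n)) + 2 * sqnorm M (\<lambda>x. weak_grad \<Omega> (w n) x - gradient (\<phi> n) x)"
      using sqnorm_add_le(2)[OF W(5)[of n] square_integrable_diff[OF W(5)[of n] P(2)[of n]]] by simp
    then show ?thesis using B(1)[of n] sqnorm_le_energy(1)[OF w[of n]] \<phi>(3)[of n] one[of n] unfolding P(4) by linarith
  qed
  have B0: "B \<ge> 0" using B(2)[of 0] sqnorm_nonneg[of M "w 0"] by linarith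
  have inv: "(\<lambda>n. 1 / real (Suc n)) \<longlonglongrightarrow> 0" using lim_1_over_n[THEN LIMSEQ_Suc] .
  have tight: "\<exists>R. \<forall>\<^sub>F n in sequentially. sqnorm lborel (\<lambda>x. indicator (- ball 0 R) x * \<phi> n x) \<le> e" if e: "e > 0" for e
  proof -
    have "e / 4 > 0" using e by simp
    then obtain R where R: "\<And>u. u \<in> ES \<Longrightarrow> energy \<Omega> V u \<le> B \<Longrightarrow> sqnorm M (\<lambda>x. indicator (- ball 0 R) x * u x) \<le> e / 4"
      by (rule energy_bound_tight[OF conf _ B0]) blast
    have "\<forall>\<^sub>F n in sequentially. 1 / real (Suc n) < e / 4" using e by (intro order_tendstoD(2)[OF inv]) simp
    then have "\<forall>\<^sub>F n in sequentially. sqnorm lborel (\<lambda>x. indicator (- ball 0 R) x * \<phi> n x) \<le> e"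
    proof eventually_elim
      case (elim n)
      let ?i = "indicator (- ball (0::'a) R) :: 'a \<Rightarrow> real"
      have m: "- ball (0::'a) R \<inter> \<Omega> \<in> sets M" using open_domain by (auto simp: sets_restrict_space)
      have im: "square_integrable M (\<lambda>x. ?i x * f x)" "sqnorm M (\<lambda>x. ?i x * f x) \<le> sqnorm M f"
        if f: "square_integrable M f" for f
      proof -
        have "sqnorm M (\<lambda>x. ?i x * f x) = sqnorm M (\<lambda>x. indicator (- ball (0::'a) R \<inter> \<Omega>) x * f x)"
          unfolding sqnorm_def by (intro Bochner_Integration.integral_cong) (auto simp: indicator_def)
        then show "sqnorm M (\<lambda>x. ?i x * f x) \<le> sqnorm M f" using square_integrable_indicator_mult(2)[OF f m] by simp
        have "?i \<in> borel_measurable M" by (intro borel_measurable_lebesgue_on) simp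
        then have mf: "(\<lambda>x. ?i x * f x) \<in> borel_measurable M"
          by (rule borel_measurable_times[OF _ square_integrable_measurable[OF f]])
        have "AE x in M. indicator (- ball (0::'a) R \<inter> \<Omega>) x * f x = ?i x * f x"
          by (intro AE_I2) (simp add: indicator_def)
        from square_integrable_cong_AE[OF square_integrable_indicator_mult(1)[OF f m] this mf]
        show "square_integrable M (\<lambda>x. ?i x * f x)" .
      qed
      have "(\<lambda>x. ?i x * \<phi> n x) \<in> borel_measurable borel"
        using test_function_measurable(1)[OF \<phi>(1)] by (intro borel_measurable_times borel_measurable_indicator) auto
      then have "sqnorm lborel (\<lambda>x. ?i x * \<phi> n x) = sqnorm M (\<lambda>x. ?i x * \<phi> n x)"
        by (intro sqnorm_lebesgue_on_eq_lborel(1)[OF \<Omega>s, symmetric]) (auto simp: test_function_outside[OF \<phi>(1)])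
      also have "\<dots> \<le> 2 * sqnorm M (\<lambda>x. ?i x * w n x) + 2 * sqnorm M (\<lambda>x. ?i x * (w n x - \<phi> n x))"
        using sqnorm_add_le(2)[OF im(1)[OF W(4)[of n]] im(1)[OF square_integrable_diff[OF W(4)[of n] P(1)[of n]]]]
        by (simp add: algebra_simps)
      also have "\<dots> \<le> e"
        using im(2)[OF square_integrable_diff[OF W(4)[of n] P(1)[of n]]] R[OF w B(1), of n] \<phi>(2)[of n] elim by linarith
      finally show ?case .
    qed
    then show ?thesis by blast
  qed
  obtain r :: "nat \<Rightarrow> nat" where r: "strict_mono r"
    "\<And>e. e > 0 \<Longrightarrow> \<exists>N. \<forall>m\<ge>N. \<forall>n\<ge>N. sqnorm lborel (\<lambda>x. \<phi> (r m) x - \<phi> (r n) x) < e"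
    by (rule tight_test_functions_Cauchy_subsequence[of \<phi> \<Omega> "2 * B + 2", OF \<phi>(1) B1 B2 tight]) blast+
  have eqn: "sqnorm lborel (\<lambda>x. \<phi> m x - \<phi> n x) = sqnorm M (\<lambda>x. \<phi> m x - \<phi> n x)" for m n
  proof -
    have "(\<lambda>x. \<phi> m x - \<phi> n x) \<in> borel_measurable borel"
      using test_function_measurable(1)[OF \<phi>(1)] by (intro borel_measurable_diff)
    then show ?thesis
      by (intro sqnorm_lebesgue_on_eq_lborel(1)[OF \<Omega>s, symmetric]) (auto simp: test_function_outside[OF \<phi>(1)])
  qed
  obtain u where u: "square_integrable M u" "(\<lambda>n. sqnorm M (\<lambda>x. \<phi> (r n) x - u x)) \<longlonglongrightarrow> 0"
    using square_integrable_complete[of M "\<lambda>n. \<phi> (r n)", OF P(1) r(2)[unfolded eqn]] by blast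
  have "(\<lambda>n. 2 * (1 / real (Suc (r n))) + 2 * sqnorm M (\<lambda>x. \<phi> (r n) x - u x)) \<longlonglongrightarrow> 2 * 0 + 2 * 0"
    using LIMSEQ_subseq_LIMSEQ[OF inv r(1)] by (intro tendsto_intros u) (simp add: o_def)
  then have lim0: "(\<lambda>n. 2 * (1 / real (Suc (r n))) + 2 * sqnorm M (\<lambda>x. \<phi> (r n) x - u x)) \<longlonglongrightarrow> 0" by simp
  have "(\<lambda>n. sqnorm M (\<lambda>x. w (r n) x - u x)) \<longlonglongrightarrow> 0"
  proof (rule tendsto_sandwich[OF _ _ tendsto_const lim0])
    show "\<forall>\<^sub>F n in sequentially. sqnorm M (\<lambda>x. w (r n) x - u x) \<le> 2 * (1 / real (Suc (r n))) + 2 * sqnorm M (\<lambda>x. \<phi> (r n) x - u x)"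
    proof (intro always_eventually allI)
      fix n
      have "sqnorm M (\<lambda>x. w (r n) x - u x) \<le> 2 * sqnorm M (\<lambda>x. w (r n) x - \<phi> (r n) x) + 2 * sqnorm M (\<lambda>x. \<phi> (r n) x - u x)"
        using sqnorm_add_le(1)[OF square_integrable_diff[OF W(4)[of "r n"] P(1)[of "r n"]] square_integrable_diff[OF P(1)[of "r n"] u(1)]] by simp
      then show "sqnorm M (\<lambda>x. w (r n) x - u x) \<le> 2 * (1 / real (Suc (r n))) + 2 * sqnorm M (\<lambda>x. \<phi> (r n) x - u x)"
        using \<phi>(2)[of "r n"] by linarith
    qed
  qed simp
  then show ?thesis by (rule that[OF r(1) u(1)])
qed

end

section \<open>Functions with finitely many values\<close>

lemma AE_lborel_translation:
  assumes "AE x in lborel. P (x :: 'a::euclidean_space)"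
  shows "AE x in lborel. P (x + c)"
proof -
  have "AE x in distr lborel borel ((+) c). P x" unfolding lborel_distr_plus by (rule assms)
  then have "AE x in lborel. P (c + x)" by (rule AE_distrD[rotated]) simp
  then show ?thesis by (simp add: add.commute)
qed

text \<open>  A ball and all its translates carry the same mass, but the mass of a far translate tends to zero.\<close>
lemma translation_invariant_AE_zero:
  fixes q :: "'a::euclidean_space \<Rightarrow> real"
  assumes q: "square_integrable lborel q" and inv: "\<And>h. AE x in lborel. q (x + h) = q x"
  shows "AE x in lborel. q x = 0"
proof -
  have [measurable]: "q \<in> borel_measurable borel" using square_integrable_measurable[OF q] by simp
  have iq: "integrable lborel (\<lambda>x. (q x)\<^sup>2)" using square_integrable_integrable[OF q] by simp
  obtain e :: 'a where e: "e \<in> Basis" using nonempty_Basis by blast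
  have "AE x in lborel. x \<in> ball 0 R \<longrightarrow> q x = 0" for R
  proof -
    let ?i = "\<lambda>x. indicator (ball (0::'a) R) x :: real"
    have [measurable]: "ball (0::'a) R \<in> sets borel" by simp
    have I: "(LINT x|lborel. ?i x * (q x)\<^sup>2) = (LINT x|lborel. ?i (x - real n *\<^sub>R e) * (q x)\<^sup>2)" for n
    proof -
      have "(LINT x|lborel. ?i x * (q x)\<^sup>2) = (LINT x|lborel. ?i x * (q (x + real n *\<^sub>R e))\<^sup>2)"
      proof (rule integral_cong_AE)
        show "AE x in lborel. ?i x * (q x)\<^sup>2 = ?i x * (q (x + real n *\<^sub>R e))\<^sup>2"
          using inv[of "real n *\<^sub>R e"] by eventually_elim simp
      qed measurable
      also have "\<dots> = (LINT x|lborel. (\<lambda>y. ?i (y - real n *\<^sub>R e) * (q y)\<^sup>2) (x + real n *\<^sub>R e))" by simp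
      also have "\<dots> = (LINT x|lborel. ?i (x - real n *\<^sub>R e) * (q x)\<^sup>2)"
        by (rule lborel_integral_translation) measurable
      finally show ?thesis .
    qed
    have "(\<lambda>n. LINT x|lborel. ?i (x - real n *\<^sub>R e) * (q x)\<^sup>2) \<longlonglongrightarrow> (LINT x|(lborel :: 'a measure). (0::real))"
    proof (rule integral_dominated_convergence[where w="\<lambda>x. (q x)\<^sup>2"])
      show "integrable lborel (\<lambda>x. (q x)\<^sup>2)" by (rule iq)
      show "AE x in lborel. (\<lambda>n. ?i (x - real n *\<^sub>R e) * (q x)\<^sup>2) \<longlonglongrightarrow> 0"
      proof (rule AE_I2)
        fix x :: 'a
        obtain N :: nat where N: "real N > norm x + R" using reals_Archimedean2 by blast
        have "?i (x - real n *\<^sub>R e) = 0" if "n \<ge> N" for n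
        proof -
          have "real N \<le> real n" using that by simp
          moreover have "norm (real n *\<^sub>R e) - norm x \<le> norm (x - real n *\<^sub>R e)"
            using norm_triangle_ineq2[of "real n *\<^sub>R e" x] by (simp add: norm_minus_commute)
          ultimately have "R \<le> norm (x - real n *\<^sub>R e)" using N e by simp
          then show ?thesis by simp
        qed
        then have "\<forall>\<^sub>F n in sequentially. ?i (x - real n *\<^sub>R e) * (q x)\<^sup>2 = 0"
          by (intro eventually_sequentiallyI[of N]) simp
        then show "(\<lambda>n. ?i (x - real n *\<^sub>R e) * (q x)\<^sup>2) \<longlonglongrightarrow> 0" by (rule tendsto_eventually)
      qed
      show "AE x in lborel. norm (?i (x - real n *\<^sub>R e) * (q x)\<^sup>2) \<le> (q x)\<^sup>2" for n
        by (rule AE_I2) (simp add: indicator_def)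
    qed measurable
    then have "(\<lambda>n. LINT x|lborel. ?i x * (q x)\<^sup>2) \<longlonglongrightarrow> 0" unfolding I[symmetric] by simp
    then have z: "(LINT x|lborel. ?i x * (q x)\<^sup>2) = 0" by (simp add: LIMSEQ_const_iff)
    have "integrable lborel (\<lambda>x. ?i x * (q x)\<^sup>2)"
      using integrable_mult_indicator[OF _ iq, of "ball 0 R"] by simp
    then have "AE x in lborel. ?i x * (q x)\<^sup>2 = 0"
      using z by (subst (asm) integral_nonneg_eq_0_iff_AE) auto
    then show ?thesis by eventually_elim (auto simp: indicator_def)
  qed
  then have "AE x in lborel. \<forall>n::nat. x \<in> ball 0 (real n) \<longrightarrow> q x = 0"
    by (intro AE_all_countable[THEN iffD2] allI)
  then show ?thesis
  proof eventually_elim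
    case (elim x)
    obtain n :: nat where "norm x < real n" using reals_Archimedean2 by blast
    then have "x \<in> ball 0 (real n)" by simp
    then show ?case using elim by blast
  qed
qed

lemma finite_set_gap:
  fixes S :: "real set"
  assumes "finite S"
  obtains d where "d > 0" "\<And>s t. s \<in> S \<Longrightarrow> t \<in> S \<Longrightarrow> s \<noteq> t \<Longrightarrow> d \<le> \<bar>s - t\<bar>"
proof -
  \<comment> \<open>the element \<open>1\<close> keeps the set nonempty when \<open>S\<close> has at most one element\<close>
  define D where "D = insert 1 ((\<lambda>(s, t). \<bar>s - t\<bar>) ` {p \<in> S \<times> S. fst p \<noteq> snd p})"
  have fin: "finite D" unfolding D_def using assms by simp
  have pos: "\<forall>y\<in>D. 0 < y" by (auto simp: D_def)
  show ?thesis
  proof (rule that[of "Min D"])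
    show "Min D > 0" using fin pos by (subst Min_gr_iff) (auto simp: D_def)
    show "Min D \<le> \<bar>s - t\<bar>" if "s \<in> S" "t \<in> S" "s \<noteq> t" for s t
    proof (rule Min_le[OF fin])
      have "(s, t) \<in> {p \<in> S \<times> S. fst p \<noteq> snd p}" using that by simp
      then show "\<bar>s - t\<bar> \<in> D" unfolding D_def by force
    qed
  qed
qed

text \<open>  With \<open>d\<close> the smallest gap between values, an increment is at most its square divided by \<open>d\<close>. The
  resulting \<open>L\<^sup>1\<close> bound is quadratic in \<open>h\<close>, whereas the triangle inequality is additive along a
  chain of steps; a chain of \<open>n\<close> steps \<open>h / n\<close> gives a bound of order \<open>1 / n\<close>.\<close>
lemma finitely_valued_AE_zero:
  fixes q :: "'a::euclidean_space \<Rightarrow> real"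
  assumes q: "square_integrable lborel q" and K: "K \<ge> 0"
    and lip: "\<And>h. sqnorm lborel (\<lambda>x. q (x + h) - q x) \<le> K * (norm h)\<^sup>2"
    and S: "finite S" "AE x in lborel. q x \<in> S"
  shows "AE x in lborel. q x = 0"
proof (rule translation_invariant_AE_zero[OF q])
  have [measurable]: "q \<in> borel_measurable borel" using square_integrable_measurable[OF q] by simp
  obtain d where d: "d > 0" "\<And>s t. s \<in> S \<Longrightarrow> t \<in> S \<Longrightarrow> s \<noteq> t \<Longrightarrow> d \<le> \<bar>s - t\<bar>" by (rule finite_set_gap[OF S(1)]) blast
  have step: "(\<integral>\<^sup>+x. ennreal \<bar>q (x + h) - q x\<bar> \<partial>lborel) \<le> ennreal (K * (norm h)\<^sup>2 / d)" for h
  proof -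
    have sq: "square_integrable lborel (\<lambda>x. q (x + h) - q x)"
      by (intro square_integrable_diff square_integrable_translation q)
    have "(\<integral>\<^sup>+x. ennreal \<bar>q (x + h) - q x\<bar> \<partial>lborel) \<le> (\<integral>\<^sup>+x. ennreal (1 / d) * ennreal ((norm (q (x + h) - q x))\<^sup>2) \<partial>lborel)"
    proof (rule nn_integral_mono_AE)
      show "AE x in lborel. ennreal \<bar>q (x + h) - q x\<bar> \<le> ennreal (1 / d) * ennreal ((norm (q (x + h) - q x))\<^sup>2)"
        using S(2) AE_lborel_translation[OF S(2), of h]
      proof eventually_elim
        case (elim x)
        have "\<bar>q (x + h) - q x\<bar> \<le> 1 / d * (norm (q (x + h) - q x))\<^sup>2"
        proof (cases "q (x + h) = q x")
          case False
          then have "d * \<bar>q (x + h) - q x\<bar> \<le> \<bar>q (x + h) - q x\<bar> * \<bar>q (x + h) - q x\<bar>"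
            using d(2)[OF elim(2,1)] by (intro mult_right_mono) auto
          then show ?thesis using d(1) by (simp add: power2_eq_square field_simps)
        qed simp
        then show ?case using d(1) by (simp add: ennreal_mult[symmetric] ennreal_leI)
      qed
    qed
    also have "\<dots> = ennreal (1 / d) * ennreal (sqnorm lborel (\<lambda>x. q (x + h) - q x))"
      unfolding nn_integral_eq_sqnorm[OF sq, symmetric] by (rule nn_integral_cmult) measurable
    also have "\<dots> \<le> ennreal (1 / d) * ennreal (K * (norm h)\<^sup>2)"
      by (intro mult_left_mono ennreal_leI lip) simp
    also have "\<dots> = ennreal (K * (norm h)\<^sup>2 / d)" using d(1) K by (simp add: ennreal_mult[symmetric])
    finally show ?thesis .
  qed
  fix h :: 'a
  have bound: "(\<integral>\<^sup>+x. ennreal \<bar>q (x + h) - q x\<bar> \<partial>lborel) \<le> ennreal (K * (norm h)\<^sup>2 / d * (1 / real (Suc n)))" for n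
  proof -
    let ?N = "real (Suc n)" and ?v = "(1 / real (Suc n)) *\<^sub>R h"
    have "q (x + ?N *\<^sub>R v) - q x = (\<Sum>i<Suc n. q ((x + real i *\<^sub>R v) + v) - q (x + real i *\<^sub>R v))" for x v
    proof -
      have st: "(x + real i *\<^sub>R v) + v = x + real (Suc i) *\<^sub>R v" for i by (simp add: scaleR_left_distrib)
      show ?thesis unfolding st
        using sum_lessThan_telescope[of "\<lambda>i. q (x + real i *\<^sub>R v)" "Suc n", symmetric]
        by (simp only: of_nat_0 scaleR_zero_left add_0_right)
    qed
    from this[of _ ?v]
    have tele: "q (x + h) - q x = (\<Sum>i<Suc n. q ((x + real i *\<^sub>R ?v) + ?v) - q (x + real i *\<^sub>R ?v))" for x
      by (simp del: sum.lessThan_Suc of_nat_Suc)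
    have "(\<integral>\<^sup>+x. ennreal \<bar>q (x + h) - q x\<bar> \<partial>lborel) \<le>
        (\<integral>\<^sup>+x. (\<Sum>i<Suc n. ennreal \<bar>q ((x + real i *\<^sub>R ?v) + ?v) - q (x + real i *\<^sub>R ?v)\<bar>) \<partial>lborel)"
      unfolding tele by (intro nn_integral_mono) (simp only: sum_ennreal abs_ge_zero ennreal_leI sum_abs)
    also have "\<dots> = (\<Sum>i<Suc n. \<integral>\<^sup>+x. ennreal \<bar>q ((x + real i *\<^sub>R ?v) + ?v) - q (x + real i *\<^sub>R ?v)\<bar> \<partial>lborel)"
      by (rule nn_integral_sum) measurable
    also have "\<dots> = (\<Sum>i<Suc n. \<integral>\<^sup>+x. ennreal \<bar>q (x + ?v) - q x\<bar> \<partial>lborel)"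
    proof (intro sum.cong refl)
      fix i
      show "(\<integral>\<^sup>+x. ennreal \<bar>q ((x + real i *\<^sub>R ?v) + ?v) - q (x + real i *\<^sub>R ?v)\<bar> \<partial>lborel) = (\<integral>\<^sup>+x. ennreal \<bar>q (x + ?v) - q x\<bar> \<partial>lborel)"
        by (rule lborel_nn_integral_translation[of "\<lambda>x. ennreal \<bar>q (x + ?v) - q x\<bar>"]) measurable
    qed
    also have "\<dots> \<le> (\<Sum>i<Suc n. ennreal (K * (norm ?v)\<^sup>2 / d))" by (intro sum_mono step)
    also have "\<dots> = ennreal (\<Sum>i<Suc n. K * (norm ?v)\<^sup>2 / d)" using K d(1) by (intro sum_ennreal) simp
    also have "(\<Sum>i<Suc n. K * (norm ?v)\<^sup>2 / d) = K * (norm h)\<^sup>2 / d * (1 / ?N)"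
    proof -
      have nv: "(norm ?v)\<^sup>2 = (norm h)\<^sup>2 / ?N\<^sup>2" by (simp add: power_divide del: of_nat_Suc)
      have "(\<Sum>i<Suc n. K * (norm ?v)\<^sup>2 / d) = ?N * (K * (norm ?v)\<^sup>2 / d)" by (simp only: sum_constant card_lessThan)
      also have "\<dots> = K * (norm h)\<^sup>2 / d * (1 / ?N)" unfolding nv
        by (simp add: power2_eq_square del: of_nat_Suc)
      finally show ?thesis .
    qed
    finally show ?thesis .
  qed
  have "(\<lambda>n. ennreal (K * (norm h)\<^sup>2 / d * (1 / real (Suc n)))) \<longlonglongrightarrow> ennreal (K * (norm h)\<^sup>2 / d * 0)"
    by (intro tendsto_ennrealI tendsto_intros lim_1_over_n[THEN LIMSEQ_Suc])
  then have "(\<integral>\<^sup>+x. ennreal \<bar>q (x + h) - q x\<bar> \<partial>lborel) \<le> ennreal (K * (norm h)\<^sup>2 / d * 0)"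
    by (rule LIMSEQ_le_const) (use bound in blast)
  then have "(\<integral>\<^sup>+x. ennreal \<bar>q (x + h) - q x\<bar> \<partial>lborel) = 0" by simp
  then have "AE x in lborel. ennreal \<bar>q (x + h) - q x\<bar> = 0"
    by (subst (asm) nn_integral_0_iff_AE) auto
  then show "AE x in lborel. q (x + h) = q x" by eventually_elim simp
qed

text \<open>  The square root of the quadratic form is the norm of a vector, and by the reverse triangle inequality
  its increments are dominated by those of the components.\<close>
lemma finitely_valued_quadratic_AE_zero:
  fixes w1 w2 :: "'a::euclidean_space \<Rightarrow> real"
  assumes w: "square_integrable lborel w1" "square_integrable lborel w2"
    and lip: "\<And>h. sqnorm lborel (\<lambda>x. w1 (x + h) - w1 x) \<le> (norm h)\<^sup>2 * K1"
      "\<And>h. sqnorm lborel (\<lambda>x. w2 (x + h) - w2 x) \<le> (norm h)\<^sup>2 * K2"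
    and ab: "a \<ge> 0" "b \<ge> 0" and K: "K1 \<ge> 0" "K2 \<ge> 0"
    and S: "finite S" "AE x in lborel. a * (w1 x)\<^sup>2 + b * (w2 x)\<^sup>2 \<in> S"
  shows "AE x in lborel. a * (w1 x)\<^sup>2 + b * (w2 x)\<^sup>2 = 0"
proof -
  define p where "p x = (sqrt a * w1 x, sqrt b * w2 x)" for x
  define q where "q x = norm (p x)" for x
  have [measurable]: "w1 \<in> borel_measurable borel" "w2 \<in> borel_measurable borel"
    using w[THEN square_integrable_measurable] by auto
  have np: "(norm (sqrt a * s, sqrt b * t))\<^sup>2 = a * s\<^sup>2 + b * t\<^sup>2" for s t :: real
    using ab by (simp add: norm_Pair power_mult_distrib)
  have q2: "(q x)\<^sup>2 = a * (w1 x)\<^sup>2 + b * (w2 x)\<^sup>2" for x unfolding q_def p_def by (rule np)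
  have qr: "q x = sqrt (a * (w1 x)\<^sup>2 + b * (w2 x)\<^sup>2)" for x
    using q2[of x] by (metis q_def norm_ge_zero real_sqrt_unique)
  have [measurable]: "q \<in> borel_measurable borel" unfolding qr by measurable
  have "integrable lborel (\<lambda>x. a * (norm (w1 x))\<^sup>2 + b * (norm (w2 x))\<^sup>2)"
    by (intro Bochner_Integration.integrable_add integrable_mult_right square_integrable_integrable w)
  then have sq: "square_integrable lborel q" by (simp add: square_integrable_def q2)
  have "AE x in lborel. q x = 0"
  proof (rule finitely_valued_AE_zero[OF sq])
    show "0 \<le> a * K1 + b * K2" using ab K by simp
    show "finite (sqrt ` S)" using S by simp
    show "AE x in lborel. q x \<in> sqrt ` S" using S(2) by eventually_elim (simp add: qr)
    fix h
    have d1: "square_integrable lborel (\<lambda>x. w1 (x + h) - w1 x)" and d2: "square_integrable lborel (\<lambda>x. w2 (x + h) - w2 x)"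
      by (intro square_integrable_diff square_integrable_translation w)+
    have "sqnorm lborel (\<lambda>x. q (x + h) - q x) \<le> (LINT x|lborel. a * (norm (w1 (x + h) - w1 x))\<^sup>2 + b * (norm (w2 (x + h) - w2 x))\<^sup>2)"
      unfolding sqnorm_def
    proof (rule integral_mono)
      show "integrable lborel (\<lambda>x. (norm (q (x + h) - q x))\<^sup>2)"
        by (intro square_integrable_integrable square_integrable_diff square_integrable_translation sq)
      show "integrable lborel (\<lambda>x. a * (norm (w1 (x + h) - w1 x))\<^sup>2 + b * (norm (w2 (x + h) - w2 x))\<^sup>2)"
        by (intro Bochner_Integration.integrable_add integrable_mult_right square_integrable_integrable d1 d2)
      fix x
      have "norm (q (x + h) - q x) \<le> norm (p (x + h) - p x)"
        unfolding q_def real_norm_def by (rule norm_triangle_ineq3)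
      then have "(norm (q (x + h) - q x))\<^sup>2 \<le> (norm (p (x + h) - p x))\<^sup>2" by (intro power_mono) auto
      also have "p (x + h) - p x = (sqrt a * (w1 (x + h) - w1 x), sqrt b * (w2 (x + h) - w2 x))"
        by (simp add: p_def right_diff_distrib)
      finally show "(norm (q (x + h) - q x))\<^sup>2 \<le> a * (norm (w1 (x + h) - w1 x))\<^sup>2 + b * (norm (w2 (x + h) - w2 x))\<^sup>2"
        unfolding np by simp
    qed
    also have "\<dots> = a * sqnorm lborel (\<lambda>x. w1 (x + h) - w1 x) + b * sqnorm lborel (\<lambda>x. w2 (x + h) - w2 x)"
      unfolding sqnorm_def using square_integrable_integrable[OF d1] square_integrable_integrable[OF d2] by simp
    also have "\<dots> \<le> a * ((norm h)\<^sup>2 * K1) + b * ((norm h)\<^sup>2 * K2)" by (intro add_mono mult_left_mono lip ab)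
    finally show "sqnorm lborel (\<lambda>x. q (x + h) - q x) \<le> (a * K1 + b * K2) * (norm h)\<^sup>2" by (simp add: algebra_simps)
  qed
  then show ?thesis by eventually_elim (simp add: q2[symmetric])
qed

text \<open>  If \<open>\<mu>1 \<mu>2 \<noteq> \<beta>\<^sup>2\<close>, the two equations determine \<open>s\<^sup>2\<close> and \<open>t\<^sup>2\<close> where both functions are
  nonzero, and one coordinate whose coefficient \<open>\<mu>i\<close> is nonzero takes finitely many values.
  Otherwise (NonDeg) makes \<open>\<mu>1\<close>, \<open>\<mu>2\<close> and \<open>\<beta>\<close> nonzero of the same sign, and the left side of the
  first equation is, up to that sign, the required combination.\<close>
lemma NonDeg_finitely_many_values:
  fixes \<mu>1 \<mu>2 \<beta> \<omega>1 \<omega>2 :: real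
  assumes "NonDeg \<mu>1 \<mu>2 \<beta>"
  obtains a b S where "a \<ge> 0" "b \<ge> 0" "a > 0 \<or> b > 0" "finite S"
    "\<And>s t. s = 0 \<or> \<mu>1 * s\<^sup>2 + \<beta> * t\<^sup>2 = \<omega>1 \<Longrightarrow> t = 0 \<or> \<mu>2 * t\<^sup>2 + \<beta> * s\<^sup>2 = \<omega>2 \<Longrightarrow> a * s\<^sup>2 + b * t\<^sup>2 \<in> S"
proof -
  define D where "D = \<mu>1 * \<mu>2 - \<beta>\<^sup>2"
  show ?thesis
  proof (cases "D = 0")
    case False
    have solve: "D * s = \<omega>1 * \<mu>2 - \<beta> * \<omega>2" "D * t = \<mu>1 * \<omega>2 - \<beta> * \<omega>1"
      if "\<mu>1 * s + \<beta> * t = \<omega>1" "\<mu>2 * t + \<beta> * s = \<omega>2" for s t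
      unfolding D_def that[symmetric] by (simp_all add: algebra_simps power2_eq_square)
    show ?thesis
    proof (cases "\<mu>1 = 0")
      case \<mu>1: False
      show ?thesis
      proof (rule that[of 1 0 "{0, \<omega>1 / \<mu>1, (\<omega>1 * \<mu>2 - \<beta> * \<omega>2) / D}"])
        fix s t assume A: "s = 0 \<or> \<mu>1 * s\<^sup>2 + \<beta> * t\<^sup>2 = \<omega>1" "t = 0 \<or> \<mu>2 * t\<^sup>2 + \<beta> * s\<^sup>2 = \<omega>2"
        consider "s = 0" | "t = 0" "\<mu>1 * s\<^sup>2 = \<omega>1" | "\<mu>1 * s\<^sup>2 + \<beta> * t\<^sup>2 = \<omega>1" "\<mu>2 * t\<^sup>2 + \<beta> * s\<^sup>2 = \<omega>2"
          using A by auto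
        then have "s\<^sup>2 = 0 \<or> s\<^sup>2 = \<omega>1 / \<mu>1 \<or> s\<^sup>2 = (\<omega>1 * \<mu>2 - \<beta> * \<omega>2) / D"
        proof cases
          case 3
          then have "D * s\<^sup>2 = \<omega>1 * \<mu>2 - \<beta> * \<omega>2" by (rule solve(1))
          then show ?thesis using False by (simp add: field_simps)
        qed (use \<mu>1 in \<open>auto simp: field_simps\<close>)
        then show "1 * s\<^sup>2 + 0 * t\<^sup>2 \<in> {0, \<omega>1 / \<mu>1, (\<omega>1 * \<mu>2 - \<beta> * \<omega>2) / D}" by simp
      qed auto
    next
      case True
      then have \<mu>2: "\<mu>2 \<noteq> 0" using assms by (auto simp: NonDeg_def)
      show ?thesis
      proof (rule that[of 0 1 "{0, \<omega>2 / \<mu>2, (\<mu>1 * \<omega>2 - \<beta> * \<omega>1) / D}"])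
        fix s t assume A: "s = 0 \<or> \<mu>1 * s\<^sup>2 + \<beta> * t\<^sup>2 = \<omega>1" "t = 0 \<or> \<mu>2 * t\<^sup>2 + \<beta> * s\<^sup>2 = \<omega>2"
        consider "t = 0" | "s = 0" "\<mu>2 * t\<^sup>2 = \<omega>2" | "\<mu>1 * s\<^sup>2 + \<beta> * t\<^sup>2 = \<omega>1" "\<mu>2 * t\<^sup>2 + \<beta> * s\<^sup>2 = \<omega>2"
          using A by auto
        then have "t\<^sup>2 = 0 \<or> t\<^sup>2 = \<omega>2 / \<mu>2 \<or> t\<^sup>2 = (\<mu>1 * \<omega>2 - \<beta> * \<omega>1) / D"
        proof cases
          case 3
          then have "D * t\<^sup>2 = \<mu>1 * \<omega>2 - \<beta> * \<omega>1" by (rule solve(2))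
          then show ?thesis using False by (simp add: field_simps)
        qed (use \<mu>2 in \<open>auto simp: field_simps\<close>)
        then show "0 * s\<^sup>2 + 1 * t\<^sup>2 \<in> {0, \<omega>2 / \<mu>2, (\<mu>1 * \<omega>2 - \<beta> * \<omega>1) / D}" by simp
      qed auto
    qed
  next
    case True
    then have \<beta>: "\<beta>\<^sup>2 = \<mu>1 * \<mu>2" by (simp add: D_def)
    then have pos: "0 \<le> \<mu>1 * \<mu>2" by (metis zero_le_power2)
    have root: "\<bar>\<beta>\<bar> = sqrt (\<mu>1 * \<mu>2)" using real_sqrt_abs[of \<beta>] \<beta> by simp
    have "(\<mu>1 > 0 \<and> \<mu>2 > 0 \<and> \<beta> > 0) \<or> (\<mu>1 < 0 \<and> \<mu>2 < 0 \<and> \<beta> < 0)"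
    proof -
      consider "\<mu>1 \<ge> 0" "\<mu>2 \<ge> 0" "\<beta> \<noteq> - sqrt (\<mu>1 * \<mu>2)" | "\<mu>1 \<le> 0" "\<mu>2 \<le> 0" "\<beta> \<noteq> sqrt (\<mu>1 * \<mu>2)"
        using assms pos unfolding NonDeg_def by linarith
      then show ?thesis
      proof cases
        case 1
        then have "\<beta> > 0" using root by linarith
        then have "\<mu>1 * \<mu>2 \<noteq> 0" using \<beta> by auto
        then have "\<mu>1 \<noteq> 0" "\<mu>2 \<noteq> 0" by auto
        then show ?thesis using 1 \<open>\<beta> > 0\<close> by linarith
      next
        case 2
        then have "\<beta> < 0" using root by linarith
        then have "\<mu>1 * \<mu>2 \<noteq> 0" using \<beta> by auto
        then have "\<mu>1 \<noteq> 0" "\<mu>2 \<noteq> 0" by auto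
        then show ?thesis using 2 \<open>\<beta> < 0\<close> by linarith
      qed
    qed
    then obtain \<sigma> :: real where \<sigma>: "\<sigma> * \<mu>1 > 0" "\<sigma> * \<beta> > 0" "\<mu>2 \<noteq> 0"
      using that by (metis linorder_neq_iff mult.left_neutral mult_minus_left neg_0_less_iff_less)
    show ?thesis
    proof (rule that[of "\<sigma> * \<mu>1" "\<sigma> * \<beta>" "{0, \<sigma> * \<omega>1, \<sigma> * \<beta> * (\<omega>2 / \<mu>2)}"])
      fix s t assume A: "s = 0 \<or> \<mu>1 * s\<^sup>2 + \<beta> * t\<^sup>2 = \<omega>1" "t = 0 \<or> \<mu>2 * t\<^sup>2 + \<beta> * s\<^sup>2 = \<omega>2"
      show "\<sigma> * \<mu>1 * s\<^sup>2 + \<sigma> * \<beta> * t\<^sup>2 \<in> {0, \<sigma> * \<omega>1, \<sigma> * \<beta> * (\<omega>2 / \<mu>2)}"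
      proof (cases "s = 0")
        case True
        then have "t = 0 \<or> t\<^sup>2 = \<omega>2 / \<mu>2" using A(2) \<sigma>(3) by (auto simp: field_simps)
        then show ?thesis using True by auto
      next
        case False
        then have "\<mu>1 * s\<^sup>2 + \<beta> * t\<^sup>2 = \<omega>1" using A(1) by simp
        then have "\<sigma> * \<mu>1 * s\<^sup>2 + \<sigma> * \<beta> * t\<^sup>2 = \<sigma> * \<omega>1" by (metis distrib_left mult.assoc)
        then show ?thesis by simp
      qed
    qed (use \<sigma> in auto)
  qed
qed

section \<open>The quartic functional\<close>

lemma square_integrable_product:
  fixes u v :: "'m \<Rightarrow> real"
  assumes "u \<in> borel_measurable M" "v \<in> borel_measurable M"
    "square_integrable M (\<lambda>x. (u x)\<^sup>2)" "square_integrable M (\<lambda>x. (v x)\<^sup>2)"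
  shows "square_integrable M (\<lambda>x. u x * v x)"
proof -
  have "integrable M (\<lambda>x. (u x)\<^sup>2 \<bullet> (v x)\<^sup>2)" by (rule square_integrable_inner[OF assms(3,4)])
  then have "integrable M (\<lambda>x. (norm (u x * v x))\<^sup>2)" by (simp add: power_mult_distrib)
  then show ?thesis using assms(1,2) by (simp add: square_integrable_def)
qed

text \<open>  The inner product is a polynomial in \<open>t\<close> of degree four, and only its linear coefficient counts.\<close>
lemma sqinner_quadratic_curves_derivative:
  fixes p q r p' q' r' :: "'m \<Rightarrow> real"
  assumes S: "square_integrable M p" "square_integrable M q" "square_integrable M r"
    and S': "square_integrable M p'" "square_integrable M q'" "square_integrable M r'"
  shows "((\<lambda>t. sqinner M (\<lambda>x. p x + t * q x + t\<^sup>2 * r x) (\<lambda>x. p' x + t * q' x + t\<^sup>2 * r' x))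
    has_real_derivative (sqinner M p q' + sqinner M q p')) (at 0)"
proof -
  have i: "integrable M (\<lambda>x. f x * g x)" if "square_integrable M f" "square_integrable M g" for f g :: "'m \<Rightarrow> real"
    using square_integrable_inner[OF that] by simp
  note I = i[OF S(1) S'(1)] i[OF S(1) S'(2)] i[OF S(1) S'(3)] i[OF S(2) S'(1)] i[OF S(2) S'(2)] i[OF S(2) S'(3)]
    i[OF S(3) S'(1)] i[OF S(3) S'(2)] i[OF S(3) S'(3)]
  have "sqinner M (\<lambda>x. p x + t * q x + t\<^sup>2 * r x) (\<lambda>x. p' x + t * q' x + t\<^sup>2 * r' x) =
      sqinner M p p' + t * (sqinner M p q' + sqinner M q p') + t^2 * (sqinner M p r' + sqinner M q q' + sqinner M r p')
      + t^3 * (sqinner M q r' + sqinner M r q') + t^4 * sqinner M r r'" for t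
  proof -
    have "(p x + t * q x + t\<^sup>2 * r x) * (p' x + t * q' x + t\<^sup>2 * r' x) =
      p x * p' x + t * (p x * q' x + q x * p' x) + t^2 * (p x * r' x + q x * q' x + r x * p' x)
      + t^3 * (q x * r' x + r x * q' x) + t^4 * (r x * r' x)" for x
      by (simp add: power2_eq_square power3_eq_cube power4_eq_xxxx algebra_simps)
    then show ?thesis unfolding sqinner_def inner_real_def using I by simp
  qed
  then have eq: "(\<lambda>t. sqinner M (\<lambda>x. p x + t * q x + t\<^sup>2 * r x) (\<lambda>x. p' x + t * q' x + t\<^sup>2 * r' x)) =
      (\<lambda>t. sqinner M p p' + t * (sqinner M p q' + sqinner M q p') + t^2 * (sqinner M p r' + sqinner M q q' + sqinner M r p')
      + t^3 * (sqinner M q r' + sqinner M r q') + t^4 * sqinner M r r')" by (intro ext)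
  show ?thesis unfolding eq by (rule derivative_eq_intros refl | simp)+
qed

text \<open>  The integral of \<open>(\<mu> u\<^sup>3 + \<beta> u v\<^sup>2) \<phi>\<close>, arranged as inner products of square-integrable
  functions; this is where \<open>u\<^sup>2\<close>, \<open>v\<^sup>2\<close> and \<open>u \<phi>\<close> are used as elements of \<open>L\<^sup>2\<close>.\<close>
definition cubic_form :: "'m measure \<Rightarrow> real \<Rightarrow> real \<Rightarrow> ('m \<Rightarrow> real) \<Rightarrow> ('m \<Rightarrow> real) \<Rightarrow> ('m \<Rightarrow> real) \<Rightarrow> real" where
  "cubic_form M \<mu> \<beta> u v \<phi> = \<mu> * sqinner M (\<lambda>x. (u x)\<^sup>2) (\<lambda>x. u x * \<phi> x) + \<beta> * sqinner M (\<lambda>x. (v x)\<^sup>2) (\<lambda>x. u x * \<phi> x)"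

lemma cubic_form_integral:
  assumes "square_integrable M (\<lambda>x. (u x :: real)\<^sup>2)" "square_integrable M (\<lambda>x. (v x :: real)\<^sup>2)" "square_integrable M (\<lambda>x. u x * \<phi> x)"
  shows "integrable M (\<lambda>x. (\<mu> * (u x)^3 + \<beta> * u x * (v x)\<^sup>2) * \<phi> x)"
    "(LINT x|M. (\<mu> * (u x)^3 + \<beta> * u x * (v x)\<^sup>2) * \<phi> x) = cubic_form M \<mu> \<beta> u v \<phi>"
proof -
  have eq: "(\<mu> * (u x)^3 + \<beta> * u x * (v x)\<^sup>2) * \<phi> x = \<mu> * ((u x)\<^sup>2 \<bullet> (u x * \<phi> x)) + \<beta> * ((v x)\<^sup>2 \<bullet> (u x * \<phi> x))" for x
    by (simp add: power2_eq_square power3_eq_cube algebra_simps)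
  note I = square_integrable_inner[OF assms(1,3)] square_integrable_inner[OF assms(2,3)]
  show "integrable M (\<lambda>x. (\<mu> * (u x)^3 + \<beta> * u x * (v x)\<^sup>2) * \<phi> x)"
    unfolding eq by (intro Bochner_Integration.integrable_add integrable_mult_right I)
  show "(LINT x|M. (\<mu> * (u x)^3 + \<beta> * u x * (v x)\<^sup>2) * \<phi> x) = cubic_form M \<mu> \<beta> u v \<phi>"
    unfolding eq Bochner_Integration.integral_add[OF integrable_mult_right[OF I(1)] integrable_mult_right[OF I(2)]]
      integral_mult_right_zero cubic_form_def sqinner_def ..
qed

lemma cubic_form_lincomb:
  assumes "square_integrable M (\<lambda>x. (u x :: real)\<^sup>2)" "square_integrable M (\<lambda>x. (v x :: real)\<^sup>2)"
    "square_integrable M (\<lambda>x. u x * \<phi> x)" "square_integrable M (\<lambda>x. u x * \<psi> x)"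
  shows "cubic_form M \<mu> \<beta> u v (\<lambda>x. a * \<phi> x + b * \<psi> x) = a * cubic_form M \<mu> \<beta> u v \<phi> + b * cubic_form M \<mu> \<beta> u v \<psi>"
proof -
  have eq: "(\<lambda>x. u x * (a * \<phi> x + b * \<psi> x)) = (\<lambda>x. a *\<^sub>R (u x * \<phi> x) + b *\<^sub>R (u x * \<psi> x))" by (auto simp: algebra_simps)
  show ?thesis
    unfolding cubic_form_def eq sqinner_commute[of M "\<lambda>x. (u x)\<^sup>2"] sqinner_commute[of M "\<lambda>x. (v x)\<^sup>2"]
      sqinner_lincomb_left[OF assms(3,4,1)] sqinner_lincomb_left[OF assms(3,4,2)]
    by (simp add: algebra_simps)
qed

lemma zero_direction [simp]:
  fixes u v :: "'m \<Rightarrow> real"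
  shows "sqinner M u (\<lambda>x. 0) = 0" "sqnorm M (\<lambda>x. 0 :: real) = 0" "cubic_form M \<mu> \<beta> u v (\<lambda>x. 0) = 0"
  by (simp_all add: sqinner_def sqnorm_def cubic_form_def)

lemma F_functional_eq:
  assumes "square_integrable (lebesgue_on \<Omega>) (\<lambda>x. (u x)\<^sup>2)" "square_integrable (lebesgue_on \<Omega>) (\<lambda>x. (v x)\<^sup>2)"
  shows "F_functional \<Omega> \<mu>1 \<mu>2 \<beta> (u, v) = 1/4 * (\<mu>1 * sqinner (lebesgue_on \<Omega>) (\<lambda>x. (u x)\<^sup>2) (\<lambda>x. (u x)\<^sup>2) +
    2 * \<beta> * sqinner (lebesgue_on \<Omega>) (\<lambda>x. (u x)\<^sup>2) (\<lambda>x. (v x)\<^sup>2) + \<mu>2 * sqinner (lebesgue_on \<Omega>) (\<lambda>x. (v x)\<^sup>2) (\<lambda>x. (v x)\<^sup>2))"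
proof -
  let ?M = "lebesgue_on \<Omega>"
  have eq: "\<mu>1 * (u x)^4 + 2 * \<beta> * (u x)\<^sup>2 * (v x)\<^sup>2 + \<mu>2 * (v x)^4 =
      \<mu>1 * ((u x)\<^sup>2 \<bullet> (u x)\<^sup>2) + 2 * \<beta> * ((u x)\<^sup>2 \<bullet> (v x)\<^sup>2) + \<mu>2 * ((v x)\<^sup>2 \<bullet> (v x)\<^sup>2)" for x
    by (simp add: power2_eq_square power4_eq_xxxx)
  note I = square_integrable_inner[OF assms(1) assms(1)] square_integrable_inner[OF assms] square_integrable_inner[OF assms(2) assms(2)]
  have "(LINT x|?M. \<mu>1 * (u x)^4 + 2 * \<beta> * (u x)\<^sup>2 * (v x)\<^sup>2 + \<mu>2 * (v x)^4) =
    \<mu>1 * sqinner ?M (\<lambda>x. (u x)\<^sup>2) (\<lambda>x. (u x)\<^sup>2) + 2 * \<beta> * sqinner ?M (\<lambda>x. (u x)\<^sup>2) (\<lambda>x. (v x)\<^sup>2) + \<mu>2 * sqinner ?M (\<lambda>x. (v x)\<^sup>2) (\<lambda>x. (v x)\<^sup>2)"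
    unfolding eq sqinner_def
      Bochner_Integration.integral_add[OF Bochner_Integration.integrable_add[OF integrable_mult_right[OF I(1)] integrable_mult_right[OF I(2)]] integrable_mult_right[OF I(3)]]
      Bochner_Integration.integral_add[OF integrable_mult_right[OF I(1)] integrable_mult_right[OF I(2)]] integral_mult_right_zero ..
  then show ?thesis unfolding F_functional_def by simp
qed

text \<open>  The Euler equation of a point that is critical without an energy constraint contains no derivatives,
  and the fundamental lemma turns it into a pointwise identity.\<close>
lemma critical_point_pointwise:
  fixes u v :: "'a::euclidean_space \<Rightarrow> real"
  assumes \<Omega>: "open \<Omega>" and u: "square_integrable (lebesgue_on \<Omega>) u"
    and sq: "square_integrable (lebesgue_on \<Omega>) (\<lambda>x. (u x)\<^sup>2)" "square_integrable (lebesgue_on \<Omega>) (\<lambda>x. (v x)\<^sup>2)"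
    and crit: "\<And>\<phi>. \<phi> \<in> test_functions \<Omega> \<Longrightarrow> cubic_form (lebesgue_on \<Omega>) \<mu> \<beta> u v \<phi> = \<omega> * sqinner (lebesgue_on \<Omega>) u \<phi>"
  shows "AE x in lebesgue_on \<Omega>. u x = 0 \<or> \<mu> * (u x)\<^sup>2 + \<beta> * (v x)\<^sup>2 = \<omega>"
proof -
  let ?M = "lebesgue_on \<Omega>"
  let ?f = "\<lambda>x. (\<mu> * (u x)^3 + \<beta> * u x * (v x)\<^sup>2) - \<omega> * u x"
  have [measurable]: "u \<in> borel_measurable ?M" "(\<lambda>x. (v x)\<^sup>2) \<in> borel_measurable ?M"
    using u sq(2) by (auto dest: square_integrable_measurable)
  have "AE x in ?M. ?f x = 0"
  proof (rule fundamental_lemma_calculus_of_variations[OF \<Omega>])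
    show "?f \<in> borel_measurable ?M" by measurable
  next
    fix a b :: 'a assume ab: "cbox a b \<subseteq> \<Omega>"
    have i: "integrable ?M (\<lambda>x. \<mu> * (u x \<bullet> (u x)\<^sup>2) + \<beta> * (u x \<bullet> (v x)\<^sup>2))"
      by (intro Bochner_Integration.integrable_add integrable_mult_right square_integrable_inner u sq)
    have m: "cbox a b \<in> sets ?M" using ab \<Omega> by (auto simp: sets_restrict_space_iff)
    have "integrable ?M (\<lambda>x. indicator (cbox a b) x *\<^sub>R (\<mu> * (u x \<bullet> (u x)\<^sup>2) + \<beta> * (u x \<bullet> (v x)\<^sup>2)))"
      by (rule integrable_mult_indicator[OF m i])
    moreover have "square_integrable ?M (indicator (cbox a b) :: 'a \<Rightarrow> real)"
      using \<Omega> ab square_integrable_indicator_cbox by (subst sqnorm_lebesgue_on_eq_lborel) (auto simp: indicator_def)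
    from integrable_mult_right[OF square_integrable_inner[OF this u], of \<omega>]
    have "integrable ?M (\<lambda>x. \<omega> * (indicator (cbox a b) x \<bullet> u x))" .
    ultimately have "integrable ?M (\<lambda>x. indicator (cbox a b) x *\<^sub>R (\<mu> * (u x \<bullet> (u x)\<^sup>2) + \<beta> * (u x \<bullet> (v x)\<^sup>2)) - \<omega> * (indicator (cbox a b) x \<bullet> u x))"
      by (rule Bochner_Integration.integrable_diff)
    moreover have "indicator (cbox a b) x *\<^sub>R (\<mu> * (u x \<bullet> (u x)\<^sup>2) + \<beta> * (u x \<bullet> (v x)\<^sup>2)) - \<omega> * (indicator (cbox a b) x \<bullet> u x)
        = indicator (cbox a b) x * ?f x" for x
      by (simp add: power2_eq_square power3_eq_cube algebra_simps)
    ultimately show "integrable ?M (\<lambda>x. indicator (cbox a b) x * ?f x)" by (simp only:)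
  next
    fix \<phi> assume \<phi>: "\<phi> \<in> test_functions \<Omega>"
    have t: "(\<lambda>x. \<phi> x * \<phi> x) \<in> test_functions \<Omega>" by (intro test_functions_mult \<phi> test_functions_tcd[OF \<phi>])
    note T = test_function_square_integrable_on[OF \<phi> \<Omega>]
    have "square_integrable ?M (\<lambda>x. (\<phi> x)\<^sup>2)"
      using test_function_square_integrable_on(1)[OF t \<Omega>] by (simp add: power2_eq_square)
    then have u\<phi>: "square_integrable ?M (\<lambda>x. u x * \<phi> x)"
      by (intro square_integrable_product sq square_integrable_measurable[OF u] square_integrable_measurable[OF T(1)])
    note C = cubic_form_integral[OF sq u\<phi>, of \<mu> \<beta>]
    have i: "integrable ?M (\<lambda>x. \<omega> * (u x \<bullet> \<phi> x))" by (rule integrable_mult_right[OF square_integrable_inner[OF u T(1)]])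
    have "?f x * \<phi> x = (\<mu> * (u x)^3 + \<beta> * u x * (v x)\<^sup>2) * \<phi> x - \<omega> * (u x \<bullet> \<phi> x)" for x by (simp add: algebra_simps)
    then have "(LINT x|?M. ?f x * \<phi> x) = cubic_form ?M \<mu> \<beta> u v \<phi> - \<omega> * sqinner ?M u \<phi>"
      by (simp only: Bochner_Integration.integral_diff[OF C(1) i] C(2) integral_mult_right_zero sqinner_def)
    then show "(LINT x|?M. ?f x * \<phi> x) = 0" using crit[OF \<phi>] by simp
  qed
  then show ?thesis
  proof eventually_elim
    case (elim x)
    have "u x * (\<mu> * (u x)\<^sup>2 + \<beta> * (v x)\<^sup>2 - \<omega>) = 0"
      using elim by (simp add: power2_eq_square power3_eq_cube algebra_simps)
    then show ?case by simp
  qed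
qed

context nonneg_potential
begin

lemma test_function_ES:
  assumes V: "continuous_on \<Omega> V" and \<phi>: "\<phi> \<in> test_functions \<Omega>"
  shows "\<phi> \<in> ES"
proof -
  note T = test_function_square_integrable_on[OF \<phi> open_domain]
  obtain K where K: "compact K" "K \<subseteq> \<Omega>" "\<And>x. x \<notin> K \<Longrightarrow> \<phi> x = 0" by (rule test_functions_support[OF \<phi>]) blast
  have "compact (V ` K)" by (rule compact_continuous_image[OF continuous_on_subset[OF V K(2)] K(1)])
  then obtain C where C: "\<And>x. x \<in> K \<Longrightarrow> norm (V x) \<le> C" using compact_imp_bounded bounded_iff by (metis imageI)
  have le: "norm (V x * (\<phi> x)\<^sup>2) \<le> norm (C * (norm (\<phi> x))\<^sup>2)" for x
  proof (cases "x \<in> K")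
    case True
    have "norm (V x * (\<phi> x)\<^sup>2) \<le> C * (\<phi> x)\<^sup>2"
      unfolding norm_mult using C[OF True] by (simp add: mult_right_mono)
    also have "\<dots> \<le> norm (C * (norm (\<phi> x))\<^sup>2)" by simp
    finally show ?thesis .
  qed (simp add: K(3))
  have "integrable M (\<lambda>x. V x * (\<phi> x)\<^sup>2)"
  proof (rule Bochner_Integration.integrable_bound)
    show "integrable M (\<lambda>x. C * (norm (\<phi> x))\<^sup>2)" by (rule integrable_mult_right[OF square_integrable_integrable[OF T(1)]])
    show "(\<lambda>x. V x * (\<phi> x)\<^sup>2) \<in> borel_measurable M"
      by (intro borel_measurable_times borel_measurable_power V_measurable square_integrable_measurable[OF T(1)])
  qed (use le in auto)
  from Bochner_Integration.integrable_add[OF square_integrable_integrable[OF H1D(3)[OF test_function_H1(1)[OF open_domain \<phi>]]] this]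
  show ?thesis unfolding energy_space_def using test_function_H10[OF open_domain \<phi>] by simp
qed

lemma ES_product_square_integrable:
  assumes "DIM('a) \<le> 3" "u \<in> ES" "\<phi> \<in> ES"
  shows "square_integrable M (\<lambda>x. u x * \<phi> x)"
  by (intro square_integrable_product ES_square_square_integrable assms square_integrable_measurable ES_D(4))

section \<open>Curves of constant mass\<close>

text \<open>  The line through \<open>u\<close> in direction \<open>\<phi>\<close>, rescaled to mass \<open>\<rho>\<close>. For \<open>\<phi>\<close> orthogonal to \<open>u\<close>
  the mass on the line is \<open>\<rho> + t\<^sup>2\<close> times that of \<open>\<phi>\<close>, so the scaling factor has no first-order
  term at \<open>t = 0\<close>.\<close>
definition mass_curve :: "real \<Rightarrow> ('a \<Rightarrow> real) \<Rightarrow> ('a \<Rightarrow> real) \<Rightarrow> real \<Rightarrow> 'a \<Rightarrow> real" where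
  "mass_curve \<rho> u \<phi> t x = sqrt (\<rho> / (\<rho> + t\<^sup>2 * sqnorm M \<phi>)) * (u x + t * \<phi> x)"

lemma mass_curve:
  assumes \<rho>: "\<rho> > 0" "sqnorm M u = \<rho>" and u: "u \<in> ES" and \<phi>: "\<phi> \<in> ES" "sqinner M u \<phi> = 0"
  shows "mass_curve \<rho> u \<phi> t \<in> ES" "sqnorm M (mass_curve \<rho> u \<phi> t) = \<rho>"
    "energy \<Omega> V (mass_curve \<rho> u \<phi> t) =
      \<rho> / (\<rho> + t\<^sup>2 * sqnorm M \<phi>) * (energy \<Omega> V u + 2 * t * energy_form u \<phi> + t\<^sup>2 * energy \<Omega> V \<phi>)"
proof -
  let ?s = "sqrt (\<rho> / (\<rho> + t\<^sup>2 * sqnorm M \<phi>))"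
  have den: "\<rho> + t\<^sup>2 * sqnorm M \<phi> > 0" using \<rho>(1) by (intro add_pos_nonneg) auto
  have s: "?s\<^sup>2 = \<rho> / (\<rho> + t\<^sup>2 * sqnorm M \<phi>)" using den \<rho>(1) by simp
  have eq: "mass_curve \<rho> u \<phi> t = (\<lambda>x. ?s * (1 * u x + t * \<phi> x))" by (auto simp: mass_curve_def)
  note L = ES_lincomb[OF u \<phi>(1), of 1 t]
  show "mass_curve \<rho> u \<phi> t \<in> ES" unfolding eq by (rule ES_scale(1)[OF L(1)])
  have "sqnorm M (\<lambda>x. 1 *\<^sub>R u x + t *\<^sub>R \<phi> x) = \<rho> + t\<^sup>2 * sqnorm M \<phi>"
    unfolding sqnorm_lincomb[OF ES_D(4)[OF u] ES_D(4)[OF \<phi>(1)]] using \<rho>(2) \<phi>(2) by simp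
  then show "sqnorm M (mass_curve \<rho> u \<phi> t) = \<rho>" unfolding eq sqnorm_mult s using den by simp
  show "energy \<Omega> V (mass_curve \<rho> u \<phi> t) =
      \<rho> / (\<rho> + t\<^sup>2 * sqnorm M \<phi>) * (energy \<Omega> V u + 2 * t * energy_form u \<phi> + t\<^sup>2 * energy \<Omega> V \<phi>)"
    unfolding eq ES_scale(2)[OF L(1)] s L(2) by simp
qed

lemma mass_curve_square:
  assumes "\<rho> > 0"
  shows "(mass_curve \<rho> u \<phi> t x)\<^sup>2 = \<rho> / (\<rho> + t\<^sup>2 * sqnorm M \<phi>) * ((u x)\<^sup>2 + t * (2 * (u x * \<phi> x)) + t\<^sup>2 * (\<phi> x)\<^sup>2)"
proof -
  have den: "\<rho> + t\<^sup>2 * sqnorm M \<phi> > 0" using assms by (intro add_pos_nonneg) auto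
  have "(u x + t * \<phi> x)\<^sup>2 = (u x)\<^sup>2 + t * (2 * (u x * \<phi> x)) + t\<^sup>2 * (\<phi> x)\<^sup>2"
    by (simp add: power2_eq_square algebra_simps)
  then show ?thesis unfolding mass_curve_def power_mult_distrib using den assms by simp
qed

lemma mass_factor_derivative:
  "\<rho> > 0 \<Longrightarrow> ((\<lambda>t. \<rho> / (\<rho> + t\<^sup>2 * m)) has_real_derivative 0) (at 0)"
  by (auto intro!: derivative_eq_intros)

lemma energy_curve_derivative:
  assumes \<rho>: "\<rho> > 0" "sqnorm M u = \<rho>" and u: "u \<in> ES" and \<phi>: "\<phi> \<in> ES" "sqinner M u \<phi> = 0"
  shows "((\<lambda>t. energy \<Omega> V (mass_curve \<rho> u \<phi> t)) has_real_derivative 2 * energy_form u \<phi>) (at 0)"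
  unfolding mass_curve(3)[OF assms]
  by (rule derivative_eq_intros mass_factor_derivative[OF \<rho>(1)] refl | use \<rho>(1) in simp)+

text \<open>  Subtracting a multiple of \<open>u\<close> moves any direction to the tangent space; the multiplier of the mass
  constraint is \<open>L u / \<rho>\<close>.\<close>
lemma tangent_kernel:
  assumes \<rho>: "\<rho> > 0" "sqnorm M u = \<rho>" and u: "u \<in> ES"
    and lin: "\<And>a b \<phi> \<psi>. \<phi> \<in> ES \<Longrightarrow> \<psi> \<in> ES \<Longrightarrow> L (\<lambda>x. a * \<phi> x + b * \<psi> x) = a * L \<phi> + b * L \<psi>"
    and tan: "\<And>\<phi>. \<phi> \<in> ES \<Longrightarrow> sqinner M u \<phi> = 0 \<Longrightarrow> L \<phi> = (0::real)" and \<phi>: "\<phi> \<in> ES"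
  shows "L \<phi> = L u / \<rho> * sqinner M u \<phi>"
proof -
  define c where "c = sqinner M u \<phi> / \<rho>"
  have ES: "(\<lambda>x. 1 * \<phi> x + (-c) * u x) \<in> ES" by (rule ES_lincomb(1)[OF \<phi> u])
  have "sqinner M (\<lambda>x. 1 *\<^sub>R \<phi> x + (-c) *\<^sub>R u x) u = 1 * sqinner M \<phi> u + (-c) * sqinner M u u"
    by (rule sqinner_lincomb_left[OF ES_D(4)[OF \<phi>] ES_D(4)[OF u] ES_D(4)[OF u]])
  also have "\<dots> = 0" using \<rho> by (simp add: c_def sqinner_commute[of M \<phi>] sqnorm_eq_sqinner[symmetric])
  finally have "sqinner M u (\<lambda>x. 1 * \<phi> x + (-c) * u x) = 0" by (simp add: sqinner_commute[of M u])
  from tan[OF ES this] have "L \<phi> = c * L u" unfolding lin[OF \<phi> u] by simp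
  then show ?thesis by (simp add: c_def)
qed

lemma cubic_form_ES_lincomb:
  assumes dim: "DIM('a) \<le> 3" and "u \<in> ES" "square_integrable M (\<lambda>x. (v x)\<^sup>2)" "\<phi> \<in> ES" "\<psi> \<in> ES"
  shows "cubic_form M \<mu> \<beta> u v (\<lambda>x. a * \<phi> x + b * \<psi> x) = a * cubic_form M \<mu> \<beta> u v \<phi> + b * cubic_form M \<mu> \<beta> u v \<psi>"
  by (intro cubic_form_lincomb ES_square_square_integrable ES_product_square_integrable assms)

lemma sqinner_tangent_lincomb:
  assumes "u \<in> ES" "\<phi> \<in> ES" "\<psi> \<in> ES"
  shows "sqinner M u (\<lambda>x. a * \<phi> x + b * \<psi> x) = a * sqinner M u \<phi> + b * sqinner M u \<psi>"
  using sqinner_lincomb_left[OF ES_D(4)[OF assms(2)] ES_D(4)[OF assms(3)] ES_D(4)[OF assms(1)], of a b]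
  by (simp add: sqinner_commute[of M u])

section \<open>Normalised solutions and the principal eigenvalue\<close>

lemma mass_eq_sqnorm: "mass \<Omega> u = sqnorm M u"
  by (simp add: mass_def sqnorm_def)

text \<open>  The equation for \<open>u\<close> carries the factor \<open>\<kappa>\<close> in front of the differential operator. Both sides
  are homogeneous, of degrees three and one, and scaling by \<open>sqrt (1 / \<kappa>)\<close> removes the factor.\<close>
lemma multiplier_imp_weak_solution:
  assumes dim: "DIM('a) \<le> 3" and \<rho>: "\<rho> > 0" "sqnorm M u = \<rho>" and u: "u \<in> ES"
    and v: "square_integrable M (\<lambda>x. (v x)\<^sup>2)" and \<kappa>: "\<kappa> > 0"
    and mult: "\<And>\<phi>. \<phi> \<in> ES \<Longrightarrow> sqinner M u \<phi> = 0 \<Longrightarrow> cubic_form M \<mu> \<beta> u v \<phi> = \<kappa> * energy_form u \<phi>"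
  shows "\<exists>\<omega>. weak_solution \<Omega> V \<omega> (\<lambda>x. sqrt (1 / \<kappa>) * u x)
    (\<lambda>x. \<mu> * (sqrt (1 / \<kappa>) * u x) ^ 3 + \<beta> * (sqrt (1 / \<kappa>) * u x) * (sqrt (1 / \<kappa>) * v x)\<^sup>2)"
proof -
  define L where "L \<phi> = cubic_form M \<mu> \<beta> u v \<phi> - \<kappa> * energy_form u \<phi>" for \<phi>
  have L: "L \<phi> = L u / \<rho> * sqinner M u \<phi>" if \<phi>: "\<phi> \<in> ES" for \<phi>
  proof (rule tangent_kernel[OF \<rho> u _ _ \<phi>])
    show "L (\<lambda>x. a * \<phi> x + b * \<psi> x) = a * L \<phi> + b * L \<psi>" if "\<phi> \<in> ES" "\<psi> \<in> ES" for a b \<phi> \<psi>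
      unfolding L_def cubic_form_ES_lincomb[OF dim u v that] energy_form_lincomb[OF that u]
      by (simp add: algebra_simps)
    show "L \<phi> = 0" if "\<phi> \<in> ES" "sqinner M u \<phi> = 0" for \<phi>
      using mult[OF that] by (simp add: L_def)
  qed
  define \<gamma> where "\<gamma> = 1 / \<kappa>"
  have \<gamma>: "\<gamma> * \<kappa> = 1" "(sqrt \<gamma>)\<^sup>2 = \<gamma>" using \<kappa> by (simp_all add: \<gamma>_def)
  have cub: "cubic_form M \<mu> \<beta> (\<lambda>x. sqrt \<gamma> * u x) (\<lambda>x. sqrt \<gamma> * v x) \<phi> = sqrt \<gamma> * (\<gamma> * cubic_form M \<mu> \<beta> u v \<phi>)" for \<phi>
  proof -
    have sc: "sqinner M (\<lambda>x. (sqrt \<gamma> * f x)\<^sup>2) (\<lambda>x. sqrt \<gamma> * u x * \<phi> x) = \<gamma> * sqrt \<gamma> * sqinner M (\<lambda>x. (f x)\<^sup>2) (\<lambda>x. u x * \<phi> x)"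
      for f :: "'a \<Rightarrow> real"
    proof -
      have "(sqrt \<gamma> * f x)\<^sup>2 \<bullet> (sqrt \<gamma> * u x * \<phi> x) = \<gamma> * sqrt \<gamma> * ((f x)\<^sup>2 \<bullet> (u x * \<phi> x))" for x
        unfolding power_mult_distrib \<gamma>(2) by simp
      then show ?thesis unfolding sqinner_def by (simp only: integral_mult_right_zero)
    qed
    show ?thesis unfolding cubic_form_def sc by (simp add: algebra_simps)
  qed
  have sqi: "sqinner M (\<lambda>x. sqrt \<gamma> * u x) \<phi> = sqrt \<gamma> * sqinner M u \<phi>" for \<phi> :: "'a \<Rightarrow> real"
  proof -
    have "(sqrt \<gamma> * u x) \<bullet> \<phi> x = sqrt \<gamma> * (u x \<bullet> \<phi> x)" for x by simp
    then show ?thesis unfolding sqinner_def by (simp only: integral_mult_right_zero)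
  qed
  have U: "(\<lambda>x. sqrt \<gamma> * u x) \<in> ES" by (rule ES_scale(1)[OF u])
  have sv: "square_integrable M (\<lambda>x. (sqrt \<gamma> * v x)\<^sup>2)"
    unfolding power_mult_distrib by (rule square_integrable_mult[OF v])
  have "weak_solution \<Omega> V (\<gamma> * (L u / \<rho>)) (\<lambda>x. sqrt \<gamma> * u x)
      (\<lambda>x. \<mu> * (sqrt \<gamma> * u x) ^ 3 + \<beta> * (sqrt \<gamma> * u x) * (sqrt \<gamma> * v x)\<^sup>2)"
    unfolding weak_solution_def
  proof (intro conjI ballI U)
    fix \<phi> assume \<phi>: "\<phi> \<in> ES"
    note W = weak_form_eq_energy_form[OF U \<phi>, of "\<gamma> * (L u / \<rho>)"]
    note C = cubic_form_integral[OF ES_square_square_integrable[OF dim U] sv ES_product_square_integrable[OF dim U \<phi>], of \<mu> \<beta>]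
    show "integrable M (\<lambda>x. weak_grad \<Omega> (\<lambda>x. sqrt \<gamma> * u x) x \<bullet> weak_grad \<Omega> \<phi> x + (V x + \<gamma> * (L u / \<rho>)) * (sqrt \<gamma> * u x) * \<phi> x)"
      by (rule W(1))
    show "integrable M (\<lambda>x. (\<mu> * (sqrt \<gamma> * u x) ^ 3 + \<beta> * (sqrt \<gamma> * u x) * (sqrt \<gamma> * v x)\<^sup>2) * \<phi> x)"
      by (rule C(1))
    have e: "energy_form (\<lambda>x. sqrt \<gamma> * u x) \<phi> = sqrt \<gamma> * energy_form u \<phi>"
      using energy_form_lincomb[OF u u \<phi>, of "sqrt \<gamma>" 0] by (simp add: energy_form_commute[of _ \<phi>])
    have "cubic_form M \<mu> \<beta> u v \<phi> = \<kappa> * energy_form u \<phi> + L u / \<rho> * sqinner M u \<phi>"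
      using L[OF \<phi>] by (simp add: L_def)
    then have "\<gamma> * cubic_form M \<mu> \<beta> u v \<phi> = \<gamma> * \<kappa> * energy_form u \<phi> + \<gamma> * (L u / \<rho>) * sqinner M u \<phi>"
      by (simp only: distrib_left mult.assoc)
    then show "(LINT x|M. weak_grad \<Omega> (\<lambda>x. sqrt \<gamma> * u x) x \<bullet> weak_grad \<Omega> \<phi> x + (V x + \<gamma> * (L u / \<rho>)) * (sqrt \<gamma> * u x) * \<phi> x) =
        (LINT x|M. (\<mu> * (sqrt \<gamma> * u x) ^ 3 + \<beta> * (sqrt \<gamma> * u x) * (sqrt \<gamma> * v x)\<^sup>2) * \<phi> x)"
      unfolding W(2) C(2) cub e sqi \<gamma>(1) by (simp add: algebra_simps)
  qed
  then show ?thesis unfolding \<gamma>_def by blast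
qed

lemma exists_unit_mass:
  assumes V: "continuous_on \<Omega> V" and ne: "\<Omega> \<noteq> {}"
  shows "\<exists>\<phi>\<in>ES. mass \<Omega> \<phi> = 1"
proof -
  obtain z where z: "z \<in> \<Omega>" using ne by blast
  obtain a b where c: "cbox a b \<subseteq> \<Omega>" and ab: "\<forall>i\<in>Basis. a \<bullet> i < b \<bullet> i"
    by (rule open_contains_cbox[OF open_domain z]) blast
  define \<phi> where "\<phi> = box_bump 1 a b"
  have \<phi>: "\<phi> \<in> test_functions \<Omega>" unfolding \<phi>_def by (rule box_bump_test_function[OF c])
  note T = test_function_square_integrable[OF \<phi>] and N = test_function_square_integrable_on(3)[OF \<phi> open_domain]
  have "sqnorm lborel \<phi> \<noteq> 0"
  proof
    assume "sqnorm lborel \<phi> = 0"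
    then have "AE x in lborel. (norm (\<phi> x))\<^sup>2 = 0"
      unfolding sqnorm_def by (subst (asm) integral_nonneg_eq_0_iff_AE) (use square_integrable_integrable[OF T(1)] in auto)
    then have "AE x in lborel. \<not> x \<in> box a b"
    proof eventually_elim
      case (elim x)
      then show ?case using box_bump_pos[of x a b 1] by (auto simp: \<phi>_def)
    qed
    then have "emeasure lborel (box a b) = 0" using emeasure_eq_0_AE[of "\<lambda>x. x \<in> box a b" lborel] by simp
    moreover have "emeasure lborel (box a b) = ennreal (\<Prod>i\<in>Basis. (b - a) \<bullet> i)"
      using ab by (simp add: emeasure_lborel_box_eq less_imp_le)
    ultimately have "(\<Prod>i\<in>Basis. (b - a) \<bullet> i) \<le> 0" by (simp only: ennreal_eq_0_iff)
    moreover have "0 < (\<Prod>i\<in>Basis. (b - a) \<bullet> i)" using ab by (intro prod_pos) (simp add: inner_diff_left)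
    ultimately show False by linarith
  qed
  then have n: "sqnorm M \<phi> > 0" using N sqnorm_nonneg[of lborel \<phi>] by linarith
  have "(\<lambda>x. 1 / sqrt (sqnorm M \<phi>) * \<phi> x) \<in> ES" by (rule ES_scale(1)[OF test_function_ES[OF V \<phi>]])
  moreover have "mass \<Omega> (\<lambda>x. 1 / sqrt (sqnorm M \<phi>) * \<phi> x) = 1"
  proof -
    have "mass \<Omega> (\<lambda>x. 1 / sqrt (sqnorm M \<phi>) * \<phi> x) = sqnorm M (\<lambda>x. 1 / sqrt (sqnorm M \<phi>) * \<phi> x)"
      by (rule mass_eq_sqnorm)
    also have "\<dots> = (1 / sqrt (sqnorm M \<phi>))\<^sup>2 * sqnorm M \<phi>" by (rule sqnorm_mult)
    also have "\<dots> = 1" using n by (simp add: power_divide)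
    finally show ?thesis .
  qed
  ultimately show ?thesis by blast
qed

lemma principal_eigenvalue_approx:
  assumes V: "continuous_on \<Omega> V" and ne: "\<Omega> \<noteq> {}" and e: "principal_eigenvalue \<Omega> V < e"
  obtains \<phi> where "\<phi> \<in> ES" "sqnorm M \<phi> = 1" "energy \<Omega> V \<phi> < e"
proof -
  have ne: "energy \<Omega> V ` {\<phi> \<in> ES. mass \<Omega> \<phi> = 1} \<noteq> {}" using exists_unit_mass[OF V ne] by blast
  have "Inf (energy \<Omega> V ` {\<phi> \<in> ES. mass \<Omega> \<phi> = 1}) < e" using e by (simp add: principal_eigenvalue_def)
  from cInf_lessD[OF ne this] show ?thesis using that by (auto simp: mass_eq_sqnorm)
qed

text \<open>  The projection to the tangent space of a function of unit mass whose energy is close to the principal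
  eigenvalue.\<close>
lemma constrained_critical_descent_direction:
  assumes V: "continuous_on \<Omega> V" and ne: "\<Omega> \<noteq> {}"
    and \<rho>: "\<rho> > 0" "sqnorm M u = \<rho>" and u: "u \<in> ES"
    and crit: "\<And>\<phi>. \<phi> \<in> ES \<Longrightarrow> sqinner M u \<phi> = 0 \<Longrightarrow> energy_form u \<phi> = 0"
    and large: "principal_eigenvalue \<Omega> V < energy \<Omega> V u / \<rho>"
  obtains \<psi> where "\<psi> \<in> ES" "sqinner M u \<psi> = 0" "energy \<Omega> V \<psi> < energy \<Omega> V u / \<rho> * sqnorm M \<psi>"
proof -
  obtain \<eta> where \<eta>: "\<eta> \<in> ES" "sqnorm M \<eta> = 1" "energy \<Omega> V \<eta> < energy \<Omega> V u / \<rho>"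
    by (rule principal_eigenvalue_approx[OF V ne large]) blast
  define c where "c = sqinner M u \<eta> / \<rho>"
  define l where "l = energy \<Omega> V u / \<rho>"
  have cr: "sqinner M u \<eta> = c * \<rho>" "energy \<Omega> V u = l * \<rho>" using \<rho>(1) by (simp_all add: c_def l_def)
  have "energy_form u \<eta> = energy_form u u / \<rho> * sqinner M u \<eta>"
    by (rule tangent_kernel[OF \<rho> u energy_form_lincomb[OF _ _ u] crit \<eta>(1)])
  then have ef: "energy_form u \<eta> = l * c * \<rho>" using \<rho>(1) by (simp add: energy_form_self cr)
  let ?\<psi> = "\<lambda>x. 1 * \<eta> x + (-c) * u x"
  note L = ES_lincomb[OF \<eta>(1) u, of 1 "-c"]
  show ?thesis
  proof (rule that[OF L(1)])
    show "sqinner M u ?\<psi> = 0"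
      unfolding sqinner_tangent_lincomb[OF u \<eta>(1) u] by (simp add: cr sqnorm_eq_sqinner[symmetric] \<rho>(2))
    have m: "sqnorm M ?\<psi> = 1 - c\<^sup>2 * \<rho>"
      using sqnorm_lincomb[OF ES_D(4)[OF \<eta>(1)] ES_D(4)[OF u], of 1 "-c"]
      by (simp add: \<eta>(2) \<rho>(2) sqinner_commute[of M \<eta>] cr power2_eq_square algebra_simps)
    have E: "energy \<Omega> V ?\<psi> = energy \<Omega> V \<eta> - l * c\<^sup>2 * \<rho>"
      unfolding L(2) energy_form_commute[of \<eta>] ef cr by (simp add: power2_eq_square algebra_simps)
    show "energy \<Omega> V ?\<psi> < energy \<Omega> V u / \<rho> * sqnorm M ?\<psi>"
      using \<eta>(3) unfolding E m l_def[symmetric] by (simp add: algebra_simps)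
  qed
qed

end

section \<open>The coupled problem\<close>

locale coupled_problem = P1: nonneg_potential \<Omega> V1 + P2: nonneg_potential \<Omega> V2
  for \<Omega> :: "'a::euclidean_space set" and V1 V2 :: "'a \<Rightarrow> real" +
  fixes \<mu>1 \<mu>2 \<beta> \<alpha> \<rho>1 \<rho>2 :: real
  assumes dim: "DIM('a) \<le> 3" and nonempty: "\<Omega> \<noteq> {}"
    and cont1: "continuous_on \<Omega> V1" and cont2: "continuous_on \<Omega> V2"
    and conf1: "bounded \<Omega> \<or> (\<Omega> = UNIV \<and> filterlim V1 at_top at_infinity)"
    and conf2: "bounded \<Omega> \<or> (\<Omega> = UNIV \<and> filterlim V2 at_top at_infinity)"
    and nondeg: "NonDeg \<mu>1 \<mu>2 \<beta>"
    and \<rho>1: "\<rho>1 > 0" and \<rho>2: "\<rho>2 > 0"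
    and \<alpha>: "\<alpha> > principal_eigenvalue \<Omega> V1 * \<rho>1 + principal_eigenvalue \<Omega> V2 * \<rho>2"
begin

abbreviation "M \<equiv> lebesgue_on \<Omega>"
abbreviation "F \<equiv> F_functional \<Omega> \<mu>1 \<mu>2 \<beta>"
abbreviation "E1 \<equiv> energy \<Omega> V1"
abbreviation "E2 \<equiv> energy \<Omega> V2"

definition relaxed :: "(('a \<Rightarrow> real) \<times> ('a \<Rightarrow> real)) set" where
  "relaxed = {(u1, u2). u1 \<in> P1.ES \<and> u2 \<in> P2.ES \<and> sqnorm M u1 = \<rho>1 \<and> sqnorm M u2 = \<rho>2 \<and> E1 u1 + E2 u2 \<le> \<alpha>}"

definition tangent :: "('a \<Rightarrow> real) \<Rightarrow> ('a \<Rightarrow> real) \<Rightarrow> ('a \<Rightarrow> real) \<Rightarrow> ('a \<Rightarrow> real) \<Rightarrow> bool" where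
  "tangent u1 u2 \<phi>1 \<phi>2 \<longleftrightarrow> \<phi>1 \<in> P1.ES \<and> \<phi>2 \<in> P2.ES \<and> sqinner M u1 \<phi>1 = 0 \<and> sqinner M u2 \<phi>2 = 0"

text \<open>  The derivative of \<open>F\<close> in the direction \<open>(\<phi>1, \<phi>2)\<close>. The form \<open>dE\<close> below is half the derivative
  of the total energy.\<close>
definition dF :: "('a \<Rightarrow> real) \<Rightarrow> ('a \<Rightarrow> real) \<Rightarrow> ('a \<Rightarrow> real) \<Rightarrow> ('a \<Rightarrow> real) \<Rightarrow> real" where
  "dF u1 u2 \<phi>1 \<phi>2 = cubic_form M \<mu>1 \<beta> u1 u2 \<phi>1 + cubic_form M \<mu>2 \<beta> u2 u1 \<phi>2"

definition dE :: "('a \<Rightarrow> real) \<Rightarrow> ('a \<Rightarrow> real) \<Rightarrow> ('a \<Rightarrow> real) \<Rightarrow> ('a \<Rightarrow> real) \<Rightarrow> real" where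
  "dE u1 u2 \<phi>1 \<phi>2 = P1.energy_form u1 \<phi>1 + P2.energy_form u2 \<phi>2"

lemma relaxedD:
  assumes "(u1, u2) \<in> relaxed"
  shows "u1 \<in> P1.ES" "u2 \<in> P2.ES" "sqnorm M u1 = \<rho>1" "sqnorm M u2 = \<rho>2" "E1 u1 + E2 u2 \<le> \<alpha>"
  using assms by (auto simp: relaxed_def)

text \<open>  If the derivative of \<open>F\<close> vanishes in all tangent directions, the pointwise equations leave finitely
  many values for a nontrivial combination of the squares, which is then zero, against the positive
  masses. The extensions by zero satisfy the same equations outside \<open>\<Omega>\<close>.\<close>
lemma free_critical_point_impossible:
  assumes u: "u1 \<in> P1.ES" "u2 \<in> P2.ES" "sqnorm M u1 = \<rho>1" "sqnorm M u2 = \<rho>2"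
    and c1: "\<And>\<phi>. \<phi> \<in> P1.ES \<Longrightarrow> sqinner M u1 \<phi> = 0 \<Longrightarrow> cubic_form M \<mu>1 \<beta> u1 u2 \<phi> = 0"
    and c2: "\<And>\<phi>. \<phi> \<in> P2.ES \<Longrightarrow> sqinner M u2 \<phi> = 0 \<Longrightarrow> cubic_form M \<mu>2 \<beta> u2 u1 \<phi> = 0"
  shows False
proof -
  have \<Omega>s: "\<Omega> \<in> sets lebesgue" using P1.open_domain by simp
  note S1 = P1.ES_square_square_integrable[OF dim u(1)] and S2 = P2.ES_square_square_integrable[OF dim u(2)]
  define \<omega>1 where "\<omega>1 = cubic_form M \<mu>1 \<beta> u1 u2 u1 / \<rho>1"
  define \<omega>2 where "\<omega>2 = cubic_form M \<mu>2 \<beta> u2 u1 u2 / \<rho>2"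
  have k1: "cubic_form M \<mu>1 \<beta> u1 u2 \<phi> = \<omega>1 * sqinner M u1 \<phi>" if "\<phi> \<in> P1.ES" for \<phi>
    unfolding \<omega>1_def by (rule P1.tangent_kernel[OF \<rho>1 u(3,1) P1.cubic_form_ES_lincomb[OF dim u(1) S2] c1 that])
  have k2: "cubic_form M \<mu>2 \<beta> u2 u1 \<phi> = \<omega>2 * sqinner M u2 \<phi>" if "\<phi> \<in> P2.ES" for \<phi>
    unfolding \<omega>2_def by (rule P2.tangent_kernel[OF \<rho>2 u(4,2) P2.cubic_form_ES_lincomb[OF dim u(2) S1] c2 that])
  have A1: "AE x in M. u1 x = 0 \<or> \<mu>1 * (u1 x)\<^sup>2 + \<beta> * (u2 x)\<^sup>2 = \<omega>1"
    by (rule critical_point_pointwise[OF P1.open_domain P1.ES_D(4)[OF u(1)] S1 S2 k1[OF P1.test_function_ES[OF cont1]]])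
  have A2: "AE x in M. u2 x = 0 \<or> \<mu>2 * (u2 x)\<^sup>2 + \<beta> * (u1 x)\<^sup>2 = \<omega>2"
    by (rule critical_point_pointwise[OF P1.open_domain P2.ES_D(4)[OF u(2)] S2 S1 k2[OF P2.test_function_ES[OF cont2]]])
  obtain w1 where w1: "square_integrable lborel w1" "AE x in M. w1 x = u1 x" "AE x in lborel. x \<notin> \<Omega> \<longrightarrow> w1 x = 0"
    "\<And>h. sqnorm lborel (\<lambda>x. w1 (x + h) - w1 x) \<le> (norm h)\<^sup>2 * sqnorm M (weak_grad \<Omega> u1)"
    by (rule H10_zero_extension[OF P1.open_domain P1.ES_D(1)[OF u(1)]]) blast
  obtain w2 where w2: "square_integrable lborel w2" "AE x in M. w2 x = u2 x" "AE x in lborel. x \<notin> \<Omega> \<longrightarrow> w2 x = 0"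
    "\<And>h. sqnorm lborel (\<lambda>x. w2 (x + h) - w2 x) \<le> (norm h)\<^sup>2 * sqnorm M (weak_grad \<Omega> u2)"
    by (rule H10_zero_extension[OF P1.open_domain P2.ES_D(1)[OF u(2)]]) blast
  obtain a b S where abS: "a \<ge> 0" "b \<ge> 0" "a > 0 \<or> b > 0" "finite S"
    "\<And>s t. s = 0 \<or> \<mu>1 * s\<^sup>2 + \<beta> * t\<^sup>2 = \<omega>1 \<Longrightarrow> t = 0 \<or> \<mu>2 * t\<^sup>2 + \<beta> * s\<^sup>2 = \<omega>2 \<Longrightarrow> a * s\<^sup>2 + b * t\<^sup>2 \<in> S"
    by (rule NonDeg_finitely_many_values[OF nondeg, of \<omega>1 \<omega>2]) blast
  have "AE x in M. a * (w1 x)\<^sup>2 + b * (w2 x)\<^sup>2 \<in> S"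
    using A1 A2 w1(2) w2(2)
  proof eventually_elim
    case (elim x)
    show ?case by (rule abS(5)) (use elim in auto)
  qed
  then have "AE x in lebesgue. x \<in> \<Omega> \<longrightarrow> a * (w1 x)\<^sup>2 + b * (w2 x)\<^sup>2 \<in> S" using \<Omega>s by (simp add: AE_restrict_space_iff)
  then have "AE x in lborel. x \<in> \<Omega> \<longrightarrow> a * (w1 x)\<^sup>2 + b * (w2 x)\<^sup>2 \<in> S" by (simp add: AE_completion_iff)
  then have "AE x in lborel. a * (w1 x)\<^sup>2 + b * (w2 x)\<^sup>2 \<in> S"
    using w1(3) w2(3)
  proof eventually_elim
    case (elim x)
    show ?case
    proof (cases "x \<in> \<Omega>")
      case False
      then show ?thesis using elim abS(5)[of 0 0] by simp
    qed (use elim in simp)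
  qed
  from finitely_valued_quadratic_AE_zero[OF w1(1) w2(1) w1(4) w2(4) abS(1,2) sqnorm_nonneg sqnorm_nonneg abS(4) this]
  have z: "AE x in lborel. a * (w1 x)\<^sup>2 + b * (w2 x)\<^sup>2 = 0" .
  have "AE x in lebesgue. a * (w1 x)\<^sup>2 + b * (w2 x)\<^sup>2 = 0" by (rule AE_completion[OF z])
  then have "AE x in lebesgue. x \<in> \<Omega> \<longrightarrow> a * (w1 x)\<^sup>2 + b * (w2 x)\<^sup>2 = 0" by eventually_elim simp
  then have zM: "AE x in M. a * (w1 x)\<^sup>2 + b * (w2 x)\<^sup>2 = 0" using \<Omega>s by (simp add: AE_restrict_space_iff)
  have null: "sqnorm M f = 0" if "square_integrable M f" "AE x in M. f x = 0" for f :: "'a \<Rightarrow> real"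
    using sqnorm_cong_AE[of f M "\<lambda>x. 0"] square_integrable_measurable[OF that(1)] that(2) by (simp add: sqnorm_def)
  from abS(3) show False
  proof
    assume a: "a > 0"
    have "AE x in M. u1 x = 0"
      using zM w1(2)
    proof eventually_elim
      case (elim x)
      have "a * (w1 x)\<^sup>2 \<le> 0" using elim(1) mult_nonneg_nonneg[OF abS(2) zero_le_power2[of "w2 x"]] by linarith
      then show ?case using a elim(2) by (simp add: mult_le_0_iff)
    qed
    from null[OF P1.ES_D(4)[OF u(1)] this] show False using u(3) \<rho>1 by simp
  next
    assume b: "b > 0"
    have "AE x in M. u2 x = 0"
      using zM w2(2)
    proof eventually_elim
      case (elim x)
      have "b * (w2 x)\<^sup>2 \<le> 0" using elim(1) mult_nonneg_nonneg[OF abS(1) zero_le_power2[of "w1 x"]] by linarith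
      then show ?case using b elim(2) by (simp add: mult_le_0_iff)
    qed
    from null[OF P2.ES_D(4)[OF u(2)] this] show False using u(4) \<rho>2 by simp
  qed
qed

lemma dF_nonzero:
  assumes u: "u1 \<in> P1.ES" "u2 \<in> P2.ES" "sqnorm M u1 = \<rho>1" "sqnorm M u2 = \<rho>2"
    and z: "\<And>\<phi>1 \<phi>2. tangent u1 u2 \<phi>1 \<phi>2 \<Longrightarrow> dF u1 u2 \<phi>1 \<phi>2 = 0"
  shows False
proof (rule free_critical_point_impossible[OF u])
  show "cubic_form M \<mu>1 \<beta> u1 u2 \<phi> = 0" if "\<phi> \<in> P1.ES" "sqinner M u1 \<phi> = 0" for \<phi>
    using z[of \<phi> "\<lambda>x. 0"] that P2.ES_zero[OF u(2)] by (simp add: tangent_def dF_def)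
  show "cubic_form M \<mu>2 \<beta> u2 u1 \<phi> = 0" if "\<phi> \<in> P2.ES" "sqinner M u2 \<phi> = 0" for \<phi>
    using z[of "\<lambda>x. 0" \<phi>] that P1.ES_zero[OF u(1)] by (simp add: tangent_def dF_def)
qed

lemma F_curve_derivative:
  assumes u: "u1 \<in> P1.ES" "u2 \<in> P2.ES" and \<phi>: "\<phi>1 \<in> P1.ES" "\<phi>2 \<in> P2.ES"
    and t: "sqnorm M u1 = \<rho>1" "sqnorm M u2 = \<rho>2" "sqinner M u1 \<phi>1 = 0" "sqinner M u2 \<phi>2 = 0"
  shows "((\<lambda>t. F (P1.mass_curve \<rho>1 u1 \<phi>1 t, P2.mass_curve \<rho>2 u2 \<phi>2 t)) has_real_derivative dF u1 u2 \<phi>1 \<phi>2) (at 0)"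
proof -
  let ?v1 = "P1.mass_curve \<rho>1 u1 \<phi>1" and ?v2 = "P2.mass_curve \<rho>2 u2 \<phi>2"
  define A1 where "A1 t = \<rho>1 / (\<rho>1 + t\<^sup>2 * sqnorm M \<phi>1)" for t
  define A2 where "A2 t = \<rho>2 / (\<rho>2 + t\<^sup>2 * sqnorm M \<phi>2)" for t
  define q1 where "q1 t x = (u1 x)\<^sup>2 + t * (2 * (u1 x * \<phi>1 x)) + t\<^sup>2 * (\<phi>1 x)\<^sup>2" for t x
  define q2 where "q2 t x = (u2 x)\<^sup>2 + t * (2 * (u2 x * \<phi>2 x)) + t\<^sup>2 * (\<phi>2 x)\<^sup>2" for t x
  have DA: "(A1 has_real_derivative 0) (at 0)" "(A2 has_real_derivative 0) (at 0)"
    unfolding A1_def[abs_def] A2_def[abs_def]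
    using P1.mass_factor_derivative[OF \<rho>1] P1.mass_factor_derivative[OF \<rho>2] by auto
  have A0: "A1 0 = 1" "A2 0 = 1" using \<rho>1 \<rho>2 by (simp_all add: A1_def A2_def)
  note S = P1.ES_square_square_integrable[OF dim u(1)] P2.ES_square_square_integrable[OF dim u(2)]
    P1.ES_square_square_integrable[OF dim \<phi>(1)] P2.ES_square_square_integrable[OF dim \<phi>(2)]
  have p: "square_integrable M (\<lambda>x. 2 * (u1 x * \<phi>1 x))" "square_integrable M (\<lambda>x. 2 * (u2 x * \<phi>2 x))"
    by (intro square_integrable_mult P1.ES_product_square_integrable[OF dim u(1) \<phi>(1)]
        P2.ES_product_square_integrable[OF dim u(2) \<phi>(2)])+
  have two: "sqinner M f (\<lambda>x. 2 * g x) = 2 * sqinner M f g" "sqinner M (\<lambda>x. 2 * g x) f = 2 * sqinner M f g"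
    for f g :: "'a \<Rightarrow> real"
  proof -
    have "f x \<bullet> (2 * g x) = 2 * (f x \<bullet> g x)" "(2 * g x) \<bullet> f x = 2 * (f x \<bullet> g x)" for x by simp_all
    then show "sqinner M f (\<lambda>x. 2 * g x) = 2 * sqinner M f g" "sqinner M (\<lambda>x. 2 * g x) f = 2 * sqinner M f g"
      unfolding sqinner_def by (simp_all only: integral_mult_right_zero)
  qed
  have DQ: "((\<lambda>t. sqinner M (q1 t) (q1 t)) has_real_derivative 4 * sqinner M (\<lambda>x. (u1 x)\<^sup>2) (\<lambda>x. u1 x * \<phi>1 x)) (at 0)"
    "((\<lambda>t. sqinner M (q1 t) (q2 t)) has_real_derivative
      (2 * sqinner M (\<lambda>x. (u1 x)\<^sup>2) (\<lambda>x. u2 x * \<phi>2 x) + 2 * sqinner M (\<lambda>x. (u2 x)\<^sup>2) (\<lambda>x. u1 x * \<phi>1 x))) (at 0)"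
    "((\<lambda>t. sqinner M (q2 t) (q2 t)) has_real_derivative 4 * sqinner M (\<lambda>x. (u2 x)\<^sup>2) (\<lambda>x. u2 x * \<phi>2 x)) (at 0)"
    using sqinner_quadratic_curves_derivative[OF S(1) p(1) S(3) S(1) p(1) S(3)]
      sqinner_quadratic_curves_derivative[OF S(1) p(1) S(3) S(2) p(2) S(4)]
      sqinner_quadratic_curves_derivative[OF S(2) p(2) S(4) S(2) p(2) S(4)]
    unfolding q1_def[abs_def] q2_def[abs_def] two by simp_all
  have sc: "sqinner M (\<lambda>x. a * f x) (\<lambda>x. b * g x) = a * b * sqinner M f g" for a b and f g :: "'a \<Rightarrow> real"
  proof -
    have "sqinner M (\<lambda>x. a * f x) (\<lambda>x. b * g x) = (LINT x|M. (a * b) * (f x * g x))"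
      unfolding sqinner_def by (simp add: mult_ac)
    then show ?thesis by (simp add: sqinner_def)
  qed
  have sq: "(\<lambda>x. (?v1 t x)\<^sup>2) = (\<lambda>x. A1 t * q1 t x)" "(\<lambda>x. (?v2 t x)\<^sup>2) = (\<lambda>x. A2 t * q2 t x)" for t
    unfolding P1.mass_curve_square[OF \<rho>1] P2.mass_curve_square[OF \<rho>2] A1_def A2_def q1_def q2_def by auto
  have F: "F (?v1 t, ?v2 t) = 1/4 * (\<mu>1 * (A1 t * A1 t * sqinner M (q1 t) (q1 t)) +
      2 * \<beta> * (A1 t * A2 t * sqinner M (q1 t) (q2 t)) + \<mu>2 * (A2 t * A2 t * sqinner M (q2 t) (q2 t)))" for t
    unfolding F_functional_eq[OF P1.ES_square_square_integrable[OF dim P1.mass_curve(1)[OF \<rho>1 t(1) u(1) \<phi>(1) t(3)]]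
        P2.ES_square_square_integrable[OF dim P2.mass_curve(1)[OF \<rho>2 t(2) u(2) \<phi>(2) t(4)]]] sq sc ..
  show ?thesis unfolding F dF_def cubic_form_def
    by (rule derivative_eq_intros DA DQ refl)+ (simp add: A0 algebra_simps)
qed

text \<open>  Otherwise \<open>F\<close> would increase along a curve inside the relaxed class.\<close>
lemma first_order_condition:
  assumes u: "u1 \<in> P1.ES" "u2 \<in> P2.ES" "sqnorm M u1 = \<rho>1" "sqnorm M u2 = \<rho>2"
    and max: "\<And>v. v \<in> relaxed \<Longrightarrow> F v \<le> F (u1, u2)" and T: "tangent u1 u2 \<phi>1 \<phi>2"
    and ev: "\<exists>d>0. \<forall>t. 0 < t \<and> t < d \<longrightarrow> E1 (P1.mass_curve \<rho>1 u1 \<phi>1 t) + E2 (P2.mass_curve \<rho>2 u2 \<phi>2 t) \<le> \<alpha>"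
  shows "dF u1 u2 \<phi>1 \<phi>2 \<le> 0"
proof (rule ccontr)
  assume "\<not> dF u1 u2 \<phi>1 \<phi>2 \<le> 0"
  then have pos: "0 < dF u1 u2 \<phi>1 \<phi>2" by simp
  note T' = T[unfolded tangent_def]
  let ?g = "\<lambda>t. F (P1.mass_curve \<rho>1 u1 \<phi>1 t, P2.mass_curve \<rho>2 u2 \<phi>2 t)"
  have D: "(?g has_real_derivative dF u1 u2 \<phi>1 \<phi>2) (at 0)"
    using T' by (intro F_curve_derivative u) auto
  have zero: "P1.mass_curve \<rho>1 u1 \<phi>1 0 = u1" "P2.mass_curve \<rho>2 u2 \<phi>2 0 = u2"
    using \<rho>1 \<rho>2 by (auto simp: P1.mass_curve_def)
  obtain d1 where d1: "d1 > 0" "\<And>h. h > 0 \<Longrightarrow> h < d1 \<Longrightarrow> ?g 0 < ?g (0 + h)"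
    using DERIV_pos_inc_right[OF D pos] by auto
  obtain d2 where d2: "d2 > 0" "\<And>t. 0 < t \<and> t < d2 \<Longrightarrow> E1 (P1.mass_curve \<rho>1 u1 \<phi>1 t) + E2 (P2.mass_curve \<rho>2 u2 \<phi>2 t) \<le> \<alpha>"
    using ev by blast
  define t where "t = min d1 d2 / 2"
  have t: "0 < t" "t < d1" "t < d2" using d1(1) d2(1) by (auto simp: t_def)
  have "(P1.mass_curve \<rho>1 u1 \<phi>1 t, P2.mass_curve \<rho>2 u2 \<phi>2 t) \<in> relaxed"
    using P1.mass_curve(1,2)[OF \<rho>1 u(3,1), of \<phi>1 t] P2.mass_curve(1,2)[OF \<rho>2 u(4,2), of \<phi>2 t] T' d2(2)[of t] t
    by (simp add: relaxed_def)
  from max[OF this] have "?g t \<le> ?g 0" unfolding zero .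
  moreover have "?g 0 < ?g t" using d1(2)[OF t(1,2)] by simp
  ultimately show False by linarith
qed

section \<open>Saturation and the Lagrange multiplier\<close>

lemma tangent_lincomb:
  assumes u: "u1 \<in> P1.ES" "u2 \<in> P2.ES" and T: "tangent u1 u2 \<phi>1 \<phi>2" "tangent u1 u2 \<psi>1 \<psi>2"
  shows "tangent u1 u2 (\<lambda>x. a * \<phi>1 x + b * \<psi>1 x) (\<lambda>x. a * \<phi>2 x + b * \<psi>2 x)"
    "dF u1 u2 (\<lambda>x. a * \<phi>1 x + b * \<psi>1 x) (\<lambda>x. a * \<phi>2 x + b * \<psi>2 x) = a * dF u1 u2 \<phi>1 \<phi>2 + b * dF u1 u2 \<psi>1 \<psi>2"
    "dE u1 u2 (\<lambda>x. a * \<phi>1 x + b * \<psi>1 x) (\<lambda>x. a * \<phi>2 x + b * \<psi>2 x) = a * dE u1 u2 \<phi>1 \<phi>2 + b * dE u1 u2 \<psi>1 \<psi>2"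
proof -
  have E: "\<phi>1 \<in> P1.ES" "\<psi>1 \<in> P1.ES" "\<phi>2 \<in> P2.ES" "\<psi>2 \<in> P2.ES" using T by (auto simp: tangent_def)
  show "tangent u1 u2 (\<lambda>x. a * \<phi>1 x + b * \<psi>1 x) (\<lambda>x. a * \<phi>2 x + b * \<psi>2 x)"
    unfolding tangent_def
    using T P1.ES_lincomb(1)[OF E(1,2)] P2.ES_lincomb(1)[OF E(3,4)]
      P1.sqinner_tangent_lincomb[OF u(1) E(1,2)] P2.sqinner_tangent_lincomb[OF u(2) E(3,4)]
    by (simp add: tangent_def)
  show "dF u1 u2 (\<lambda>x. a * \<phi>1 x + b * \<psi>1 x) (\<lambda>x. a * \<phi>2 x + b * \<psi>2 x) = a * dF u1 u2 \<phi>1 \<phi>2 + b * dF u1 u2 \<psi>1 \<psi>2"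
    unfolding dF_def
      P1.cubic_form_ES_lincomb[OF dim u(1) P2.ES_square_square_integrable[OF dim u(2)] E(1,2)]
      P2.cubic_form_ES_lincomb[OF dim u(2) P1.ES_square_square_integrable[OF dim u(1)] E(3,4)]
    by (simp add: algebra_simps)
  show "dE u1 u2 (\<lambda>x. a * \<phi>1 x + b * \<psi>1 x) (\<lambda>x. a * \<phi>2 x + b * \<psi>2 x) = a * dE u1 u2 \<phi>1 \<phi>2 + b * dE u1 u2 \<psi>1 \<psi>2"
    unfolding dE_def P1.energy_form_lincomb[OF E(1,2) u(1)] P2.energy_form_lincomb[OF E(3,4) u(2)]
    by (simp add: algebra_simps)
qed

lemma energy_sum_curve_derivative:
  assumes u: "u1 \<in> P1.ES" "u2 \<in> P2.ES" "sqnorm M u1 = \<rho>1" "sqnorm M u2 = \<rho>2" and T: "tangent u1 u2 \<phi>1 \<phi>2"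
  shows "((\<lambda>t. E1 (P1.mass_curve \<rho>1 u1 \<phi>1 t) + E2 (P2.mass_curve \<rho>2 u2 \<phi>2 t)) has_real_derivative 2 * dE u1 u2 \<phi>1 \<phi>2) (at 0)"
    "P1.mass_curve \<rho>1 u1 \<phi>1 0 = u1" "P2.mass_curve \<rho>2 u2 \<phi>2 0 = u2"
proof -
  note T' = T[unfolded tangent_def]
  have "((\<lambda>t. E1 (P1.mass_curve \<rho>1 u1 \<phi>1 t)) has_real_derivative 2 * P1.energy_form u1 \<phi>1) (at 0)"
    using T' by (intro P1.energy_curve_derivative \<rho>1 u) auto
  moreover have "((\<lambda>t. E2 (P2.mass_curve \<rho>2 u2 \<phi>2 t)) has_real_derivative 2 * P2.energy_form u2 \<phi>2) (at 0)"
    using T' by (intro P2.energy_curve_derivative \<rho>2 u) auto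
  ultimately show "((\<lambda>t. E1 (P1.mass_curve \<rho>1 u1 \<phi>1 t) + E2 (P2.mass_curve \<rho>2 u2 \<phi>2 t)) has_real_derivative 2 * dE u1 u2 \<phi>1 \<phi>2) (at 0)"
    unfolding dE_def by (auto intro!: derivative_eq_intros)
  show "P1.mass_curve \<rho>1 u1 \<phi>1 0 = u1" "P2.mass_curve \<rho>2 u2 \<phi>2 0 = u2"
    using \<rho>1 \<rho>2 by (auto simp: P1.mass_curve_def)
qed

text \<open>  The opposite direction, in the shape produced by linear combinations.\<close>
lemma tangent_uminus:
  assumes u: "u1 \<in> P1.ES" "u2 \<in> P2.ES" and T: "tangent u1 u2 \<phi>1 \<phi>2"
  shows "tangent u1 u2 (\<lambda>x. - 1 * \<phi>1 x + 0 * \<phi>1 x) (\<lambda>x. - 1 * \<phi>2 x + 0 * \<phi>2 x)"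
    "dF u1 u2 (\<lambda>x. - 1 * \<phi>1 x + 0 * \<phi>1 x) (\<lambda>x. - 1 * \<phi>2 x + 0 * \<phi>2 x) = - dF u1 u2 \<phi>1 \<phi>2"
    "dE u1 u2 (\<lambda>x. - 1 * \<phi>1 x + 0 * \<phi>1 x) (\<lambda>x. - 1 * \<phi>2 x + 0 * \<phi>2 x) = - dE u1 u2 \<phi>1 \<phi>2"
proof -
  note L = tangent_lincomb[OF u T T, of "-1" 0]
  show "tangent u1 u2 (\<lambda>x. - 1 * \<phi>1 x + 0 * \<phi>1 x) (\<lambda>x. - 1 * \<phi>2 x + 0 * \<phi>2 x)" by (rule L(1))
  show "dF u1 u2 (\<lambda>x. - 1 * \<phi>1 x + 0 * \<phi>1 x) (\<lambda>x. - 1 * \<phi>2 x + 0 * \<phi>2 x) = - dF u1 u2 \<phi>1 \<phi>2" unfolding L(2) by simp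
  show "dE u1 u2 (\<lambda>x. - 1 * \<phi>1 x + 0 * \<phi>1 x) (\<lambda>x. - 1 * \<phi>2 x + 0 * \<phi>2 x) = - dE u1 u2 \<phi>1 \<phi>2" unfolding L(3) by simp
qed

text \<open>  Below the energy level \<open>\<alpha>\<close> both a tangent direction and its opposite are allowed.\<close>
lemma relaxed_maximum_saturates:
  assumes u: "(u1, u2) \<in> relaxed" and max: "\<And>v. v \<in> relaxed \<Longrightarrow> F v \<le> F (u1, u2)"
  shows "E1 u1 + E2 u2 = \<alpha>"
proof (rule ccontr)
  note U = relaxedD[OF u]
  assume "E1 u1 + E2 u2 \<noteq> \<alpha>"
  then have less: "E1 u1 + E2 u2 < \<alpha>" using U(5) by simp
  have le: "dF u1 u2 \<phi>1 \<phi>2 \<le> 0" if T: "tangent u1 u2 \<phi>1 \<phi>2" for \<phi>1 \<phi>2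
  proof (rule first_order_condition[OF U(1-4) max T])
    let ?e = "\<lambda>t. E1 (P1.mass_curve \<rho>1 u1 \<phi>1 t) + E2 (P2.mass_curve \<rho>2 u2 \<phi>2 t)"
    note D = energy_sum_curve_derivative[OF U(1-4) T]
    have "isCont ?e 0" by (rule DERIV_isCont[OF D(1)])
    then have "?e \<midarrow>0\<rightarrow> E1 u1 + E2 u2" unfolding isCont_def D(2,3) .
    then have "\<forall>\<^sub>F t in at 0. ?e t < \<alpha>" using less by (rule order_tendstoD(2))
    then obtain d where d: "d > 0" "\<And>t. t \<noteq> 0 \<and> dist t 0 < d \<Longrightarrow> ?e t < \<alpha>" unfolding eventually_at by auto
    have "?e t \<le> \<alpha>" if "0 < t \<and> t < d" for t using d(2)[of t] that by (simp add: less_imp_le)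
    with d(1) show "\<exists>d>0. \<forall>t. 0 < t \<and> t < d \<longrightarrow> ?e t \<le> \<alpha>" by blast
  qed
  have "dF u1 u2 \<phi>1 \<phi>2 = 0" if T: "tangent u1 u2 \<phi>1 \<phi>2" for \<phi>1 \<phi>2
    using le[OF T] le[OF tangent_uminus(1)[OF U(1,2) T]] tangent_uminus(2)[OF U(1,2) T] by linarith
  then show False by (rule dF_nonzero[OF U(1-4)])
qed

lemma descent_first_order:
  assumes u: "(u1, u2) \<in> relaxed" and max: "\<And>v. v \<in> relaxed \<Longrightarrow> F v \<le> F (u1, u2)"
    and T: "tangent u1 u2 \<phi>1 \<phi>2" and neg: "dE u1 u2 \<phi>1 \<phi>2 < 0"
  shows "dF u1 u2 \<phi>1 \<phi>2 \<le> 0"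
proof -
  note U = relaxedD[OF u]
  show ?thesis
  proof (rule first_order_condition[OF U(1-4) max T])
    let ?e = "\<lambda>t. E1 (P1.mass_curve \<rho>1 u1 \<phi>1 t) + E2 (P2.mass_curve \<rho>2 u2 \<phi>2 t)"
    note D = energy_sum_curve_derivative[OF U(1-4) T]
    have "2 * dE u1 u2 \<phi>1 \<phi>2 < 0" using neg by simp
    from DERIV_neg_dec_right[OF D(1) this]
    obtain d where d: "d > 0" "\<And>h. h > 0 \<Longrightarrow> h < d \<Longrightarrow> ?e (0 + h) < ?e 0" by blast
    have "?e t \<le> \<alpha>" if "0 < t \<and> t < d" for t using d(2)[of t] that U(5) unfolding D(2,3) by simp
    with d(1) show "\<exists>d>0. \<forall>t. 0 < t \<and> t < d \<longrightarrow> ?e t \<le> \<alpha>" by blast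
  qed
qed

text \<open>  The second variation of the total energy at a pair that is critical for fixed masses; the quotients
  \<open>E1 u1 / \<rho>1\<close> and \<open>E2 u2 / \<rho>2\<close> are then the multipliers of the mass constraints.\<close>
definition second_variation :: "('a \<Rightarrow> real) \<Rightarrow> ('a \<Rightarrow> real) \<Rightarrow> ('a \<Rightarrow> real) \<Rightarrow> ('a \<Rightarrow> real) \<Rightarrow> real" where
  "second_variation u1 u2 \<phi>1 \<phi>2 = (E1 \<phi>1 - E1 u1 / \<rho>1 * sqnorm M \<phi>1) + (E2 \<phi>2 - E2 u2 / \<rho>2 * sqnorm M \<phi>2)"

lemma energy_critical_components:
  assumes u: "u1 \<in> P1.ES" "u2 \<in> P2.ES" and z: "\<And>\<phi>1 \<phi>2. tangent u1 u2 \<phi>1 \<phi>2 \<Longrightarrow> dE u1 u2 \<phi>1 \<phi>2 = 0"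
  shows "\<phi>1 \<in> P1.ES \<Longrightarrow> sqinner M u1 \<phi>1 = 0 \<Longrightarrow> P1.energy_form u1 \<phi>1 = 0"
    "\<phi>2 \<in> P2.ES \<Longrightarrow> sqinner M u2 \<phi>2 = 0 \<Longrightarrow> P2.energy_form u2 \<phi>2 = 0"
proof -
  show "P1.energy_form u1 \<phi>1 = 0" if "\<phi>1 \<in> P1.ES" "sqinner M u1 \<phi>1 = 0"
    using z[of \<phi>1 "\<lambda>x. 0"] that P2.ES_zero[OF u(2)] P2.energy_form_zero[OF u(2)] by (simp add: tangent_def dE_def)
  show "P2.energy_form u2 \<phi>2 = 0" if "\<phi>2 \<in> P2.ES" "sqinner M u2 \<phi>2 = 0"
    using z[of "\<lambda>x. 0" \<phi>2] that P1.ES_zero[OF u(1)] P1.energy_form_zero[OF u(1)] by (simp add: tangent_def dE_def)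
qed

text \<open>  Along the curve the energy changes by \<open>t\<^sup>2 (A1 t q1 + A2 t q2)\<close>, where \<open>q1 + q2\<close> is the second
  variation and the factors \<open>A1 t\<close>, \<open>A2 t\<close> tend to one.\<close>
lemma descent_second_order:
  assumes u: "(u1, u2) \<in> relaxed" and max: "\<And>v. v \<in> relaxed \<Longrightarrow> F v \<le> F (u1, u2)"
    and z: "\<And>\<phi>1 \<phi>2. tangent u1 u2 \<phi>1 \<phi>2 \<Longrightarrow> dE u1 u2 \<phi>1 \<phi>2 = 0"
    and T: "tangent u1 u2 \<phi>1 \<phi>2" and neg: "second_variation u1 u2 \<phi>1 \<phi>2 < 0"
  shows "dF u1 u2 \<phi>1 \<phi>2 \<le> 0"
proof -
  note U = relaxedD[OF u] and T' = T[unfolded tangent_def]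
  have e0: "P1.energy_form u1 \<phi>1 = 0" "P2.energy_form u2 \<phi>2 = 0"
    using energy_critical_components[OF U(1,2) z] T' by auto
  define A1 where "A1 t = \<rho>1 / (\<rho>1 + t\<^sup>2 * sqnorm M \<phi>1)" for t
  define A2 where "A2 t = \<rho>2 / (\<rho>2 + t\<^sup>2 * sqnorm M \<phi>2)" for t
  define q1 where "q1 = E1 \<phi>1 - E1 u1 / \<rho>1 * sqnorm M \<phi>1"
  define q2 where "q2 = E2 \<phi>2 - E2 u2 / \<rho>2 * sqnorm M \<phi>2"
  have alg: "\<rho> / (\<rho> + s * m) * (e + s * f) = e + s * (\<rho> / (\<rho> + s * m) * (f - e / \<rho> * m))"
    if "\<rho> > 0" "s \<ge> 0" "m \<ge> 0" for \<rho> s m e f :: real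
  proof -
    define D where "D = \<rho> + s * m"
    have D: "D > 0" unfolding D_def using that by (intro add_pos_nonneg) auto
    have "\<rho> * (f - e / \<rho> * m) = \<rho> * f - e * m" using that(1) by (simp add: right_diff_distrib)
    then have "e + s * (\<rho> / D * (f - e / \<rho> * m)) = (e * D + s * (\<rho> * f - e * m)) / D"
      using D by (simp add: add_divide_distrib)
    also have "e * D + s * (\<rho> * f - e * m) = \<rho> * (e + s * f)" by (simp add: D_def algebra_simps)
    finally show ?thesis by (simp add: D_def)
  qed
  have e1: "E1 (P1.mass_curve \<rho>1 u1 \<phi>1 t) = E1 u1 + t\<^sup>2 * (A1 t * q1)" for t
    using P1.mass_curve(3)[OF \<rho>1 U(3,1), of \<phi>1 t] T' e0(1) alg[OF \<rho>1, of "t\<^sup>2" "sqnorm M \<phi>1" "E1 u1" "E1 \<phi>1"]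
    by (simp add: A1_def q1_def)
  have e2: "E2 (P2.mass_curve \<rho>2 u2 \<phi>2 t) = E2 u2 + t\<^sup>2 * (A2 t * q2)" for t
    using P2.mass_curve(3)[OF \<rho>2 U(4,2), of \<phi>2 t] T' e0(2) alg[OF \<rho>2, of "t\<^sup>2" "sqnorm M \<phi>2" "E2 u2" "E2 \<phi>2"]
    by (simp add: A2_def q2_def)
  have "isCont A1 0" "isCont A2 0"
    unfolding A1_def[abs_def] A2_def[abs_def]
    using DERIV_isCont[OF P1.mass_factor_derivative[OF \<rho>1]] DERIV_isCont[OF P1.mass_factor_derivative[OF \<rho>2]] by auto
  then have "isCont (\<lambda>t. A1 t * q1 + A2 t * q2) 0" by (intro continuous_intros)
  moreover have "A1 0 = 1" "A2 0 = 1" using \<rho>1 \<rho>2 by (simp_all add: A1_def A2_def)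
  ultimately have "(\<lambda>t. A1 t * q1 + A2 t * q2) \<midarrow>0\<rightarrow> q1 + q2" by (simp add: isCont_def)
  moreover have "q1 + q2 < 0" using neg by (simp add: second_variation_def q1_def q2_def)
  ultimately have "\<forall>\<^sub>F t in at 0. A1 t * q1 + A2 t * q2 < 0" by (rule order_tendstoD(2))
  then obtain d where d: "d > 0" "\<And>t. t \<noteq> 0 \<and> dist t 0 < d \<Longrightarrow> A1 t * q1 + A2 t * q2 < 0" unfolding eventually_at by auto
  show ?thesis
  proof (rule first_order_condition[OF U(1-4) max T])
    have "E1 (P1.mass_curve \<rho>1 u1 \<phi>1 t) + E2 (P2.mass_curve \<rho>2 u2 \<phi>2 t) \<le> \<alpha>" if "0 < t \<and> t < d" for t
    proof -
      have "t\<^sup>2 * (A1 t * q1 + A2 t * q2) \<le> 0"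
        using d(2)[of t] that by (intro mult_nonneg_nonpos) auto
      then show ?thesis unfolding e1 e2 using U(5) by (simp add: distrib_left)
    qed
    with d(1) show "\<exists>d>0. \<forall>t. 0 < t \<and> t < d \<longrightarrow>
        E1 (P1.mass_curve \<rho>1 u1 \<phi>1 t) + E2 (P2.mass_curve \<rho>2 u2 \<phi>2 t) \<le> \<alpha>" by blast
  qed
qed

lemma second_variation_expand:
  assumes "tangent u1 u2 \<psi>1 \<psi>2" "tangent u1 u2 \<phi>1 \<phi>2"
  shows "\<exists>b c. \<forall>s. second_variation u1 u2 (\<lambda>x. \<epsilon> * \<psi>1 x + s * \<phi>1 x) (\<lambda>x. \<epsilon> * \<psi>2 x + s * \<phi>2 x) =
    \<epsilon>\<^sup>2 * second_variation u1 u2 \<psi>1 \<psi>2 + s * b + s\<^sup>2 * c"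
proof -
  have E: "\<psi>1 \<in> P1.ES" "\<phi>1 \<in> P1.ES" "\<psi>2 \<in> P2.ES" "\<phi>2 \<in> P2.ES" using assms by (auto simp: tangent_def)
  have m1: "sqnorm M (\<lambda>x. \<epsilon> * \<psi>1 x + s * \<phi>1 x) = \<epsilon>\<^sup>2 * sqnorm M \<psi>1 + 2 * \<epsilon> * s * sqinner M \<psi>1 \<phi>1 + s\<^sup>2 * sqnorm M \<phi>1" for s
    using sqnorm_lincomb[OF P1.ES_D(4)[OF E(1)] P1.ES_D(4)[OF E(2)], of \<epsilon> s] by simp
  have m2: "sqnorm M (\<lambda>x. \<epsilon> * \<psi>2 x + s * \<phi>2 x) = \<epsilon>\<^sup>2 * sqnorm M \<psi>2 + 2 * \<epsilon> * s * sqinner M \<psi>2 \<phi>2 + s\<^sup>2 * sqnorm M \<phi>2" for s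
    using sqnorm_lincomb[OF P2.ES_D(4)[OF E(3)] P2.ES_D(4)[OF E(4)], of \<epsilon> s] by simp
  let ?b = "2 * \<epsilon> * (P1.energy_form \<psi>1 \<phi>1 - E1 u1 / \<rho>1 * sqinner M \<psi>1 \<phi>1) + 2 * \<epsilon> * (P2.energy_form \<psi>2 \<phi>2 - E2 u2 / \<rho>2 * sqinner M \<psi>2 \<phi>2)"
  show ?thesis
  proof (rule exI[of _ ?b], rule exI[of _ "second_variation u1 u2 \<phi>1 \<phi>2"], rule allI)
    fix s
    show "second_variation u1 u2 (\<lambda>x. \<epsilon> * \<psi>1 x + s * \<phi>1 x) (\<lambda>x. \<epsilon> * \<psi>2 x + s * \<phi>2 x) =
      \<epsilon>\<^sup>2 * second_variation u1 u2 \<psi>1 \<psi>2 + s * ?b + s\<^sup>2 * second_variation u1 u2 \<phi>1 \<phi>2"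
      unfolding second_variation_def m1 m2 P1.ES_lincomb(2)[OF E(1,2)] P2.ES_lincomb(2)[OF E(3,4)]
      by (simp add: algebra_simps)
  qed
qed

text \<open>  Suppose that \<open>dE\<close> vanishes. The bound on \<open>\<alpha>\<close> gives a tangent direction \<open>\<psi>\<close> of negative second
  variation, and for small \<open>s > 0\<close> the second variation is still negative at \<open>\<psi> + s \<phi>\<close> and at
  \<open>- \<psi> + s \<phi>\<close>. The first-order conditions in these two directions add up to \<open>2 s dF(\<phi>) \<le> 0\<close>.\<close>
lemma not_energy_critical:
  assumes u: "(u1, u2) \<in> relaxed" and max: "\<And>v. v \<in> relaxed \<Longrightarrow> F v \<le> F (u1, u2)"
  shows "\<exists>\<phi>1 \<phi>2. tangent u1 u2 \<phi>1 \<phi>2 \<and> dE u1 u2 \<phi>1 \<phi>2 \<noteq> 0"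
proof (rule ccontr)
  note U = relaxedD[OF u]
  have sat: "E1 u1 + E2 u2 = \<alpha>" by (rule relaxed_maximum_saturates[OF u max])
  assume "\<not> ?thesis"
  then have z: "dE u1 u2 \<phi>1 \<phi>2 = 0" if "tangent u1 u2 \<phi>1 \<phi>2" for \<phi>1 \<phi>2 using that by blast
  note crit = energy_critical_components[OF U(1,2) z]
  have "\<exists>\<psi>1 \<psi>2. tangent u1 u2 \<psi>1 \<psi>2 \<and> second_variation u1 u2 \<psi>1 \<psi>2 < 0"
  proof (cases "principal_eigenvalue \<Omega> V1 < E1 u1 / \<rho>1")
    case True
    obtain \<psi> where "\<psi> \<in> P1.ES" "sqinner M u1 \<psi> = 0" "E1 \<psi> < E1 u1 / \<rho>1 * sqnorm M \<psi>"
      by (rule P1.constrained_critical_descent_direction[OF cont1 nonempty \<rho>1 U(3,1) crit(1) True]) blast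
    then show ?thesis using P2.ES_zero[OF U(2)]
      by (intro exI[of _ \<psi>] exI[of _ "\<lambda>x. 0"]) (simp add: tangent_def second_variation_def)
  next
    case False
    then have "E1 u1 \<le> principal_eigenvalue \<Omega> V1 * \<rho>1" using \<rho>1 by (simp add: field_simps)
    then have "principal_eigenvalue \<Omega> V2 * \<rho>2 < E2 u2" using sat \<alpha> by linarith
    then have large: "principal_eigenvalue \<Omega> V2 < E2 u2 / \<rho>2" using \<rho>2 by (simp add: field_simps)
    obtain \<psi> where "\<psi> \<in> P2.ES" "sqinner M u2 \<psi> = 0" "E2 \<psi> < E2 u2 / \<rho>2 * sqnorm M \<psi>"
      by (rule P2.constrained_critical_descent_direction[OF cont2 nonempty \<rho>2 U(4,2) crit(2) large]) blast
    then show ?thesis using P1.ES_zero[OF U(1)]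
      by (intro exI[of _ "\<lambda>x. 0"] exI[of _ \<psi>]) (simp add: tangent_def second_variation_def)
  qed
  then obtain \<psi>1 \<psi>2 where \<psi>: "tangent u1 u2 \<psi>1 \<psi>2" "second_variation u1 u2 \<psi>1 \<psi>2 < 0" by blast
  have le: "dF u1 u2 \<phi>1 \<phi>2 \<le> 0" if T: "tangent u1 u2 \<phi>1 \<phi>2" for \<phi>1 \<phi>2
  proof -
    have ev: "\<forall>\<^sub>F s in at_right 0. \<epsilon> * dF u1 u2 \<psi>1 \<psi>2 + s * dF u1 u2 \<phi>1 \<phi>2 \<le> 0" if \<epsilon>: "\<epsilon>\<^sup>2 = 1" for \<epsilon>
    proof -
      obtain b c where bc: "\<And>s. second_variation u1 u2 (\<lambda>x. \<epsilon> * \<psi>1 x + s * \<phi>1 x) (\<lambda>x. \<epsilon> * \<psi>2 x + s * \<phi>2 x) =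
        \<epsilon>\<^sup>2 * second_variation u1 u2 \<psi>1 \<psi>2 + s * b + s\<^sup>2 * c"
        using second_variation_expand[OF \<psi>(1) T, of \<epsilon>] by blast
      have "((\<lambda>s. \<epsilon>\<^sup>2 * second_variation u1 u2 \<psi>1 \<psi>2 + s * b + s\<^sup>2 * c) \<longlongrightarrow>
          \<epsilon>\<^sup>2 * second_variation u1 u2 \<psi>1 \<psi>2 + 0 * b + 0\<^sup>2 * c) (at_right 0)"
        by (intro tendsto_intros)
      then have "((\<lambda>s. \<epsilon>\<^sup>2 * second_variation u1 u2 \<psi>1 \<psi>2 + s * b + s\<^sup>2 * c) \<longlongrightarrow> second_variation u1 u2 \<psi>1 \<psi>2) (at_right 0)"
        using \<epsilon> by simp
      from order_tendstoD(2)[OF this \<psi>(2)]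
      show ?thesis
      proof eventually_elim
        case (elim s)
        note L = tangent_lincomb[OF U(1,2) \<psi>(1) T, of \<epsilon> s]
        have "dF u1 u2 (\<lambda>x. \<epsilon> * \<psi>1 x + s * \<phi>1 x) (\<lambda>x. \<epsilon> * \<psi>2 x + s * \<phi>2 x) \<le> 0"
          by (rule descent_second_order[OF u max z L(1)]) (use elim bc in simp_all)
        then show ?case unfolding L(2) .
      qed
    qed
    have "\<forall>\<^sub>F s in at_right (0::real). 0 < s" by (rule eventually_at_right_less)
    then have "\<forall>\<^sub>F s in at_right (0::real). dF u1 u2 \<phi>1 \<phi>2 \<le> 0"
      using ev[of 1, simplified] ev[of "-1", simplified]
    proof eventually_elim
      case (elim s)
      then have "s * dF u1 u2 \<phi>1 \<phi>2 \<le> 0" by linarith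
      then show ?case using elim(1) by (simp add: mult_le_0_iff)
    qed
    then show ?thesis by simp
  qed
  have "dF u1 u2 \<phi>1 \<phi>2 = 0" if T: "tangent u1 u2 \<phi>1 \<phi>2" for \<phi>1 \<phi>2
    using le[OF T] le[OF tangent_uminus(1)[OF U(1,2) T]] tangent_uminus(2)[OF U(1,2) T] by linarith
  then show False by (rule dF_nonzero[OF U(1-4)])
qed

text \<open>  Directions that lower the energy do not increase \<open>F\<close>. Adding a small multiple of one of them shows
  that \<open>dF\<close> vanishes on the kernel of \<open>dE\<close>, so the two forms are proportional, and their signs agree
  on a lowering direction. A zero factor would contradict the nondegeneracy.\<close>
lemma Lagrange_multiplier:
  assumes u: "(u1, u2) \<in> relaxed" and max: "\<And>v. v \<in> relaxed \<Longrightarrow> F v \<le> F (u1, u2)"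
  shows "\<exists>\<kappa>>0. \<forall>\<phi>1 \<phi>2. tangent u1 u2 \<phi>1 \<phi>2 \<longrightarrow> dF u1 u2 \<phi>1 \<phi>2 = \<kappa> * dE u1 u2 \<phi>1 \<phi>2"
proof -
  note U = relaxedD[OF u]
  obtain \<eta>1 \<eta>2 where \<eta>: "tangent u1 u2 \<eta>1 \<eta>2" "dE u1 u2 \<eta>1 \<eta>2 < 0"
  proof -
    obtain \<phi>1 \<phi>2 where p: "tangent u1 u2 \<phi>1 \<phi>2" "dE u1 u2 \<phi>1 \<phi>2 \<noteq> 0" using not_energy_critical[OF u max] by blast
    show ?thesis
    proof (cases "dE u1 u2 \<phi>1 \<phi>2 < 0")
      case True with p(1) show ?thesis by (rule that)
    next
      case False
      show ?thesis by (rule that[OF tangent_uminus(1)[OF U(1,2) p(1)]]) (use tangent_uminus(3)[OF U(1,2) p(1)] False p(2) in linarith)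
    qed
  qed
  have flat: "dF u1 u2 \<phi>1 \<phi>2 \<le> 0" if T: "tangent u1 u2 \<phi>1 \<phi>2" and e: "dE u1 u2 \<phi>1 \<phi>2 = 0" for \<phi>1 \<phi>2
  proof (rule ccontr)
    assume "\<not> ?thesis"
    then have pos: "dF u1 u2 \<phi>1 \<phi>2 > 0" by simp
    \<comment> \<open>small enough for the lowering direction to cost at most half of the gain\<close>
    define s where "s = dF u1 u2 \<phi>1 \<phi>2 / (2 * (\<bar>dF u1 u2 \<eta>1 \<eta>2\<bar> + 1))"
    have s: "s > 0" using pos by (simp add: s_def add_nonneg_pos)
    note L = tangent_lincomb[OF U(1,2) T \<eta>(1), of 1 s]
    have "s * dE u1 u2 \<eta>1 \<eta>2 < 0" using s \<eta>(2) by (rule mult_pos_neg)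
    then have "dF u1 u2 \<phi>1 \<phi>2 + s * dF u1 u2 \<eta>1 \<eta>2 \<le> 0"
      using descent_first_order[OF u max L(1)] unfolding L(2,3) e by simp
    moreover have "s * (- dF u1 u2 \<eta>1 \<eta>2) \<le> s * (\<bar>dF u1 u2 \<eta>1 \<eta>2\<bar> + 1)"
      using s by (intro mult_left_mono) auto
    moreover have "s * (\<bar>dF u1 u2 \<eta>1 \<eta>2\<bar> + 1) = dF u1 u2 \<phi>1 \<phi>2 / 2"
    proof -
      have gen: "d / (2 * K) * K = d / 2" if "K \<noteq> 0" for d K :: real using that by simp
      show ?thesis unfolding s_def by (rule gen) linarith
    qed
    ultimately show False using pos unfolding mult_minus_right by linarith
  qed
  have flat0: "dF u1 u2 \<phi>1 \<phi>2 = 0" if T: "tangent u1 u2 \<phi>1 \<phi>2" and e: "dE u1 u2 \<phi>1 \<phi>2 = 0" for \<phi>1 \<phi>2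
    using flat[OF T e] flat[OF tangent_uminus(1)[OF U(1,2) T]] tangent_uminus(2,3)[OF U(1,2) T] e by simp
  define \<kappa> where "\<kappa> = dF u1 u2 \<eta>1 \<eta>2 / dE u1 u2 \<eta>1 \<eta>2"
  have mult: "dF u1 u2 \<phi>1 \<phi>2 = \<kappa> * dE u1 u2 \<phi>1 \<phi>2" if T: "tangent u1 u2 \<phi>1 \<phi>2" for \<phi>1 \<phi>2
  proof -
    \<comment> \<open>subtracting \<open>c\<close> times the lowering direction moves \<open>\<phi>\<close> to the kernel of \<open>dE\<close>\<close>
    define c where "c = dE u1 u2 \<phi>1 \<phi>2 / dE u1 u2 \<eta>1 \<eta>2"
    note L = tangent_lincomb[OF U(1,2) T \<eta>(1), of 1 "-c"]
    have "1 * dE u1 u2 \<phi>1 \<phi>2 + (-c) * dE u1 u2 \<eta>1 \<eta>2 = 0" using \<eta>(2) by (simp add: c_def)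
    then have "1 * dF u1 u2 \<phi>1 \<phi>2 + (-c) * dF u1 u2 \<eta>1 \<eta>2 = 0"
      using flat0[OF L(1)] unfolding L(2,3) by simp
    then show ?thesis by (simp add: c_def \<kappa>_def)
  qed
  have "\<kappa> \<noteq> 0"
  proof
    assume "\<kappa> = 0"
    then have "dF u1 u2 \<phi>1 \<phi>2 = 0" if "tangent u1 u2 \<phi>1 \<phi>2" for \<phi>1 \<phi>2 using mult[OF that] by simp
    then show False by (rule dF_nonzero[OF U(1-4)])
  qed
  moreover have "\<kappa> \<ge> 0"
    unfolding \<kappa>_def using descent_first_order[OF u max \<eta>] \<eta>(2) by (intro divide_nonpos_neg)
  ultimately have "\<kappa> > 0" by simp
  then show ?thesis using mult by blast
qed

section \<open>Existence of maximum points\<close>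

lemma relaxed_nonempty: "relaxed \<noteq> {}"
proof -
  \<comment> \<open>the surplus energy per unit of mass\<close>
  define d where "d = (\<alpha> - principal_eigenvalue \<Omega> V1 * \<rho>1 - principal_eigenvalue \<Omega> V2 * \<rho>2) / (\<rho>1 + \<rho>2)"
  have d: "d > 0" using \<alpha> \<rho>1 \<rho>2 by (simp add: d_def)
  have dd: "d * (\<rho>1 + \<rho>2) = \<alpha> - principal_eigenvalue \<Omega> V1 * \<rho>1 - principal_eigenvalue \<Omega> V2 * \<rho>2"
    using \<rho>1 \<rho>2 by (simp add: d_def)
  obtain \<phi>1 where p1: "\<phi>1 \<in> P1.ES" "sqnorm M \<phi>1 = 1" "E1 \<phi>1 < principal_eigenvalue \<Omega> V1 + d"
    by (rule P1.principal_eigenvalue_approx[OF cont1 nonempty, of "principal_eigenvalue \<Omega> V1 + d"]) (use d in auto)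
  obtain \<phi>2 where p2: "\<phi>2 \<in> P2.ES" "sqnorm M \<phi>2 = 1" "E2 \<phi>2 < principal_eigenvalue \<Omega> V2 + d"
    by (rule P2.principal_eigenvalue_approx[OF cont2 nonempty, of "principal_eigenvalue \<Omega> V2 + d"]) (use d in auto)
  have s: "(sqrt \<rho>1)\<^sup>2 = \<rho>1" "(sqrt \<rho>2)\<^sup>2 = \<rho>2" using \<rho>1 \<rho>2 by auto
  have "\<rho>1 * E1 \<phi>1 \<le> \<rho>1 * (principal_eigenvalue \<Omega> V1 + d)" "\<rho>2 * E2 \<phi>2 \<le> \<rho>2 * (principal_eigenvalue \<Omega> V2 + d)"
    using p1(3) p2(3) \<rho>1 \<rho>2 by (auto intro: mult_left_mono)
  then have "\<rho>1 * E1 \<phi>1 + \<rho>2 * E2 \<phi>2 \<le> \<alpha>" using dd by (simp add: algebra_simps)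
  then have "((\<lambda>x. sqrt \<rho>1 * \<phi>1 x), (\<lambda>x. sqrt \<rho>2 * \<phi>2 x)) \<in> relaxed"
    using P1.ES_scale[OF p1(1), of "sqrt \<rho>1"] P2.ES_scale[OF p2(1), of "sqrt \<rho>2"] p1(2) p2(2)
    by (simp add: relaxed_def sqnorm_mult s)
  then show ?thesis by blast
qed

lemma real_bounded_subsequence:
  fixes f :: "nat \<Rightarrow> real"
  assumes "\<And>n. 0 \<le> f n" "\<And>n. f n \<le> B"
  obtains r l where "strict_mono (r :: nat \<Rightarrow> nat)" "(\<lambda>n. f (r n)) \<longlonglongrightarrow> l"
proof -
  have "\<exists>l\<in>{0..B}. \<exists>r::nat\<Rightarrow>nat. strict_mono r \<and> (f \<circ> r) \<longlonglongrightarrow> l"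
    using compact_Icc[of 0 B, unfolded compact_def, rule_format, of f] assms by simp
  then obtain l r where "strict_mono (r :: nat \<Rightarrow> nat)" "(f \<circ> r) \<longlonglongrightarrow> l" by blast
  then show ?thesis unfolding o_def by (rule that)
qed

text \<open>  Successive subsequences make the two components and then their two energies converge.\<close>
lemma relaxed_compact:
  assumes w: "\<And>n. (w1 n, w2 n) \<in> relaxed"
  obtains r u1 u2 where "strict_mono (r :: nat \<Rightarrow> nat)" "(u1, u2) \<in> relaxed"
    "(\<lambda>n. F (w1 (r n), w2 (r n))) \<longlonglongrightarrow> F (u1, u2)"
proof -
  note W = relaxedD[OF w]
  define B where "B = \<bar>\<alpha>\<bar> + \<rho>1 + \<rho>2"
  have b: "E1 (w1 n) \<le> B" "E2 (w2 n) \<le> B" "sqnorm M (w1 n) \<le> B" "sqnorm M (w2 n) \<le> B" for n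
    unfolding B_def
    using W(3-5)[of n] P1.energy_nonneg[of "w1 n"] P2.energy_nonneg[of "w2 n"] \<rho>1 \<rho>2
      abs_ge_self[of \<alpha>] abs_ge_zero[of \<alpha>] by linarith+
  obtain r1 u1 where r1: "strict_mono (r1 :: nat \<Rightarrow> nat)" "square_integrable M u1" "(\<lambda>n. sqnorm M (\<lambda>x. w1 (r1 n) x - u1 x)) \<longlonglongrightarrow> 0"
    by (rule P1.ES_bounded_compact[of w1 B, OF conf1 W(1) b(1) b(3)]) blast
  obtain r2 u2 where r2: "strict_mono (r2 :: nat \<Rightarrow> nat)" "square_integrable M u2" "(\<lambda>n. sqnorm M (\<lambda>x. w2 (r1 (r2 n)) x - u2 x)) \<longlonglongrightarrow> 0"
    by (rule P2.ES_bounded_compact[of "\<lambda>n. w2 (r1 n)" B, OF conf2 W(2) b(2) b(4)]) blast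
  obtain r3 a1 where r3: "strict_mono (r3 :: nat \<Rightarrow> nat)" "(\<lambda>n. E1 (w1 (r1 (r2 (r3 n))))) \<longlonglongrightarrow> a1"
    by (rule real_bounded_subsequence[of "\<lambda>n. E1 (w1 (r1 (r2 n)))" B, OF P1.energy_nonneg b(1)]) blast
  obtain r4 a2 where r4: "strict_mono (r4 :: nat \<Rightarrow> nat)" "(\<lambda>n. E2 (w2 (r1 (r2 (r3 (r4 n)))))) \<longlonglongrightarrow> a2"
    by (rule real_bounded_subsequence[of "\<lambda>n. E2 (w2 (r1 (r2 (r3 n))))" B, OF P2.energy_nonneg b(2)]) blast
  define r where "r n = r1 (r2 (r3 (r4 n)))" for n
  have s34: "strict_mono (\<lambda>n. r3 (r4 n))" using strict_mono_o[OF r3(1) r4(1)] by (simp add: o_def)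
  have s234: "strict_mono (\<lambda>n. r2 (r3 (r4 n)))" using strict_mono_o[OF r2(1) s34] by (simp add: o_def)
  have r: "strict_mono r" unfolding r_def using strict_mono_o[OF r1(1) s234] by (simp add: o_def)
  have l1: "(\<lambda>n. sqnorm M (\<lambda>x. w1 (r n) x - u1 x)) \<longlonglongrightarrow> 0"
    using LIMSEQ_subseq_LIMSEQ[OF r1(3) s234] by (simp add: o_def r_def)
  have l2: "(\<lambda>n. sqnorm M (\<lambda>x. w2 (r n) x - u2 x)) \<longlonglongrightarrow> 0"
    using LIMSEQ_subseq_LIMSEQ[OF r2(3) s34] by (simp add: o_def r_def)
  have e1: "(\<lambda>n. E1 (w1 (r n))) \<longlonglongrightarrow> a1"
    using LIMSEQ_subseq_LIMSEQ[OF r3(2) r4(1)] by (simp add: o_def r_def)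
  have e2: "(\<lambda>n. E2 (w2 (r n))) \<longlonglongrightarrow> a2" using r4(2) by (simp add: r_def)
  note lsc1 = P1.energy_lower_semicontinuous[of "\<lambda>n. w1 (r n)", OF W(1) r1(2) l1 e1]
  note lsc2 = P2.energy_lower_semicontinuous[of "\<lambda>n. w2 (r n)", OF W(2) r2(2) l2 e2]
  have "a1 + a2 \<le> \<alpha>"
    by (rule LIMSEQ_le_const2[OF tendsto_add[OF e1 e2]]) (use W(5) in blast)
  then have "E1 u1 + E2 u2 \<le> \<alpha>" using lsc1(2) lsc2(2) by linarith
  moreover have "(\<lambda>n. sqnorm M (w1 (r n))) \<longlonglongrightarrow> sqnorm M u1"
    by (rule sqnorm_tendsto[OF P1.ES_D(4)[OF W(1)] r1(2) l1])
  then have "sqnorm M u1 = \<rho>1" unfolding W(3) by (simp add: LIMSEQ_const_iff)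
  moreover have "(\<lambda>n. sqnorm M (w2 (r n))) \<longlonglongrightarrow> sqnorm M u2"
    by (rule sqnorm_tendsto[OF P2.ES_D(4)[OF W(2)] r2(2) l2])
  then have "sqnorm M u2 = \<rho>2" unfolding W(4) by (simp add: LIMSEQ_const_iff)
  ultimately have u: "(u1, u2) \<in> relaxed" using lsc1(1) lsc2(1) by (simp add: relaxed_def)
  note s1 = P1.ES_square_square_integrable[OF dim] and s2 = P2.ES_square_square_integrable[OF dim]
  note t1 = P1.ES_squares_tendsto[of "\<lambda>n. w1 (r n)" u1 B, OF dim W(1) lsc1(1) b(1) l1]
  note t2 = P2.ES_squares_tendsto[of "\<lambda>n. w2 (r n)" u2 B, OF dim W(2) lsc2(1) b(2) l2]
  have "(\<lambda>n. F (w1 (r n), w2 (r n))) \<longlonglongrightarrow> F (u1, u2)"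
    unfolding F_functional_eq[OF s1[OF W(1)] s2[OF W(2)]] F_functional_eq[OF s1[OF lsc1(1)] s2[OF lsc2(1)]]
    by (intro tendsto_intros sqinner_tendsto s1[OF W(1)] s2[OF W(2)] s1[OF lsc1(1)] s2[OF lsc2(1)] t1 t2)
  with r u show ?thesis by (rule that)
qed

lemma relaxed_maximum_exists: "\<exists>u\<in>relaxed. \<forall>v\<in>relaxed. F v \<le> F u"
proof -
  let ?S = "(\<lambda>v. ereal (F v)) ` relaxed"
  have "?S \<noteq> {}" using relaxed_nonempty by simp
  from Sup_countable_SUP[OF this] obtain f :: "nat \<Rightarrow> ereal"
    where f: "incseq f" "range f \<subseteq> ?S" "Sup ?S = (SUP i. f i)" by blast
  have "\<exists>w1 w2. (w1, w2) \<in> relaxed \<and> f n = ereal (F (w1, w2))" for n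
  proof -
    have "f n \<in> ?S" using f(2) by blast
    then obtain v where v: "f n = ereal (F v)" "v \<in> relaxed" by (rule imageE)
    then show ?thesis by (intro exI[of _ "fst v"] exI[of _ "snd v"]) simp
  qed
  then obtain w1 w2 where w: "\<And>n. (w1 n, w2 n) \<in> relaxed" "\<And>n. f n = ereal (F (w1 n, w2 n))" by metis
  obtain r u1 u2 where r: "strict_mono (r :: nat \<Rightarrow> nat)" "(u1, u2) \<in> relaxed" "(\<lambda>n. F (w1 (r n), w2 (r n))) \<longlonglongrightarrow> F (u1, u2)"
    by (rule relaxed_compact[of w1 w2, OF w(1)]) blast
  have "f \<longlonglongrightarrow> Sup ?S" unfolding f(3) by (rule LIMSEQ_SUP[OF f(1)])
  from LIMSEQ_subseq_LIMSEQ[OF this r(1)] have "(\<lambda>n. ereal (F (w1 (r n), w2 (r n)))) \<longlonglongrightarrow> Sup ?S"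
    by (simp add: o_def w(2))
  moreover have "(\<lambda>n. ereal (F (w1 (r n), w2 (r n)))) \<longlonglongrightarrow> ereal (F (u1, u2))" using r(3) by simp
  ultimately have sup: "Sup ?S = ereal (F (u1, u2))" by (rule LIMSEQ_unique)
  have "F v \<le> F (u1, u2)" if "v \<in> relaxed" for v
  proof -
    have "ereal (F v) \<le> Sup ?S" by (rule Sup_upper) (use that in blast)
    then show ?thesis unfolding sup by simp
  qed
  with r(2) show ?thesis by blast
qed

lemma admissible_iff: "(u1, u2) \<in> admissible \<Omega> V1 V2 \<alpha> \<rho>1 \<rho>2 \<longleftrightarrow> (u1, u2) \<in> relaxed \<and> E1 u1 + E2 u2 = \<alpha>"
  unfolding admissible_def relaxed_def HH_def by (auto simp: P1.mass_eq_sqnorm)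

text \<open>  A relaxed maximum is admissible, so the two suprema coincide.\<close>
lemma maximum_point_exists_and_is_relaxed_maximum:
  "\<exists>u. maximum_point \<Omega> V1 V2 \<mu>1 \<mu>2 \<beta> \<alpha> \<rho>1 \<rho>2 u"
  "maximum_point \<Omega> V1 V2 \<mu>1 \<mu>2 \<beta> \<alpha> \<rho>1 \<rho>2 (v1, v2) \<Longrightarrow> (v1, v2) \<in> relaxed \<and> (\<forall>v\<in>relaxed. F v \<le> F (v1, v2))"
proof -
  let ?A = "admissible \<Omega> V1 V2 \<alpha> \<rho>1 \<rho>2"
  obtain u1 u2 where u: "(u1, u2) \<in> relaxed" "\<And>v. v \<in> relaxed \<Longrightarrow> F v \<le> F (u1, u2)"
    using relaxed_maximum_exists by force
  have uA: "(u1, u2) \<in> ?A" using admissible_iff u(1) relaxed_maximum_saturates[OF u] by blast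
  have AR: "v \<in> relaxed" if "v \<in> ?A" for v using admissible_iff[of "fst v" "snd v"] that by simp
  have M: "M_value \<Omega> V1 V2 \<mu>1 \<mu>2 \<beta> \<alpha> \<rho>1 \<rho>2 = ereal (F (u1, u2))"
    unfolding M_value_def
  proof (rule antisym)
    show "(SUP u\<in>?A. ereal (F u)) \<le> ereal (F (u1, u2))" using u(2) AR by (intro SUP_least) simp
    show "ereal (F (u1, u2)) \<le> (SUP u\<in>?A. ereal (F u))" by (rule SUP_upper[OF uA])
  qed
  show "\<exists>u. maximum_point \<Omega> V1 V2 \<mu>1 \<mu>2 \<beta> \<alpha> \<rho>1 \<rho>2 u"
    unfolding maximum_point_def M using uA by blast
  show "(v1, v2) \<in> relaxed \<and> (\<forall>v\<in>relaxed. F v \<le> F (v1, v2))"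
    if "maximum_point \<Omega> V1 V2 \<mu>1 \<mu>2 \<beta> \<alpha> \<rho>1 \<rho>2 (v1, v2)"
    using that u(2) AR unfolding maximum_point_def M by simp
qed

lemma scaled_Euler_Lagrange:
  assumes u: "(u1, u2) \<in> relaxed" and max: "\<And>v. v \<in> relaxed \<Longrightarrow> F v \<le> F (u1, u2)"
  shows "\<exists>\<omega>1 \<omega>2 \<gamma>. \<gamma> > 0 \<and>
    weak_solution \<Omega> V1 \<omega>1 (\<lambda>x. sqrt \<gamma> * u1 x) (\<lambda>x. \<mu>1 * (sqrt \<gamma> * u1 x) ^ 3 + \<beta> * (sqrt \<gamma> * u1 x) * (sqrt \<gamma> * u2 x)\<^sup>2) \<and>
    weak_solution \<Omega> V2 \<omega>2 (\<lambda>x. sqrt \<gamma> * u2 x) (\<lambda>x. \<mu>2 * (sqrt \<gamma> * u2 x) ^ 3 + \<beta> * (sqrt \<gamma> * u2 x) * (sqrt \<gamma> * u1 x)\<^sup>2)"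
proof -
  note U = relaxedD[OF u]
  note S = P1.ES_square_square_integrable[OF dim U(1)] P2.ES_square_square_integrable[OF dim U(2)]
  obtain \<kappa> where \<kappa>: "\<kappa> > 0" "\<And>\<phi>1 \<phi>2. tangent u1 u2 \<phi>1 \<phi>2 \<Longrightarrow> dF u1 u2 \<phi>1 \<phi>2 = \<kappa> * dE u1 u2 \<phi>1 \<phi>2"
    using Lagrange_multiplier[OF u max] by blast
  have "cubic_form M \<mu>1 \<beta> u1 u2 \<phi> = \<kappa> * P1.energy_form u1 \<phi>" if "\<phi> \<in> P1.ES" "sqinner M u1 \<phi> = 0" for \<phi>
    using \<kappa>(2)[of \<phi> "\<lambda>x. 0"] that P2.ES_zero[OF U(2)] P2.energy_form_zero[OF U(2)]
    by (simp add: tangent_def dF_def dE_def)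
  from P1.multiplier_imp_weak_solution[OF dim \<rho>1 U(3,1) S(2) \<kappa>(1) this] obtain \<omega>1 where
    "weak_solution \<Omega> V1 \<omega>1 (\<lambda>x. sqrt (1 / \<kappa>) * u1 x)
      (\<lambda>x. \<mu>1 * (sqrt (1 / \<kappa>) * u1 x) ^ 3 + \<beta> * (sqrt (1 / \<kappa>) * u1 x) * (sqrt (1 / \<kappa>) * u2 x)\<^sup>2)" by blast
  moreover have "cubic_form M \<mu>2 \<beta> u2 u1 \<phi> = \<kappa> * P2.energy_form u2 \<phi>" if "\<phi> \<in> P2.ES" "sqinner M u2 \<phi> = 0" for \<phi>
    using \<kappa>(2)[of "\<lambda>x. 0" \<phi>] that P1.ES_zero[OF U(1)] P1.energy_form_zero[OF U(1)]
    by (simp add: tangent_def dF_def dE_def)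
  from P2.multiplier_imp_weak_solution[OF dim \<rho>2 U(4,2) S(1) \<kappa>(1) this] obtain \<omega>2 where
    "weak_solution \<Omega> V2 \<omega>2 (\<lambda>x. sqrt (1 / \<kappa>) * u2 x)
      (\<lambda>x. \<mu>2 * (sqrt (1 / \<kappa>) * u2 x) ^ 3 + \<beta> * (sqrt (1 / \<kappa>) * u2 x) * (sqrt (1 / \<kappa>) * u1 x)\<^sup>2)" by blast
  ultimately show ?thesis using \<kappa>(1)
    by (intro exI[of _ \<omega>1] exI[of _ \<omega>2] exI[of _ "1 / \<kappa>"]) simp
qed

end

lemma TraPot_nonneg_potential:
  assumes \<Omega>: "open \<Omega>" and V: "TraPot \<Omega> V"
  shows "nonneg_potential \<Omega> V" "continuous_on \<Omega> V"
proof -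
  show c: "continuous_on \<Omega> V"
    by (rule continuous_on_subset[OF _ closure_subset]) (use V in \<open>simp add: TraPot_def\<close>)
  show "nonneg_potential \<Omega> V"
  proof
    show "V \<in> borel_measurable (lebesgue_on \<Omega>)"
      using \<Omega> by (intro continuous_imp_measurable_on_sets_lebesgue c) simp
    show "0 \<le> V x" if "x \<in> \<Omega>" for x using V subsetD[OF closure_subset that] by (simp add: TraPot_def)
  qed (rule \<Omega>)
qed

theorem theorem1p1:
  fixes \<Omega> :: "'a::euclidean_space set"
    and V1 V2 :: "'a \<Rightarrow> real"
    and \<mu>1 \<mu>2 \<beta> \<alpha> \<rho>1 \<rho>2 :: real
  assumes "DIM('a) \<le> 3"
    and "\<Omega> = UNIV \<or> bounded_lipschitz_domain \<Omega>"
    and "TraPot \<Omega> V1" and "TraPot \<Omega> V2"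
    and "NonDeg \<mu>1 \<mu>2 \<beta>"
    and "\<rho>1 > 0" and "\<rho>2 > 0"
    and "\<alpha> > principal_eigenvalue \<Omega> V1 * \<rho>1 + principal_eigenvalue \<Omega> V2 * \<rho>2"
  shows "(\<exists>u. maximum_point \<Omega> V1 V2 \<mu>1 \<mu>2 \<beta> \<alpha> \<rho>1 \<rho>2 u) \<and>
    (\<forall>u1 u2. maximum_point \<Omega> V1 V2 \<mu>1 \<mu>2 \<beta> \<alpha> \<rho>1 \<rho>2 (u1, u2) \<longrightarrow>
      (\<exists>\<omega>1 \<omega>2 \<gamma>. \<gamma> > 0 \<and>
        (let U1 = (\<lambda>x. sqrt \<gamma> * u1 x); U2 = (\<lambda>x. sqrt \<gamma> * u2 x) in
          (U1, U2) \<in> HH \<Omega> V1 V2 \<and>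
          weak_solution \<Omega> V1 \<omega>1 U1 (\<lambda>x. \<mu>1 * (U1 x) ^ 3 + \<beta> * U1 x * (U2 x)\<^sup>2) \<and>
          weak_solution \<Omega> V2 \<omega>2 U2 (\<lambda>x. \<mu>2 * (U2 x) ^ 3 + \<beta> * U2 x * (U1 x)\<^sup>2) \<and>
          mass \<Omega> U1 = \<gamma> * \<rho>1 \<and> mass \<Omega> U2 = \<gamma> * \<rho>2)))"
proof -
  have \<Omega>: "open \<Omega>" "\<Omega> \<noteq> {}" "bounded \<Omega> \<or> \<Omega> = UNIV"
    using assms(2) by (auto simp: bounded_lipschitz_domain_def)
  have conf: "bounded \<Omega> \<or> (\<Omega> = UNIV \<and> filterlim V at_top at_infinity)" if "TraPot \<Omega> V" for V
    using \<Omega>(3) that by (auto simp: TraPot_def)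
  interpret coupled_problem \<Omega> V1 V2 \<mu>1 \<mu>2 \<beta> \<alpha> \<rho>1 \<rho>2
  proof (rule coupled_problem.intro)
    show "nonneg_potential \<Omega> V1" "nonneg_potential \<Omega> V2"
      by (rule TraPot_nonneg_potential(1)[OF \<Omega>(1) assms(3)], rule TraPot_nonneg_potential(1)[OF \<Omega>(1) assms(4)])
    show "coupled_problem_axioms \<Omega> V1 V2 \<mu>1 \<mu>2 \<beta> \<alpha> \<rho>1 \<rho>2"
      by (rule coupled_problem_axioms.intro[OF assms(1) \<Omega>(2) TraPot_nonneg_potential(2)[OF \<Omega>(1) assms(3)]
            TraPot_nonneg_potential(2)[OF \<Omega>(1) assms(4)] conf[OF assms(3)] conf[OF assms(4)] assms(5-8)])
  qed
  show ?thesis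
  proof (intro conjI allI impI)
    show "\<exists>u. maximum_point \<Omega> V1 V2 \<mu>1 \<mu>2 \<beta> \<alpha> \<rho>1 \<rho>2 u" by (rule maximum_point_exists_and_is_relaxed_maximum(1))
    fix u1 u2 assume "maximum_point \<Omega> V1 V2 \<mu>1 \<mu>2 \<beta> \<alpha> \<rho>1 \<rho>2 (u1, u2)"
    then have u: "(u1, u2) \<in> relaxed" "\<And>v. v \<in> relaxed \<Longrightarrow> F v \<le> F (u1, u2)"
      using maximum_point_exists_and_is_relaxed_maximum(2) by blast+
    obtain \<omega>1 \<omega>2 \<gamma> where \<gamma>: "\<gamma> > 0"
      "weak_solution \<Omega> V1 \<omega>1 (\<lambda>x. sqrt \<gamma> * u1 x) (\<lambda>x. \<mu>1 * (sqrt \<gamma> * u1 x) ^ 3 + \<beta> * (sqrt \<gamma> * u1 x) * (sqrt \<gamma> * u2 x)\<^sup>2)"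
      "weak_solution \<Omega> V2 \<omega>2 (\<lambda>x. sqrt \<gamma> * u2 x) (\<lambda>x. \<mu>2 * (sqrt \<gamma> * u2 x) ^ 3 + \<beta> * (sqrt \<gamma> * u2 x) * (sqrt \<gamma> * u1 x)\<^sup>2)"
      using scaled_Euler_Lagrange[OF u] by blast
    have "mass \<Omega> (\<lambda>x. sqrt \<gamma> * u1 x) = \<gamma> * \<rho>1" "mass \<Omega> (\<lambda>x. sqrt \<gamma> * u2 x) = \<gamma> * \<rho>2"
      using relaxedD(3,4)[OF u(1)] \<gamma>(1) by (simp_all add: P1.mass_eq_sqnorm sqnorm_mult)
    moreover have "((\<lambda>x. sqrt \<gamma> * u1 x), (\<lambda>x. sqrt \<gamma> * u2 x)) \<in> HH \<Omega> V1 V2"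
      using \<gamma>(2,3) by (simp add: HH_def weak_solution_def)
    ultimately show "\<exists>\<omega>1 \<omega>2 \<gamma>. \<gamma> > 0 \<and>
        (let U1 = (\<lambda>x. sqrt \<gamma> * u1 x); U2 = (\<lambda>x. sqrt \<gamma> * u2 x) in
          (U1, U2) \<in> HH \<Omega> V1 V2 \<and>
          weak_solution \<Omega> V1 \<omega>1 U1 (\<lambda>x. \<mu>1 * (U1 x) ^ 3 + \<beta> * U1 x * (U2 x)\<^sup>2) \<and>
          weak_solution \<Omega> V2 \<omega>2 U2 (\<lambda>x. \<mu>2 * (U2 x) ^ 3 + \<beta> * U2 x * (U1 x)\<^sup>2) \<and>
          mass \<Omega> U1 = \<gamma> * \<rho>1 \<and> mass \<Omega> U2 = \<gamma> * \<rho>2)"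
      unfolding Let_def using \<gamma> by (intro exI[of _ \<omega>1] exI[of _ \<omega>2] exI[of _ \<gamma>]) simp
  qed
qed

end
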